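(* Let $G$ be an abelian group with a faithful and liftable action on a smooth cubic fourfold $X=V(F)\subseteq\mathbb{P}^5$. Choose a coordinate system $x_1,\dots,x_6$ for $\mathbb{P}^5$ such that the action of $G$ is diagonal, and let $I=(G,\lambda,\lambda_1,\dots,\lambda_6)$ be the associated data. Suppose $[I]$ is maximal in the poset $\mathcal{P}_{3,6}$. Then either $S=S_I$ is simple, or, up to a permutation of the coordinates $x_1,\dots,x_6$, the pair $(G,S)$ is one of the following (where $C_n=\mathbb{Z}/n\mathbb{Z}$): (1) $G=\{\mathrm{diag}[\omega:\omega^5:\omega^3:1:\omega^4:\omega^2]\mid\omega^6=1\}\cong C_2\oplus C_3$, $S=\{x_1^2x_2,\,x_2^2x_3,\,x_3^2x_1,\,x_4^2x_1,\,x_5^2x_2,\,x_6^2x_3,\,x_3x_4x_5,\,x_1x_5x_6,\,x_2x_4x_6\}$; (2) $G=\{\mathrm{diag}[\omega:\omega^6:\omega^4:1:\omega^5:\omega^2]\mid\omega^8=1\}\cong C_8$, $S=\{x_1^2x_2,\,x_2^2x_3,\,x_3^2x_4,\,x_4^3,\,x_5^2x_2,\,x_1x_5x_6,\,x_6^2x_3,\,x_2x_6x_4\}$; (3) $G=\{\mathrm{diag}[\omega:\omega^2:1:\zeta:\omega^2\zeta:1]\mid\omega^4=\zeta^2=1\}\cong C_2\oplus C_4$, $S=\{x_1^2x_2,\,x_2^2x_3,\,x_2^2x_6,\,x_2x_4x_5,\,x_3^3,\,x_3^2x_6,\,x_4^2x_3,\,x_5^2x_3,\,x_6^2x_3,\,x_4^2x_6,\,x_5^2x_6,\,x_6^3\}$;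 (4) $G=\{\mathrm{diag}[\omega:\omega^2:1:\omega\zeta:\omega^2\zeta:1]\mid\omega^4=\zeta^2=1\}\cong C_2\oplus C_4$, $S=\{x_1^2x_2,\,x_2^2x_3,\,x_3^3,\,x_4^2x_2,\,x_1x_4x_5,\,x_5^2x_3,\,x_5^2x_6,\,x_6^2x_3,\,x_2^2x_6,\,x_3^2x_6,\,x_6^3\}$; (5) $G=\{\mathrm{diag}[\omega:\omega^2:1:\omega\zeta:\omega^2\zeta:\zeta]\mid\omega^4=\zeta^2=1\}\cong C_2\oplus C_4$, $S=\{x_1^2x_2,\,x_2^2x_3,\,x_3^3,\,x_4^2x_2,\,x_1x_4x_5,\,x_5^2x_3,\,x_2x_5x_6,\,x_6^2x_3\}$; (6) $G=\{\mathrm{diag}[\omega:\omega^2:1:\omega^2\zeta:\zeta:\omega^3\zeta]\mid\omega^4=\zeta^2=1\}\cong C_2\oplus C_4$, $S=\{x_1^2x_2,\,x_2^2x_3,\,x_3^3,\,x_4^2x_3,\,x_5^2x_3,\,x_2x_4x_5,\,x_1x_5x_6,\,x_6^2x_2\}$; (7) $G=\{\mathrm{diag}[\alpha:\beta:\alpha\beta:1:\omega:\zeta]\mid\alpha^2=\beta^2=\omega^3=\zeta^3=1\}\cong C_2^2\oplus C_3^2$, $S=\{x_1^2x_4,\,x_2^2x_4,\,x_3^2x_4,\,x_1x_2x_3,\,x_4^3,\,x_5^3,\,x_6^3\}$; (8) $G=\{\mathrm{diag}[\alpha:\beta:\alpha\beta:\omega:1:\omega^4]\mid\alpha^2=\beta^2=\omega^6=1\}\cong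 C_2^3\oplus C_3$, $S=\{x_1^2x_5,\,x_2^2x_5,\,x_3^2x_5,\,x_1x_2x_3,\,x_5^3,\,x_4^2x_6,\,x_6^3\}$.
   Context: Everything is over $\mathbb{C}$. In general fix integers $d\ge 3$, $N\ge 3$ (here $d=3$, $N=6$). A homogeneous polynomial $F(x_1,\dots,x_N)$ is called smooth if $\partial F/\partial x_1=\dots=\partial F/\partial x_N=0$ has only the solution $(0,\dots,0)$. For $F$ homogeneous of degree $d$, $V(F)\subseteq\mathbb{P}^{N-1}$ is its zero locus and $\mathrm{Lin}(V(F))\le \mathrm{PGL}(N,\mathbb{C})$ is the group of linear automorphisms of $\mathbb{P}^{N-1}$ preserving $V(F)$ (finite when $V(F)$ is smooth). Liftable action: the action of a subgroup $G\le\mathrm{Lin}(V(F))\le\mathrm{PGL}(N)$ on $V(F)$ is liftable if the inclusion $G\hookrightarrow\mathrm{PGL}(N)$ factors as a group homomorphism through $\mathrm{GL}(N)\to\mathrm{PGL}(N)$; a resulting $G\hookrightarrow\mathrm{GL}(N)$ is called a lifting. $\mathrm{diag}[\lambda_1:\dots:\lambda_N]$ denotes the class in $\mathrm{PGL}(N)$ of the diagonal matrix $\mathrm{diag}(\lambda_1,\dots,\lambda_N)$. Associated data: given a liftable action of a finite abelian group $G$ on a smooth $V(F)$ of degree $d$, choose a lifting and coordinates $x_1,\dots,x_N$ in which $G$ acts diagonally, $g(x_1,\dots,x_N)=(\lambda_1(g)x_1,\dots,\lambda_N(g)x_N)$ with characters $\lambda_i:G\to\mathbb{C}^\times$; there is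 a character $\lambda:G\to\mathbb{C}^\times$ with $F(\lambda_1(g)x_1,\dots,\lambda_N(g)x_N)=\lambda(g)F(x_1,\dots,x_N)$ for all $g\in G$. Put $I=(G,\lambda,\lambda_1,\dots,\lambda_N)$ and $$S_I=\Big\{\prod_{i=1}^N x_i^{\alpha_i}\ \Big|\ \sum_i\alpha_i=d,\ \lambda=\prod_i\lambda_i^{\alpha_i}\Big\}.$$ Two data $I=(G,\lambda,\lambda_1,\dots,\lambda_N)$ and $I'=(G,\lambda',\lambda_1',\dots,\lambda_N')$ are equivalent if there is a character $\xi:G\to\mathbb{C}^\times$ with $\lambda_i'=\lambda_i\xi$ for all $i$ and $\lambda'=\lambda\xi^d$ (this corresponds to changing the lifting; $S_I$ depends only on the equivalence class $[I]$). Poset: $\mathcal{P}_{d,N}$ is the set of equivalence classes $[I]$ of all data $I=(G,\lambda,\lambda_1,\dots,\lambda_N)$ associated with liftable actions of finite abelian groups $G$ on smooth hypersurfaces $V(F)$ of degree $d$ in $\mathbb{P}^{N-1}$, where $\lambda_1,\dots,\lambda_N$ are the characters by which $G$ acts on diagonalizing coordinates for some lifting and $\lambda$ is the character by which $G$ acts on $F$. If $H\le G$ is a subgroup and $J=(H,\lambda|_H,\lambda_1|_H,\dots,\lambda_N|_H)$, write $[J]\le[I]$, and $[J]<[I]$ if $H\subsetneq G$. Maximal means maximal for this partial order. Types of polynomials (each up to a permutation of coordinates): type $K$: $x_1^{d-1}x_2+x_2^{d-1}x_3+\dots+x_k^{d-1}x_1$; type $T$: $x_1^{d-1}x_2+\dots+x_{k-1}^{d-1}x_k+x_k^d$;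 and, for $d=3$, type $Y$: $x_1^2x_2+\dots+x_{a-1}^2x_a+y_1^2y_2+\dots+y_{b-1}^2y_b+x_a^2z+y_b^2z+z^2w+w^3+x_ay_bw$ with $a,b\ge1$. For $d=3$, a smooth homogeneous polynomial is simple if it is a sum of finitely many polynomials of type $K$, $T$ or $Y$ in independent (pairwise disjoint sets of) variables. A set $S$ of monomials of degree $d$ in $x_1,\dots,x_N$ is simple if the sum of certain elements of $S$ is a simple polynomial in $x_1,\dots,x_N$ (all $N$ variables being used). *)

theory Defs
  imports
    "HOL-Analysis.Cartesian_Space"
    "HOL-Library.Poly_Mapping"
    "HOL-Library.Disjoint_Sets"
    "HOL-Combinatorics.Permutations"
    "HOL-Algebra.Coset"
    "HOL-Algebra.Elementary_Groups"
begin

section \<open>Polynomials in finitely many variables\<close>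

text \<open>
  The variables are indexed by a finite type \<open>'n\<close>, so that \<open>N = CARD('n)\<close>.  A monomial is its
  exponent vector, and the ring structure on polynomials is the convolution product of
  \<^theory>\<open>HOL-Library.Poly_Mapping\<close>.
\<close>

type_synonym 'n monomial = "'n \<Rightarrow>\<^sub>0 nat"
type_synonym 'n mpoly = "'n monomial \<Rightarrow>\<^sub>0 complex"

definition mono_deg :: "'n::finite monomial \<Rightarrow> nat" where
  "mono_deg m = (\<Sum>i\<in>UNIV. Poly_Mapping.lookup m i)"

definition mono_poly :: "'n monomial \<Rightarrow> 'n mpoly" where
  "mono_poly m = Poly_Mapping.single m 1"

definition Var :: "'n \<Rightarrow> 'n mpoly" where
  "Var i = mono_poly (Poly_Mapping.single i 1)"

text \<open>The product of a list of variables with repetition: \<open>xmon [1, 1, 2]\<close> is \<open>x\<^sub>1\<^sup>2 x\<^sub>2\<close>.\<close>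

definition xmon :: "'n list \<Rightarrow> 'n monomial" where
  "xmon vs = (\<Sum>v\<leftarrow>vs. Poly_Mapping.single v 1)"

definition eval_poly :: "'n::finite mpoly \<Rightarrow> complex ^ 'n \<Rightarrow> complex" where
  "eval_poly F x =
     (\<Sum>m\<in>Poly_Mapping.keys F. Poly_Mapping.lookup F m * (\<Prod>i\<in>UNIV. (x $ i) ^ Poly_Mapping.lookup m i))"

text \<open>If \<open>x\<^sub>i\<close> does not occur in \<open>m\<close>, the subtraction truncates but the coefficient is \<open>0\<close>.\<close>

definition partial_deriv :: "'n \<Rightarrow> 'n mpoly \<Rightarrow> 'n mpoly" where
  "partial_deriv i F =
     (\<Sum>m\<in>Poly_Mapping.keys F.
        Poly_Mapping.single (m - Poly_Mapping.single i 1)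
          (of_nat (Poly_Mapping.lookup m i) * Poly_Mapping.lookup F m))"

definition homogeneous :: "nat \<Rightarrow> 'n::finite mpoly \<Rightarrow> bool" where
  "homogeneous d F \<longleftrightarrow> (\<forall>m\<in>Poly_Mapping.keys F. mono_deg m = d)"

definition smooth :: "'n::finite mpoly \<Rightarrow> bool" where
  "smooth F \<longleftrightarrow> {x. \<forall>i. eval_poly (partial_deriv i F) x = 0} = {0}"


section \<open>The groups $\mathrm{GL}(N)$, $\mathrm{PGL}(N)$ and $\mathrm{Lin}(V(F))$\<close>

definition GL :: "(complex ^ 'n ^ 'n) monoid" where
  "GL = \<lparr>carrier = {A. invertible A}, mult = (**), one = mat 1\<rparr>"

definition scalars :: "(complex ^ 'n ^ 'n) set" where
  "scalars = {mat c |c. c \<noteq> 0}"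

lemma group_GL: "group (GL :: (complex ^ 'n ^ 'n) monoid)"
proof (rule groupI)
  fix A :: "complex ^ 'n ^ 'n"
  assume "A \<in> carrier GL"
  then show "\<exists>B\<in>carrier GL. B \<otimes>\<^bsub>GL\<^esub> A = \<one>\<^bsub>GL\<^esub>"
    unfolding GL_def invertible_def by auto
next
  show "\<one>\<^bsub>GL\<^esub> \<in> carrier (GL :: (complex ^ 'n ^ 'n) monoid)"
    unfolding GL_def invertible_def by (auto intro: exI[of _ "mat 1"])
qed (auto simp: GL_def invertible_mult matrix_mul_assoc)

lemma mat_mult_component:
  fixes A :: "complex ^ 'n ^ 'n"
  shows "(mat c ** A) $ i $ j = c * A $ i $ j" and "(A ** mat c) $ i $ j = A $ i $ j * c"
  by (simp_all add: matrix_matrix_mult_def mat_def if_distrib if_distribR cong: if_cong)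

lemma mat_mult_commute: "mat c ** A = A ** mat c" for A :: "complex ^ 'n ^ 'n"
  by (simp add: vec_eq_iff mat_mult_component)

lemma mat_mult_mat: "mat a ** mat b = (mat (a * b) :: complex ^ 'n ^ 'n)"
  by (simp add: vec_eq_iff mat_mult_component) (simp add: mat_def)

lemma normal_scalars: "scalars \<lhd> (GL :: (complex ^ 'n ^ 'n) monoid)"
proof -
  interpret group "GL :: (complex ^ 'n ^ 'n) monoid" by (rule group_GL)
  have inv: "invertible (mat c :: complex ^ 'n ^ 'n)" if "c \<noteq> 0" for c
    unfolding invertible_def using that
    by (intro exI[of _ "mat (inverse c)"]) (simp add: mat_mult_mat)
  have sub: "subgroup scalars (GL :: (complex ^ 'n ^ 'n) monoid)"
  proof (rule subgroupI)
    show "scalars \<subseteq> carrier (GL :: (complex ^ 'n ^ 'n) monoid)"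
      using inv by (auto simp: scalars_def GL_def)
    show "(scalars :: (complex ^ 'n ^ 'n) set) \<noteq> {}"
      unfolding scalars_def by (auto intro: exI[of _ 1])
  next
    fix A :: "complex ^ 'n ^ 'n"
    assume "A \<in> scalars"
    then obtain c where c: "A = mat c" "c \<noteq> 0" by (auto simp: scalars_def)
    then have "inv\<^bsub>GL\<^esub> A = mat (inverse c)"
      using inv[of c] inv[of "inverse c"] by (intro inv_equality) (simp_all add: GL_def mat_mult_mat)
    with c show "inv\<^bsub>GL\<^esub> A \<in> scalars"
      unfolding scalars_def by (auto intro: exI[of _ "inverse c"])
  next
    fix A B :: "complex ^ 'n ^ 'n"
    assume "A \<in> scalars" "B \<in> scalars"
    then obtain a b where "A = mat a" "a \<noteq> 0" "B = mat b" "b \<noteq> 0" by (auto simp: scalars_def)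
    then have "A \<otimes>\<^bsub>GL\<^esub> B = mat (a * b)" "a * b \<noteq> 0" by (simp_all add: GL_def mat_mult_mat)
    then show "A \<otimes>\<^bsub>GL\<^esub> B \<in> scalars" unfolding scalars_def by blast
  qed
  show ?thesis
  proof (rule normalI[OF sub], intro ballI)
    fix A :: "complex ^ 'n ^ 'n"
    have "B ** A = A ** B" if "B \<in> scalars" for B
      using that by (auto simp: scalars_def intro: mat_mult_commute)
    then show "scalars #>\<^bsub>GL\<^esub> A = A <#\<^bsub>GL\<^esub> scalars"
      by (simp add: r_coset_def l_coset_def GL_def)
  qed
qed

type_synonym 'n pgl = "(complex ^ 'n ^ 'n) set"

definition PGL :: "'n::finite pgl monoid" where
  "PGL = GL Mod scalars"

lemma group_PGL: "group (PGL :: 'n::finite pgl monoid)"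
  unfolding PGL_def by (rule normal.factorgroup_is_group[OF normal_scalars])

definition pgl_class :: "complex ^ 'n ^ 'n \<Rightarrow> 'n::finite pgl" where
  "pgl_class A = scalars #>\<^bsub>GL\<^esub> A"

definition diag_mat :: "complex ^ 'n \<Rightarrow> complex ^ 'n ^ 'n" where
  "diag_mat v = (\<chi> i j. if i = j then v $ i else 0)"

text \<open>A point of projective space is the line, including \<open>0\<close>, spanned by a nonzero vector.\<close>

definition proj_point :: "complex ^ 'n \<Rightarrow> (complex ^ 'n) set" where
  "proj_point x = {c *s x |c. True}"

definition zero_locus :: "'n::finite mpoly \<Rightarrow> (complex ^ 'n) set set" where
  "zero_locus F = {proj_point x |x. x \<noteq> 0 \<and> eval_poly F x = 0}"

definition pgl_act :: "'n::finite pgl \<Rightarrow> (complex ^ 'n) set \<Rightarrow> (complex ^ 'n) set" where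
  "pgl_act g p = {A *v x |A x. A \<in> g \<and> x \<in> p}"

definition Lin :: "(complex ^ 'n) set set \<Rightarrow> 'n::finite pgl set" where
  "Lin X = {g \<in> carrier PGL. pgl_act g ` X = X}"


section \<open>Liftable actions and the associated data\<close>

abbreviation sub_PGL :: "'n::finite pgl set \<Rightarrow> 'n::finite pgl monoid" where
  "sub_PGL G \<equiv> PGL\<lparr>carrier := G\<rparr>"

definition is_lifting :: "'n::finite pgl set \<Rightarrow> ('n::finite pgl \<Rightarrow> complex ^ 'n ^ 'n) \<Rightarrow> bool" where
  "is_lifting G s \<longleftrightarrow> s \<in> hom (sub_PGL G) GL \<and> (\<forall>g\<in>G. pgl_class (s g) = g)"

definition liftable :: "'n::finite pgl set \<Rightarrow> bool" where
  "liftable G \<longleftrightarrow> (\<exists>s. is_lifting G s)"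

text \<open>
  A faithful liftable action of an abelian group on \<open>V(F)\<close>, the group being identified with its
  image in \<open>PGL(N)\<close>.
\<close>

definition abelian_liftable_action :: "'n::finite mpoly \<Rightarrow> 'n::finite pgl set \<Rightarrow> bool" where
  "abelian_liftable_action F G \<longleftrightarrow>
     subgroup G PGL \<and> G \<subseteq> Lin (zero_locus F) \<and> comm_group (sub_PGL G) \<and> liftable G"

definition complex_units :: "complex monoid" where
  "complex_units = \<lparr>carrier = - {0}, mult = (*), one = 1\<rparr>"

definition characters :: "'n::finite pgl set \<Rightarrow> ('n::finite pgl \<Rightarrow> complex) set" where
  "characters G = hom (sub_PGL G) complex_units"

text \<open>
  The tuple \<open>(G, \<lambda>, \<lambda>\<^sub>1, \<dots>, \<lambda>\<^sub>N)\<close>.  Only the values of the characters on \<open>G\<close> are meaningful; the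
  equivalence relation below ignores all others.
\<close>

record 'n action_data =
  grp :: "'n pgl set"
  chr :: "'n pgl \<Rightarrow> complex"
  chrs :: "'n \<Rightarrow> 'n pgl \<Rightarrow> complex"

text \<open>
  \<open>I\<close> is associated with the action of the group \<open>grp I\<close> on \<open>V(F)\<close> in the coordinates given by the
  invertible matrix \<open>P\<close>: the original coordinate vector of the point with new coordinates \<open>x\<close> is
  \<open>P *v x\<close>, so the columns of \<open>P\<close> are common eigenvectors of the lifting \<open>s\<close>, and
  \<open>eval_poly F (P *v x)\<close> is \<open>F\<close> written in the new coordinates.
\<close>

definition associated_data ::
    "'n::finite mpoly \<Rightarrow> complex ^ 'n ^ 'n \<Rightarrow> 'n::finite action_data \<Rightarrow> bool" where
  "associated_data F P I \<longleftrightarrow>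
     invertible P \<and>
     (\<exists>s. is_lifting (grp I) s \<and>
        (\<forall>g\<in>grp I. s g ** P = P ** diag_mat (\<chi> i. chrs I i g))) \<and>
     chr I \<in> characters (grp I) \<and> (\<forall>i. chrs I i \<in> characters (grp I)) \<and>
     (\<forall>g\<in>grp I. \<forall>x. eval_poly F (P *v (\<chi> i. chrs I i g * x $ i)) = chr I g * eval_poly F (P *v x))"

definition monomials_of :: "nat \<Rightarrow> 'n::finite action_data \<Rightarrow> 'n monomial set" where
  "monomials_of d I =
     {m. mono_deg m = d \<and>
         (\<forall>g\<in>grp I. chr I g = (\<Prod>i\<in>UNIV. chrs I i g ^ Poly_Mapping.lookup m i))}"


section \<open>The poset of equivalence classes of data\<close>

definition data_rel :: "nat \<Rightarrow> ('n::finite action_data \<times> 'n::finite action_data) set" where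
  "data_rel d =
     {(I, I'). grp I' = grp I \<and>
        (\<exists>\<xi>\<in>characters (grp I). \<forall>g\<in>grp I.
           (\<forall>i. chrs I' i g = chrs I i g * \<xi> g) \<and> chr I' g = chr I g * \<xi> g ^ d)}"

definition data_class :: "nat \<Rightarrow> 'n::finite action_data \<Rightarrow> 'n::finite action_data set" where
  "data_class d I = data_rel d `` {I}"

definition restrict_data :: "'n::finite pgl set \<Rightarrow> 'n::finite action_data \<Rightarrow> 'n::finite action_data" where
  "restrict_data H I =
     \<lparr>grp = H, chr = restrict (chr I) H, chrs = (\<lambda>i. restrict (chrs I i) H)\<rparr>"

definition data_poset :: "nat \<Rightarrow> 'n::finite action_data set set" where
  "data_poset d =
     {data_class d I |I. \<exists>F P. homogeneous d F \<and> smooth F \<and> finite (grp I) \<and>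
        abelian_liftable_action F (grp I) \<and> associated_data F P I}"

text \<open>\<open>data_less d C D\<close> is \<open>[J] < [I]\<close> for \<open>C = [J]\<close> and \<open>D = [I]\<close>.\<close>

definition data_less :: "nat \<Rightarrow> 'n::finite action_data set \<Rightarrow> 'n::finite action_data set \<Rightarrow> bool" where
  "data_less d C D \<longleftrightarrow>
     (\<exists>I H. D = data_class d I \<and> subgroup H (sub_PGL (grp I)) \<and> H \<subset> grp I \<and>
        C = data_class d (restrict_data H I))"

definition maximal_in_poset :: "nat \<Rightarrow> 'n::finite action_data set \<Rightarrow> bool" where
  "maximal_in_poset d C \<longleftrightarrow> C \<in> data_poset d \<and> \<not> (\<exists>D\<in>data_poset d. data_less d C D)"


section \<open>Simple polynomials\<close>

text \<open>
  The second argument is the set of variables used by the polynomial.  In type \<open>K\<close> the indices are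
  cyclic.  For \<open>k = 1\<close> both types give \<open>x\<^sub>1\<^sup>d\<close>.
\<close>

definition type_K :: "nat \<Rightarrow> 'n mpoly \<Rightarrow> 'n set \<Rightarrow> bool" where
  "type_K d f V \<longleftrightarrow>
     (\<exists>xs. xs \<noteq> [] \<and> distinct xs \<and> set xs = V \<and>
        f = (\<Sum>i<length xs. Var (xs ! i) ^ (d - 1) * Var (xs ! (Suc i mod length xs))))"

definition chain_sum :: "nat \<Rightarrow> 'n list \<Rightarrow> 'n mpoly" where
  "chain_sum d xs = (\<Sum>i<length xs - 1. Var (xs ! i) ^ (d - 1) * Var (xs ! Suc i))"

definition type_T :: "nat \<Rightarrow> 'n mpoly \<Rightarrow> 'n set \<Rightarrow> bool" where
  "type_T d f V \<longleftrightarrow>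
     (\<exists>xs. xs \<noteq> [] \<and> distinct xs \<and> set xs = V \<and> f = chain_sum d xs + Var (last xs) ^ d)"

definition type_Y :: "'n mpoly \<Rightarrow> 'n set \<Rightarrow> bool" where
  "type_Y f V \<longleftrightarrow>
     (\<exists>xs ys z w. xs \<noteq> [] \<and> ys \<noteq> [] \<and> distinct (xs @ ys @ [z, w]) \<and> set (xs @ ys @ [z, w]) = V \<and>
        f = chain_sum 3 xs + chain_sum 3 ys
          + Var (last xs) ^ 2 * Var z + Var (last ys) ^ 2 * Var z
          + Var z ^ 2 * Var w + Var w ^ 3 + Var (last xs) * Var (last ys) * Var w)"

definition simple_cubic :: "'n::finite mpoly \<Rightarrow> bool" where
  "simple_cubic f \<longleftrightarrow> homogeneous 3 f \<and> smooth f \<and>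
     (\<exists>\<V> p. partition_on UNIV \<V> \<and>
        (\<forall>V\<in>\<V>. type_K 3 (p V) V \<or> type_T 3 (p V) V \<or> type_Y (p V) V) \<and> f = (\<Sum>V\<in>\<V>. p V))"

definition simple_monomials :: "'n::finite monomial set \<Rightarrow> bool" where
  "simple_monomials S \<longleftrightarrow> (\<exists>A\<subseteq>S. simple_cubic (\<Sum>m\<in>A. mono_poly m))"


section \<open>Diagonal groups up to permutation of the coordinates\<close>

text \<open>The group \<open>G\<close> written in the coordinates \<open>P\<close>, i.e. \<open>P\<inverse> G P\<close>.\<close>

definition in_coords :: "complex ^ 'n ^ 'n \<Rightarrow> 'n::finite pgl set \<Rightarrow> 'n::finite pgl set" where
  "in_coords P G = (\<lambda>g. (\<lambda>A. matrix_inv P ** A ** P) ` g) ` G"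

text \<open>
  After renaming the coordinates by \<open>y\<^bsub>\<sigma> i\<^esub> = x\<^sub>i\<close>, for one and the same permutation \<open>\<sigma>\<close>, the group
  \<open>G\<close> becomes \<open>{diag[v] | v \<in> D}\<close> and the set of monomials \<open>S\<close> becomes \<open>M\<close>.
\<close>

definition same_up_to_perm ::
    "'n::finite pgl set \<Rightarrow> 'n monomial set \<Rightarrow> (complex ^ 'n) set \<Rightarrow> 'n monomial set \<Rightarrow> bool" where
  "same_up_to_perm G S D M \<longleftrightarrow>
     (\<exists>\<sigma>. \<sigma> permutes UNIV \<and>
        G = (\<lambda>v. pgl_class (diag_mat (\<chi> i. v $ \<sigma> i))) ` D \<and>
        S = {m. \<exists>m'\<in>M. \<forall>i. Poly_Mapping.lookup m i = Poly_Mapping.lookup m' (\<sigma> i)})"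

abbreviation Cyc :: "nat \<Rightarrow> int monoid" where
  "Cyc n \<equiv> integer_mod_group n"

end

theory Submission
  imports Defs "HOL-Computational_Algebra.Fundamental_Theorem_Algebra"
begin

text \<open>
  A cubic that is singular nowhere on a linear span of at most three coordinate points must contain
  enough monomials on that span: if all monomials \<open>x\<^sub>i x\<^sub>j x\<^sub>k\<close> with \<open>i, j \<in> J\<close> have \<open>k \<in> E\<close>, where
  \<open>|E| < |J| \<le> 3\<close>, then the at most two quadrics given by the derivatives in the directions of \<open>E\<close>
  have a common zero on the span of \<open>J\<close>, and it is a singular point.  On the other hand, \<open>S\<close> is closed
  under those products and quotients of monomials that have degree \<open>3\<close> again, because it is the set of
  monomials on which the characters take a prescribed value.  From these two properties alone, a finite
  case distinction up to permutations of the variables shows that \<open>S\<close> contains either the monomials of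
  a simple polynomial or one of seven exceptional sets of monomials.

  In the exceptional cases a suitable cubic with precisely these monomials is smooth.  A diagonal group
  that preserves a cubic always lifts, by normalising one coordinate, so the maximality of \<open>[I]\<close>
  forces \<open>G\<close> to be the full group of diagonal symmetries of every smooth cubic supported in \<open>S\<close>.
  This group, and hence \<open>S\<close>, is computed from the exceptional set of monomials.
\<close>

section \<open>Cubic forms\<close>

text \<open>Smoothness at the coordinate points gives every variable x_i a cofactor x_k with x_i^2
  x_k in S. As long as no variable is the cofactor of two others, these monomials form cycles and
  chains ending in a cube, that is, types K and T. The difficulty is therefore a shared cofactor, as
  in x_1^2 x_4 and x_2^2 x_4; there the lines and planes spanned by the competing coordinate points
  are used, with their few cofactors as E. Type Y and all exceptional sets arise in this situation
  only. The class [I] remembers the group and its characters but not the cubic. So F may be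
  exchanged for any smooth cubic supported in S, and in the exceptional cases the coefficients are
  free: they are 1, and 2 on products of three distinct variables, which keeps the equations of a
  singular point within reach of a short elimination.\<close>

lemma eval_poly_superset:
  assumes "finite A" "Poly_Mapping.keys F \<subseteq> A"
  shows "eval_poly F x = (\<Sum>m\<in>A. Poly_Mapping.lookup F m * (\<Prod>i\<in>UNIV. (x $ i) ^ Poly_Mapping.lookup m i))"
  unfolding eval_poly_def using assms by (intro sum.mono_neutral_left) (auto simp: in_keys_iff)

lemma eval_poly_single:
  "eval_poly (Poly_Mapping.single m c) x = c * (\<Prod>i\<in>UNIV. (x $ i) ^ Poly_Mapping.lookup m i)"
  by (subst eval_poly_superset[of "{m}"]) auto

lemma eval_poly_zero [simp]: "eval_poly 0 x = 0"
  by (simp add: eval_poly_def)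

lemma eval_poly_add: "eval_poly (F + H) x = eval_poly F x + eval_poly H x"
proof -
  let ?A = "Poly_Mapping.keys F \<union> Poly_Mapping.keys H"
  show ?thesis
    by (subst (1 2 3) eval_poly_superset[of ?A])
      (auto simp: lookup_add sum.distrib ring_distribs dest: subsetD[OF keys_add])
qed

lemma eval_poly_sum: "eval_poly (sum f A) x = (\<Sum>a\<in>A. eval_poly (f a) x)"
  by (induction A rule: infinite_finite_induct) (auto simp: eval_poly_add)

lemma partial_deriv_superset:
  assumes "finite A" "Poly_Mapping.keys F \<subseteq> A"
  shows "partial_deriv i F = (\<Sum>m\<in>A. Poly_Mapping.single (m - Poly_Mapping.single i 1)
      (of_nat (Poly_Mapping.lookup m i) * Poly_Mapping.lookup F m))"
  unfolding partial_deriv_def using assms by (intro sum.mono_neutral_left) (auto simp: in_keys_iff)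

lemma partial_deriv_zero [simp]: "partial_deriv i 0 = 0"
  by (simp add: partial_deriv_def)

lemma partial_deriv_add: "partial_deriv i (F + H) = partial_deriv i F + partial_deriv i H"
proof -
  let ?A = "Poly_Mapping.keys F \<union> Poly_Mapping.keys H"
  show ?thesis
    by (subst (1 2 3) partial_deriv_superset[of ?A])
      (auto simp: lookup_add sum.distrib ring_distribs single_add dest: subsetD[OF keys_add])
qed

lemma partial_deriv_sum: "partial_deriv i (sum f A) = (\<Sum>a\<in>A. partial_deriv i (f a))"
  by (induction A rule: infinite_finite_induct) (auto simp: partial_deriv_add)

lemma partial_deriv_single:
  "partial_deriv i (Poly_Mapping.single m c) =
     Poly_Mapping.single (m - Poly_Mapping.single i 1) (of_nat (Poly_Mapping.lookup m i) * c)"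
  by (subst partial_deriv_superset[of "{m}"]) auto

section \<open>Monomials as lists of variables\<close>

lemma xmon_Nil [simp]: "xmon [] = 0"
  by (simp add: xmon_def)

lemma xmon_Cons: "xmon (v # vs) = Poly_Mapping.single v 1 + xmon vs"
  by (simp add: xmon_def)

lemma xmon_append: "xmon (vs @ ws) = xmon vs + xmon ws"
  by (simp add: xmon_def)

lemma xmon_cong_mset: "mset vs = mset ws \<Longrightarrow> xmon vs = xmon ws"
  by (metis (mono_tags) mset_map sum_mset_sum_list xmon_def)

lemma lookup_xmon: "Poly_Mapping.lookup (xmon vs) i = count_list vs i"
  by (induction vs) (auto simp: xmon_Cons lookup_add lookup_single when_def)

lemma mono_deg_xmon [simp]: "mono_deg (xmon vs) = length vs"
  by (induction vs) (auto simp: mono_deg_def xmon_Cons lookup_add lookup_single when_def sum.distrib)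

lemma monomial_eq_xmon:
  fixes m :: "'n::finite monomial"
  shows "\<exists>vs. m = xmon vs \<and> length vs = mono_deg m"
proof (induction "mono_deg m" arbitrary: m)
  case 0
  then have "m = 0"
    by (intro poly_mapping_eqI) (auto simp: mono_deg_def)
  then show ?case using 0 by (auto intro: exI[of _ "[]"])
next
  case (Suc d)
  then obtain i where i: "Poly_Mapping.lookup m i \<noteq> 0"
    unfolding mono_deg_def by (metis Zero_not_Suc sum.not_neutral_contains_not_neutral)
  define m' where "m' = m - Poly_Mapping.single i 1"
  have m: "m = Poly_Mapping.single i 1 + m'"
    unfolding m'_def using i
    by (intro poly_mapping_eqI) (auto simp: lookup_add lookup_minus lookup_single when_def)
  then have "mono_deg m = Suc (mono_deg m')"
    by (auto simp: mono_deg_def lookup_add lookup_single when_def sum.distrib)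
  moreover from this obtain vs where "m' = xmon vs" "length vs = mono_deg m'"
    using Suc(1)[of m'] Suc(2) by auto
  ultimately show ?case
    using m by (intro exI[of _ "i # vs"] conjI) (simp_all only: xmon_Cons list.size)
qed

lemma cubic_monomial:
  fixes m :: "'n::finite monomial"
  assumes "mono_deg m = 3"
  obtains a b c where "m = xmon [a, b, c]"
proof -
  obtain vs where "m = xmon vs" "length vs = 3"
    using monomial_eq_xmon[of m] assms by auto
  moreover from this obtain a b c where "vs = [a, b, c]"
    by (auto simp: numeral_3_eq_3 length_Suc_conv)
  ultimately show ?thesis
    using that by blast
qed

lemma prod_xmon:
  fixes x :: "'n::finite \<Rightarrow> 'b::comm_semiring_1"
  shows "(\<Prod>i\<in>UNIV. x i ^ Poly_Mapping.lookup (xmon vs) i) = prod_list (map x vs)"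
proof (induction vs)
  case (Cons v vs)
  have "(\<Prod>i\<in>UNIV. x i ^ (if v = i then Suc 0 else 0)) = x v"
    using prod.delta[of UNIV v x] by (simp add: if_distrib cong: if_cong)
  with Cons show ?case
    by (simp add: xmon_Cons lookup_add lookup_single when_def power_add prod.distrib
        )
qed auto

lemma eval_single_xmon:
  "eval_poly (Poly_Mapping.single (xmon vs) c) x = c * prod_list (map (($) x) vs)"
  by (simp add: eval_poly_single prod_xmon)

text \<open>Reading a monomial as three factors turns the derivative into the Leibniz rule with one
  term per position. Repeated variables are counted by the positions that match, so no exponent
  appears.\<close>

lemma eval_partial_deriv_xmon:
  "eval_poly (partial_deriv i (Poly_Mapping.single (xmon [a, b, c]) k)) x =
     k * ((if a = i then x $ b * x $ c else 0) + (if b = i then x $ a * x $ c else 0)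
        + (if c = i then x $ a * x $ b else 0))"
proof -
  \<comment> \<open>With \<open>i\<close> in front, the truncated subtraction of exponents simply
    removes the first factor; the other positions are reduced to this one by permuting the
    factors.\<close>
  have del: "xmon [i, u, v] - Poly_Mapping.single i 1 = xmon [u, v]" for u v :: 'a
    by (simp add: xmon_Cons)
  have val: "eval_poly (partial_deriv i (Poly_Mapping.single (xmon [i, u, v]) k)) x
      = k * (x $ u * x $ v + (if u = i then x $ i * x $ v else 0) + (if v = i then x $ i * x $ u else 0))"
    for u v
    unfolding partial_deriv_single del
    by (auto simp: eval_single_xmon lookup_xmon algebra_simps)
  have perm: "xmon [a, b, c] = xmon [b, a, c]" "xmon [a, b, c] = xmon [c, a, b]"
    by (auto intro: xmon_cong_mset)
  show ?thesis
  proof (cases "i \<in> {a, b, c}")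
    case False
    then have "Poly_Mapping.lookup (xmon [a, b, c]) i = 0"
      by (auto simp: lookup_xmon)
    then show ?thesis
      using False by (auto simp: partial_deriv_single)
  next
    case True
    then consider "a = i" | "b = i" "a \<noteq> i" | "c = i" "a \<noteq> i" "b \<noteq> i" by auto
    then show ?thesis
    proof cases
      case 1 then show ?thesis using val[of b c] by auto
    next
      case 2 then show ?thesis using val[of a c] perm(1) by (auto simp: algebra_simps)
    next
      case 3 then show ?thesis using val[of a b] perm(2) by (auto simp: algebra_simps)
    qed
  qed
qed

lemma homogeneous_zero [simp]: "homogeneous d 0"
  by (simp add: homogeneous_def)

lemma homogeneous_add: "homogeneous d F \<Longrightarrow> homogeneous d H \<Longrightarrow> homogeneous d (F + H)"
  using keys_add[of F H] by (auto simp: homogeneous_def)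

lemma homogeneous_sum: "(\<And>a. a \<in> A \<Longrightarrow> homogeneous d (f a)) \<Longrightarrow> homogeneous d (sum f A)"
  by (induction A rule: infinite_finite_induct) (auto intro: homogeneous_add)

lemma homogeneous_single: "mono_deg m = d \<Longrightarrow> homogeneous d (Poly_Mapping.single m c)"
  by (simp add: homogeneous_def)

lemma poly_eq_sum_single:
  "F = (\<Sum>m\<in>Poly_Mapping.keys F. Poly_Mapping.single m (Poly_Mapping.lookup F m))"
  by (intro poly_mapping_eqI) (auto simp: lookup_sum lookup_single when_def in_keys_iff)

text \<open>A choice of three factors for every monomial of the support, made so that the Leibniz
  rule can be applied term by term.\<close>

lemma homogeneous_cubic_sum:
  fixes F :: "'n::finite mpoly"
  assumes "homogeneous 3 F"
  shows "\<exists>a b c. (\<forall>m\<in>Poly_Mapping.keys F. xmon [a m, b m, c m] = m) \<and>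
    F = (\<Sum>m\<in>Poly_Mapping.keys F. Poly_Mapping.single (xmon [a m, b m, c m]) (Poly_Mapping.lookup F m))"
proof -
  have "\<exists>t. m = xmon [fst t, fst (snd t), snd (snd t)]" if "m \<in> Poly_Mapping.keys F" for m
    using that assms unfolding homogeneous_def by (metis cubic_monomial fst_conv snd_conv)
  then obtain t where t: "\<And>m. m \<in> Poly_Mapping.keys F \<Longrightarrow> m = xmon [fst (t m), fst (snd (t m)), snd (snd (t m))]"
    by metis
  define a b c where abc: "a = (\<lambda>m. fst (t m))" "b = (\<lambda>m. fst (snd (t m)))" "c = (\<lambda>m. snd (snd (t m)))"
  have x: "xmon [a m, b m, c m] = m" if "m \<in> Poly_Mapping.keys F" for m
    using t[OF that] by (simp only: abc)
  have "F = (\<Sum>m\<in>Poly_Mapping.keys F. Poly_Mapping.single m (Poly_Mapping.lookup F m))"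
    by (rule poly_eq_sum_single)
  also have "\<dots> = (\<Sum>m\<in>Poly_Mapping.keys F. Poly_Mapping.single (xmon [a m, b m, c m]) (Poly_Mapping.lookup F m))"
    by (intro sum.cong refl arg_cong2[where f = Poly_Mapping.single]) (simp only: x)
  finally have "F = (\<Sum>m\<in>Poly_Mapping.keys F. Poly_Mapping.single (xmon [a m, b m, c m]) (Poly_Mapping.lookup F m))" .
  then show ?thesis
    by (intro exI[of _ a] exI[of _ b] exI[of _ c] conjI ballI) (rule x)
qed

lemma cubic_partial_deriv_at_0:
  assumes "homogeneous 3 F"
  shows "eval_poly (partial_deriv i F) 0 = 0"
proof -
  obtain a b c where F:
    "F = (\<Sum>m\<in>Poly_Mapping.keys F. Poly_Mapping.single (xmon [a m, b m, c m]) (Poly_Mapping.lookup F m))"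
    using homogeneous_cubic_sum[OF assms] by (elim exE conjE) (rule that)
  show ?thesis
    by (subst F) (simp add: partial_deriv_sum eval_poly_sum eval_partial_deriv_xmon cong: if_cong)
qed

lemma smooth_cubic_iff:
  assumes "homogeneous 3 F"
  shows "smooth F \<longleftrightarrow> (\<forall>x. (\<forall>i. eval_poly (partial_deriv i F) x = 0) \<longrightarrow> x = 0)"
  unfolding smooth_def using cubic_partial_deriv_at_0[OF assms] by auto

section \<open>Linear changes of coordinates\<close>

lemma trilinear_sum:
  fixes u v w :: "'n \<Rightarrow> complex"
  shows "(\<Sum>j\<in>A. \<Sum>k\<in>B. \<Sum>l\<in>C. u j * v k * w l) = sum u A * sum v B * sum w C"
  by (simp only: sum_distrib_left[symmetric] sum_distrib_right[symmetric])

text \<open>Each monomial becomes a product of three linear forms, given by rows of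
  \<open>P\<close>, and \<open>H\<close> is its expansion over all triples of indices. The chain
  rule is stated together with the construction so that later proofs can forget the formula for
  \<open>H\<close>.\<close>

lemma cubic_substitution:
  fixes F :: "'n::finite mpoly" and P :: "complex ^ 'n ^ 'n"
  assumes "homogeneous 3 F"
  obtains H where "homogeneous 3 H" "\<And>x. eval_poly H x = eval_poly F (P *v x)"
    "\<And>x i. eval_poly (partial_deriv i H) x = (\<Sum>r\<in>UNIV. P $ r $ i * eval_poly (partial_deriv r F) (P *v x))"
proof -
  obtain a b c where F:
    "F = (\<Sum>m\<in>Poly_Mapping.keys F. Poly_Mapping.single (xmon [a m, b m, c m]) (Poly_Mapping.lookup F m))"
    using homogeneous_cubic_sum[OF assms] by (elim exE conjE) (rule that)
  define H where "H = (\<Sum>m\<in>Poly_Mapping.keys F. \<Sum>j\<in>UNIV. \<Sum>k\<in>UNIV. \<Sum>l\<in>UNIV.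
     Poly_Mapping.single (xmon [j, k, l]) (Poly_Mapping.lookup F m * (P $ a m $ j * P $ b m $ k * P $ c m $ l)))"
  have "homogeneous 3 H"
    unfolding H_def by (intro homogeneous_sum homogeneous_single) simp
  moreover have "eval_poly H x = eval_poly F (P *v x)" for x
  proof -
    have "(\<Sum>j\<in>UNIV. \<Sum>k\<in>UNIV. \<Sum>l\<in>UNIV. p * (P $ s $ j * P $ t $ k * P $ u $ l) * (x $ j * (x $ k * x $ l)))
        = p * ((P *v x) $ s * ((P *v x) $ t * (P *v x) $ u))" (is "?l = _") for p s t u
    proof -
      have "?l = (\<Sum>j\<in>UNIV. \<Sum>k\<in>UNIV. \<Sum>l\<in>UNIV.
          (p * (P $ s $ j * x $ j)) * (P $ t $ k * x $ k) * (P $ u $ l * x $ l))"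
        by (intro sum.cong refl) (simp only: mult_ac)
      also have "\<dots> = p * (P *v x) $ s * (P *v x) $ t * (P *v x) $ u"
        unfolding trilinear_sum by (simp add: matrix_vector_mult_def sum_distrib_left)
      finally show ?thesis by (simp add: mult.assoc)
    qed
    then show ?thesis
      by (subst F) (simp only: H_def eval_poly_sum eval_single_xmon list.map prod_list.Cons prod_list.Nil mult_1_right)
  qed
  moreover have "eval_poly (partial_deriv i H) x
    = (\<Sum>r\<in>UNIV. P $ r $ i * eval_poly (partial_deriv r F) (P *v x))" for x i
  proof -
    \<comment> \<open>The position that is differentiated contributes the coefficient of x_i in its
      linear form; the other two positions sum up to entries of \<open>P *v x\<close>.\<close>
    have D: "(\<Sum>j\<in>UNIV. \<Sum>k\<in>UNIV. \<Sum>l\<in>UNIV. p * (P $ s $ j * P $ t $ k * P $ u $ l) *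
        ((if j = i then x $ k * x $ l else 0) + (if k = i then x $ j * x $ l else 0) + (if l = i then x $ j * x $ k else 0)))
      = p * (P $ s $ i * (P *v x) $ t * (P *v x) $ u + P $ t $ i * (P *v x) $ s * (P *v x) $ u
          + P $ u $ i * (P *v x) $ s * (P *v x) $ t)" (is "?l = _") for p s t u
    proof -
      have "?l = (\<Sum>j\<in>UNIV. \<Sum>k\<in>UNIV. \<Sum>l\<in>UNIV.
            (if j = i then p * P $ s $ i else 0) * (P $ t $ k * x $ k) * (P $ u $ l * x $ l)
          + (P $ s $ j * x $ j) * (if k = i then p * P $ t $ i else 0) * (P $ u $ l * x $ l)
          + (P $ s $ j * x $ j) * (P $ t $ k * x $ k) * (if l = i then p * P $ u $ i else 0))"
        by (intro sum.cong refl) (simp add: algebra_simps)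
      also have "\<dots> = p * P $ s $ i * (P *v x) $ t * (P *v x) $ u + (P *v x) $ s * (p * P $ t $ i) * (P *v x) $ u
          + (P *v x) $ s * (P *v x) $ t * (p * P $ u $ i)"
        by (simp only: sum.distrib trilinear_sum) (simp add: matrix_vector_mult_def)
      finally show ?thesis by (simp add: algebra_simps)
    qed
    \<comment> \<open>The same three terms seen from the gradient of \<open>F\<close>: the sum over
      \<open>r\<close> picks the row belonging to each factor.\<close>
    have E: "(\<Sum>r\<in>UNIV. P $ r $ i * (p * ((if s = r then y $ t * y $ u else 0) + (if t = r then y $ s * y $ u else 0)
        + (if u = r then y $ s * y $ t else 0))))
      = p * (P $ s $ i * y $ t * y $ u + P $ t $ i * y $ s * y $ u + P $ u $ i * y $ s * y $ t)" for p s t u and y :: "complex^'n"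
    proof -
      have "P $ r $ i * (p * ((if s = r then y $ t * y $ u else 0) + (if t = r then y $ s * y $ u else 0)
        + (if u = r then y $ s * y $ t else 0))) = (if s = r then p * P $ r $ i * y $ t * y $ u else 0)
        + (if t = r then p * P $ r $ i * y $ s * y $ u else 0) + (if u = r then p * P $ r $ i * y $ s * y $ t else 0)" for r
        by (simp add: algebra_simps)
      then show ?thesis
        by (simp add: sum.distrib algebra_simps)
    qed
    have "eval_poly (partial_deriv i H) x = (\<Sum>m\<in>Poly_Mapping.keys F. Poly_Mapping.lookup F m *
        (P $ a m $ i * (P *v x) $ b m * (P *v x) $ c m + P $ b m $ i * (P *v x) $ a m * (P *v x) $ c m
          + P $ c m $ i * (P *v x) $ a m * (P *v x) $ b m))"
      unfolding H_def partial_deriv_sum eval_poly_sum eval_partial_deriv_xmon D ..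
    also have "\<dots> = (\<Sum>m\<in>Poly_Mapping.keys F. \<Sum>r\<in>UNIV. P $ r $ i *
        eval_poly (partial_deriv r (Poly_Mapping.single (xmon [a m, b m, c m]) (Poly_Mapping.lookup F m))) (P *v x))"
      unfolding eval_partial_deriv_xmon E ..
    also have "\<dots> = (\<Sum>r\<in>UNIV. P $ r $ i * eval_poly (partial_deriv r F) (P *v x))"
      by (subst (3) F, subst sum.swap) (simp only: partial_deriv_sum eval_poly_sum sum_distrib_left)
    finally show ?thesis .
  qed
  ultimately show ?thesis using that by blast
qed

text \<open>The gradient of \<open>H\<close> at x is the transpose of \<open>P\<close> applied to
  the gradient of \<open>F\<close> at \<open>P *v x\<close>, so a singular point of \<open>H\<close>
  is carried to one of \<open>F\<close>.\<close>

lemma smooth_substitution: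
  fixes F H :: "'n::finite mpoly" and P :: "complex ^ 'n ^ 'n"
  assumes "homogeneous 3 F" "smooth F" "invertible P" "homogeneous 3 H"
    and grad: "\<And>x i. eval_poly (partial_deriv i H) x
      = (\<Sum>r\<in>UNIV. P $ r $ i * eval_poly (partial_deriv r F) (P *v x))"
  shows "smooth H"
  unfolding smooth_cubic_iff[OF assms(4)]
proof (intro allI impI)
  fix x assume x: "\<forall>i. eval_poly (partial_deriv i H) x = 0"
  obtain Q where Q: "P ** Q = mat 1" "Q ** P = mat 1"
    using assms(3) unfolding invertible_def by blast
  define w :: "complex ^ 'n" where "w = (\<chi> r. eval_poly (partial_deriv r F) (P *v x))"
  have "w v* P = 0"
    using x by (simp add: vec_eq_iff vector_matrix_mult_def w_def grad mult.commute)
  then have "w v* (P ** Q) = 0"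
    by (simp add: vector_matrix_mul_assoc[symmetric])
  then have "w = 0"
    by (simp add: Q)
  then have "P *v x = 0"
    using assms(2) unfolding smooth_cubic_iff[OF assms(1)] by (auto simp: w_def vec_eq_iff)
  then have "(Q ** P) *v x = 0"
    by (simp add: matrix_vector_mul_assoc[symmetric])
  then show "x = 0" by (simp add: Q)
qed

text \<open>Dedekind's argument for the independence of distinct characters.\<close>

lemma monomial_functions_independent:
  fixes A :: "'n::finite monomial set" and c :: "'n monomial \<Rightarrow> complex"
  assumes "finite A" "\<And>x :: complex ^ 'n. (\<Sum>m\<in>A. c m * (\<Prod>i\<in>UNIV. (x $ i) ^ Poly_Mapping.lookup m i)) = 0" "m \<in> A"
  shows "c m = 0"
  using assms
proof (induction A arbitrary: c m rule: finite_induct)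
  case (insert a A)
  define M where "M m x = (\<Prod>i\<in>UNIV. (x $ i) ^ Poly_Mapping.lookup m i)" for m and x :: "complex ^ 'n"
  have M_mult: "M m (\<chi> i. x $ i * y $ i) = M m x * M m y" for m x y
    by (simp add: M_def power_mult_distrib prod.distrib)
  have zero: "c a * M a x + (\<Sum>m\<in>A. c m * M m x) = 0" for x
    using insert.prems(1)[of x] insert.hyps by (simp add: M_def)
  have cA: "c b = 0" if "b \<in> A" for b
  proof -
    obtain i where i: "Poly_Mapping.lookup a i \<noteq> Poly_Mapping.lookup b i"
      using \<open>b \<in> A\<close> insert.hyps poly_mapping_eqI by metis
    \<comment> \<open>Doubling one variable in which \<open>a\<close> and \<open>b\<close> have
      different exponents separates the two monomials, because powers of 2 are distinct.\<close>
    define y :: "complex ^ 'n" where "y = (\<chi> j. if j = i then 2 else 1)"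
    have My: "M m y = 2 ^ Poly_Mapping.lookup m i" for m
    proof -
      have "M m y = (\<Prod>j\<in>UNIV. if j = i then 2 ^ Poly_Mapping.lookup m i else 1)"
        unfolding M_def y_def by (intro prod.cong) auto
      then show ?thesis by simp
    qed
    \<comment> \<open>The relation at the scaled point minus \<open>M a y\<close> times the relation
      itself no longer contains \<open>a\<close>, so the induction hypothesis applies to the new
      coefficients.\<close>
    have "(\<Sum>m\<in>A. c m * (M m y - M a y) * M m x) = 0" for x
    proof -
      have "c a * (M a x * M a y) + (\<Sum>m\<in>A. c m * (M m x * M m y)) = 0"
        using zero[of "\<chi> i. x $ i * y $ i"] by (simp add: M_mult)
      moreover have "(c a * M a x + (\<Sum>m\<in>A. c m * M m x)) * M a y = 0"
        using zero[of x] by simp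
      then have "c a * (M a x * M a y) + (\<Sum>m\<in>A. c m * (M m x * M a y)) = 0"
        by (simp add: distrib_right sum_distrib_right mult.assoc)
      ultimately have "c a * (M a x * M a y) + (\<Sum>m\<in>A. c m * (M m x * M m y))
          = c a * (M a x * M a y) + (\<Sum>m\<in>A. c m * (M m x * M a y))"
        by (simp only:)
      then have "(\<Sum>m\<in>A. c m * (M m x * M m y)) = (\<Sum>m\<in>A. c m * (M m x * M a y))"
        by (simp only: add_left_cancel)
      then show ?thesis
        by (simp add: algebra_simps sum_subtractf)
    qed
    then have "c b * (M b y - M a y) = 0"
      using insert.IH[of "\<lambda>m. c m * (M m y - M a y)" b] \<open>b \<in> A\<close> unfolding M_def by blast
    moreover have "M b y \<noteq> M a y"
    proof
      assume "M b y = M a y"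
      then have "of_nat (2 ^ Poly_Mapping.lookup b i) = (of_nat (2 ^ Poly_Mapping.lookup a i) :: complex)"
        by (simp add: My)
      then have "(2::nat) ^ Poly_Mapping.lookup b i = 2 ^ Poly_Mapping.lookup a i"
        by (simp only: of_nat_eq_iff)
      with i show False by simp
    qed
    ultimately show ?thesis by simp
  qed
  have "c a * M a (\<chi> i. 1) = 0"
    using zero[of "\<chi> i. 1"] cA by simp
  then have "c a = 0" by (simp add: M_def)
  with cA insert.prems show ?case by blast
qed simp

text \<open>Scaling the variables by \<open>l\<close> multiplies each monomial by its own value at
  \<open>l\<close>; the independence just proved allows the coefficients of both sides to be
  compared.\<close>

lemma semi_invariant_monomials:
  fixes F :: "'n::finite mpoly"
  assumes "\<And>x. eval_poly F (\<chi> i. l i * x $ i) = k * eval_poly F x" "m \<in> Poly_Mapping.keys F"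
  shows "(\<Prod>i\<in>UNIV. l i ^ Poly_Mapping.lookup m i) = k"
proof -
  define M where "M m x = (\<Prod>i\<in>UNIV. (x $ i) ^ Poly_Mapping.lookup m i)" for m and x :: "complex ^ 'n"
  define L where "L m = (\<Prod>i\<in>UNIV. l i ^ Poly_Mapping.lookup m i)" for m
  have "M m (\<chi> i. l i * x $ i) = L m * M m x" for m x
    by (simp add: M_def L_def power_mult_distrib prod.distrib)
  moreover have "eval_poly F x = (\<Sum>m\<in>Poly_Mapping.keys F. Poly_Mapping.lookup F m * M m x)" for x
    by (simp add: eval_poly_def M_def)
  ultimately have "(\<Sum>m\<in>Poly_Mapping.keys F. (Poly_Mapping.lookup F m * (L m - k)) * M m x) = 0" for x
    using assms(1)[of x] by (simp add: algebra_simps sum_subtractf sum_distrib_left)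
  then have "Poly_Mapping.lookup F m * (L m - k) = 0"
    using monomial_functions_independent[OF finite_keys _ assms(2), of
      "\<lambda>m. Poly_Mapping.lookup F m * (L m - k)"]
    unfolding M_def by blast
  then show ?thesis
    using assms(2) by (auto simp: in_keys_iff L_def)
qed

section \<open>Two conics meet\<close>

text \<open>The fundamental theorem of algebra in homogeneous form: a vanishing leading coefficient
  puts a root at (1, 0), otherwise y = 1 leaves a polynomial of degree 4.\<close>

lemma binary_quartic_root:
  fixes c0 c1 c2 c3 c4 :: complex
  obtains x y where "x \<noteq> 0 \<or> y \<noteq> 0"
    "c4 * x ^ 4 + c3 * x ^ 3 * y + c2 * x\<^sup>2 * y\<^sup>2 + c1 * x * y ^ 3 + c0 * y ^ 4 = 0"
proof (cases "c4 = 0")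
  case True
  then show ?thesis using that[of 1 0] by simp
next
  case False
  then obtain x where "poly [:c0, c1, c2, c3, c4:] x = 0"
    using alg_closed_imp_poly_has_root[of "[:c0, c1, c2, c3, c4:]"] by auto
  then show ?thesis
    using that[of x 1] by (simp add: algebra_simps power2_eq_square power3_eq_cube power4_eq_xxxx)
qed

lemma binary_quadratic_root:
  fixes a b c :: complex
  obtains x y where "x \<noteq> 0 \<or> y \<noteq> 0" "a * x\<^sup>2 + b * x * y + c * y\<^sup>2 = 0"
proof (cases "a = 0")
  case True
  then show ?thesis using that[of 1 0] by simp
next
  case False
  then obtain x where "poly [:c, b, a:] x = 0"
    using alg_closed_imp_poly_has_root[of "[:c, b, a:]"] by auto
  then show ?thesis
    using that[of x 1] by (simp add: algebra_simps power2_eq_square)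
qed

text \<open>Quadratic forms are functions with unspecified coefficients, the zero form included.
  Sums over monomials and linear substitutions then need closure properties only.\<close>

definition ternary_quadratic :: "(complex \<Rightarrow> complex \<Rightarrow> complex \<Rightarrow> complex) \<Rightarrow> bool" where
  "ternary_quadratic f \<longleftrightarrow> (\<exists>a b c d e g. \<forall>x y z.
     f x y z = a * x\<^sup>2 + b * y\<^sup>2 + c * z\<^sup>2 + d * x * y + e * x * z + g * y * z)"

lemma ternary_quadraticE:
  assumes "ternary_quadratic f"
  obtains a b c d e g where
    "\<And>x y z. f x y z = a * x\<^sup>2 + b * y\<^sup>2 + c * z\<^sup>2 + d * x * y + e * x * z + g * y * z"
  using assms unfolding ternary_quadratic_def by (elim exE) (rule that, blast)

lemma ternary_quadraticI:
  "(\<And>x y z. f x y z = a * x\<^sup>2 + b * y\<^sup>2 + c * z\<^sup>2 + d * x * y + e * x * z + g * y * z)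
    \<Longrightarrow> ternary_quadratic f"
  unfolding ternary_quadratic_def by blast

lemma ternary_quadratic_zero: "ternary_quadratic (\<lambda>x y z. 0)"
  by (rule ternary_quadraticI[of _ 0 0 0 0 0 0]) simp

lemma ternary_quadratic_add:
  assumes "ternary_quadratic f" "ternary_quadratic h"
  shows "ternary_quadratic (\<lambda>x y z. f x y z + h x y z)"
proof -
  obtain a b c d e g where
    "\<And>x y z. f x y z = a * x\<^sup>2 + b * y\<^sup>2 + c * z\<^sup>2 + d * x * y + e * x * z + g * y * z"
    by (rule ternary_quadraticE[OF assms(1)], rule that)
  moreover obtain a' b' c' d' e' g' where
    "\<And>x y z. h x y z = a' * x\<^sup>2 + b' * y\<^sup>2 + c' * z\<^sup>2 + d' * x * y + e' * x * z + g' * y * z"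
    by (rule ternary_quadraticE[OF assms(2)], rule that)
  ultimately show ?thesis
    by (intro ternary_quadraticI[of _ "a + a'" "b + b'" "c + c'" "d + d'" "e + e'"
      "g + g'"]) (simp add: algebra_simps)
qed

lemma ternary_quadratic_cmult:
  assumes "ternary_quadratic f"
  shows "ternary_quadratic (\<lambda>x y z. k * f x y z)"
proof -
  obtain a b c d e g where
    "\<And>x y z. f x y z = a * x\<^sup>2 + b * y\<^sup>2 + c * z\<^sup>2 + d * x * y + e * x * z + g * y * z"
    by (rule ternary_quadraticE[OF assms], rule that)
  then show ?thesis
    by (intro ternary_quadraticI[of _ "k * a" "k * b" "k * c" "k * d" "k * e"
      "k * g"]) (simp add: algebra_simps)
qed

lemma ternary_quadratic_sum:
  "(\<And>i. i \<in> A \<Longrightarrow> ternary_quadratic (f i)) \<Longrightarrow> ternary_quadratic (\<lambda>x y z. \<Sum>i\<in>A. f i x y z)"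
  by (induction A rule: infinite_finite_induct) (auto intro: ternary_quadratic_zero ternary_quadratic_add)

lemma ternary_quadratic_mult:
  "ternary_quadratic (\<lambda>x y z. (p * x + q * y + r * z) * (p' * x + q' * y + r' * z))"
  by (rule ternary_quadraticI[of _ "p * p'" "q * q'" "r * r'" "p * q' + q * p'" "p * r' + r * p'"
    "q * r' + r * q'"]) (simp add: algebra_simps power2_eq_square)

lemma ternary_quadratic_subst:
  assumes "ternary_quadratic f"
  shows "ternary_quadratic (\<lambda>x y z. f (p1 * x + q1 * y + r1 * z) (p2 * x + q2 * y + r2 * z) (p3 * x + q3 * y + r3 * z))"
proof -
  obtain a b c d e g where
    "\<And>x y z. f x y z = a * x\<^sup>2 + b * y\<^sup>2 + c * z\<^sup>2 + d * x * y + e * x * z + g * y * z"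
    by (rule ternary_quadraticE[OF assms], rule that)
  then have "f x y z = a * (x * x) + b * (y * y) + c * (z * z) + d * (x * y) + e * (x * z) + g * (y * z)" for x y z
    by (simp add: power2_eq_square)
  then show ?thesis
    by (simp only:) (intro ternary_quadratic_add ternary_quadratic_cmult ternary_quadratic_mult)
qed

text \<open>The conic \<open>f\<close> passes through \<open>(1, 0, 0)\<close>, so that it is parametrised by the lines through
  this point.\<close>

lemma conics_meet_aux:
  assumes f: "\<And>x y z. f x y z = x * (\<beta> * y + \<delta> * z) + (\<gamma> * y\<^sup>2 + \<epsilon> * y * z + \<phi> * z\<^sup>2)"
    and h: "ternary_quadratic h"
  shows "\<exists>x y z. (x \<noteq> 0 \<or> y \<noteq> 0 \<or> z \<noteq> 0) \<and> f x y z = 0 \<and> h x y z = (0 :: complex)"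
proof -
  obtain a b c d e g where
    h: "\<And>x y z. h x y z = a * x\<^sup>2 + b * y\<^sup>2 + c * z\<^sup>2 + d * x * y + e * x * z + g * y * z"
    by (rule ternary_quadraticE[OF h], rule that)
  \<comment> \<open>At (x, t y, t z) the form \<open>f\<close> takes the value t x l + t^2 q, so
    besides (1, 0, 0) the line in direction (y, z) meets the conic in (-q, y l, z l).\<close>
  define l where "l y z = \<beta> * y + \<delta> * z" for y z
  define q where "q y z = \<gamma> * y\<^sup>2 + \<epsilon> * y * z + \<phi> * z\<^sup>2" for y z
  \<comment> \<open>The coefficients are those of \<open>h\<close> at (-q, y l, z l), a form of
    degree four in y and z.\<close>
  obtain y z where yz: "y \<noteq> 0 \<or> z \<noteq> 0" and
    R: "(a * \<gamma>\<^sup>2 - d * (\<gamma> * \<beta>) + \<beta>\<^sup>2 * b) * y ^ 4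
     + (2 * a * \<gamma> * \<epsilon> - d * (\<gamma> * \<delta> + \<epsilon> * \<beta>) - e * \<gamma> * \<beta> + 2 * \<beta> * \<delta> * b + \<beta>\<^sup>2 * g) * y ^ 3 * z
     + (a * (\<epsilon>\<^sup>2 + 2 * \<gamma> * \<phi>) - d * (\<epsilon> * \<delta> + \<phi> * \<beta>) - e * (\<gamma> * \<delta> + \<epsilon> * \<beta>) + \<delta>\<^sup>2 * b + 2 * \<beta> * \<delta> * g + \<beta>\<^sup>2 * c) * y\<^sup>2 * z\<^sup>2
     + (2 * a * \<epsilon> * \<phi> - d * \<phi> * \<delta> - e * (\<epsilon> * \<delta> + \<phi> * \<beta>) + \<delta>\<^sup>2 * g + 2 * \<beta> * \<delta> * c) * y * z ^ 3
     + (a * \<phi>\<^sup>2 - e * \<phi> * \<delta> + \<delta>\<^sup>2 * c) * z ^ 4 = 0"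
    by (rule binary_quartic_root)
  have h0: "h (- q y z) (y * l y z) (z * l y z) = 0"
    using R unfolding h q_def l_def by algebra
  consider "l y z \<noteq> 0" | "l y z = 0" "q y z = 0" | "l y z = 0" "q y z \<noteq> 0" by blast
  then show ?thesis
  proof cases
    case 1
    have "f (- q y z) (y * l y z) (z * l y z) = - q y z * (l y z * l y z) + (l y z)\<^sup>2 * q y z"
      unfolding f l_def q_def by algebra
    then have "f (- q y z) (y * l y z) (z * l y z) = 0"
      by (simp add: power2_eq_square)
    moreover have "y * l y z \<noteq> 0 \<or> z * l y z \<noteq> 0"
      using 1 yz by simp
    ultimately show ?thesis using h0 by blast
  next
    case 2
    \<comment> \<open>The whole line through (1, 0, 0) and (0, y, z) lies on the conic
      \<open>f\<close>, so any zero of \<open>h\<close> on it will do.\<close>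
    obtain s k where sk: "s \<noteq> 0 \<or> k \<noteq> 0"
      "a * s\<^sup>2 + (d * y + e * z) * s * k + (b * y\<^sup>2 + c * z\<^sup>2 + g * y * z) * k\<^sup>2 = 0"
      by (rule binary_quadratic_root)
    have "f s (k * y) (k * z) = s * k * l y z + k\<^sup>2 * q y z"
      unfolding f l_def q_def by algebra
    moreover have "h s (k * y) (k * z) = a * s\<^sup>2 + (d * y + e * z) * s * k + (b * y\<^sup>2 + c * z\<^sup>2 + g * y * z) * k\<^sup>2"
      unfolding h by algebra
    moreover have "s \<noteq> 0 \<or> k * y \<noteq> 0 \<or> k * z \<noteq> 0"
      using sk yz by auto
    ultimately show ?thesis
      using 2 sk(2) by (metis add_0 mult_zero_right)
  next
    case 3
    \<comment> \<open>The point found is (-q, 0, 0) with q nonzero, so \<open>h\<close> vanishes at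
      (1, 0, 0) itself.\<close>
    with h0 have "a = 0" by (simp add: h)
    then have "f 1 0 0 = 0" "h 1 0 0 = 0"
      by (simp_all add: f h)
    then show ?thesis
      using one_neq_zero by blast
  qed
qed

text \<open>A zero of \<open>f\<close> on the line z = 0 is moved to (1, 0, 0), which brings
  \<open>f\<close> into the normal form of \<open>conics_meet_aux\<close>.\<close>

lemma conics_meet:
  assumes f: "ternary_quadratic f" and h: "ternary_quadratic h"
  obtains x y z where "x \<noteq> 0 \<or> y \<noteq> 0 \<or> z \<noteq> 0" "f x y z = 0" "h x y z = 0"
proof -
  obtain a b c d e g where
    F: "\<And>x y z. f x y z = a * x\<^sup>2 + b * y\<^sup>2 + c * z\<^sup>2 + d * x * y + e * x * z + g * y * z"
    by (rule ternary_quadraticE[OF f], rule that)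
  obtain p q where pq: "p \<noteq> 0 \<or> q \<noteq> 0" "a * p\<^sup>2 + d * p * q + b * q\<^sup>2 = 0"
    by (rule binary_quadratic_root)
  \<comment> \<open>\<open>(u, v)\<close> is a unit vector completing \<open>(p, q)\<close> to a
    basis: (1, 0) if p = 0, since then q is nonzero, and (0, 1) otherwise.\<close>
  define u where "u = (if p = 0 then 1 else 0 :: complex)"
  define v where "v = (if p = 0 then 0 else 1 :: complex)"
  define f' where "f' x y z = f (p * x + u * y + 0 * z) (q * x + v * y + 0 * z) (0 * x + 0 * y + 1 * z)" for x y z
  define h' where "h' x y z = h (p * x + u * y + 0 * z) (q * x + v * y + 0 * z) (0 * x + 0 * y + 1 * z)" for x y z
  have F': "f' x y z = x * ((2 * a * p * u + 2 * b * q * v + d * (p * v + q * u)) * y + (e * p + g * q) * z)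
      + ((a * u\<^sup>2 + b * v\<^sup>2 + d * u * v) * y\<^sup>2 + (e * u + g * v) * y * z + c * z\<^sup>2)" for x y z
  proof -
    have "f' x y z = (a * p\<^sup>2 + d * p * q + b * q\<^sup>2) * x\<^sup>2 + x * ((2 * a * p * u + 2 * b * q * v + d * (p * v + q * u)) * y + (e * p + g * q) * z)
      + ((a * u\<^sup>2 + b * v\<^sup>2 + d * u * v) * y\<^sup>2 + (e * u + g * v) * y * z + c * z\<^sup>2)"
      unfolding f'_def F by algebra
    with pq show ?thesis by simp
  qed
  have "ternary_quadratic h'"
    unfolding h'_def by (rule ternary_quadratic_subst[OF h])
  then obtain x y z where xyz: "x \<noteq> 0 \<or> y \<noteq> 0 \<or> z \<noteq> 0" "f' x y z = 0" "h' x y z = 0"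
    using conics_meet_aux[OF F'] by blast
  show ?thesis
  proof (rule that)
    show "p * x + u * y \<noteq> 0 \<or> q * x + v * y \<noteq> 0 \<or> z \<noteq> 0"
    proof (cases "p = 0")
      case True
      with pq(1) have "u = 1" "v = 0" "q \<noteq> 0" by (simp_all add: u_def v_def)
      with True xyz(1) show ?thesis by simp
    next
      case False
      then have "u = 0" "v = 1" by (simp_all add: u_def v_def)
      with False xyz(1) show ?thesis by (cases "x = 0") simp_all
    qed
    show "f (p * x + u * y) (q * x + v * y) z = 0" "h (p * x + u * y) (q * x + v * y) z = 0"
      using xyz(2,3) by (simp_all add: f'_def h'_def)
  qed
qed

section \<open>The monomials of a smooth cubic\<close>

lemma ternary_quadratic_partial_deriv:
  fixes F :: "'n::finite mpoly" and u v w :: "complex ^ 'n"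
  assumes "homogeneous 3 F"
  shows "ternary_quadratic (\<lambda>x y z. eval_poly (partial_deriv i F) (x *s u + y *s v + z *s w))"
proof -
  obtain a b c where F:
    "F = (\<Sum>m\<in>Poly_Mapping.keys F. Poly_Mapping.single (xmon [a m, b m, c m]) (Poly_Mapping.lookup F m))"
    using homogeneous_cubic_sum[OF assms] by (elim exE conjE) (rule that)
  have prod: "ternary_quadratic (\<lambda>x y z. if t then (x *s u + y *s v + z *s w) $ j * (x *s u + y *s v + z *s w) $ k else 0)" for t j k
    using ternary_quadratic_mult[of "u $ j" "v $ j" "w $ j" "u $ k" "v $ k" "w $ k"]
    by (cases t) (simp_all add: mult.commute ternary_quadratic_zero)
  show ?thesis
    by (subst F) (simp only: partial_deriv_sum eval_poly_sum eval_partial_deriv_xmon,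
        intro ternary_quadratic_sum ternary_quadratic_cmult ternary_quadratic_add prod)
qed

text \<open>A term x_i x_j x_k contributes a multiple of x_i x_j to the derivative by x_k. On the
  span of \<open>J\<close> this can be nonzero only for i and j in \<open>J\<close>, and for k
  outside \<open>E\<close> no such term exists.\<close>

lemma partial_deriv_vanishes:
  fixes F :: "'n::finite mpoly" and x :: "complex ^ 'n"
  assumes "homogeneous 3 F" "\<And>i. i \<notin> J \<Longrightarrow> x $ i = 0" "k \<notin> E"
    and none: "\<And>i j k. i \<in> J \<Longrightarrow> j \<in> J \<Longrightarrow> k \<notin> E \<Longrightarrow> xmon [i, j, k] \<notin> Poly_Mapping.keys F"
  shows "eval_poly (partial_deriv k F) x = 0"
proof -
  obtain a b c where "\<forall>m\<in>Poly_Mapping.keys F. xmon [a m, b m, c m] = m" and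
    F: "F = (\<Sum>m\<in>Poly_Mapping.keys F. Poly_Mapping.single (xmon [a m, b m, c m]) (Poly_Mapping.lookup F m))"
    using homogeneous_cubic_sum[OF assms(1)] by (elim exE conjE) (rule that)
  note m = bspec[OF this(1)]
  have z: "x $ i * x $ j = 0" if "xmon [i, j, k] \<in> Poly_Mapping.keys F" for i j
  proof (rule ccontr)
    assume "x $ i * x $ j \<noteq> 0"
    then have "i \<in> J" "j \<in> J" using assms(2)[of i] assms(2)[of j] by auto
    then show False using none[of i j k] assms(3) that by blast
  qed
  have "eval_poly (partial_deriv k (Poly_Mapping.single (xmon [a m, b m, c m]) (Poly_Mapping.lookup F m))) x = 0"
    if "m \<in> Poly_Mapping.keys F" for m
  proof -
    have "xmon [b m, c m, a m] = xmon [a m, b m, c m]" "xmon [a m, c m, b m] = xmon [a m, b m, c m]"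
      by (auto intro!: xmon_cong_mset)
    then have "(if a m = k then x $ b m * x $ c m else 0) = 0" "(if b m = k then x $ a m * x $ c m else 0) = 0"
      "(if c m = k then x $ a m * x $ b m else 0) = 0"
      using z[of "b m" "c m"] z[of "a m" "c m"] z[of "a m" "b m"] m[OF that] that
      by (auto simp del: mult_eq_0_iff)
    then show ?thesis
      unfolding eval_partial_deriv_xmon by (simp only: add_0 mult_zero_right)
  qed
  then show ?thesis
    by (subst F) (simp only: partial_deriv_sum eval_poly_sum, rule sum.neutral, blast)
qed

lemma smooth_cubic_monomials:
  fixes F :: "'n::finite mpoly" and J E :: "'n list"
  assumes F: "homogeneous 3 F" "smooth F"
    and J: "distinct J" "length J \<le> 3" "length E < length J"
  shows "\<exists>i\<in>set J. \<exists>j\<in>set J. \<exists>k. k \<notin> set E \<and> xmon [i, j, k] \<in> Poly_Mapping.keys F"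
proof (rule ccontr)
  assume none: "\<not> ?thesis"
  define ax where "ax = (\<lambda>a::'n. axis a (1::complex))"
  have sing: False if "x \<noteq> 0" "\<And>i. i \<notin> set J \<Longrightarrow> x $ i = 0"
    "\<And>e. e \<in> set E \<Longrightarrow> eval_poly (partial_deriv e F) x = 0" for x
  proof -
    have "eval_poly (partial_deriv k F) x = 0" for k
      using that partial_deriv_vanishes[OF F(1), of "set J" x k "set E"] none by blast
    then show False
      using F(2) \<open>x \<noteq> 0\<close> unfolding smooth_cubic_iff[OF F(1)] by blast
  qed
  have quad: "ternary_quadratic (\<lambda>x y z. eval_poly (partial_deriv e F) (x *s ax a + y *s ax b + z *s ax c))" for e a b c
    by (rule ternary_quadratic_partial_deriv[OF F(1)])
  have yy: "ternary_quadratic (\<lambda>x y z. y * y)" and zz: "ternary_quadratic (\<lambda>x y z. z * z)"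
    using ternary_quadratic_mult[of 0 1 0 0 1 0] ternary_quadratic_mult[of 0 0 1 0 0 1] by simp_all
  have comb: "(x *s ax a + y *s ax b + z *s ax c) $ i
    = (if i = a then x else 0) + (if i = b then y else 0) + (if i = c then z else 0)"
    for x y z a b c i
    by (auto simp: ax_def axis_def)
  have nz: "x *s ax a + y *s ax b + z *s ax c \<noteq> 0" if "x \<noteq> 0 \<or> y \<noteq> 0 \<or> z \<noteq> 0"
    "a \<noteq> b" "a \<noteq> c" "b \<noteq> c" for x y z a b c
  proof
    assume "x *s ax a + y *s ax b + z *s ax c = 0"
    then have "(x *s ax a + y *s ax b + z *s ax c) $ i = 0" for i by simp
    from this[of a] this[of b] this[of c] that show False
      unfolding comb by (auto split: if_splits)
  qed
  consider a where "J = [a]" | a b where "J = [a, b]" | a b c where "J = [a, b, c]"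
    using J(2,3) by (cases J; cases "tl J"; cases "tl (tl J)"; cases "tl (tl (tl J))") auto
  then show False
  proof cases
    case 1
    then have "E = []" using J by simp
    moreover have "ax a \<noteq> 0"
      by (simp add: ax_def axis_eq_0_iff)
    moreover have "ax a $ i = 0" if "i \<notin> set J" for i
      using that 1 by (auto simp: ax_def axis_def)
    ultimately show False
      using sing[of "ax a"] by simp
  next
    case 2
    \<comment> \<open>For empty \<open>E\<close> any \<open>e\<close> serves; one equation more does
      no harm.\<close>
    obtain e where e: "set E \<subseteq> {e}"
      using J(3) 2 by (cases E) auto
    \<comment> \<open>A line carries a single quadric. The second conic z^2 forces z = 0, so that
      the third vector, a dummy copy of \<open>ax a\<close>, drops out.\<close>
    obtain x y z where "x \<noteq> 0 \<or> y \<noteq> 0 \<or> z \<noteq> 0" "z * z = 0"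
      "eval_poly (partial_deriv e F) (x *s ax a + y *s ax b + z *s ax a) = 0"
      by (rule conics_meet[OF zz quad[of e a b a]])
    then have *: "x \<noteq> 0 \<or> y \<noteq> 0" "z = 0" by auto
    have "x *s ax a + y *s ax b + z *s ax a \<noteq> 0"
    proof
      assume "x *s ax a + y *s ax b + z *s ax a = 0"
      then have "(x *s ax a + y *s ax b + z *s ax a) $ i = 0" for i by simp
      from this[of a] this[of b] * J 2 show False
        unfolding comb by (auto split: if_splits)
    qed
    then show False
    proof (rule sing)
      show "(x *s ax a + y *s ax b + z *s ax a) $ i = 0" if "i \<notin> set J" for i
        unfolding comb using that 2 by auto
      show "eval_poly (partial_deriv i F) (x *s ax a + y *s ax b + z *s ax a) = 0" if "i \<in> set E" for i
        using that e \<open>eval_poly (partial_deriv e F) (x *s ax a + y *s ax b + z *s ax a) = 0\<close> by blast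
    qed
  next
    case 3
    obtain e e' where e: "set E \<subseteq> {e, e'}"
    proof (cases E)
      case (Cons e E')
      with J(3) 3 show ?thesis using that[of e "hd E'"] by (cases E') auto
    qed (use that in auto)
    obtain x y z where *: "x \<noteq> 0 \<or> y \<noteq> 0 \<or> z \<noteq> 0"
      "eval_poly (partial_deriv e F) (x *s ax a + y *s ax b + z *s ax c) = 0"
      "eval_poly (partial_deriv e' F) (x *s ax a + y *s ax b + z *s ax c) = 0"
      by (rule conics_meet[OF quad[of e a b c] quad[of e' a b c]])
    have "x *s ax a + y *s ax b + z *s ax c \<noteq> 0"
      using nz[OF *(1)] J(1) 3 by auto
    then show False
    proof (rule sing)
      show "(x *s ax a + y *s ax b + z *s ax c) $ i = 0" if "i \<notin> set J" for i
        unfolding comb using that 3 by auto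
      show "eval_poly (partial_deriv i F) (x *s ax a + y *s ax b + z *s ax c) = 0" if "i \<in> set E" for i
        using that e *(2,3) by blast
    qed
  qed
qed

section \<open>The case distinction\<close>

text \<open>Variables are the numbers 1 to 6, so that the search can be evaluated; a bijection
  \<open>\<sigma>\<close> onto the actual index type enters only in the soundness proofs.\<close>

datatype block = K "nat list" | T "nat list" | Y "nat list" "nat list" nat nat

fun block_vars :: "block \<Rightarrow> nat list" where
  "block_vars (K xs) = xs"
| "block_vars (T xs) = xs"
| "block_vars (Y xs ys z w) = xs @ ys @ [z, w]"

definition links :: "'a list \<Rightarrow> 'a list \<Rightarrow> 'a list list" where
  "links xs ys = map2 (\<lambda>a b. [a, a, b]) xs ys"

text \<open>The types differ in what follows the last variable: the first one for a cycle, the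
  variable itself for a chain, which produces its cube, and the common variable z for both arms of
  Y.\<close>

fun block_monos :: "block \<Rightarrow> nat list list" where
  "block_monos (K xs) = links xs (tl xs @ [hd xs])"
| "block_monos (T xs) = links xs (tl xs @ [last xs])"
| "block_monos (Y xs ys z w) = links xs (tl xs @ [z]) @ links ys (tl ys @ [z])
      @ [[z, z, w], [w, w, w], [last xs, last ys, w]]"

fun proper_block :: "block \<Rightarrow> bool" where
  "proper_block (K xs) \<longleftrightarrow> xs \<noteq> []"
| "proper_block (T xs) \<longleftrightarrow> xs \<noteq> []"
| "proper_block (Y xs ys z w) \<longleftrightarrow> xs \<noteq> [] \<and> ys \<noteq> []"

text \<open>The sorted list of variables says at once that the blocks are disjoint and use all six
  variables. Distinctness of the sorted monomials ensures that every coefficient of the sum is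
  1.\<close>

definition simple_blocks :: "block list \<Rightarrow> bool" where
  "simple_blocks bs \<longleftrightarrow> list_all proper_block bs \<and>
     sort (concat (map block_vars bs)) = [1, 2, 3, 4, 5, 6] \<and>
     distinct (map sort (concat (map block_monos bs)))"

text \<open>Parts of the sets of monomials (1)--(5), (7), (8) of the theorem.  The set (6) arises from (5) by a
  permutation of the variables.\<close>

definition exceptional_supports :: "nat list list list" where
  "exceptional_supports =
    [[[1,1,2],[2,2,3],[1,3,3],[1,4,4],[2,5,5],[3,6,6],[3,4,5],[1,5,6],[2,4,6]],
     [[1,1,2],[2,2,3],[3,3,4],[4,4,4],[2,5,5],[1,5,6],[3,6,6],[2,4,6]],
     [[1,1,2],[2,4,5],[2,2,3],[3,3,3],[3,5,5],[4,4,6],[6,6,6]],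
     [[1,1,2],[1,4,5],[2,2,3],[2,2,6],[2,4,4],[3,3,3],[3,6,6],[5,5,6]],
     [[1,1,2],[2,2,3],[3,3,3],[2,4,4],[1,4,5],[3,5,5],[2,5,6],[3,6,6]],
     [[1,1,4],[2,2,4],[3,3,4],[1,2,3],[4,4,4],[5,5,5],[6,6,6]],
     [[1,1,5],[2,2,5],[3,3,5],[1,2,3],[5,5,5],[4,4,6],[6,6,6]]]"

text \<open>A child \<open>(m, ds, t)\<close> of a case treats the possibility that the element \<open>m\<close> of the clause of \<open>J\<close>
  and \<open>E\<close> lies in \<open>S\<close>.  A step \<open>(m, pos, neg)\<close> of \<open>ds\<close> derives that the quotient \<open>m\<close> of the products of \<open>pos\<close>
  and \<open>neg\<close> lies in \<open>S\<close> as well, and \<open>t\<close> says which configuration has then been found: besides those of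
  the theorem, this can be the image of an earlier case under a permutation, or an element of the same clause
  that has been treated before.\<close>

datatype target = Simple "block list" | Exceptional nat "nat list" | Lemma nat "nat list" | Literal "nat list"

type_synonym derivation = "nat list \<times> nat list list \<times> nat list list"
type_synonym child = "nat list \<times> derivation list \<times> target"
type_synonym case_split = "nat list list \<times> nat list \<times> nat list \<times> child list"

text \<open>Sorted lists are the normal forms of monomials; the entries of \<open>st\<close> are
  therefore expected to be sorted.\<close>

definition has_mono :: "nat list list \<Rightarrow> nat list \<Rightarrow> bool" where
  "has_mono st t \<longleftrightarrow> List.member st (sort t)"

text \<open>\<open>\<pi>\<close> lists the images of 1, ..., 6, while list positions start at 0;
  hence the shift by one.\<close>

definition has_image :: "nat list list \<Rightarrow> nat list \<Rightarrow> nat list list \<Rightarrow> bool" where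
  "has_image st \<pi> ts \<longleftrightarrow> sort \<pi> = [1, 2, 3, 4, 5, 6] \<and>
     list_all (\<lambda>t. has_mono st (map (\<lambda>v. \<pi> ! (v - 1)) t)) ts"

fun check_target :: "nat list list list \<Rightarrow> nat list list \<Rightarrow> nat list list \<Rightarrow> target \<Rightarrow> bool" where
  "check_target cores done st (Simple bs) \<longleftrightarrow> simple_blocks bs \<and> list_all (has_mono st) (concat (map block_monos bs))"
| "check_target cores done st (Exceptional j \<pi>) \<longleftrightarrow> j < 7 \<and> has_image st \<pi> (exceptional_supports ! j)"
| "check_target cores done st (Lemma k \<pi>) \<longleftrightarrow> k < length cores \<and> has_image st \<pi> (cores ! k)"
| "check_target cores done st (Literal m) \<longleftrightarrow> List.member done m \<and> has_mono st m"

text \<open>One factor more in the numerator than in the denominator brings the degree back to 3.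
  The equation between \<open>m\<close> times \<open>neg\<close> and \<open>pos\<close> is compared
  on sorted lists of variables.\<close>

fun check_derivation ::
  "nat list list list \<Rightarrow> nat list list \<Rightarrow> nat list list \<Rightarrow> derivation list \<Rightarrow> target \<Rightarrow> bool" where
  "check_derivation cores done st [] t \<longleftrightarrow> check_target cores done st t"
| "check_derivation cores done st ((m, pos, neg) # ds) t \<longleftrightarrow>
     list_all (has_mono st) (pos @ neg) \<and> length pos = Suc (length neg) \<and>
     sort (m @ concat neg) = sort (concat pos) \<and> check_derivation cores done (m # st) ds t"

definition clause_literals :: "nat list \<Rightarrow> nat list \<Rightarrow> nat list list" where
  "clause_literals J E = [sort [i, j, k]. i \<leftarrow> J, j \<leftarrow> J, k \<leftarrow> filter (\<lambda>k. \<not> List.member E k) [1, 2, 3, 4, 5, 6]]"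

text \<open>\<open>done\<close> collects the literals dealt with so far and must contain the whole
  clause in the end. A child can appeal only to literals treated before it, which excludes circular
  references.\<close>

fun check_children ::
  "nat list list list \<Rightarrow> nat list list \<Rightarrow> nat list list \<Rightarrow> nat list list \<Rightarrow> child list \<Rightarrow> bool" where
  "check_children cores core ls done [] \<longleftrightarrow> list_all (List.member done) ls"
| "check_children cores core ls done ((m, ds, t) # cs) \<longleftrightarrow>
     check_derivation cores done (m # core) ds t \<and> check_children cores core ls (m # done) cs"

fun check_case :: "nat list list list \<Rightarrow> case_split \<Rightarrow> bool" where
  "check_case cores (core, J, E, cs) \<longleftrightarrow>
     distinct J \<and> length J \<le> 3 \<and> length E < length J \<and> list_all (\<lambda>v. List.member [1, 2, 3, 4, 5, 6] v) J \<and>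
     check_children cores core (clause_literals J E) [] cs"

text \<open>All that the search knows about \<open>S\<close> is \<open>clause\<close> and
  \<open>closed\<close>. The conclusion \<open>Q\<close> stays abstract and is reached through
  \<open>simple\<close> or \<open>exceptional\<close>.\<close>

locale cubic_case_distinction =
  fixes S :: "'n::finite monomial set" and Q :: bool
  assumes clause: "\<And>J E. distinct J \<Longrightarrow> length J \<le> 3 \<Longrightarrow> length E < length J \<Longrightarrow>
      \<exists>i\<in>set J. \<exists>j\<in>set J. \<exists>k. k \<notin> set E \<and> xmon [i, j, k] \<in> S"
    and closed: "\<And>m pos neg. set pos \<subseteq> S \<Longrightarrow> set neg \<subseteq> S \<Longrightarrow> length pos = Suc (length neg) \<Longrightarrow>
      m + sum_list neg = sum_list pos \<Longrightarrow> m \<in> S"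
    and simple: "\<And>\<sigma> bs. bij_betw \<sigma> {1..6} UNIV \<Longrightarrow> simple_blocks bs \<Longrightarrow>
      \<forall>t\<in>set (concat (map block_monos bs)). xmon (map \<sigma> t) \<in> S \<Longrightarrow> Q"
    and exceptional: "\<And>\<sigma> j. bij_betw \<sigma> {1..6} UNIV \<Longrightarrow> j < 7 \<Longrightarrow>
      \<forall>t\<in>set (exceptional_supports ! j). xmon (map \<sigma> t) \<in> S \<Longrightarrow> Q"
begin

section \<open>Soundness of the checker\<close>

definition holds :: "(nat \<Rightarrow> 'n) \<Rightarrow> nat list list \<Rightarrow> bool" where
  "holds \<sigma> st \<longleftrightarrow> (\<forall>t\<in>set st. xmon (map \<sigma> t) \<in> S)"

text \<open>Quantifying over all namings \<open>\<sigma>\<close> is what lets a settled core be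
  reused after a permutation of the variables.\<close>

definition settled :: "nat list list \<Rightarrow> bool" where
  "settled ts \<longleftrightarrow> (\<forall>\<sigma>. bij_betw \<sigma> {1..6} UNIV \<longrightarrow> holds \<sigma> ts \<longrightarrow> Q)"

lemma xmon_map_sort: "xmon (map \<sigma> (sort t)) = xmon (map \<sigma> t)"
  by (rule xmon_cong_mset) simp

lemma has_mono_sound: "holds \<sigma> st \<Longrightarrow> has_mono st t \<Longrightarrow> xmon (map \<sigma> t) \<in> S"
  unfolding holds_def has_mono_def using xmon_map_sort[of \<sigma> t] by auto

text \<open>The new naming is the permutation listed by \<open>\<pi>\<close> followed by
  \<open>\<sigma>\<close>.\<close>

lemma has_image_sound:
  assumes "holds \<sigma> st" "has_image st \<pi> ts" "bij_betw \<sigma> {1..6} UNIV"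
  obtains \<rho> where "bij_betw \<rho> {1..6} UNIV" "holds \<rho> ts"
proof
  have \<pi>: "mset \<pi> = mset [1, 2, 3, 4, 5, 6]"
    using assms(2) by (metis has_image_def mset_sort)
  have "distinct \<pi>" "length \<pi> = 6"
    using mset_eq_imp_distinct_iff[OF \<pi>] mset_eq_length[OF \<pi>] by simp_all
  moreover have "set \<pi> = {1..6}"
    unfolding mset_eq_setD[OF \<pi>] by auto
  ultimately have "bij_betw (\<lambda>i. \<pi> ! i) {..<6} {1..6}"
    by (intro bij_betw_nth) auto
  moreover have "bij_betw (\<lambda>v::nat. v - 1) {1..6} {..<6}"
    by (rule bij_betw_byWitness[where f' = Suc]) auto
  ultimately have "bij_betw (\<sigma> \<circ> ((\<lambda>i. \<pi> ! i) \<circ> (\<lambda>v. v - 1))) {1..6} UNIV"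
    using assms(3) by (intro bij_betw_trans)
  then show "bij_betw (\<lambda>v. \<sigma> (\<pi> ! (v - 1))) {1..6} UNIV"
    by (simp add: o_def)
  show "holds (\<lambda>v. \<sigma> (\<pi> ! (v - 1))) ts"
    unfolding holds_def
  proof
    fix t assume "t \<in> set ts"
    then have "has_mono st (map (\<lambda>v. \<pi> ! (v - 1)) t)"
      using assms(2) by (simp add: has_image_def list_all_iff)
    from has_mono_sound[OF assms(1) this] show "xmon (map (\<lambda>v. \<sigma> (\<pi> ! (v - 1))) t) \<in> S"
      by (simp add: o_def)
  qed
qed

lemma check_target_sound:
  assumes "bij_betw \<sigma> {1..6} UNIV" "\<forall>c\<in>set cores. settled c"
    "\<forall>m\<in>set done. xmon (map \<sigma> m) \<in> S \<longrightarrow> Q" "holds \<sigma> st" "check_target cores done st t"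
  shows Q
proof (cases t)
  case (Simple bs)
  then show ?thesis
    using assms(5) has_mono_sound[OF assms(4)] by (intro simple[OF assms(1), of bs]) (auto simp: list_all_iff)
next
  case (Exceptional j \<pi>)
  with assms(5) have "has_image st \<pi> (exceptional_supports ! j)" "j < 7" by auto
  with has_image_sound[OF assms(4) this(1) assms(1)] exceptional show ?thesis
    unfolding holds_def by metis
next
  case (Lemma k \<pi>)
  with assms(5) have "has_image st \<pi> (cores ! k)" "k < length cores" by auto
  with has_image_sound[OF assms(4) this(1) assms(1)] assms(2) show ?thesis
    unfolding settled_def by (metis nth_mem)
next
  case (Literal m)
  then show ?thesis
    using assms(3,5) has_mono_sound[OF assms(4)] by auto
qed

lemma xmon_concat: "xmon (concat vss) = sum_list (map xmon vss)"
  by (induction vss) (auto simp: xmon_append)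

lemma check_derivation_sound:
  assumes "bij_betw \<sigma> {1..6} UNIV" "\<forall>c\<in>set cores. settled c"
    "\<forall>m\<in>set done. xmon (map \<sigma> m) \<in> S \<longrightarrow> Q" "holds \<sigma> st" "check_derivation cores done st ds t"
  shows Q
  using assms(2-5)
proof (induction cores "done" st ds t rule: check_derivation.induct)
  case (1 cores "done" st t)
  then show ?case using check_target_sound[OF assms(1)] by simp
next
  case (2 cores "done" st m pos neg ds t)
  have "xmon (map \<sigma> m) \<in> S"
  proof (rule closed[of "map (\<lambda>t. xmon (map \<sigma> t)) pos" "map (\<lambda>t. xmon (map \<sigma> t)) neg"])
    show "set (map (\<lambda>t. xmon (map \<sigma> t)) pos) \<subseteq> S" "set (map (\<lambda>t. xmon (map \<sigma> t)) neg) \<subseteq> S"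
      "length (map (\<lambda>t. xmon (map \<sigma> t)) pos) = Suc (length (map (\<lambda>t. xmon (map \<sigma> t)) neg))"
      using 2(5) has_mono_sound[OF 2(4)] by (auto simp: list_all_iff)
    have "mset (m @ concat neg) = mset (concat pos)"
      using 2(5) by (metis check_derivation.simps(2) mset_sort)
    then have "xmon (map \<sigma> (m @ concat neg)) = xmon (map \<sigma> (concat pos))"
      by (intro xmon_cong_mset) (simp only: mset_map)
    then show "xmon (map \<sigma> m) + sum_list (map (\<lambda>t. xmon (map \<sigma> t)) neg) = sum_list (map (\<lambda>t. xmon (map \<sigma> t)) pos)"
      by (simp add: map_concat xmon_append xmon_concat o_def)
  qed
  then show ?case
    using 2 by (auto simp: holds_def)
qed

text \<open>Invariant of the recursion: every literal in \<open>done\<close> implies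
  \<open>Q\<close>. At the end the literal that holds is one of them.\<close>

lemma check_children_sound:
  assumes "bij_betw \<sigma> {1..6} UNIV" "\<forall>c\<in>set cores. settled c" "holds \<sigma> core"
    "\<forall>m\<in>set done. xmon (map \<sigma> m) \<in> S \<longrightarrow> Q"
      "check_children cores core ls done cs" "l \<in> set ls" "xmon (map \<sigma> l) \<in> S"
  shows Q
  using assms(2-6)
proof (induction cores core ls "done" cs rule: check_children.induct)
  case (1 cores core ls "done")
  then show ?case using assms(7) by (auto simp: list_all_iff)
next
  case (2 cores core ls "done" m ds t cs)
  have "xmon (map \<sigma> m) \<in> S \<longrightarrow> Q"
    using check_derivation_sound[OF assms(1), of cores "done" "m # core" ds t] 2(2-5)
    by (auto simp: holds_def)
  then show ?case
    using 2 by auto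
qed

lemma clause_literalsI:
  assumes "i \<in> set J" "j \<in> set J" "k \<in> set [1, 2, 3, 4, 5, 6]" "k \<notin> set E"
  shows "sort [i, j, k] \<in> set (clause_literals J E)"
proof -
  define ks where "ks = filter (\<lambda>k. \<not> List.member E k) [1, 2, 3, 4, 5, 6]"
  have "k \<in> set ks"
    unfolding ks_def set_filter List.member_iff using assms(3,4) by blast
  then have "f i j k \<in> set [f i j k. i \<leftarrow> J, j \<leftarrow> J, k \<leftarrow> ks]" for f :: "nat \<Rightarrow> nat \<Rightarrow> nat \<Rightarrow> nat list"
    using assms(1,2) by auto
  from this[of "\<lambda>i j k. sort [i, j, k]"] show ?thesis
    unfolding clause_literals_def ks_def .
qed

text \<open>\<open>clause\<close> speaks of variables in the index type. Those from \<open>J\<close>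
  come with numbers; for the third one, k, surjectivity of \<open>\<sigma>\<close> supplies a number
  outside \<open>E\<close>.\<close>

lemma check_case_sound:
  assumes "\<forall>c\<in>set cores. settled c" "check_case cores (core, J, E, cs)"
  shows "settled core"
  unfolding settled_def
proof (intro allI impI)
  fix \<sigma> :: "nat \<Rightarrow> 'n" assume \<sigma>: "bij_betw \<sigma> {1..6} UNIV" and core: "holds \<sigma> core"
  have J: "distinct J" "length J \<le> 3" "length E < length J" "set J \<subseteq> {1..6}"
    and cs: "check_children cores core (clause_literals J E) [] cs"
    using assms(2) by (auto simp: list_all_iff)
  have "distinct (map \<sigma> J)"
    using \<sigma> J(1,4) by (metis bij_betw_def distinct_map inj_on_subset)
  then obtain i j k where ijk: "i \<in> set J" "j \<in> set J" "k \<notin> set (map \<sigma> E)" "xmon [\<sigma> i, \<sigma> j, k] \<in> S"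
    using clause[of "map \<sigma> J" "map \<sigma> E"] J by auto
  have "k \<in> \<sigma> ` {1..6}"
    using bij_betw_imp_surj_on[OF \<sigma>] by simp
  then obtain k' where k': "k = \<sigma> k'" "k' \<in> {1..6}"
    by (rule imageE)
  have "k' \<in> set [1, 2, 3, 4, 5, 6]" "k' \<notin> set E"
    using k' ijk(3) by auto
  then have "sort [i, j, k'] \<in> set (clause_literals J E)"
    by (rule clause_literalsI[OF ijk(1,2)])
  moreover have "xmon (map \<sigma> (sort [i, j, k'])) \<in> S"
    using ijk(4) k' by (simp only: xmon_map_sort list.map)
  ultimately show Q
    by (rule check_children_sound[OF \<sigma> assms(1) core _ cs, rotated]) simp
qed

lemma settled_case:
  "list_all settled cores \<Longrightarrow> check_case cores (core, J, E, cs) \<Longrightarrow> settled core"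
  using check_case_sound by (simp only: list_all_iff)

lemma settled_Nil: "list_all settled []"
  by simp

lemma settled_Cons: "settled c \<Longrightarrow> list_all settled cs \<Longrightarrow> list_all settled (c # cs)"
  by simp

section \<open>Certificates: three squares with a common cofactor\<close>

lemma settled_0: "settled [[1,1,4],[2,2,4],[2,4,4],[2,5,5],[3,3,4],[4,6,6]]"
  \<comment> \<open>The cores run from the leaves of the search to its root, the empty core, so that
    every core cited is already settled. The number after \<open>Lemma\<close> is a position in the
    list of cores handed to \<open>settled_case\<close>. The clause is chosen by counting cofactors:
    in this core the squares of 1, 3, 5 have only the cofactors 2 and 4, so the plane of 1, 3, 5
    must provide a new monomial.\<close>
  by (rule settled_case[OF settled_Nil,
    where J = "[1,3,5]" and E = "[2,4]" and cs = "[
    ([1,3,6],[([2,2,2],[[2,2,4],[2,2,4]],[[2,4,4]]),([4,4,4],[[2,4,4],[2,4,4]],[[2,2,4]])],Exceptional 6 [1,3,6,5,4,2]),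
    ([1,3,3],[([1,1,1],[[1,1,4],[1,3,3]],[[3,3,4]]),([2,2,2],[[2,2,4],[2,2,4]],[[2,4,4]]),([4,4,4],[[2,4,4],[2,4,4]],[[2,2,4]])],Simple [T [3,1], T [5,2], T [6,4]]),
    ([1,1,1],[([1,3,3],[[1,1,1],[3,3,4]],[[1,1,4]])],Literal [1,3,3]),
    ([1,5,5],[([1,1,2],[[1,1,4],[2,2,4]],[[2,4,4]]),([1,2,4],[[1,1,4],[2,5,5]],[[1,5,5]]),([1,1,1],[[1,1,2],[1,1,4]],[[1,2,4]])],Literal [1,1,1]),
    ([3,3,3],[([2,2,2],[[2,2,4],[2,2,4]],[[2,4,4]]),([3,6,6],[[3,3,3],[4,6,6]],[[3,3,4]]),([4,4,4],[[2,4,4],[2,4,4]],[[2,2,4]])],Simple [T [1,4], T [5,2], T [6,3]]),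
    ([1,1,3],[([3,3,3],[[1,1,3],[3,3,4]],[[1,1,4]])],Literal [3,3,3]),
    ([3,5,5],[([1,1,2],[[1,1,4],[2,2,4]],[[2,4,4]]),([2,3,4],[[2,2,4],[3,5,5]],[[2,5,5]]),([1,1,3],[[1,1,2],[2,3,4]],[[2,2,4]])],Literal [1,1,3]),
    ([3,3,6],[([2,2,2],[[2,2,4],[2,2,4]],[[2,4,4]]),([4,4,4],[[2,4,4],[2,4,4]],[[2,2,4]]),([6,6,6],[[3,3,6],[4,6,6]],[[3,3,4]])],Simple [T [1,4], T [3,6], T [5,2]]),
    ([1,1,6],[([3,3,6],[[1,1,6],[3,3,4]],[[1,1,4]])],Literal [3,3,6]),
    ([5,5,6],[([1,1,2],[[1,1,4],[2,2,4]],[[2,4,4]]),([2,4,6],[[2,2,4],[5,5,6]],[[2,5,5]]),([1,1,6],[[1,1,2],[2,4,6]],[[2,2,4]])],Literal [1,1,6]),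
    ([3,5,6],[([2,2,2],[[2,2,4],[2,2,4]],[[2,4,4]]),([2,3,3],[[2,2,4],[3,3,4]],[[2,4,4]]),([2,6,6],[[2,2,4],[4,6,6]],[[2,4,4]]),([4,4,4],[[2,4,4],[2,4,4]],[[2,2,4]])],Exceptional 6 [3,5,6,1,2,4]),
    ([1,3,5],[([2,2,2],[[2,2,4],[2,2,4]],[[2,4,4]]),([2,6,6],[[2,2,4],[4,6,6]],[[2,4,4]]),([4,4,4],[[2,4,4],[2,4,4]],[[2,2,4]]),([4,5,5],[[2,4,4],[2,5,5]],[[2,2,4]])],Exceptional 6 [1,3,5,6,4,2]),
    ([1,5,6],[([1,1,2],[[1,1,4],[2,2,4]],[[2,4,4]]),([2,2,2],[[2,2,4],[2,2,4]],[[2,4,4]]),([2,6,6],[[2,2,4],[4,6,6]],[[2,4,4]]),([4,4,4],[[2,4,4],[2,4,4]],[[2,2,4]])],Exceptional 6 [1,5,6,3,2,4]),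
    ([3,3,5],[([1,1,2],[[1,1,4],[2,2,4]],[[2,4,4]]),([2,2,2],[[2,2,4],[2,2,4]],[[2,4,4]]),([4,4,4],[[2,4,4],[2,4,4]],[[2,2,4]]),([1,1,5],[[1,1,4],[3,3,5]],[[3,3,4]]),([5,5,5],[[1,1,5],[2,5,5]],[[1,1,2]])],Simple [T [1,2], T [3,5], T [6,4]]),
    ([1,1,5],[([3,3,5],[[1,1,5],[3,3,4]],[[1,1,4]])],Literal [3,3,5]),
    ([5,5,5],[([1,1,2],[[1,1,4],[2,2,4]],[[2,4,4]]),([2,2,2],[[2,2,4],[2,2,4]],[[2,4,4]]),([2,2,5],[[2,5,5],[2,5,5]],[[5,5,5]]),([1,1,5],[[1,1,2],[2,2,5]],[[2,2,2]])],Literal [1,1,5])]"]) code_simp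

lemma settled_1: "settled [[1,1,4],[1,6,6],[2,2,4],[2,4,4],[2,5,5],[3,3,4]]"
  by (rule settled_case[OF settled_Cons[OF settled_0 settled_Nil],
    where J = "[1,3,5]" and E = "[2,4]" and cs = "[
    ([1,1,1],[([4,6,6],[[1,1,4],[1,6,6]],[[1,1,1]])],Lemma 0 [1,2,3,4,5,6]),
    ([1,3,3],[([1,1,1],[[1,1,4],[1,3,3]],[[3,3,4]])],Literal [1,1,1]),
    ([1,1,6],[([1,1,1],[[1,1,6],[1,1,6]],[[1,6,6]])],Literal [1,1,1]),
    ([3,3,6],[([1,1,6],[[1,1,4],[3,3,6]],[[3,3,4]])],Literal [1,1,6]),
    ([1,3,6],[([1,3,3],[[1,3,6],[1,3,6]],[[1,6,6]])],Literal [1,3,3]),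
    ([1,3,5],[([2,2,2],[[2,2,4],[2,2,4]],[[2,4,4]]),([4,4,4],[[2,4,4],[2,4,4]],[[2,2,4]])],Exceptional 2 [6,1,4,5,3,2]),
    ([1,5,5],[([1,4,4],[[1,5,5],[2,4,4]],[[2,5,5]]),([1,3,3],[[1,1,4],[3,3,4]],[[1,4,4]])],Lemma 0 [3,4,5,1,2,6]),
    ([1,5,6],[([1,5,5],[[1,5,6],[1,5,6]],[[1,6,6]])],Literal [1,5,5]),
    ([3,5,6],[([1,1,2],[[1,1,4],[2,2,4]],[[2,4,4]]),([1,3,3],[[1,1,2],[3,5,6],[3,5,6]],[[1,6,6],[2,5,5]])],Literal [1,3,3]),
    ([3,3,5],[([2,2,2],[[2,2,4],[2,2,4]],[[2,4,4]]),([4,4,4],[[2,4,4],[2,4,4]],[[2,2,4]])],Simple [T [3,5,2], T [6,1,4]]),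
    ([1,1,5],[([3,3,5],[[1,1,5],[3,3,4]],[[1,1,4]])],Literal [3,3,5]),
    ([1,1,3],[([3,3,3],[[1,1,3],[3,3,4]],[[1,1,4]]),([4,4,4],[[2,4,4],[2,4,4]],[[2,2,4]])],Simple [T [5,2,4], T [6,1,3]]),
    ([3,3,3],[([1,1,3],[[1,1,4],[3,3,3]],[[3,3,4]])],Literal [1,1,3]),
    ([5,5,6],[([1,2,6],[[1,6,6],[2,5,5]],[[5,5,6]]),([2,4,6],[[2,2,4],[5,5,6]],[[2,5,5]]),([1,1,1],[[1,1,4],[1,2,6]],[[2,4,6]])],Literal [1,1,1]),
    ([3,5,5],[([1,1,2],[[1,1,4],[2,2,4]],[[2,4,4]]),([2,3,4],[[2,2,4],[3,5,5]],[[2,5,5]]),([1,1,3],[[1,1,2],[2,3,4]],[[2,2,4]])],Literal [1,1,3]),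
    ([5,5,5],[([2,2,2],[[2,2,4],[2,2,4]],[[2,4,4]]),([2,3,3],[[2,2,4],[3,3,4]],[[2,4,4]]),([4,4,4],[[2,4,4],[2,4,4]],[[2,2,4]])],Simple [T [3,2], K [5], T [6,1,4]])]"]) code_simp

lemma settled_2: "settled [[1,1,4],[2,2,4],[2,4,4],[2,5,5],[3,3,4],[6,6,6]]"
  by (rule settled_case[OF settled_Cons[OF settled_0 settled_Nil],
    where J = "[1,3,5]" and E = "[2,4]" and cs = "[
    ([3,3,6],[([4,6,6],[[3,3,4],[6,6,6]],[[3,3,6]])],Lemma 0 [1,2,3,4,5,6]),
    ([1,1,6],[([3,3,6],[[1,1,6],[3,3,4]],[[1,1,4]])],Literal [3,3,6]),
    ([5,5,6],[([2,3,3],[[2,2,4],[3,3,4]],[[2,4,4]]),([2,6,6],[[2,5,5],[6,6,6]],[[5,5,6]])],Lemma 0 [3,4,5,2,1,6]),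
    ([3,5,6],[([2,3,3],[[2,2,4],[3,3,4]],[[2,4,4]]),([4,6,6],[[2,2,4],[3,5,6],[3,5,6]],[[2,3,3],[2,5,5]])],Lemma 0 [1,2,3,4,5,6]),
    ([1,5,6],[([1,1,2],[[1,1,4],[2,2,4]],[[2,4,4]]),([4,6,6],[[1,5,6],[1,5,6],[2,2,4]],[[1,1,2],[2,5,5]])],Lemma 0 [1,2,3,4,5,6]),
    ([3,3,3],[([2,2,2],[[2,2,4],[2,2,4]],[[2,4,4]]),([3,4,4],[[3,3,4],[3,3,4]],[[3,3,3]])],Simple [T [1,4,3], T [5,2], K [6]]),
    ([1,1,3],[([3,3,3],[[1,1,3],[3,3,4]],[[1,1,4]])],Literal [3,3,3]),
    ([3,3,5],[([2,2,2],[[2,2,4],[2,2,4]],[[2,4,4]]),([4,4,4],[[2,4,4],[2,4,4]],[[2,2,4]])],Simple [T [1,4], T [3,5,2], K [6]]),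
    ([1,1,5],[([3,3,5],[[1,1,5],[3,3,4]],[[1,1,4]])],Literal [3,3,5]),
    ([1,1,1],[([1,4,4],[[1,1,4],[1,1,4]],[[1,1,1]]),([2,2,2],[[2,2,4],[2,2,4]],[[2,4,4]])],Simple [T [3,4,1], T [5,2], K [6]]),
    ([1,3,3],[([1,1,1],[[1,1,4],[1,3,3]],[[3,3,4]])],Literal [1,1,1]),
    ([1,5,5],[([1,1,2],[[1,1,4],[2,2,4]],[[2,4,4]]),([1,2,4],[[1,1,4],[2,5,5]],[[1,5,5]]),([1,1,1],[[1,1,2],[1,1,4]],[[1,2,4]])],Literal [1,1,1]),
    ([3,5,5],[([1,1,2],[[1,1,4],[2,2,4]],[[2,4,4]]),([2,3,4],[[2,2,4],[3,5,5]],[[2,5,5]]),([1,1,3],[[1,1,2],[2,3,4]],[[2,2,4]])],Literal [1,1,3]),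
    ([1,3,6],[([2,2,2],[[2,2,4],[2,2,4]],[[2,4,4]]),([4,4,6],[[1,1,4],[3,3,4],[6,6,6]],[[1,3,6],[1,3,6]])],Simple [Y [1] [3] 4 6, T [5,2]]),
    ([1,3,5],[([2,2,2],[[2,2,4],[2,2,4]],[[2,4,4]]),([4,4,4],[[2,4,4],[2,4,4]],[[2,2,4]]),([4,5,5],[[2,4,4],[2,5,5]],[[2,2,4]])],Exceptional 5 [1,3,5,4,2,6]),
    ([5,5,5],[([2,2,2],[[2,2,4],[2,2,4]],[[2,4,4]]),([2,3,3],[[2,2,4],[3,3,4]],[[2,4,4]]),([4,4,4],[[2,4,4],[2,4,4]],[[2,2,4]])],Simple [T [1,4], T [3,2], K [5], K [6]])]"]) code_simp

lemma settled_3: "settled [[1,1,4],[2,2,4],[2,4,4],[2,5,5],[3,3,4]]"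
  by (rule settled_case[OF settled_Cons[OF settled_0 settled_Cons[OF settled_1 settled_Cons[OF settled_2 settled_Nil]]],
    where J = "[6]" and E = "[]" and cs = "[
    ([4,6,6],[],Lemma 0 [1,2,3,4,5,6]),
    ([2,6,6],[([4,6,6],[[2,4,4],[2,6,6]],[[2,2,4]])],Literal [4,6,6]),
    ([1,6,6],[],Lemma 1 [1,2,3,4,5,6]),
    ([3,6,6],[],Lemma 1 [3,2,1,4,5,6]),
    ([6,6,6],[],Lemma 2 [1,2,3,4,5,6]),
    ([5,6,6],[([2,3,3],[[2,2,4],[3,3,4]],[[2,4,4]])],Lemma 1 [5,4,3,2,1,6])]"]) code_simp

lemma settled_4: "settled [[1,1,4],[1,5,5],[1,6,6],[2,2,4],[2,4,4],[3,3,4]]"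
  by (rule settled_case[OF settled_Cons[OF settled_3 settled_Nil],
    where J = "[5,6]" and E = "[1]" and cs = "[
    ([2,6,6],[],Lemma 0 [1,2,3,4,6,5]),
    ([2,5,5],[],Lemma 0 [1,2,3,4,5,6]),
    ([4,5,5],[([2,5,5],[[2,2,4],[4,5,5]],[[2,4,4]])],Literal [2,5,5]),
    ([4,6,6],[([2,6,6],[[2,2,4],[4,6,6]],[[2,4,4]])],Literal [2,6,6]),
    ([5,5,6],[([1,1,6],[[1,5,5],[1,6,6]],[[5,5,6]]),([4,5,5],[[1,1,4],[5,5,6]],[[1,1,6]])],Literal [4,5,5]),
    ([6,6,6],[([5,5,6],[[1,5,5],[6,6,6]],[[1,6,6]])],Literal [5,5,6]),
    ([5,6,6],[([1,1,5],[[1,5,5],[1,6,6]],[[5,6,6]]),([4,6,6],[[1,1,4],[5,6,6]],[[1,1,5]])],Literal [4,6,6]),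
    ([5,5,5],[([5,6,6],[[1,6,6],[5,5,5]],[[1,5,5]])],Literal [5,6,6]),
    ([3,5,6],[([1,1,2],[[1,1,4],[2,2,4]],[[2,4,4]]),([2,2,2],[[2,2,4],[2,2,4]],[[2,4,4]])],Exceptional 3 [5,1,2,6,3,4]),
    ([3,6,6],[([2,2,2],[[2,2,4],[2,2,4]],[[2,4,4]]),([2,3,3],[[2,2,4],[3,3,4]],[[2,4,4]]),([4,4,4],[[2,4,4],[2,4,4]],[[2,2,4]])],Simple [T [5,1,4], T [6,3,2]]),
    ([3,5,5],[([3,6,6],[[1,6,6],[3,5,5]],[[1,5,5]])],Literal [3,6,6]),
    ([4,5,6],[([2,2,2],[[2,2,4],[2,2,4]],[[2,4,4]]),([2,3,3],[[2,2,4],[3,3,4]],[[2,4,4]]),([4,4,4],[[2,4,4],[2,4,4]],[[2,2,4]])],Simple [Y [5] [6] 1 4, T [3,2]]),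
    ([2,5,6],[([4,5,6],[[2,4,4],[2,5,6]],[[2,2,4]])],Literal [4,5,6])]"]) code_simp

lemma settled_5: "settled [[1,1,4],[1,5,5],[2,2,4],[2,4,4],[3,3,4]]"
  by (rule settled_case[OF settled_Cons[OF settled_3 settled_Cons[OF settled_4 settled_Nil]],
    where J = "[6]" and E = "[]" and cs = "[
    ([2,6,6],[],Lemma 0 [1,2,3,4,6,5]),
    ([4,6,6],[([2,6,6],[[2,2,4],[4,6,6]],[[2,4,4]])],Literal [2,6,6]),
    ([1,6,6],[],Lemma 1 [1,2,3,4,5,6]),
    ([6,6,6],[([2,2,2],[[2,2,4],[2,2,4]],[[2,4,4]]),([2,3,3],[[2,2,4],[3,3,4]],[[2,4,4]]),([4,4,4],[[2,4,4],[2,4,4]],[[2,2,4]])],Simple [T [3,2], T [5,1,4], K [6]]),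
    ([3,6,6],[([2,2,2],[[2,2,4],[2,2,4]],[[2,4,4]]),([2,3,3],[[2,2,4],[3,3,4]],[[2,4,4]]),([4,4,4],[[2,4,4],[2,4,4]],[[2,2,4]])],Simple [T [5,1,4], T [6,3,2]]),
    ([5,6,6],[([2,2,2],[[2,2,4],[2,2,4]],[[2,4,4]]),([2,3,3],[[2,2,4],[3,3,4]],[[2,4,4]]),([4,4,4],[[2,4,4],[2,4,4]],[[2,2,4]])],Simple [T [3,2], T [6,5,1,4]])]"]) code_simp

lemma settled_6: "settled [[1,1,4],[2,2,4],[2,4,4],[3,3,4],[5,5,5]]"
  by (rule settled_case[OF settled_Cons[OF settled_5 settled_Cons[OF settled_3 settled_Nil]],
    where J = "[6]" and E = "[]" and cs = "[
    ([1,6,6],[],Lemma 0 [1,2,3,4,6,5]),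
    ([3,6,6],[],Lemma 0 [3,2,1,4,6,5]),
    ([2,6,6],[],Lemma 1 [1,2,3,4,6,5]),
    ([4,6,6],[([2,6,6],[[2,2,4],[4,6,6]],[[2,4,4]])],Literal [2,6,6]),
    ([6,6,6],[([2,2,2],[[2,2,4],[2,2,4]],[[2,4,4]]),([2,3,3],[[2,2,4],[3,3,4]],[[2,4,4]]),([4,4,4],[[2,4,4],[2,4,4]],[[2,2,4]])],Simple [T [1,4], T [3,2], K [5], K [6]]),
    ([5,6,6],[([2,2,2],[[2,2,4],[2,2,4]],[[2,4,4]]),([2,3,3],[[2,2,4],[3,3,4]],[[2,4,4]]),([4,4,4],[[2,4,4],[2,4,4]],[[2,2,4]])],Simple [T [1,4], T [3,2], T [6,5]])]"]) code_simp

lemma settled_7: "settled [[1,1,4],[2,2,4],[2,4,4],[3,3,4],[5,5,6]]"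
  by (rule settled_case[OF settled_Cons[OF settled_6 settled_Cons[OF settled_5 settled_Cons[OF settled_3 settled_Nil]]],
    where J = "[6]" and E = "[]" and cs = "[
    ([6,6,6],[],Lemma 0 [1,2,3,4,6,5]),
    ([4,6,6],[],Lemma 1 [6,2,1,4,5,3]),
    ([2,6,6],[],Lemma 2 [1,2,3,4,6,5]),
    ([1,6,6],[],Lemma 1 [1,2,3,4,6,5]),
    ([3,6,6],[],Lemma 1 [3,2,1,4,6,5]),
    ([5,6,6],[([6,6,6],[[5,6,6],[5,6,6]],[[5,5,6]])],Literal [6,6,6])]"]) code_simp

text \<open>The quotient of x_2^2 x_4 and x_2 x_4^2 makes the factors 2 and 4 interchangeable in
  \<open>S\<close>; in particular x_2^3, x_4^3, x_1^2 x_2 and x_3^2 x_2 lie in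
  \<open>S\<close>.\<close>

lemma settled_8: "settled [[1,1,4],[2,2,4],[2,4,4],[3,3,4]]"
  by (rule settled_case[OF settled_Cons[OF settled_3 settled_Cons[OF settled_5 settled_Cons[OF settled_6 settled_Cons[OF settled_7 settled_Nil]]]],
    where J = "[5]" and E = "[]" and cs = "[
    ([2,5,5],[],Lemma 0 [1,2,3,4,5,6]),
    ([4,5,5],[([2,5,5],[[2,2,4],[4,5,5]],[[2,4,4]])],Literal [2,5,5]),
    ([1,5,5],[],Lemma 1 [1,2,3,4,5,6]),
    ([3,5,5],[],Lemma 1 [3,2,1,4,5,6]),
    ([5,5,5],[],Lemma 2 [1,2,3,4,5,6]),
    ([5,5,6],[],Lemma 3 [1,2,3,4,5,6])]"]) code_simp

text \<open>With x_2^2 x_4 and x_2^2 x_6 in \<open>S\<close>, a factor 4 of a monomial in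
  \<open>S\<close> may be exchanged for 6 and conversely, so most literals on the line of 4 and 6
  reduce to one another.\<close>

lemma settled_9: "settled [[1,1,4],[2,2,4],[2,2,6],[3,3,4]]"
  by (rule settled_case[OF settled_Cons[OF settled_8 settled_Nil],
    where J = "[4,6]" and E = "[5]" and cs = "[
    ([3,4,4],[],Lemma 0 [1,3,2,4,5,6]),
    ([1,4,4],[],Lemma 0 [2,1,3,4,5,6]),
    ([2,4,4],[],Lemma 0 [1,2,3,4,5,6]),
    ([1,4,6],[([1,4,4],[[1,4,6],[2,2,4]],[[2,2,6]])],Literal [1,4,4]),
    ([2,4,6],[([2,4,4],[[2,2,4],[2,4,6]],[[2,2,6]])],Literal [2,4,4]),
    ([3,4,6],[([3,4,4],[[2,2,4],[3,4,6]],[[2,2,6]])],Literal [3,4,4]),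
    ([3,6,6],[([3,4,6],[[2,2,4],[3,6,6]],[[2,2,6]])],Literal [3,4,6]),
    ([2,6,6],[([2,4,6],[[2,2,4],[2,6,6]],[[2,2,6]])],Literal [2,4,6]),
    ([1,6,6],[([1,4,6],[[1,6,6],[2,2,4]],[[2,2,6]])],Literal [1,4,6]),
    ([4,4,6],[([4,6,6],[[2,2,6],[4,4,6]],[[2,2,4]])],Lemma 0 [1,6,2,4,3,5]),
    ([4,6,6],[([4,4,6],[[2,2,4],[4,6,6]],[[2,2,6]])],Literal [4,4,6]),
    ([4,4,4],[([4,4,6],[[2,2,6],[4,4,4]],[[2,2,4]])],Literal [4,4,6]),
    ([6,6,6],[([4,6,6],[[2,2,4],[6,6,6]],[[2,2,6]])],Literal [4,6,6])]"]) code_simp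

lemma settled_10: "settled [[1,1,4],[1,2,5],[2,2,4],[2,3,5],[3,3,4]]"
  by (rule settled_case[OF settled_Cons[OF settled_9 settled_Cons[OF settled_8 settled_Nil]],
    where J = "[1,3]" and E = "[4]" and cs = "[
    ([1,1,6],[],Lemma 0 [2,1,3,4,5,6]),
    ([3,3,6],[],Lemma 0 [1,3,2,4,5,6]),
    ([3,3,5],[],Lemma 0 [1,3,2,4,6,5]),
    ([1,1,5],[],Lemma 0 [2,1,3,4,6,5]),
    ([1,3,6],[([1,1,6],[[1,2,5],[1,3,6]],[[2,3,5]])],Literal [1,1,6]),
    ([1,3,5],[([1,1,5],[[1,2,5],[1,3,5]],[[2,3,5]])],Literal [1,1,5]),
    ([2,3,3],[([2,4,4],[[2,2,4],[3,3,4]],[[2,3,3]])],Lemma 1 [1,2,3,4,5,6]),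
    ([1,1,2],[([2,3,3],[[1,1,2],[3,3,4]],[[1,1,4]])],Literal [2,3,3]),
    ([1,2,3],[([1,1,2],[[1,2,3],[1,2,5]],[[2,3,5]])],Literal [1,1,2]),
    ([1,3,3],[([1,4,4],[[1,1,4],[3,3,4]],[[1,3,3]])],Lemma 1 [2,1,3,4,5,6]),
    ([1,1,1],[([1,3,3],[[1,1,1],[3,3,4]],[[1,1,4]])],Literal [1,3,3]),
    ([3,3,3],[([1,3,3],[[1,2,5],[3,3,3]],[[2,3,5]])],Literal [1,3,3]),
    ([1,1,3],[([1,1,1],[[1,1,3],[1,2,5]],[[2,3,5]])],Literal [1,1,1])]"]) code_simp

lemma settled_11: "settled [[1,1,4],[1,2,6],[1,3,5],[2,2,4],[3,3,4]]"
  by (rule settled_case[OF settled_Cons[OF settled_9 settled_Cons[OF settled_10 settled_Cons[OF settled_8 settled_Nil]]],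
    where J = "[2,3]" and E = "[4]" and cs = "[
    ([2,2,5],[],Lemma 0 [1,2,3,4,6,5]),
    ([2,3,6],[],Lemma 1 [1,2,3,4,6,5]),
    ([2,2,6],[],Lemma 0 [1,2,3,4,5,6]),
    ([3,3,6],[],Lemma 0 [1,3,2,4,5,6]),
    ([2,3,5],[],Lemma 1 [1,3,2,4,5,6]),
    ([3,3,5],[],Lemma 0 [1,3,2,4,6,5]),
    ([1,3,3],[([1,4,4],[[1,1,4],[3,3,4]],[[1,3,3]])],Lemma 2 [2,1,3,4,5,6]),
    ([1,2,2],[([1,3,3],[[1,2,2],[3,3,4]],[[2,2,4]])],Literal [1,3,3]),
    ([2,2,3],[([3,4,4],[[2,2,4],[3,3,4]],[[2,2,3]])],Lemma 2 [1,3,2,4,5,6]),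
    ([3,3,3],[([2,2,3],[[2,2,4],[3,3,3]],[[3,3,4]])],Literal [2,2,3]),
    ([2,3,3],[([2,4,4],[[2,2,4],[3,3,4]],[[2,3,3]])],Lemma 2 [1,2,3,4,5,6]),
    ([2,2,2],[([2,3,3],[[2,2,2],[3,3,4]],[[2,2,4]])],Literal [2,3,3]),
    ([1,2,3],[([2,4,5],[[1,3,5],[2,2,4]],[[1,2,3]]),([4,5,5],[[1,3,5],[2,4,5]],[[1,2,3]])],Lemma 1 [2,1,5,4,3,6])]"]) code_simp

lemma settled_12: "settled [[1,1,4],[1,2,6],[2,2,4],[3,3,4]]"
  by (rule settled_case[OF settled_Cons[OF settled_9 settled_Cons[OF settled_8 settled_Cons[OF settled_10 settled_Cons[OF settled_11 settled_Nil]]]],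
    where J = "[1,3]" and E = "[4]" and cs = "[
    ([1,1,5],[],Lemma 0 [2,1,3,4,6,5]),
    ([1,1,6],[],Lemma 0 [2,1,3,4,5,6]),
    ([3,3,5],[],Lemma 0 [1,3,2,4,6,5]),
    ([3,3,6],[],Lemma 0 [1,3,2,4,5,6]),
    ([1,1,3],[([3,4,4],[[1,1,4],[3,3,4]],[[1,1,3]])],Lemma 1 [1,3,2,4,5,6]),
    ([3,3,3],[([1,1,3],[[1,1,4],[3,3,3]],[[3,3,4]])],Literal [1,1,3]),
    ([2,3,3],[([2,4,4],[[2,2,4],[3,3,4]],[[2,3,3]])],Lemma 1 [1,2,3,4,5,6]),
    ([1,1,2],[([2,3,3],[[1,1,2],[3,3,4]],[[1,1,4]])],Literal [2,3,3]),
    ([1,3,3],[([1,4,4],[[1,1,4],[3,3,4]],[[1,3,3]])],Lemma 1 [2,1,3,4,5,6]),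
    ([1,1,1],[([1,3,3],[[1,1,1],[3,3,4]],[[1,1,4]])],Literal [1,3,3]),
    ([1,3,6],[],Lemma 2 [2,1,3,4,6,5]),
    ([1,3,5],[],Lemma 3 [1,2,3,4,5,6]),
    ([1,2,3],[([3,4,6],[[1,2,6],[3,3,4]],[[1,2,3]]),([4,6,6],[[1,2,6],[3,4,6]],[[1,2,3]])],Lemma 2 [3,1,6,4,2,5])]"]) code_simp

lemma settled_13: "settled [[1,1,4],[1,2,3],[1,6,6],[2,2,4],[3,3,4],[5,5,5]]"
  by (rule settled_case[OF settled_Cons[OF settled_12 settled_Cons[OF settled_9 settled_Cons[OF settled_8 settled_Nil]]],
    where J = "[2,3,6]" and E = "[1,4]" and cs = "[
    ([2,3,5],[],Lemma 0 [2,3,1,4,6,5]),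
    ([2,3,6],[],Lemma 0 [2,3,1,4,5,6]),
    ([3,3,5],[],Lemma 1 [1,3,2,4,6,5]),
    ([2,2,5],[],Lemma 1 [1,2,3,4,6,5]),
    ([3,3,6],[],Lemma 1 [1,3,2,4,5,6]),
    ([2,2,6],[],Lemma 1 [1,2,3,4,5,6]),
    ([5,6,6],[([2,3,5],[[1,2,3],[5,6,6]],[[1,6,6]])],Literal [2,3,5]),
    ([6,6,6],[([2,3,6],[[1,2,3],[6,6,6]],[[1,6,6]])],Literal [2,3,6]),
    ([2,2,2],[([2,4,4],[[2,2,4],[2,2,4]],[[2,2,2]])],Lemma 2 [1,2,3,4,5,6]),
    ([2,3,3],[([2,2,2],[[2,2,4],[2,3,3]],[[3,3,4]])],Literal [2,2,2]),
    ([3,6,6],[([2,3,3],[[1,2,3],[3,6,6]],[[1,6,6]])],Literal [2,3,3]),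
    ([2,2,3],[([3,4,4],[[2,2,4],[3,3,4]],[[2,2,3]])],Lemma 2 [1,3,2,4,5,6]),
    ([3,3,3],[([2,2,3],[[2,2,4],[3,3,3]],[[3,3,4]])],Literal [2,2,3]),
    ([2,6,6],[([2,2,3],[[1,2,3],[2,6,6]],[[1,6,6]])],Literal [2,2,3]),
    ([2,5,6],[([1,4,5],[[1,6,6],[2,2,4],[5,5,5]],[[2,5,6],[2,5,6]]),([2,3,5],[[1,2,3],[1,4,5]],[[1,1,4]])],Literal [2,3,5]),
    ([3,5,6],[([1,4,5],[[1,6,6],[3,3,4],[5,5,5]],[[3,5,6],[3,5,6]]),([2,3,5],[[1,2,3],[1,4,5]],[[1,1,4]])],Literal [2,3,5])]"]) code_simp

lemma settled_14: "settled [[1,1,4],[1,2,3],[2,2,4],[3,3,4],[4,4,4],[5,5,5]]"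
  by (rule settled_case[OF settled_Cons[OF settled_12 settled_Cons[OF settled_13 settled_Nil]],
    where J = "[6]" and E = "[]" and cs = "[
    ([6,6,6],[],Exceptional 5 [1,2,3,4,5,6]),
    ([5,6,6],[],Exceptional 6 [1,2,3,6,4,5]),
    ([4,6,6],[],Lemma 0 [1,2,6,4,5,3]),
    ([1,6,6],[],Lemma 1 [1,2,3,4,5,6]),
    ([3,6,6],[],Lemma 1 [3,1,2,4,5,6]),
    ([2,6,6],[],Lemma 1 [2,1,3,4,5,6])]"]) code_simp

lemma settled_15: "settled [[1,1,4],[1,2,3],[2,2,4],[3,3,4],[3,5,5],[4,4,4]]"
  by (rule settled_case[OF settled_Cons[OF settled_9 settled_Cons[OF settled_12 settled_Cons[OF settled_14 settled_Cons[OF settled_8 settled_Nil]]]],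
    where J = "[1,2,5]" and E = "[3,4]" and cs = "[
    ([2,2,6],[],Lemma 0 [1,2,3,4,5,6]),
    ([1,2,5],[],Lemma 1 [1,2,3,4,6,5]),
    ([1,1,6],[],Lemma 0 [2,1,3,4,5,6]),
    ([1,2,6],[],Lemma 1 [1,2,3,4,5,6]),
    ([5,5,5],[],Lemma 2 [1,2,3,4,5,6]),
    ([1,1,5],[],Lemma 0 [2,1,3,4,6,5]),
    ([2,2,5],[],Lemma 0 [1,2,3,4,6,5]),
    ([5,5,6],[([1,2,6],[[1,2,3],[5,5,6]],[[3,5,5]])],Literal [1,2,6]),
    ([2,2,2],[([2,4,4],[[2,2,2],[4,4,4]],[[2,2,4]])],Lemma 3 [1,2,3,4,5,6]),
    ([1,1,2],[([2,2,2],[[1,1,2],[2,2,4]],[[1,1,4]])],Literal [2,2,2]),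
    ([1,5,5],[([1,1,2],[[1,2,3],[1,5,5]],[[3,5,5]])],Literal [1,1,2]),
    ([1,1,1],[([1,4,4],[[1,1,1],[4,4,4]],[[1,1,4]])],Lemma 3 [2,1,3,4,5,6]),
    ([1,2,2],[([1,1,1],[[1,1,4],[1,2,2]],[[2,2,4]])],Literal [1,1,1]),
    ([2,5,5],[([1,2,2],[[1,2,3],[2,5,5]],[[3,5,5]])],Literal [1,2,2]),
    ([2,5,6],[([3,6,6],[[2,5,6],[2,5,6],[3,3,4]],[[2,2,4],[3,5,5]])],Exceptional 4 [5,3,4,6,2,1]),
    ([1,5,6],[([3,6,6],[[1,5,6],[1,5,6],[3,3,4]],[[1,1,4],[3,5,5]])],Exceptional 4 [5,3,4,6,1,2])]"]) code_simp

lemma settled_16: "settled [[1,1,4],[1,2,3],[2,2,4],[3,3,4],[4,4,4],[5,5,6]]"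
  by (rule settled_case[OF settled_Cons[OF settled_12 settled_Cons[OF settled_14 settled_Cons[OF settled_15 settled_Nil]]],
    where J = "[6]" and E = "[]" and cs = "[
    ([4,6,6],[],Lemma 0 [1,2,6,4,5,3]),
    ([6,6,6],[],Lemma 1 [1,2,3,4,6,5]),
    ([2,6,6],[],Lemma 2 [1,3,2,4,6,5]),
    ([1,6,6],[],Lemma 2 [2,3,1,4,6,5]),
    ([3,6,6],[],Lemma 2 [1,2,3,4,6,5]),
    ([5,6,6],[([6,6,6],[[5,6,6],[5,6,6]],[[5,5,6]])],Literal [6,6,6])]"]) code_simp

text \<open>The core is the part in four variables shared by the sets (7) and (8), which differ in
  the two remaining variables: two cubes there, a chain here.\<close>

lemma settled_17: "settled [[1,1,4],[1,2,3],[2,2,4],[3,3,4],[4,4,4]]"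
  by (rule settled_case[OF settled_Cons[OF settled_12 settled_Cons[OF settled_14 settled_Cons[OF settled_15 settled_Cons[OF settled_16 settled_Nil]]]],
    where J = "[5]" and E = "[]" and cs = "[
    ([4,5,5],[],Lemma 0 [1,2,5,4,6,3]),
    ([5,5,5],[],Lemma 1 [1,2,3,4,5,6]),
    ([3,5,5],[],Lemma 2 [1,2,3,4,5,6]),
    ([2,5,5],[],Lemma 2 [1,3,2,4,5,6]),
    ([5,5,6],[],Lemma 3 [1,2,3,4,5,6]),
    ([1,5,5],[],Lemma 2 [2,3,1,4,5,6])]"]) code_simp

text \<open>The squares of 1, 2, 3 are interchangeable in \<open>S\<close>, having the same
  cofactor, which explains the reduction of x_1^2 x_k to x_2^2 x_k. All exceptional supports other
  than those of (1) and (2) occur under this core.\<close>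

lemma settled_18: "settled [[1,1,4],[2,2,4],[3,3,4]]"
  by (rule settled_case[OF settled_Cons[OF settled_12 settled_Cons[OF settled_9 settled_Cons[OF settled_8 settled_Cons[OF settled_17 settled_Nil]]]],
    where J = "[1,2]" and E = "[4]" and cs = "[
    ([1,2,6],[],Lemma 0 [1,2,3,4,5,6]),
    ([2,2,6],[],Lemma 1 [1,2,3,4,5,6]),
    ([1,1,6],[([2,2,6],[[1,1,6],[2,2,4]],[[1,1,4]])],Literal [2,2,6]),
    ([2,2,5],[],Lemma 1 [1,2,3,4,6,5]),
    ([1,1,5],[([2,2,5],[[1,1,5],[2,2,4]],[[1,1,4]])],Literal [2,2,5]),
    ([1,2,5],[],Lemma 0 [1,2,3,4,6,5]),
    ([2,2,3],[([3,4,4],[[2,2,4],[3,3,4]],[[2,2,3]])],Lemma 2 [1,3,2,4,5,6]),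
    ([1,1,3],[([2,2,3],[[1,1,3],[2,2,4]],[[1,1,4]])],Literal [2,2,3]),
    ([1,2,2],[([1,4,4],[[1,1,4],[2,2,4]],[[1,2,2]])],Lemma 2 [2,1,3,4,5,6]),
    ([1,1,1],[([1,2,2],[[1,1,1],[2,2,4]],[[1,1,4]])],Literal [1,2,2]),
    ([2,2,2],[([2,4,4],[[2,2,4],[2,2,4]],[[2,2,2]])],Lemma 2 [1,2,3,4,5,6]),
    ([1,1,2],[([2,2,2],[[1,1,2],[2,2,4]],[[1,1,4]])],Literal [2,2,2]),
    ([1,2,3],[([4,4,4],[[1,1,4],[2,2,4],[3,3,4]],[[1,2,3],[1,2,3]])],Lemma 3 [1,2,3,4,5,6])]"]) code_simp

section \<open>Certificates: two squares with a common cofactor, one of them ending an arm of length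
  two\<close>

lemma settled_19: "settled [[1,1,4],[1,2,6],[2,2,4],[2,3,3],[4,4,6]]"
  by (rule settled_case[OF settled_Cons[OF settled_18 settled_Nil],
    where J = "[3,4,5]" and E = "[2,6]" and cs = "[
    ([3,3,4],[],Lemma 0 [1,2,3,4,5,6]),
    ([4,5,5],[],Lemma 0 [1,2,5,4,3,6]),
    ([1,4,5],[([4,5,5],[[1,4,5],[1,4,5]],[[1,1,4]])],Literal [4,5,5]),
    ([1,3,4],[([3,3,4],[[1,3,4],[1,3,4]],[[1,1,4]])],Literal [3,3,4]),
    ([4,4,4],[([4,6,6],[[4,4,6],[4,4,6]],[[4,4,4]])],Lemma 0 [1,2,6,4,3,5]),
    ([1,4,4],[([4,4,4],[[1,4,4],[1,4,4]],[[1,1,4]])],Literal [4,4,4]),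
    ([1,3,3],[([1,1,6],[[1,2,6],[1,3,3]],[[2,3,3]]),([4,4,4],[[1,1,4],[4,4,6]],[[1,1,6]])],Literal [4,4,4]),
    ([3,4,4],[([1,2,3],[[1,2,6],[3,4,4]],[[4,4,6]]),([1,3,4],[[1,1,4],[2,3,3]],[[1,2,3]])],Literal [1,3,4]),
    ([1,5,5],[([6,6,6],[[1,2,6],[1,2,6],[4,4,6]],[[1,1,4],[2,2,4]])],Simple [Y [5,1] [3,2] 4 6]),
    ([3,4,5],[([1,5,5],[[1,2,6],[3,4,5],[3,4,5]],[[2,3,3],[4,4,6]])],Literal [1,5,5]),
    ([3,5,5],[([6,6,6],[[1,2,6],[1,2,6],[4,4,6]],[[1,1,4],[2,2,4]])],Simple [Y [1] [5,3,2] 4 6]),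
    ([5,5,5],[([6,6,6],[[1,2,6],[1,2,6],[4,4,6]],[[1,1,4],[2,2,4]])],Simple [Y [1] [3,2] 4 6, K [5]]),
    ([4,4,5],[([1,2,5],[[1,2,6],[4,4,5]],[[4,4,6]]),([5,5,5],[[1,2,5],[1,2,5],[4,4,5]],[[1,1,4],[2,2,4]])],Literal [5,5,5]),
    ([3,3,5],[([1,5,6],[[1,2,6],[3,3,5]],[[2,3,3]]),([2,4,5],[[2,2,4],[3,3,5]],[[2,3,3]]),([4,5,5],[[1,5,6],[2,4,5]],[[1,2,6]])],Literal [4,5,5]),
    ([3,3,3],[([1,3,6],[[1,2,6],[3,3,3]],[[2,3,3]]),([2,3,4],[[2,2,4],[3,3,3]],[[2,3,3]]),([3,3,4],[[1,3,6],[2,3,4]],[[1,2,6]])],Literal [3,3,4]),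
    ([1,3,5],[([2,5,5],[[1,3,5],[1,3,5],[2,2,4]],[[1,1,4],[2,3,3]]),([6,6,6],[[1,2,6],[1,2,6],[4,4,6]],[[1,1,4],[2,2,4]])],Exceptional 1 [3,2,4,6,5,1])]"]) code_simp

lemma settled_20: "settled [[1,1,4],[1,1,5],[2,2,4],[2,3,3],[3,4,5],[4,4,6]]"
  by (rule settled_case[OF settled_Cons[OF settled_18 settled_Nil],
    where J = "[3,6]" and E = "[2]" and cs = "[
    ([3,3,4],[],Lemma 0 [1,2,3,4,5,6]),
    ([4,6,6],[],Lemma 0 [1,2,6,4,3,5]),
    ([5,6,6],[([4,6,6],[[1,1,4],[5,6,6]],[[1,1,5]])],Literal [4,6,6]),
    ([3,5,6],[([4,6,6],[[3,5,6],[4,4,6]],[[3,4,5]])],Literal [4,6,6]),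
    ([3,3,5],[([3,3,4],[[1,1,4],[3,3,5]],[[1,1,5]])],Literal [3,3,4]),
    ([3,4,6],[([3,3,5],[[3,4,5],[3,4,6]],[[4,4,6]])],Literal [3,3,5]),
    ([6,6,6],[([3,5,5],[[1,1,5],[3,4,5]],[[1,1,4]])],Simple [T [1,5,3,2,4,6]]),
    ([1,6,6],[([3,5,5],[[1,1,5],[3,4,5]],[[1,1,4]])],Simple [K [1,5,3,2,4,6]]),
    ([3,6,6],[([3,4,4],[[1,1,4],[3,4,5]],[[1,1,5]]),([6,6,6],[[3,6,6],[4,4,6]],[[3,4,4]])],Literal [6,6,6]),
    ([3,3,6],[([2,4,4],[[2,3,3],[4,4,6]],[[3,3,6]]),([3,3,4],[[2,3,3],[2,4,4]],[[2,2,4]])],Literal [3,3,4]),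
    ([3,3,3],[([2,2,3],[[2,3,3],[2,3,3]],[[3,3,3]]),([3,3,5],[[2,2,3],[3,4,5]],[[2,2,4]])],Literal [3,3,5]),
    ([1,3,6],[([3,4,4],[[1,1,4],[3,4,5]],[[1,1,5]]),([1,6,6],[[1,3,6],[4,4,6]],[[3,4,4]])],Literal [1,6,6]),
    ([1,3,3],[([3,4,4],[[1,1,4],[3,4,5]],[[1,1,5]]),([1,3,6],[[1,3,3],[4,4,6]],[[3,4,4]])],Literal [1,3,6])]"]) code_simp

lemma settled_21: "settled [[1,1,4],[1,1,5],[2,2,4],[2,3,3],[4,4,6]]"
  by (rule settled_case[OF settled_Cons[OF settled_18 settled_Cons[OF settled_20 settled_Nil]],
    where J = "[4,5]" and E = "[6]" and cs = "[
    ([4,5,5],[],Lemma 0 [1,2,5,4,3,6]),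
    ([1,4,5],[([4,5,5],[[1,4,5],[1,4,5]],[[1,1,4]])],Literal [4,5,5]),
    ([2,4,5],[([4,5,5],[[2,4,5],[2,4,5]],[[2,2,4]])],Literal [4,5,5]),
    ([5,5,5],[([4,5,5],[[1,1,4],[5,5,5]],[[1,1,5]])],Literal [4,5,5]),
    ([2,4,4],[([2,4,5],[[1,1,5],[2,4,4]],[[1,1,4]])],Literal [2,4,5]),
    ([4,4,5],[([4,5,5],[[1,1,5],[4,4,5]],[[1,1,4]])],Literal [4,5,5]),
    ([4,4,4],[([4,4,5],[[1,1,5],[4,4,4]],[[1,1,4]])],Literal [4,4,5]),
    ([1,5,5],[([1,4,5],[[1,1,4],[1,5,5]],[[1,1,5]])],Literal [1,4,5]),
    ([2,5,5],[([2,4,5],[[1,1,4],[2,5,5]],[[1,1,5]])],Literal [2,4,5]),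
    ([1,4,4],[([1,4,5],[[1,1,5],[1,4,4]],[[1,1,4]])],Literal [1,4,5]),
    ([3,4,5],[],Lemma 1 [1,2,3,4,5,6]),
    ([3,4,4],[([3,4,5],[[1,1,5],[3,4,4]],[[1,1,4]])],Literal [3,4,5]),
    ([3,5,5],[([3,4,5],[[1,1,4],[3,5,5]],[[1,1,5]])],Literal [3,4,5])]"]) code_simp

lemma settled_22: "settled [[1,1,4],[1,2,5],[2,2,4],[2,3,3],[4,4,6]]"
  by (rule settled_case[OF settled_Cons[OF settled_18 settled_Cons[OF settled_19 settled_Cons[OF settled_21 settled_Nil]]],
    where J = "[4,5]" and E = "[6]" and cs = "[
    ([4,5,5],[],Lemma 0 [1,2,5,4,3,6]),
    ([4,4,5],[],Lemma 1 [1,2,3,4,6,5]),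
    ([1,4,5],[([4,5,5],[[1,4,5],[1,4,5]],[[1,1,4]])],Literal [4,5,5]),
    ([2,4,5],[([4,5,5],[[2,4,5],[2,4,5]],[[2,2,4]])],Literal [4,5,5]),
    ([2,5,5],[([1,4,5],[[1,1,4],[2,5,5]],[[1,2,5]])],Literal [1,4,5]),
    ([2,4,4],[([1,4,5],[[1,2,5],[2,4,4]],[[2,2,4]])],Literal [1,4,5]),
    ([1,4,4],[([2,4,5],[[1,2,5],[1,4,4]],[[1,1,4]])],Literal [2,4,5]),
    ([1,5,5],[([2,4,5],[[1,5,5],[2,2,4]],[[1,2,5]])],Literal [2,4,5]),
    ([4,4,4],[([4,6,6],[[4,4,6],[4,4,6]],[[4,4,4]])],Lemma 0 [1,2,6,4,3,5]),
    ([5,5,5],[([4,4,5],[[1,1,4],[2,2,4],[5,5,5]],[[1,2,5],[1,2,5]])],Literal [4,4,5]),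
    ([3,5,5],[([3,4,4],[[1,1,4],[2,2,4],[3,5,5]],[[1,2,5],[1,2,5]]),([5,5,6],[[1,2,5],[1,2,5],[4,4,6]],[[1,1,4],[2,2,4]])],Lemma 2 [5,4,1,3,6,2]),
    ([3,4,4],[([3,5,5],[[1,2,5],[1,2,5],[3,4,4]],[[1,1,4],[2,2,4]])],Literal [3,5,5]),
    ([3,4,5],[([1,3,6],[[1,2,5],[2,3,3],[4,4,6]],[[2,2,4],[3,4,5]]),([5,5,6],[[1,2,5],[1,2,5],[4,4,6]],[[1,1,4],[2,2,4]]),([2,6,6],[[1,2,5],[1,3,6],[4,4,6]],[[1,1,4],[3,4,5]])],Exceptional 0 [2,4,6,3,1,5])]"]) code_simp

text \<open>The monomial x_4^2 x_6 leads on from the common cofactor of the two arms. The sets (1)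
  and (2) occur under this core only.\<close>

lemma settled_23: "settled [[1,1,4],[2,2,4],[2,3,3],[4,4,6]]"
  by (rule settled_case[OF settled_Cons[OF settled_18 settled_Cons[OF settled_19 settled_Cons[OF settled_21 settled_Cons[OF settled_22 settled_Nil]]]],
    where J = "[1,2]" and E = "[4]" and cs = "[
    ([1,1,2],[([2,4,4],[[1,1,4],[2,2,4]],[[1,1,2]])],Lemma 0 [1,3,4,2,5,6]),
    ([2,2,2],[([1,1,2],[[1,1,4],[2,2,2]],[[2,2,4]])],Literal [1,1,2]),
    ([1,2,3],[([1,1,2],[[1,2,3],[1,2,3]],[[2,3,3]])],Literal [1,1,2]),
    ([2,2,3],[([2,2,2],[[2,2,3],[2,2,3]],[[2,3,3]])],Literal [2,2,2]),
    ([1,1,3],[([2,2,3],[[1,1,3],[2,2,4]],[[1,1,4]])],Literal [2,2,3]),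
    ([2,2,6],[([1,1,6],[[1,1,4],[2,2,6]],[[2,2,4]])],Lemma 0 [1,2,4,6,3,5]),
    ([1,1,6],[([2,2,6],[[1,1,6],[2,2,4]],[[1,1,4]])],Literal [2,2,6]),
    ([1,2,6],[],Lemma 1 [1,2,3,4,5,6]),
    ([1,1,5],[],Lemma 2 [1,2,3,4,5,6]),
    ([2,2,5],[([1,1,5],[[1,1,4],[2,2,5]],[[2,2,4]])],Literal [1,1,5]),
    ([1,2,5],[],Lemma 3 [1,2,3,4,5,6]),
    ([1,2,2],[([1,4,6],[[1,2,2],[4,4,6]],[[2,2,4]]),([2,2,6],[[1,2,2],[1,4,6]],[[1,1,4]])],Literal [2,2,6]),
    ([1,1,1],[([1,2,2],[[1,1,1],[2,2,4]],[[1,1,4]])],Literal [1,2,2])]"]) code_simp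

lemma settled_24: "settled [[1,1,4],[2,2,4],[2,3,3],[3,4,4]]"
  by (rule settled_case[OF settled_Cons[OF settled_18 settled_Cons[OF settled_23 settled_Nil]],
    where J = "[1,2]" and E = "[4]" and cs = "[
    ([2,2,3],[([3,3,4],[[2,2,3],[3,4,4]],[[2,2,4]])],Lemma 0 [1,2,3,4,5,6]),
    ([1,1,3],[([2,2,3],[[1,1,3],[2,2,4]],[[1,1,4]])],Literal [2,2,3]),
    ([1,1,2],[([2,4,4],[[1,1,4],[2,2,4]],[[1,1,2]])],Lemma 0 [1,3,4,2,5,6]),
    ([2,2,2],[([1,1,2],[[1,1,4],[2,2,2]],[[2,2,4]])],Literal [1,1,2]),
    ([1,2,3],[([1,1,2],[[1,2,3],[1,2,3]],[[2,3,3]])],Literal [1,1,2]),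
    ([1,2,6],[([3,6,6],[[1,2,6],[1,2,6],[3,4,4]],[[1,1,4],[2,2,4]])],Lemma 1 [6,4,1,3,5,2]),
    ([1,2,5],[([3,5,5],[[1,2,5],[1,2,5],[3,4,4]],[[1,1,4],[2,2,4]])],Lemma 1 [5,4,1,3,6,2]),
    ([1,2,2],[([1,3,4],[[1,2,2],[3,4,4]],[[2,2,4]]),([1,2,3],[[1,1,4],[2,3,3]],[[1,3,4]])],Literal [1,2,3]),
    ([1,1,1],[([1,2,2],[[1,1,1],[2,2,4]],[[1,1,4]])],Literal [1,2,2]),
    ([1,1,5],[([3,4,5],[[1,1,5],[3,4,4]],[[1,1,4]]),([3,5,5],[[1,1,5],[3,4,5]],[[1,1,4]])],Lemma 1 [5,4,1,3,6,2]),
    ([2,2,5],[([1,1,5],[[1,1,4],[2,2,5]],[[2,2,4]])],Literal [1,1,5]),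
    ([1,1,6],[([3,4,6],[[1,1,6],[3,4,4]],[[1,1,4]]),([3,6,6],[[1,1,6],[3,4,6]],[[1,1,4]])],Lemma 1 [6,4,1,3,5,2]),
    ([2,2,6],[([1,1,6],[[1,1,4],[2,2,6]],[[2,2,4]])],Literal [1,1,6])]"]) code_simp

lemma settled_25: "settled [[1,1,4],[1,4,4],[2,2,4],[2,3,3],[2,6,6],[5,5,5]]"
  by (rule settled_case[OF settled_Cons[OF settled_18 settled_Nil],
    where J = "[3,6]" and E = "[2]" and cs = "[
    ([4,6,6],[],Lemma 0 [1,2,6,4,3,5]),
    ([3,3,4],[],Lemma 0 [1,2,3,4,5,6]),
    ([1,6,6],[([4,6,6],[[1,4,4],[1,6,6]],[[1,1,4]])],Literal [4,6,6]),
    ([1,3,3],[([1,6,6],[[1,3,3],[2,6,6]],[[2,3,3]])],Literal [1,6,6]),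
    ([5,6,6],[([2,5,5],[[2,6,6],[5,5,5]],[[5,6,6]])],Lemma 0 [3,5,6,2,1,4]),
    ([3,3,5],[([5,6,6],[[2,6,6],[3,3,5]],[[2,3,3]])],Literal [5,6,6]),
    ([3,5,6],[([4,5,5],[[2,2,4],[3,5,6],[3,5,6]],[[2,3,3],[2,6,6]])],Lemma 0 [1,2,5,4,3,6]),
    ([3,3,3],[([2,2,3],[[2,3,3],[2,3,3]],[[3,3,3]]),([3,3,4],[[2,2,4],[3,3,3]],[[2,2,3]])],Literal [3,3,4]),
    ([3,6,6],[([3,3,3],[[2,3,3],[3,6,6]],[[2,6,6]])],Literal [3,3,3]),
    ([6,6,6],[([2,2,6],[[2,6,6],[2,6,6]],[[6,6,6]]),([4,6,6],[[2,2,4],[6,6,6]],[[2,2,6]])],Literal [4,6,6]),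
    ([3,3,6],[([6,6,6],[[2,6,6],[3,3,6]],[[2,3,3]])],Literal [6,6,6]),
    ([3,4,6],[([1,1,1],[[1,1,4],[1,1,4]],[[1,4,4]]),([4,4,4],[[1,4,4],[1,4,4]],[[1,1,4]])],Simple [Y [3] [6] 2 4, K [1], K [5]]),
    ([1,3,6],[([3,4,6],[[1,3,6],[1,4,4]],[[1,1,4]])],Literal [3,4,6])]"]) code_simp

lemma settled_26: "settled [[1,1,4],[1,4,4],[2,2,4],[2,3,3],[5,5,5]]"
  by (rule settled_case[OF settled_Cons[OF settled_18 settled_Cons[OF settled_25 settled_Nil]],
    where J = "[6]" and E = "[]" and cs = "[
    ([4,6,6],[],Lemma 0 [1,2,6,4,3,5]),
    ([1,6,6],[([4,6,6],[[1,4,4],[1,6,6]],[[1,1,4]])],Literal [4,6,6]),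
    ([2,6,6],[],Lemma 1 [1,2,3,4,5,6]),
    ([3,6,6],[([1,1,1],[[1,1,4],[1,1,4]],[[1,4,4]])],Simple [K [5], T [6,3,2,4,1]]),
    ([5,6,6],[([1,1,1],[[1,1,4],[1,1,4]],[[1,4,4]])],Simple [T [3,2,4,1], T [6,5]]),
    ([6,6,6],[([1,1,1],[[1,1,4],[1,1,4]],[[1,4,4]])],Simple [T [3,2,4,1], K [5], K [6]])]"]) code_simp

lemma settled_27: "settled [[1,1,4],[1,4,4],[2,2,4],[2,3,3],[2,5,5]]"
  by (rule settled_case[OF settled_Cons[OF settled_18 settled_Cons[OF settled_23 settled_Cons[OF settled_26 settled_Nil]]],
    where J = "[6]" and E = "[]" and cs = "[
    ([2,6,6],[],Lemma 0 [3,5,6,2,1,4]),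
    ([5,6,6],[],Lemma 1 [3,5,6,2,1,4]),
    ([6,6,6],[],Lemma 2 [1,2,3,4,6,5]),
    ([3,6,6],[],Lemma 1 [5,3,6,2,1,4]),
    ([4,6,6],[],Lemma 0 [1,2,6,4,3,5]),
    ([1,6,6],[([4,6,6],[[1,4,4],[1,6,6]],[[1,1,4]])],Literal [4,6,6])]"]) code_simp

lemma settled_28: "settled [[1,1,4],[2,2,4],[2,3,3],[3,5,5],[3,6,6]]"
  by (rule settled_case[OF settled_Cons[OF settled_18 settled_Cons[OF settled_23 settled_Cons[OF settled_27 settled_Nil]]],
    where J = "[5,6]" and E = "[3]" and cs = "[
    ([4,5,5],[],Lemma 0 [1,2,5,4,3,6]),
    ([4,6,6],[],Lemma 0 [1,2,6,4,3,5]),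
    ([2,5,5],[],Lemma 1 [5,3,6,2,1,4]),
    ([2,6,6],[],Lemma 1 [6,3,5,2,1,4]),
    ([1,5,6],[([3,3,4],[[1,1,4],[3,5,5],[3,6,6]],[[1,5,6],[1,5,6]])],Lemma 0 [1,2,3,4,5,6]),
    ([4,5,6],[([2,4,4],[[2,3,3],[4,5,6],[4,5,6]],[[3,5,5],[3,6,6]])],Lemma 2 [4,3,5,2,6,1]),
    ([2,5,6],[([4,5,6],[[2,2,4],[3,5,5],[3,6,6]],[[2,3,3],[2,5,6]])],Literal [4,5,6]),
    ([5,6,6],[([3,3,5],[[3,5,5],[3,6,6]],[[5,6,6]]),([2,6,6],[[2,3,3],[5,6,6]],[[3,3,5]])],Literal [2,6,6]),
    ([5,5,5],[([5,6,6],[[3,6,6],[5,5,5]],[[3,5,5]])],Literal [5,6,6]),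
    ([5,5,6],[([3,3,6],[[3,5,5],[3,6,6]],[[5,5,6]]),([2,5,5],[[2,3,3],[5,5,6]],[[3,3,6]])],Literal [2,5,5]),
    ([6,6,6],[([5,5,6],[[3,5,5],[6,6,6]],[[3,6,6]])],Literal [5,5,6]),
    ([1,5,5],[([1,3,4],[[1,1,4],[3,5,5]],[[1,5,5]]),([3,3,4],[[1,3,4],[1,3,4]],[[1,1,4]])],Lemma 0 [1,2,3,4,5,6]),
    ([1,6,6],[([1,5,5],[[1,6,6],[3,5,5]],[[3,6,6]])],Literal [1,5,5])]"]) code_simp

lemma settled_29: "settled [[1,1,4],[1,4,4],[2,2,4],[2,3,3],[3,5,5]]"
  by (rule settled_case[OF settled_Cons[OF settled_26 settled_Cons[OF settled_23 settled_Cons[OF settled_18 settled_Cons[OF settled_28 settled_Nil]]]],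
    where J = "[6]" and E = "[]" and cs = "[
    ([6,6,6],[],Lemma 0 [1,2,3,4,6,5]),
    ([2,6,6],[],Lemma 1 [6,3,5,2,1,4]),
    ([4,6,6],[],Lemma 2 [1,2,6,4,3,5]),
    ([1,6,6],[([4,6,6],[[1,4,4],[1,6,6]],[[1,1,4]])],Literal [4,6,6]),
    ([3,6,6],[],Lemma 3 [1,2,3,4,5,6]),
    ([5,6,6],[([1,1,1],[[1,1,4],[1,1,4]],[[1,4,4]])],Simple [T [6,5,3,2,4,1]])]"]) code_simp

lemma settled_30: "settled [[1,1,4],[1,4,4],[2,2,4],[2,3,3],[5,5,6]]"
  by (rule settled_case[OF settled_Cons[OF settled_26 settled_Cons[OF settled_18 settled_Cons[OF settled_29 settled_Cons[OF settled_23 settled_Nil]]]],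
    where J = "[6]" and E = "[]" and cs = "[
    ([6,6,6],[],Lemma 0 [1,2,3,4,6,5]),
    ([4,6,6],[],Lemma 1 [1,2,6,4,3,5]),
    ([3,6,6],[],Lemma 2 [1,2,3,4,6,5]),
    ([2,6,6],[],Lemma 3 [3,6,5,2,1,4]),
    ([5,6,6],[([6,6,6],[[5,6,6],[5,6,6]],[[5,5,6]])],Literal [6,6,6]),
    ([1,6,6],[([4,6,6],[[1,4,4],[1,6,6]],[[1,1,4]])],Literal [4,6,6])]"]) code_simp

lemma settled_31: "settled [[1,1,4],[1,4,4],[2,2,4],[2,3,3]]"
  by (rule settled_case[OF settled_Cons[OF settled_18 settled_Cons[OF settled_26 settled_Cons[OF settled_27 settled_Cons[OF settled_29 settled_Cons[OF settled_30 settled_Nil]]]]],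
    where J = "[5]" and E = "[]" and cs = "[
    ([4,5,5],[],Lemma 0 [1,2,5,4,3,6]),
    ([1,5,5],[([4,5,5],[[1,4,4],[1,5,5]],[[1,1,4]])],Literal [4,5,5]),
    ([5,5,5],[],Lemma 1 [1,2,3,4,5,6]),
    ([2,5,5],[],Lemma 2 [1,2,3,4,5,6]),
    ([3,5,5],[],Lemma 3 [1,2,3,4,5,6]),
    ([5,5,6],[],Lemma 4 [1,2,3,4,5,6])]"]) code_simp

lemma settled_32: "settled [[1,1,4],[2,2,4],[2,3,3],[4,4,4]]"
  by (rule settled_case[OF settled_Cons[OF settled_23 settled_Cons[OF settled_24 settled_Cons[OF settled_31 settled_Cons[OF settled_18 settled_Nil]]]],
    where J = "[1,2]" and E = "[4]" and cs = "[
    ([1,1,5],[([4,4,5],[[1,1,5],[4,4,4]],[[1,1,4]])],Lemma 0 [1,2,3,4,6,5]),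
    ([2,2,5],[([1,1,5],[[1,1,4],[2,2,5]],[[2,2,4]])],Literal [1,1,5]),
    ([1,1,3],[([3,4,4],[[1,1,3],[4,4,4]],[[1,1,4]])],Lemma 1 [1,4,2,3,5,6]),
    ([2,2,3],[([1,1,3],[[1,1,4],[2,2,3]],[[2,2,4]])],Literal [1,1,3]),
    ([1,2,2],[([1,4,4],[[1,1,4],[2,2,4]],[[1,2,2]])],Lemma 2 [4,2,3,1,5,6]),
    ([1,1,1],[([1,2,2],[[1,1,1],[2,2,4]],[[1,1,4]])],Literal [1,2,2]),
    ([1,1,6],[([4,4,6],[[1,1,6],[4,4,4]],[[1,1,4]])],Lemma 0 [1,2,3,4,5,6]),
    ([2,2,6],[([1,1,6],[[1,1,4],[2,2,6]],[[2,2,4]])],Literal [1,1,6]),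
    ([1,1,2],[([2,4,4],[[1,1,2],[4,4,4]],[[1,1,4]])],Lemma 3 [1,3,4,2,5,6]),
    ([2,2,2],[([1,1,2],[[1,1,4],[2,2,2]],[[2,2,4]])],Literal [1,1,2]),
    ([1,2,3],[([1,1,2],[[1,2,3],[1,2,3]],[[2,3,3]])],Literal [1,1,2]),
    ([1,2,6],[([4,6,6],[[1,2,6],[1,2,6],[4,4,4]],[[1,1,4],[2,2,4]])],Lemma 3 [1,2,6,4,3,5]),
    ([1,2,5],[([4,5,5],[[1,2,5],[1,2,5],[4,4,4]],[[1,1,4],[2,2,4]])],Lemma 3 [1,2,5,4,3,6])]"]) code_simp

lemma settled_33: "settled [[1,1,4],[2,2,4],[2,3,3]]"
  by (rule settled_case[OF settled_Cons[OF settled_18 settled_Cons[OF settled_23 settled_Cons[OF settled_24 settled_Cons[OF settled_31 settled_Cons[OF settled_32 settled_Nil]]]]],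
    where J = "[4]" and E = "[]" and cs = "[
    ([2,4,4],[([1,1,2],[[1,1,4],[2,2,4]],[[2,4,4]])],Lemma 0 [1,3,4,2,5,6]),
    ([4,4,6],[],Lemma 1 [1,2,3,4,5,6]),
    ([4,4,5],[],Lemma 1 [1,2,3,4,6,5]),
    ([3,4,4],[],Lemma 2 [1,2,3,4,5,6]),
    ([1,4,4],[],Lemma 3 [1,2,3,4,5,6]),
    ([4,4,4],[],Lemma 4 [1,2,3,4,5,6])]"]) code_simp

section \<open>Certificates: the other positions of a third square next to two with a common
  cofactor\<close>

lemma settled_34: "settled [[1,1,4],[2,2,4],[3,3,3],[5,5,6],[6,6,6]]"
  by (rule settled_case[OF settled_Cons[OF settled_18 settled_Cons[OF settled_33 settled_Nil]],
    where J = "[1,2]" and E = "[4]" and cs = "[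
    ([2,2,6],[([4,5,5],[[2,2,4],[5,5,6]],[[2,2,6]])],Lemma 0 [1,2,5,4,3,6]),
    ([1,1,6],[([2,2,6],[[1,1,6],[2,2,4]],[[1,1,4]])],Literal [2,2,6]),
    ([2,2,3],[([3,3,4],[[2,2,4],[3,3,3]],[[2,2,3]])],Lemma 0 [1,2,3,4,5,6]),
    ([1,1,3],[([2,2,3],[[1,1,3],[2,2,4]],[[1,1,4]])],Literal [2,2,3]),
    ([1,2,6],[([4,4,6],[[1,1,4],[2,2,4],[6,6,6]],[[1,2,6],[1,2,6]])],Lemma 1 [5,4,1,6,2,3]),
    ([1,2,5],[([4,4,6],[[1,1,4],[2,2,4],[5,5,6]],[[1,2,5],[1,2,5]])],Lemma 1 [5,4,1,6,2,3]),
    ([2,2,2],[([2,4,4],[[2,2,4],[2,2,4]],[[2,2,2]])],Simple [T [1,4,2], K [3], T [5,6]]),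
    ([1,1,2],[([2,2,2],[[1,1,2],[2,2,4]],[[1,1,4]])],Literal [2,2,2]),
    ([1,1,1],[([1,4,4],[[1,1,4],[1,1,4]],[[1,1,1]])],Simple [T [2,4,1], K [3], T [5,6]]),
    ([1,2,2],[([1,1,1],[[1,1,4],[1,2,2]],[[2,2,4]])],Literal [1,1,1]),
    ([1,2,3],[([3,4,4],[[1,1,4],[2,2,4],[3,3,3]],[[1,2,3],[1,2,3]])],Simple [Y [1] [2] 4 3, T [5,6]]),
    ([1,1,5],[([4,5,6],[[1,1,4],[5,5,6]],[[1,1,5]]),([4,4,6],[[1,1,4],[4,5,6]],[[1,1,5]])],Lemma 1 [5,4,1,6,2,3]),
    ([2,2,5],[([1,1,5],[[1,1,4],[2,2,5]],[[2,2,4]])],Literal [1,1,5])]"]) code_simp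

lemma settled_35: "settled [[1,1,4],[2,2,4],[3,3,3],[3,6,6],[5,5,6]]"
  by (rule settled_case[OF settled_Cons[OF settled_33 settled_Cons[OF settled_18 settled_Nil]],
    where J = "[1,2]" and E = "[4]" and cs = "[
    ([1,1,3],[],Lemma 0 [1,6,5,3,2,4]),
    ([2,2,3],[],Lemma 0 [2,6,5,3,1,4]),
    ([2,2,6],[([4,5,5],[[2,2,4],[5,5,6]],[[2,2,6]])],Lemma 1 [1,2,5,4,3,6]),
    ([1,1,6],[([2,2,6],[[1,1,6],[2,2,4]],[[1,1,4]])],Literal [2,2,6]),
    ([1,2,6],[([3,4,4],[[1,1,4],[2,2,4],[3,6,6]],[[1,2,6],[1,2,6]])],Lemma 0 [6,4,1,3,2,5]),
    ([1,2,3],[([3,4,4],[[1,1,4],[2,2,4],[3,3,3]],[[1,2,3],[1,2,3]])],Lemma 0 [6,4,1,3,2,5]),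
    ([1,2,5],[([4,4,6],[[1,1,4],[2,2,4],[5,5,6]],[[1,2,5],[1,2,5]])],Lemma 0 [5,4,1,6,2,3]),
    ([2,2,2],[([2,4,4],[[2,2,4],[2,2,4]],[[2,2,2]])],Simple [T [1,4,2], T [5,6,3]]),
    ([1,1,2],[([2,2,2],[[1,1,2],[2,2,4]],[[1,1,4]])],Literal [2,2,2]),
    ([1,1,1],[([1,4,4],[[1,1,4],[1,1,4]],[[1,1,1]])],Simple [T [2,4,1], T [5,6,3]]),
    ([1,2,2],[([1,1,1],[[1,1,4],[1,2,2]],[[2,2,4]])],Literal [1,1,1]),
    ([1,1,5],[([4,5,6],[[1,1,4],[5,5,6]],[[1,1,5]]),([4,4,6],[[1,1,4],[4,5,6]],[[1,1,5]])],Lemma 0 [5,4,1,6,2,3]),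
    ([2,2,5],[([1,1,5],[[1,1,4],[2,2,5]],[[2,2,4]])],Literal [1,1,5])]"]) code_simp

lemma settled_36: "settled [[1,1,4],[2,2,4],[3,3,3],[5,5,6]]"
  by (rule settled_case[OF settled_Cons[OF settled_18 settled_Cons[OF settled_33 settled_Cons[OF settled_34 settled_Cons[OF settled_35 settled_Nil]]]],
    where J = "[6]" and E = "[]" and cs = "[
    ([4,6,6],[],Lemma 0 [1,2,6,4,3,5]),
    ([1,6,6],[],Lemma 1 [2,1,6,4,3,5]),
    ([2,6,6],[],Lemma 1 [1,2,6,4,3,5]),
    ([6,6,6],[],Lemma 2 [1,2,3,4,5,6]),
    ([5,6,6],[([6,6,6],[[5,6,6],[5,6,6]],[[5,5,6]])],Literal [6,6,6]),
    ([3,6,6],[],Lemma 3 [1,2,3,4,5,6])]"]) code_simp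

lemma settled_37: "settled [[1,1,4],[2,2,4],[3,3,3],[5,5,5],[6,6,6]]"
  by (rule settled_case[OF settled_Cons[OF settled_18 settled_Nil],
    where J = "[1,2]" and E = "[4]" and cs = "[
    ([1,1,6],[([4,6,6],[[1,1,4],[6,6,6]],[[1,1,6]])],Lemma 0 [1,2,6,4,3,5]),
    ([2,2,6],[([1,1,6],[[1,1,4],[2,2,6]],[[2,2,4]])],Literal [1,1,6]),
    ([1,1,5],[([4,5,5],[[1,1,4],[5,5,5]],[[1,1,5]])],Lemma 0 [1,2,5,4,3,6]),
    ([2,2,5],[([1,1,5],[[1,1,4],[2,2,5]],[[2,2,4]])],Literal [1,1,5]),
    ([2,2,3],[([3,3,4],[[2,2,4],[3,3,3]],[[2,2,3]])],Lemma 0 [1,2,3,4,5,6]),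
    ([1,1,3],[([2,2,3],[[1,1,3],[2,2,4]],[[1,1,4]])],Literal [2,2,3]),
    ([1,1,1],[([1,4,4],[[1,1,4],[1,1,4]],[[1,1,1]])],Simple [T [2,4,1], K [3], K [5], K [6]]),
    ([1,2,2],[([1,1,1],[[1,1,4],[1,2,2]],[[2,2,4]])],Literal [1,1,1]),
    ([2,2,2],[([2,4,4],[[2,2,4],[2,2,4]],[[2,2,2]])],Simple [T [1,4,2], K [3], K [5], K [6]]),
    ([1,1,2],[([2,2,2],[[1,1,2],[2,2,4]],[[1,1,4]])],Literal [2,2,2]),
    ([1,2,5],[([4,4,5],[[1,1,4],[2,2,4],[5,5,5]],[[1,2,5],[1,2,5]])],Simple [Y [1] [2] 4 5, K [3], K [6]]),
    ([1,2,6],[([4,4,6],[[1,1,4],[2,2,4],[6,6,6]],[[1,2,6],[1,2,6]])],Simple [Y [1] [2] 4 6, K [3], K [5]]),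
    ([1,2,3],[([3,4,4],[[1,1,4],[2,2,4],[3,3,3]],[[1,2,3],[1,2,3]])],Simple [Y [1] [2] 4 3, K [5], K [6]])]"]) code_simp

lemma settled_38: "settled [[1,1,4],[2,2,4],[3,3,3],[5,5,5]]"
  by (rule settled_case[OF settled_Cons[OF settled_36 settled_Cons[OF settled_18 settled_Cons[OF settled_33 settled_Cons[OF settled_37 settled_Nil]]]],
    where J = "[6]" and E = "[]" and cs = "[
    ([5,6,6],[],Lemma 0 [1,2,3,4,6,5]),
    ([3,6,6],[],Lemma 0 [1,2,5,4,6,3]),
    ([4,6,6],[],Lemma 1 [1,2,6,4,3,5]),
    ([2,6,6],[],Lemma 2 [1,2,6,4,3,5]),
    ([1,6,6],[],Lemma 2 [2,1,6,4,3,5]),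
    ([6,6,6],[],Lemma 3 [1,2,3,4,5,6])]"]) code_simp

lemma settled_39: "settled [[1,1,4],[2,2,4],[3,3,3],[3,5,5],[3,6,6]]"
  by (rule settled_case[OF settled_Cons[OF settled_18 settled_Cons[OF settled_33 settled_Cons[OF settled_36 settled_Nil]]],
    where J = "[1,2]" and E = "[4]" and cs = "[
    ([1,1,3],[],Lemma 0 [1,5,6,3,2,4]),
    ([2,2,5],[],Lemma 1 [6,5,2,3,1,4]),
    ([1,1,1],[],Lemma 2 [5,6,1,3,2,4]),
    ([2,2,6],[],Lemma 1 [5,6,2,3,1,4]),
    ([2,2,2],[],Lemma 2 [5,6,2,3,1,4]),
    ([1,1,6],[],Lemma 1 [5,6,1,3,2,4]),
    ([1,1,5],[],Lemma 1 [6,5,1,3,2,4]),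
    ([2,2,3],[],Lemma 0 [2,5,6,3,1,4]),
    ([1,1,2],[([2,2,2],[[1,1,2],[2,2,4]],[[1,1,4]])],Literal [2,2,2]),
    ([1,2,2],[([1,1,1],[[1,1,4],[1,2,2]],[[2,2,4]])],Literal [1,1,1]),
    ([1,2,5],[([3,4,4],[[1,1,4],[2,2,4],[3,5,5]],[[1,2,5],[1,2,5]])],Lemma 0 [4,5,6,3,1,2]),
    ([1,2,3],[([3,4,4],[[1,1,4],[2,2,4],[3,3,3]],[[1,2,3],[1,2,3]])],Lemma 0 [4,5,6,3,1,2]),
    ([1,2,6],[([3,4,4],[[1,1,4],[2,2,4],[3,6,6]],[[1,2,6],[1,2,6]])],Lemma 0 [4,5,6,3,1,2])]"]) code_simp

lemma settled_40: "settled [[1,1,4],[2,2,4],[3,3,3],[3,5,5]]"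
  by (rule settled_case[OF settled_Cons[OF settled_36 settled_Cons[OF settled_33 settled_Cons[OF settled_18 settled_Cons[OF settled_39 settled_Nil]]]],
    where J = "[6]" and E = "[]" and cs = "[
    ([5,6,6],[],Lemma 0 [1,2,3,4,6,5]),
    ([6,6,6],[],Lemma 0 [1,2,6,4,5,3]),
    ([1,6,6],[],Lemma 1 [2,1,6,4,3,5]),
    ([4,6,6],[],Lemma 2 [1,2,6,4,3,5]),
    ([2,6,6],[],Lemma 1 [1,2,6,4,3,5]),
    ([3,6,6],[],Lemma 3 [1,2,3,4,5,6])]"]) code_simp

lemma settled_41: "settled [[1,1,4],[2,2,4],[3,3,3]]"
  by (rule settled_case[OF settled_Cons[OF settled_33 settled_Cons[OF settled_18 settled_Cons[OF settled_36 settled_Cons[OF settled_38 settled_Cons[OF settled_40 settled_Nil]]]]],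
    where J = "[5]" and E = "[]" and cs = "[
    ([2,5,5],[],Lemma 0 [1,2,5,4,3,6]),
    ([1,5,5],[],Lemma 0 [2,1,5,4,3,6]),
    ([4,5,5],[],Lemma 1 [1,2,5,4,3,6]),
    ([5,5,6],[],Lemma 2 [1,2,3,4,5,6]),
    ([5,5,5],[],Lemma 3 [1,2,3,4,5,6]),
    ([3,5,5],[],Lemma 4 [1,2,3,4,5,6])]"]) code_simp

lemma settled_42: "settled [[1,1,4],[2,2,4],[3,3,6],[3,5,5],[5,6,6]]"
  by (rule settled_case[OF settled_Cons[OF settled_33 settled_Nil],
    where J = "[1,2]" and E = "[4]" and cs = "[
    ([2,2,6],[],Lemma 0 [2,3,5,6,1,4]),
    ([1,1,3],[],Lemma 0 [1,5,6,3,2,4]),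
    ([2,2,5],[],Lemma 0 [2,6,3,5,1,4]),
    ([1,1,5],[],Lemma 0 [1,6,3,5,2,4]),
    ([1,1,6],[],Lemma 0 [1,3,5,6,2,4]),
    ([2,2,3],[],Lemma 0 [2,5,6,3,1,4]),
    ([1,2,6],[([4,4,5],[[1,1,4],[2,2,4],[5,6,6]],[[1,2,6],[1,2,6]])],Lemma 0 [6,4,1,5,2,3]),
    ([1,2,3],[([4,4,6],[[1,1,4],[2,2,4],[3,3,6]],[[1,2,3],[1,2,3]])],Lemma 0 [3,4,1,6,2,5]),
    ([1,2,5],[([3,4,4],[[1,1,4],[2,2,4],[3,5,5]],[[1,2,5],[1,2,5]])],Lemma 0 [5,4,1,3,2,6]),
    ([1,1,1],[([1,4,4],[[1,1,4],[1,1,4]],[[1,1,1]])],Simple [T [2,4,1], K [3,6,5]]),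
    ([1,2,2],[([1,1,1],[[1,1,4],[1,2,2]],[[2,2,4]])],Literal [1,1,1]),
    ([2,2,2],[([2,4,4],[[2,2,4],[2,2,4]],[[2,2,2]])],Simple [T [1,4,2], K [3,6,5]]),
    ([1,1,2],[([2,2,2],[[1,1,2],[2,2,4]],[[1,1,4]])],Literal [2,2,2])]"]) code_simp

lemma settled_43: "settled [[1,1,4],[2,2,4],[3,3,6],[5,6,6]]"
  by (rule settled_case[OF settled_Cons[OF settled_18 settled_Cons[OF settled_41 settled_Cons[OF settled_33 settled_Cons[OF settled_42 settled_Nil]]]],
    where J = "[5]" and E = "[]" and cs = "[
    ([4,5,5],[],Lemma 0 [1,2,5,4,3,6]),
    ([5,5,5],[],Lemma 1 [1,2,5,4,3,6]),
    ([1,5,5],[],Lemma 2 [2,1,5,4,3,6]),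
    ([2,5,5],[],Lemma 2 [1,2,5,4,3,6]),
    ([5,5,6],[([5,5,5],[[5,5,6],[5,5,6]],[[5,6,6]])],Literal [5,5,5]),
    ([3,5,5],[],Lemma 3 [1,2,3,4,5,6])]"]) code_simp

lemma settled_44: "settled [[1,1,4],[2,2,4],[3,3,6]]"
  by (rule settled_case[OF settled_Cons[OF settled_41 settled_Cons[OF settled_33 settled_Cons[OF settled_18 settled_Cons[OF settled_43 settled_Nil]]]],
    where J = "[6]" and E = "[]" and cs = "[
    ([6,6,6],[],Lemma 0 [1,2,6,4,3,5]),
    ([1,6,6],[],Lemma 1 [2,1,6,4,3,5]),
    ([4,6,6],[],Lemma 2 [1,2,6,4,3,5]),
    ([2,6,6],[],Lemma 1 [1,2,6,4,3,5]),
    ([3,6,6],[([6,6,6],[[3,6,6],[3,6,6]],[[3,3,6]])],Literal [6,6,6]),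
    ([5,6,6],[],Lemma 3 [1,2,3,4,5,6])]"]) code_simp

text \<open>From here on two squares with a common cofactor, different from both variables, settle a
  branch at once; what is left are cycles and chains.\<close>

lemma settled_45: "settled [[1,1,4],[2,2,4]]"
  by (rule settled_case[OF settled_Cons[OF settled_18 settled_Cons[OF settled_33 settled_Cons[OF settled_41 settled_Cons[OF settled_44 settled_Nil]]]],
    where J = "[3]" and E = "[]" and cs = "[
    ([3,3,4],[],Lemma 0 [1,2,3,4,5,6]),
    ([2,3,3],[],Lemma 1 [1,2,3,4,5,6]),
    ([1,3,3],[],Lemma 1 [2,1,3,4,5,6]),
    ([3,3,3],[],Lemma 2 [1,2,3,4,5,6]),
    ([3,3,6],[],Lemma 3 [1,2,3,4,5,6]),
    ([3,3,5],[],Lemma 3 [1,2,3,4,6,5])]"]) code_simp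

section \<open>Certificates: cycles and chains\<close>

lemma settled_46: "settled [[1,1,4],[2,2,6],[2,3,3],[4,4,4],[5,5,5]]"
  by (rule settled_case[OF settled_Cons[OF settled_45 settled_Nil],
    where J = "[6]" and E = "[]" and cs = "[
    ([2,6,6],[],Lemma 0 [3,6,1,2,4,5]),
    ([4,6,6],[],Lemma 0 [1,6,2,4,3,5]),
    ([5,6,6],[],Simple [T [1,4], T [3,2,6,5]]),
    ([6,6,6],[],Simple [T [1,4], T [3,2,6], K [5]]),
    ([3,6,6],[],Simple [T [1,4], K [5], K [2,6,3]]),
    ([1,6,6],[],Simple [T [3,2,6,1,4], K [5]])]"]) code_simp

lemma settled_47: "settled [[1,1,4],[2,2,6],[2,3,3],[4,4,5],[5,5,5]]"
  by (rule settled_case[OF settled_Cons[OF settled_45 settled_Nil],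
    where J = "[6]" and E = "[]" and cs = "[
    ([5,6,6],[],Lemma 0 [4,6,1,5,2,3]),
    ([2,6,6],[],Lemma 0 [3,6,1,2,4,5]),
    ([4,6,6],[],Lemma 0 [1,6,2,4,3,5]),
    ([3,6,6],[],Simple [T [1,4,5], K [2,6,3]]),
    ([1,6,6],[],Simple [T [3,2,6,1,4,5]]),
    ([6,6,6],[],Simple [T [1,4,5], T [3,2,6]])]"]) code_simp

lemma settled_48: "settled [[1,1,4],[2,2,6],[2,3,3],[3,4,4],[5,5,5]]"
  by (rule settled_case[OF settled_Cons[OF settled_46 settled_Cons[OF settled_47 settled_Cons[OF settled_45 settled_Nil]]],
    where J = "[6]" and E = "[]" and cs = "[
    ([6,6,6],[],Lemma 0 [2,4,1,6,5,3]),
    ([5,6,6],[],Lemma 1 [2,4,1,6,5,3]),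
    ([2,6,6],[],Lemma 2 [3,6,1,2,4,5]),
    ([3,6,6],[],Lemma 2 [4,6,1,3,2,5]),
    ([4,6,6],[],Lemma 2 [1,6,2,4,3,5]),
    ([1,6,6],[],Simple [K [5], K [1,4,3,2,6]])]"]) code_simp

lemma settled_49: "settled [[1,1,4],[2,2,6],[2,3,3],[5,5,5]]"
  by (rule settled_case[OF settled_Cons[OF settled_45 settled_Cons[OF settled_46 settled_Cons[OF settled_47 settled_Cons[OF settled_48 settled_Nil]]]],
    where J = "[4]" and E = "[]" and cs = "[
    ([4,4,6],[],Lemma 0 [2,4,1,6,3,5]),
    ([2,4,4],[],Lemma 0 [3,4,1,2,5,6]),
    ([4,4,4],[],Lemma 1 [1,2,3,4,5,6]),
    ([1,4,4],[([4,4,4],[[1,4,4],[1,4,4]],[[1,1,4]])],Literal [4,4,4]),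
    ([4,4,5],[],Lemma 2 [1,2,3,4,5,6]),
    ([3,4,4],[],Lemma 3 [1,2,3,4,5,6])]"]) code_simp

lemma settled_50: "settled [[1,1,4],[1,5,5],[2,2,6],[2,3,3],[3,4,4]]"
  by (rule settled_case[OF settled_Cons[OF settled_45 settled_Cons[OF settled_49 settled_Nil]],
    where J = "[6]" and E = "[]" and cs = "[
    ([4,6,6],[],Lemma 0 [1,6,2,4,3,5]),
    ([2,6,6],[],Lemma 0 [3,6,1,2,4,5]),
    ([3,6,6],[],Lemma 0 [4,6,1,3,2,5]),
    ([6,6,6],[],Lemma 1 [3,1,5,2,6,4]),
    ([1,6,6],[],Lemma 0 [5,6,2,1,3,4]),
    ([5,6,6],[],Simple [K [1,4,3,2,6,5]])]"]) code_simp

lemma settled_51: "settled [[1,1,4],[1,5,5],[2,2,6],[2,3,3],[4,4,5]]"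
  by (rule settled_case[OF settled_Cons[OF settled_45 settled_Cons[OF settled_49 settled_Nil]],
    where J = "[6]" and E = "[]" and cs = "[
    ([5,6,6],[],Lemma 0 [4,6,1,5,2,3]),
    ([6,6,6],[],Lemma 1 [3,1,5,2,6,4]),
    ([2,6,6],[],Lemma 0 [3,6,1,2,4,5]),
    ([4,6,6],[],Lemma 0 [1,6,2,4,3,5]),
    ([1,6,6],[],Lemma 0 [5,6,2,1,3,4]),
    ([3,6,6],[],Simple [K [1,4,5], K [2,6,3]])]"]) code_simp

lemma settled_52: "settled [[1,1,4],[1,5,5],[2,2,6],[2,3,3]]"
  by (rule settled_case[OF settled_Cons[OF settled_45 settled_Cons[OF settled_49 settled_Cons[OF settled_50 settled_Cons[OF settled_51 settled_Nil]]]],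
    where J = "[4]" and E = "[]" and cs = "[
    ([2,4,4],[],Lemma 0 [3,4,1,2,5,6]),
    ([1,4,4],[],Lemma 0 [4,5,2,1,3,6]),
    ([4,4,6],[],Lemma 0 [2,4,1,6,3,5]),
    ([4,4,4],[],Lemma 1 [5,2,3,1,4,6]),
    ([3,4,4],[],Lemma 2 [1,2,3,4,5,6]),
    ([4,4,5],[],Lemma 3 [1,2,3,4,5,6])]"]) code_simp

lemma settled_53: "settled [[1,1,4],[2,2,6],[2,3,3],[3,5,5],[5,6,6]]"
  by (rule settled_case[OF settled_Cons[OF settled_45 settled_Nil],
    where J = "[4]" and E = "[]" and cs = "[
    ([4,4,5],[],Lemma 0 [4,6,1,5,2,3]),
    ([2,4,4],[],Lemma 0 [3,4,1,2,5,6]),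
    ([4,4,6],[],Lemma 0 [2,4,1,6,3,5]),
    ([3,4,4],[],Lemma 0 [4,5,1,3,2,6]),
    ([4,4,4],[],Simple [T [1,4], K [2,6,5,3]]),
    ([1,4,4],[],Simple [K [1,4], K [2,6,5,3]])]"]) code_simp

lemma settled_54: "settled [[1,1,4],[2,2,6],[2,3,3],[3,5,5]]"
  by (rule settled_case[OF settled_Cons[OF settled_45 settled_Cons[OF settled_49 settled_Cons[OF settled_52 settled_Cons[OF settled_53 settled_Nil]]]],
    where J = "[6]" and E = "[]" and cs = "[
    ([3,6,6],[],Lemma 0 [5,6,1,3,2,4]),
    ([6,6,6],[],Lemma 1 [1,3,5,4,6,2]),
    ([2,6,6],[],Lemma 0 [3,6,1,2,4,5]),
    ([1,6,6],[],Lemma 2 [1,3,5,4,6,2]),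
    ([4,6,6],[],Lemma 0 [1,6,2,4,3,5]),
    ([5,6,6],[],Lemma 3 [1,2,3,4,5,6])]"]) code_simp

lemma settled_55: "settled [[1,1,4],[2,2,6],[2,3,3]]"
  by (rule settled_case[OF settled_Cons[OF settled_45 settled_Cons[OF settled_49 settled_Cons[OF settled_52 settled_Cons[OF settled_54 settled_Nil]]]],
    where J = "[5]" and E = "[]" and cs = "[
    ([4,5,5],[],Lemma 0 [1,5,2,4,3,6]),
    ([5,5,6],[],Lemma 0 [2,5,1,6,3,4]),
    ([2,5,5],[],Lemma 0 [3,5,1,2,4,6]),
    ([5,5,5],[],Lemma 1 [1,2,3,4,5,6]),
    ([1,5,5],[],Lemma 2 [1,2,3,4,5,6]),
    ([3,5,5],[],Lemma 3 [1,2,3,4,5,6])]"]) code_simp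

lemma settled_56: "settled [[1,1,4],[1,4,4],[2,2,6],[3,3,5],[3,5,5]]"
  by (rule settled_case[OF settled_Cons[OF settled_45 settled_Nil],
    where J = "[6]" and E = "[]" and cs = "[
    ([3,6,6],[],Lemma 0 [5,6,1,3,2,4]),
    ([4,6,6],[],Lemma 0 [1,6,2,4,3,5]),
    ([1,6,6],[],Lemma 0 [4,6,2,1,3,5]),
    ([5,6,6],[],Lemma 0 [3,6,1,5,2,4]),
    ([2,6,6],[],Simple [K [1,4], K [2,6], K [3,5]]),
    ([6,6,6],[],Simple [T [2,6], K [1,4], K [3,5]])]"]) code_simp

lemma settled_57: "settled [[1,1,4],[1,4,4],[2,2,6],[3,3,5],[5,5,5]]"
  by (rule settled_case[OF settled_Cons[OF settled_55 settled_Cons[OF settled_45 settled_Cons[OF settled_56 settled_Nil]]],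
    where J = "[6]" and E = "[]" and cs = "[
    ([3,6,6],[],Lemma 0 [1,6,2,4,5,3]),
    ([5,6,6],[],Lemma 1 [3,6,1,5,2,4]),
    ([1,6,6],[],Lemma 1 [4,6,2,1,3,5]),
    ([4,6,6],[],Lemma 1 [1,6,2,4,3,5]),
    ([2,6,6],[],Lemma 2 [1,3,2,4,6,5]),
    ([6,6,6],[],Simple [T [2,6], T [3,5], K [1,4]])]"]) code_simp

lemma settled_58: "settled [[1,1,4],[1,4,4],[2,2,6],[3,3,5]]"
  by (rule settled_case[OF settled_Cons[OF settled_45 settled_Cons[OF settled_55 settled_Cons[OF settled_56 settled_Cons[OF settled_57 settled_Nil]]]],
    where J = "[5]" and E = "[]" and cs = "[
    ([1,5,5],[],Lemma 0 [4,5,2,1,3,6]),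
    ([5,5,6],[],Lemma 0 [2,5,1,6,3,4]),
    ([4,5,5],[],Lemma 0 [1,5,2,4,3,6]),
    ([2,5,5],[],Lemma 1 [1,2,5,4,3,6]),
    ([3,5,5],[],Lemma 2 [1,2,3,4,5,6]),
    ([5,5,5],[],Lemma 3 [1,2,3,4,5,6])]"]) code_simp

lemma settled_59: "settled [[1,1,4],[2,2,6],[3,3,5],[4,4,4],[5,5,5]]"
  by (rule settled_case[OF settled_Cons[OF settled_45 settled_Cons[OF settled_58 settled_Cons[OF settled_55 settled_Nil]]],
    where J = "[6]" and E = "[]" and cs = "[
    ([4,6,6],[],Lemma 0 [1,6,2,4,3,5]),
    ([2,6,6],[],Lemma 1 [2,1,3,6,5,4]),
    ([1,6,6],[],Lemma 2 [3,1,6,5,2,4]),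
    ([3,6,6],[],Lemma 2 [1,6,2,4,5,3]),
    ([5,6,6],[],Lemma 0 [3,6,1,5,2,4]),
    ([6,6,6],[],Simple [T [1,4], T [2,6], T [3,5]])]"]) code_simp

lemma settled_60: "settled [[1,1,4],[2,2,6],[3,3,5],[4,4,4]]"
  by (rule settled_case[OF settled_Cons[OF settled_45 settled_Cons[OF settled_58 settled_Cons[OF settled_55 settled_Cons[OF settled_59 settled_Nil]]]],
    where J = "[5]" and E = "[]" and cs = "[
    ([5,5,6],[],Lemma 0 [2,5,1,6,3,4]),
    ([3,5,5],[],Lemma 1 [3,1,2,5,6,4]),
    ([2,5,5],[],Lemma 2 [1,2,5,4,3,6]),
    ([1,5,5],[],Lemma 2 [2,1,5,6,3,4]),
    ([4,5,5],[],Lemma 0 [1,5,2,4,3,6]),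
    ([5,5,5],[],Lemma 3 [1,2,3,4,5,6])]"]) code_simp

lemma settled_61: "settled [[1,1,4],[2,2,6],[3,3,5]]"
  by (rule settled_case[OF settled_Cons[OF settled_45 settled_Cons[OF settled_55 settled_Cons[OF settled_58 settled_Cons[OF settled_60 settled_Nil]]]],
    where J = "[4]" and E = "[]" and cs = "[
    ([4,4,6],[],Lemma 0 [2,4,1,6,3,5]),
    ([4,4,5],[],Lemma 0 [3,4,1,5,2,6]),
    ([2,4,4],[],Lemma 1 [3,4,1,5,6,2]),
    ([3,4,4],[],Lemma 1 [2,4,1,6,5,3]),
    ([1,4,4],[],Lemma 2 [1,2,3,4,5,6]),
    ([4,4,4],[],Lemma 3 [1,2,3,4,5,6])]"]) code_simp

lemma settled_62: "settled [[1,1,4],[2,2,6],[3,3,3],[4,4,4],[5,5,5]]"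
  by (rule settled_case[OF settled_Cons[OF settled_45 settled_Cons[OF settled_55 settled_Nil]],
    where J = "[6]" and E = "[]" and cs = "[
    ([4,6,6],[],Lemma 0 [1,6,2,4,3,5]),
    ([5,6,6],[],Lemma 1 [1,6,2,4,3,5]),
    ([3,6,6],[],Lemma 1 [1,6,2,4,5,3]),
    ([1,6,6],[],Simple [T [2,6,1,4], K [3], K [5]]),
    ([2,6,6],[],Simple [T [1,4], K [3], K [5], K [2,6]]),
    ([6,6,6],[],Simple [T [1,4], T [2,6], K [3], K [5]])]"]) code_simp

lemma settled_63: "settled [[1,1,4],[2,2,6],[2,4,4],[3,3,3],[5,5,5]]"
  by (rule settled_case[OF settled_Cons[OF settled_45 settled_Cons[OF settled_55 settled_Cons[OF settled_62 settled_Nil]]],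
    where J = "[6]" and E = "[]" and cs = "[
    ([2,6,6],[],Lemma 0 [4,6,1,2,3,5]),
    ([3,6,6],[],Lemma 1 [1,6,2,4,5,3]),
    ([6,6,6],[],Lemma 2 [2,1,3,6,5,4]),
    ([5,6,6],[],Lemma 1 [1,6,2,4,3,5]),
    ([4,6,6],[],Lemma 0 [1,6,2,4,3,5]),
    ([1,6,6],[],Simple [K [3], K [5], K [1,4,2,6]])]"]) code_simp

lemma settled_64: "settled [[1,1,4],[2,2,6],[3,3,3],[5,5,5]]"
  by (rule settled_case[OF settled_Cons[OF settled_45 settled_Cons[OF settled_55 settled_Cons[OF settled_62 settled_Cons[OF settled_63 settled_Nil]]]],
    where J = "[4]" and E = "[]" and cs = "[
    ([4,4,6],[],Lemma 0 [2,4,1,6,3,5]),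
    ([4,4,5],[],Lemma 1 [2,4,1,6,3,5]),
    ([3,4,4],[],Lemma 1 [2,4,1,6,5,3]),
    ([4,4,4],[],Lemma 2 [1,2,3,4,5,6]),
    ([1,4,4],[([4,4,4],[[1,4,4],[1,4,4]],[[1,1,4]])],Literal [4,4,4]),
    ([2,4,4],[],Lemma 3 [1,2,3,4,5,6])]"]) code_simp

lemma settled_65: "settled [[1,1,4],[2,2,6],[3,3,3]]"
  by (rule settled_case[OF settled_Cons[OF settled_45 settled_Cons[OF settled_55 settled_Cons[OF settled_61 settled_Cons[OF settled_64 settled_Nil]]]],
    where J = "[5]" and E = "[]" and cs = "[
    ([4,5,5],[],Lemma 0 [1,5,2,4,3,6]),
    ([2,5,5],[],Lemma 1 [1,2,5,4,3,6]),
    ([5,5,6],[],Lemma 0 [2,5,1,6,3,4]),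
    ([3,5,5],[],Lemma 2 [1,2,5,4,3,6]),
    ([1,5,5],[],Lemma 1 [2,1,5,6,3,4]),
    ([5,5,5],[],Lemma 3 [1,2,3,4,5,6])]"]) code_simp

lemma settled_66: "settled [[1,1,4],[2,2,6]]"
  by (rule settled_case[OF settled_Cons[OF settled_45 settled_Cons[OF settled_55 settled_Cons[OF settled_61 settled_Cons[OF settled_65 settled_Nil]]]],
    where J = "[3]" and E = "[]" and cs = "[
    ([3,3,4],[],Lemma 0 [1,3,2,4,5,6]),
    ([3,3,6],[],Lemma 0 [2,3,1,6,4,5]),
    ([2,3,3],[],Lemma 1 [1,2,3,4,5,6]),
    ([3,3,5],[],Lemma 2 [1,2,3,4,5,6]),
    ([1,3,3],[],Lemma 1 [2,1,3,6,5,4]),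
    ([3,3,3],[],Lemma 3 [1,2,3,4,5,6])]"]) code_simp

lemma settled_67: "settled [[1,1,4],[1,2,2],[3,3,3],[5,5,5],[6,6,6]]"
  by (rule settled_case[OF settled_Cons[OF settled_45 settled_Cons[OF settled_66 settled_Nil]],
    where J = "[4]" and E = "[]" and cs = "[
    ([1,4,4],[],Lemma 0 [2,4,3,1,5,6]),
    ([3,4,4],[],Lemma 1 [2,4,5,1,6,3]),
    ([4,4,6],[],Lemma 1 [2,4,3,1,5,6]),
    ([4,4,5],[],Lemma 1 [2,4,3,1,6,5]),
    ([2,4,4],[],Simple [K [3], K [5], K [6], K [1,4,2]]),
    ([4,4,4],[],Simple [T [2,1,4], K [3], K [5], K [6]])]"]) code_simp

lemma settled_68: "settled [[1,1,4],[1,2,2],[3,3,3],[5,5,5]]"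
  by (rule settled_case[OF settled_Cons[OF settled_45 settled_Cons[OF settled_66 settled_Cons[OF settled_67 settled_Nil]]],
    where J = "[6]" and E = "[]" and cs = "[
    ([4,6,6],[],Lemma 0 [1,6,2,4,3,5]),
    ([1,6,6],[],Lemma 0 [2,6,3,1,4,5]),
    ([2,6,6],[],Lemma 1 [1,6,3,4,5,2]),
    ([5,6,6],[],Lemma 1 [1,6,2,4,3,5]),
    ([3,6,6],[],Lemma 1 [1,6,2,4,5,3]),
    ([6,6,6],[],Lemma 2 [1,2,3,4,5,6])]"]) code_simp

lemma settled_69: "settled [[1,1,4],[1,2,2],[3,3,3]]"
  by (rule settled_case[OF settled_Cons[OF settled_45 settled_Cons[OF settled_66 settled_Cons[OF settled_68 settled_Nil]]],
    where J = "[5]" and E = "[]" and cs = "[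
    ([1,5,5],[],Lemma 0 [2,5,3,1,4,6]),
    ([5,5,6],[],Lemma 1 [1,5,2,4,3,6]),
    ([3,5,5],[],Lemma 1 [1,5,2,4,6,3]),
    ([4,5,5],[],Lemma 0 [1,5,2,4,3,6]),
    ([2,5,5],[],Lemma 1 [1,5,3,4,6,2]),
    ([5,5,5],[],Lemma 2 [1,2,3,4,5,6])]"]) code_simp

lemma settled_70: "settled [[1,1,4],[1,2,2]]"
  by (rule settled_case[OF settled_Cons[OF settled_66 settled_Cons[OF settled_45 settled_Cons[OF settled_69 settled_Nil]]],
    where J = "[3]" and E = "[]" and cs = "[
    ([3,3,6],[],Lemma 0 [1,3,2,4,5,6]),
    ([3,3,5],[],Lemma 0 [1,3,2,4,6,5]),
    ([3,3,4],[],Lemma 1 [1,3,2,4,5,6]),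
    ([1,3,3],[],Lemma 1 [2,3,4,1,5,6]),
    ([2,3,3],[],Lemma 0 [1,3,5,4,6,2]),
    ([3,3,3],[],Lemma 2 [1,2,3,4,5,6])]"]) code_simp

lemma settled_71: "settled [[1,1,4],[2,2,2],[3,3,3],[5,5,5],[6,6,6]]"
  by (rule settled_case[OF settled_Cons[OF settled_70 settled_Nil],
    where J = "[4]" and E = "[]" and cs = "[
    ([3,4,4],[],Lemma 0 [4,1,2,3,5,6]),
    ([4,4,6],[],Lemma 0 [4,1,2,6,3,5]),
    ([2,4,4],[],Lemma 0 [4,1,3,2,5,6]),
    ([4,4,5],[],Lemma 0 [4,1,2,5,3,6]),
    ([1,4,4],[],Simple [K [2], K [3], K [5], K [6], K [1,4]]),
    ([4,4,4],[],Simple [T [1,4], K [2], K [3], K [5], K [6]])]"]) code_simp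

lemma settled_72: "settled [[1,1,4],[2,2,2],[3,3,3],[5,5,5]]"
  by (rule settled_case[OF settled_Cons[OF settled_66 settled_Cons[OF settled_70 settled_Cons[OF settled_45 settled_Cons[OF settled_71 settled_Nil]]]],
    where J = "[6]" and E = "[]" and cs = "[
    ([5,6,6],[],Lemma 0 [1,6,2,4,3,5]),
    ([1,6,6],[],Lemma 1 [1,6,2,4,3,5]),
    ([4,6,6],[],Lemma 2 [1,6,2,4,3,5]),
    ([3,6,6],[],Lemma 0 [1,6,2,4,5,3]),
    ([2,6,6],[],Lemma 0 [1,6,3,4,5,2]),
    ([6,6,6],[],Lemma 3 [1,2,3,4,5,6])]"]) code_simp

lemma settled_73: "settled [[1,1,4],[2,2,2],[3,3,3]]"
  by (rule settled_case[OF settled_Cons[OF settled_45 settled_Cons[OF settled_66 settled_Cons[OF settled_70 settled_Cons[OF settled_72 settled_Nil]]]],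
    where J = "[5]" and E = "[]" and cs = "[
    ([4,5,5],[],Lemma 0 [1,5,2,4,3,6]),
    ([3,5,5],[],Lemma 1 [1,5,2,4,6,3]),
    ([5,5,6],[],Lemma 1 [1,5,2,4,3,6]),
    ([1,5,5],[],Lemma 2 [1,5,2,4,3,6]),
    ([2,5,5],[],Lemma 1 [1,5,3,4,6,2]),
    ([5,5,5],[],Lemma 3 [1,2,3,4,5,6])]"]) code_simp

lemma settled_74: "settled [[1,1,4],[2,2,2]]"
  by (rule settled_case[OF settled_Cons[OF settled_66 settled_Cons[OF settled_70 settled_Cons[OF settled_45 settled_Cons[OF settled_73 settled_Nil]]]],
    where J = "[3]" and E = "[]" and cs = "[
    ([3,3,5],[],Lemma 0 [1,3,2,4,6,5]),
    ([2,3,3],[],Lemma 0 [1,3,5,4,6,2]),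
    ([1,3,3],[],Lemma 1 [1,3,2,4,5,6]),
    ([3,3,4],[],Lemma 2 [1,3,2,4,5,6]),
    ([3,3,6],[],Lemma 0 [1,3,2,4,5,6]),
    ([3,3,3],[],Lemma 3 [1,2,3,4,5,6])]"]) code_simp

text \<open>The square of a second variable shares the cofactor 4, has a cofactor of its own, leads
  into 1, or completes to a cube; these are the four cores cited.\<close>

lemma settled_75: "settled [[1,1,4]]"
  by (rule settled_case[OF settled_Cons[OF settled_45 settled_Cons[OF settled_66 settled_Cons[OF settled_70 settled_Cons[OF settled_74 settled_Nil]]]],
    where J = "[2]" and E = "[]" and cs = "[
    ([2,2,4],[],Lemma 0 [1,2,3,4,5,6]),
    ([2,2,6],[],Lemma 1 [1,2,3,4,5,6]),
    ([1,2,2],[],Lemma 2 [1,2,3,4,5,6]),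
    ([2,2,5],[],Lemma 1 [1,2,3,4,6,5]),
    ([2,2,3],[],Lemma 1 [1,2,5,4,6,3]),
    ([2,2,2],[],Lemma 3 [1,2,3,4,5,6])]"]) code_simp

lemma settled_76: "settled [[1,1,1],[2,2,2],[3,3,3],[4,4,4],[5,5,5]]"
  by (rule settled_case[OF settled_Cons[OF settled_75 settled_Nil],
    where J = "[6]" and E = "[]" and cs = "[
    ([3,6,6],[],Lemma 0 [6,1,2,3,4,5]),
    ([1,6,6],[],Lemma 0 [6,2,3,1,4,5]),
    ([5,6,6],[],Lemma 0 [6,1,2,5,3,4]),
    ([4,6,6],[],Lemma 0 [6,1,2,4,3,5]),
    ([2,6,6],[],Lemma 0 [6,1,3,2,4,5]),
    ([6,6,6],[],Simple [K [1], K [2], K [3], K [4], K [5], K [6]])]"]) code_simp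

lemma settled_77: "settled [[1,1,1],[2,2,2],[3,3,3],[4,4,4]]"
  by (rule settled_case[OF settled_Cons[OF settled_75 settled_Cons[OF settled_76 settled_Nil]],
    where J = "[5]" and E = "[]" and cs = "[
    ([5,5,6],[],Lemma 0 [5,1,2,6,3,4]),
    ([1,5,5],[],Lemma 0 [5,2,3,1,4,6]),
    ([3,5,5],[],Lemma 0 [5,1,2,3,4,6]),
    ([2,5,5],[],Lemma 0 [5,1,3,2,4,6]),
    ([4,5,5],[],Lemma 0 [5,1,2,4,3,6]),
    ([5,5,5],[],Lemma 1 [1,2,3,4,5,6])]"]) code_simp

lemma settled_78: "settled [[1,1,1],[2,2,2],[3,3,3]]"
  by (rule settled_case[OF settled_Cons[OF settled_75 settled_Cons[OF settled_77 settled_Nil]],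
    where J = "[4]" and E = "[]" and cs = "[
    ([4,4,5],[],Lemma 0 [4,1,2,5,3,6]),
    ([2,4,4],[],Lemma 0 [4,1,3,2,5,6]),
    ([1,4,4],[],Lemma 0 [4,2,3,1,5,6]),
    ([4,4,6],[],Lemma 0 [4,1,2,6,3,5]),
    ([3,4,4],[],Lemma 0 [4,1,2,3,5,6]),
    ([4,4,4],[],Lemma 1 [1,2,3,4,5,6])]"]) code_simp

lemma settled_79: "settled [[1,1,1],[2,2,2]]"
  by (rule settled_case[OF settled_Cons[OF settled_75 settled_Cons[OF settled_78 settled_Nil]],
    where J = "[3]" and E = "[]" and cs = "[
    ([3,3,5],[],Lemma 0 [3,1,2,5,4,6]),
    ([2,3,3],[],Lemma 0 [3,1,4,2,5,6]),
    ([1,3,3],[],Lemma 0 [3,2,4,1,5,6]),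
    ([3,3,4],[],Lemma 0 [3,1,2,4,5,6]),
    ([3,3,6],[],Lemma 0 [3,1,2,6,4,5]),
    ([3,3,3],[],Lemma 1 [1,2,3,4,5,6])]"]) code_simp

lemma settled_80: "settled [[1,1,1]]"
  by (rule settled_case[OF settled_Cons[OF settled_75 settled_Cons[OF settled_79 settled_Nil]],
    where J = "[2]" and E = "[]" and cs = "[
    ([2,2,3],[],Lemma 0 [2,1,4,3,5,6]),
    ([2,2,6],[],Lemma 0 [2,1,3,6,4,5]),
    ([2,2,5],[],Lemma 0 [2,1,3,5,4,6]),
    ([1,2,2],[],Lemma 0 [2,3,4,1,5,6]),
    ([2,2,4],[],Lemma 0 [2,1,3,4,5,6]),
    ([2,2,2],[],Lemma 1 [1,2,3,4,5,6])]"]) code_simp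

text \<open>The root of the search: smoothness at one coordinate point gives x_1^2 x_k, and up to
  renaming k is 1 or 4.\<close>

lemma settled_81: "settled []"
  by (rule settled_case[OF settled_Cons[OF settled_75 settled_Cons[OF settled_80 settled_Nil]],
    where J = "[1]" and E = "[]" and cs = "[
    ([1,1,4],[],Lemma 0 [1,2,3,4,5,6]),
    ([1,1,3],[],Lemma 0 [1,2,4,3,5,6]),
    ([1,1,5],[],Lemma 0 [1,2,3,5,4,6]),
    ([1,1,1],[],Lemma 1 [1,2,3,4,5,6]),
    ([1,1,2],[],Lemma 0 [1,3,4,2,5,6]),
    ([1,1,6],[],Lemma 0 [1,2,3,6,4,5])]"]) code_simp

lemma conclusion:
  assumes "CARD('n) = 6"
  shows Q
proof -
  have "\<exists>\<sigma>. bij_betw \<sigma> {1..6 :: nat} (UNIV :: 'n set)"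
    using assms by (intro finite_same_card_bij) simp_all
  with settled_81 show Q
    by (auto simp: settled_def holds_def)
qed

end

section \<open>Smoothness of simple polynomials\<close>

text \<open>The Leibniz rule once more, now for numbered variables and a point given as a function;
  lists of any other length get the value 0.\<close>

fun dmono :: "('a \<Rightarrow> complex) \<Rightarrow> 'a \<Rightarrow> 'a list \<Rightarrow> complex" where
  "dmono y i [a, b, c] = (if a = i then y b * y c else 0) + (if b = i then y a * y c else 0)
     + (if c = i then y a * y b else 0)"
| "dmono y i _ = 0"

text \<open>The equations satisfied by a singular point along a chain: \<open>p\<close> is the value of the variable in
  front of the chain, and \<open>q\<close> collects the terms that the rest of the polynomial contributes to the
  derivative by the last variable.\<close>

fun chain_eqs :: "('a \<Rightarrow> complex) \<Rightarrow> complex \<Rightarrow> complex \<Rightarrow> 'a list \<Rightarrow> bool" where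
  "chain_eqs y p q [] \<longleftrightarrow> True"
| "chain_eqs y p q [v] \<longleftrightarrow> q + p\<^sup>2 = 0"
| "chain_eqs y p q (v # w # vs) \<longleftrightarrow> 2 * y v * y w + p\<^sup>2 = 0 \<and> chain_eqs y (y v) q (w # vs)"

lemma links_simps [simp]:
  "links [] ys = []" "links xs [] = []" "links (x # xs) (y # ys) = [x, x, y] # links xs ys"
  by (simp_all add: links_def)

lemma set_links: "t \<in> set (links xs ys) \<Longrightarrow> \<exists>a\<in>set xs. \<exists>b\<in>set ys. t = [a, a, b]"
  unfolding links_def using set_zip_leftD set_zip_rightD by fastforce

lemma links_append_last:
  "xs \<noteq> [] \<Longrightarrow> links xs (tl xs @ [z]) = links xs (tl xs) @ [[last xs, last xs, z]]"
  by (induction xs rule: induct_list012) auto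

lemma dmono_not_in: "i \<notin> set t \<Longrightarrow> dmono y i t = 0"
  by (induction y i t rule: dmono.induct) auto

lemma sum_list_neutral: "(\<And>x. x \<in> set xs \<Longrightarrow> f x = 0) \<Longrightarrow> (\<Sum>x\<leftarrow>xs. f x) = (0 :: 'b::comm_monoid_add)"
  by (induction xs) auto

lemma dmono_links_not_in: "i \<notin> set xs \<Longrightarrow> i \<notin> set ys \<Longrightarrow> (\<Sum>t\<leftarrow>links xs ys. dmono y i t) = 0"
  using set_links[of _ xs ys] by (intro sum_list_neutral dmono_not_in) fastforce

lemma set_butlast_last: "xs \<noteq> [] \<Longrightarrow> set xs = insert (last xs) (set (butlast xs))"
  by (induction xs rule: rev_induct) auto

text \<open>A variable w inside the chain occurs in x_v^2 x_w, with v its predecessor, and in the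
  square it starts itself. These are the two terms of an equation of \<open>chain_eqs\<close>; the
  end variable collects \<open>q\<close> instead.\<close>

lemma chain_eqsI:
  assumes "distinct xs"
    "\<And>i. i \<in> set xs \<Longrightarrow> (if i = hd xs then p\<^sup>2 else 0) + (\<Sum>t\<leftarrow>links xs (tl xs). dmono y i t)
        + (if i = last xs then q else 0) = 0"
  shows "chain_eqs y p q xs"
  using assms
proof (induction y p q xs rule: chain_eqs.induct)
  case (2 y p q v)
  then show ?case by (simp add: add.commute)
next
  case (3 y p q v w vs)
  have "v \<noteq> last (w # vs)"
    using 3(2) by (metis distinct.simps(2) last_in_set list.distinct(1))
  have out: "(\<Sum>t\<leftarrow>links (w # vs) vs. dmono y v t) = 0"
    using 3(2) by (intro dmono_links_not_in) auto
  have "2 * y v * y w + p\<^sup>2 = 0"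
    using 3(3)[of v] out \<open>v \<noteq> last (w # vs)\<close> 3(2) by (auto simp: algebra_simps split: if_splits)
  moreover have "chain_eqs y (y v) q (w # vs)"
  proof (rule 3(1))
    fix i assume i: "i \<in> set (w # vs)"
    with 3(2) have "i \<noteq> v" by auto
    with 3(3)[of i] i show
      "(if i = hd (w # vs) then (y v)\<^sup>2 else 0) + (\<Sum>t\<leftarrow>links (w # vs) (tl (w # vs)). dmono y i t)
        + (if i = last (w # vs) then q else 0) = 0"
      by (auto simp: power2_eq_square)
  qed (use 3(2) in simp)
  ultimately show ?case by simp
qed simp

text \<open>Behind a nonzero value the next value is 0, and the following equation would read (y
  v)^2 = 0 unless the chain ends there. So the zeros spread from the front, and only at the last
  variable can \<open>q\<close> compensate a nonzero square.\<close>

lemma chain_eqs_forward: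
  assumes "chain_eqs y 0 q xs" "xs \<noteq> []"
  shows "(\<forall>v\<in>set (butlast xs). y v = 0) \<and> q = 0 \<or> y (last xs) = 0 \<and> q \<noteq> 0"
  using assms
proof (induction xs rule: induct_list012)
  case (3 v w vs)
  then have vw: "y v = 0 \<or> y w = 0" and rest: "chain_eqs y (y v) q (w # vs)" by auto
  show ?case
  proof (cases "y v = 0")
    case True
    with 3 show ?thesis by auto
  next
    case False
    with vw have "y w = 0" by simp
    with rest False have "vs = []" by (cases vs) auto
    with rest \<open>y w = 0\<close> False show ?thesis by (auto simp: add_eq_0_iff)
  qed
qed auto

text \<open>A zero at v kills the product in the equation at v and hence the value in front of v; so
  zeros travel to the beginning. The last hypothesis covers the end of the chain, where
  \<open>q\<close> replaces the product.\<close>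

lemma chain_eqs_backward:
  assumes "chain_eqs y p q xs" "v \<in> set xs" "y v = 0" "y (last xs) = 0 \<longrightarrow> q = 0"
  shows "p = 0"
  using assms
proof (induction y p q xs rule: chain_eqs.induct)
  case (3 y p q v' w vs)
  have "y v' = 0 \<or> y v' \<noteq> 0 \<and> v \<in> set (w # vs)"
    using 3 by auto
  then have "y v' = 0"
    using 3 by auto
  then show ?case using 3(2) by simp
qed auto

text \<open>The product of all equations of the chain, written as p^2 = -2 y_v y_w and, at its end,
  p^2 = -q.\<close>

lemma chain_eqs_prod:
  assumes "chain_eqs y p q xs" "xs \<noteq> []"
  shows "p\<^sup>2 * prod_list (map y (butlast xs)) ^ 2
    = (-2) ^ (length xs - 1) * prod_list (map y (butlast xs)) * prod_list (map y (tl xs)) * (- q)"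
  using assms
proof (induction y p q xs rule: chain_eqs.induct)
  case (2 y p q v)
  then show ?case by (simp add: add_eq_0_iff2)
next
  case (3 y p q v w vs)
  let ?B = "prod_list (map y (butlast (w # vs)))" and ?T = "prod_list (map y vs)"
  have IH: "(y v)\<^sup>2 * ?B\<^sup>2 = (-2) ^ length vs * ?B * ?T * (- q)"
    using 3 by simp
  have p: "p\<^sup>2 = (-2) * (y v * y w)"
    using 3(2) unfolding chain_eqs.simps by algebra
  have "p\<^sup>2 * (y v * ?B)\<^sup>2 = (-2) * (y v * y w) * ((y v)\<^sup>2 * ?B\<^sup>2)"
    by (simp only: p power_mult_distrib)
  also have "\<dots> = (-2) ^ Suc (length vs) * (y v * ?B) * (y w * ?T) * (- q)"
    by (simp only: IH) simp
  finally show ?case by simp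
qed simp

text \<open>A cycle is a chain whose end feeds its beginning. One zero forces all values to vanish.
  Without zeros, the product \<open>P\<close> of the values satisfies
  \<open>P * P = (-2) ^ length xs * (P * P)\<close>, which absolute values exclude.\<close>

lemma cycle_singular_point:
  assumes "distinct xs" "xs \<noteq> []"
    "\<And>i. i \<in> set xs \<Longrightarrow> (\<Sum>t\<leftarrow>links xs (tl xs @ [hd xs]). dmono y i t) = 0"
  shows "\<forall>v\<in>set xs. y v = 0"
proof -
  let ?l = "last xs" and ?h = "hd xs"
  \<comment> \<open>The closing monomial contributes the square of \<open>y ?l\<close> at the head
    and 2 \<open>y ?l\<close> \<open>y ?h\<close> at the last variable. For a single variable both
    terms meet and give three times the square.\<close>
  have chain: "chain_eqs y (y ?l) (2 * y ?l * y ?h) xs"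
    using assms by (intro chain_eqsI) (fastforce simp: links_append_last power2_eq_square algebra_simps)+
  show ?thesis
  proof (cases "\<exists>v\<in>set xs. y v = 0")
    case True
    then have "y ?l = 0"
      using chain_eqs_backward[OF chain] by auto
    with chain chain_eqs_forward[of y "2 * y ?l * y ?h" xs] assms(2)
    have "\<forall>v\<in>set (butlast xs). y v = 0" by auto
    with \<open>y ?l = 0\<close> assms(2) show ?thesis
      by (simp add: set_butlast_last)
  next
    case False
    define B T P where "B = prod_list (map y (butlast xs))" "T = prod_list (map y (tl xs))"
      "P = prod_list (map y xs)"
    have "P = B * y ?l"
      using assms(2) unfolding B_T_P_def by (cases xs rule: rev_cases) auto
    have "P = y ?h * T"
      using assms(2) unfolding B_T_P_def by (cases xs) auto
    have "(y ?l)\<^sup>2 * B\<^sup>2 = (-2) ^ (length xs - 1) * B * T * (- (2 * y ?l * y ?h))"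
      unfolding B_T_P_def by (rule chain_eqs_prod[OF chain assms(2)])
    also have "\<dots> = (-2) ^ (length xs - 1) * (-2) * (B * y ?l) * (y ?h * T)"
      by (simp add: algebra_simps)
    also have "\<dots> = (-2) ^ length xs * P * P"
      using assms(2) \<open>P = B * y ?l\<close> \<open>P = y ?h * T\<close> by (cases xs) auto
    finally have "P * P = (-2) ^ length xs * (P * P)"
      using \<open>P = B * y ?l\<close> by (simp add: power2_eq_square algebra_simps)
    moreover have "P \<noteq> 0"
      using False unfolding B_T_P_def by (auto simp: prod_list_zero_iff)
    ultimately have "(-2 :: complex) ^ length xs = 1" by simp
    then have "norm ((-2 :: complex) ^ length xs) = 1" by simp
    then have "(2 :: real) ^ length xs = 1" by (simp add: norm_power)
    moreover have "(1 :: real) < 2 ^ length xs" using assms(2) by (intro one_less_power) auto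
    ultimately show ?thesis by simp
  qed
qed

lemma tail_singular_point:
  assumes "distinct xs" "xs \<noteq> []"
    "\<And>i. i \<in> set xs \<Longrightarrow> (\<Sum>t\<leftarrow>links xs (tl xs @ [last xs]). dmono y i t) = 0"
  shows "\<forall>v\<in>set xs. y v = 0"
proof -
  let ?l = "last xs"
  \<comment> \<open>The cube contributes three times the square of \<open>y ?l\<close>, so the
    alternative with \<open>y ?l = 0\<close> and a nonzero \<open>q\<close> cannot occur.\<close>
  have "chain_eqs y 0 (3 * (y ?l)\<^sup>2) xs"
    using assms by (intro chain_eqsI) (fastforce simp: links_append_last power2_eq_square algebra_simps)+
  from chain_eqs_forward[OF this assms(2)]
  have "\<forall>v\<in>set (butlast xs). y v = 0" "y ?l = 0" by auto
  with assms(2) show ?thesis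
    by (simp add: set_butlast_last)
qed

text \<open>These are the derivatives of a Y by the two arm ends a, b and by z, w. The first two are
  linear in (a, b) with determinant 4 z^2 - w^2. For w = 2 z or w = -2 z they give a = -b or a = b
  unless z = 0, and the other two leave 30 z^2 = 0.\<close>

lemma y_core:
  fixes a b z w :: complex
  assumes "2 * a * z + b * w = 0" "2 * b * z + a * w = 0" "a\<^sup>2 + b\<^sup>2 + 2 * z * w = 0"
    "z\<^sup>2 + 3 * w\<^sup>2 + a * b = 0"
  shows "a = 0 \<and> b = 0 \<and> z = 0 \<and> w = 0"
proof -
  have "(4 * z\<^sup>2 - w\<^sup>2) * a = 0" "(4 * z\<^sup>2 - w\<^sup>2) * b = 0"
    using assms(1,2) by algebra+
  then consider "a = 0" "b = 0" | "4 * z\<^sup>2 = w\<^sup>2" by auto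
  then show ?thesis
  proof cases
    case 1
    with assms(3,4) have "z * w = 0" "z\<^sup>2 + 3 * w\<^sup>2 = 0" by auto
    with 1 show ?thesis by auto
  next
    case 2
    have "z = 0 \<and> w = 0"
    proof (rule ccontr)
      assume "\<not> ?thesis"
      with 2 have "z \<noteq> 0" "w \<noteq> 0" by auto
      from 2 have "(w - 2 * z) * (w + 2 * z) = 0" by algebra
      then consider "w = 2 * z" | "w = - 2 * z" by (auto simp: eq_neg_iff_add_eq_0)
      then show False
      proof cases
        case 1
        with assms(1) have "2 * z * (a + b) = 0" by algebra
        with \<open>z \<noteq> 0\<close> have "a = - b" by (simp add: eq_neg_iff_add_eq_0)
        with 1 assms(3,4) have "z\<^sup>2 * 30 = 0" by algebra
        with \<open>z \<noteq> 0\<close> show False by simp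
      next
        case 2
        with assms(1) have "2 * z * (a - b) = 0" by algebra
        with \<open>z \<noteq> 0\<close> have "a = b" by simp
        with 2 assms(3,4) have "z\<^sup>2 * 30 = 0" by algebra
        with \<open>z \<noteq> 0\<close> show False by simp
      qed
    qed
    with assms(3,4) have "a\<^sup>2 + b\<^sup>2 = 0" "a * b = 0" by auto
    with \<open>z = 0 \<and> w = 0\<close> show ?thesis by auto
  qed
qed

lemma y_singular_point:
  assumes "distinct (xs @ ys @ [z, w])" "xs \<noteq> []" "ys \<noteq> []"
    "\<And>i. i \<in> set (xs @ ys @ [z, w]) \<Longrightarrow> (\<Sum>t\<leftarrow>block_monos (Y xs ys z w). dmono y i t) = 0"
  shows "\<forall>v\<in>set (xs @ ys @ [z, w]). y v = 0"
proof -
  let ?l = "last xs" and ?m = "last ys"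
  have l: "?l \<in> set xs" "?m \<in> set ys" using assms(2,3) by auto
  have tl: "i \<notin> set (tl xs)" if "i \<notin> set xs" for i and xs :: "nat list"
    using that by (cases xs) auto
  have S: "(\<Sum>t\<leftarrow>block_monos (Y xs ys z w). dmono y i t) =
      (\<Sum>t\<leftarrow>links xs (tl xs). dmono y i t) + dmono y i [?l, ?l, z] + (\<Sum>t\<leftarrow>links ys (tl ys). dmono y i t)
      + dmono y i [?m, ?m, z] + dmono y i [z, z, w] + dmono y i [w, w, w] + dmono y i [?l, ?m, w]" for i
    using assms(2,3) by (simp add: links_append_last)
  have xs0: "(\<Sum>t\<leftarrow>links xs (tl xs). dmono y i t) = 0" if "i \<notin> set xs" for i
    using that tl by (intro dmono_links_not_in)
  have ys0: "(\<Sum>t\<leftarrow>links ys (tl ys). dmono y i t) = 0" if "i \<notin> set ys" for i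
    using that tl by (intro dmono_links_not_in)
  have "chain_eqs y 0 (2 * y ?l * y z + y ?m * y w) xs"
  proof (rule chain_eqsI)
    fix i assume i: "i \<in> set xs"
    then have "i \<notin> set ys" "i \<noteq> z" "i \<noteq> w" "i \<noteq> ?m" using assms(1) l by auto
    with assms(4)[of i] i ys0[of i] show "(if i = hd xs then 0\<^sup>2 else 0) + (\<Sum>t\<leftarrow>links xs (tl xs). dmono y i t) +
         (if i = ?l then 2 * y ?l * y z + y ?m * y w else 0) = 0"
      unfolding S by (auto simp: algebra_simps)
  qed (use assms(1) in auto)
  note X = chain_eqs_forward[OF this assms(2)]
  have "chain_eqs y 0 (2 * y ?m * y z + y ?l * y w) ys"
  proof (rule chain_eqsI)
    fix i assume i: "i \<in> set ys"
    then have "i \<notin> set xs" "i \<noteq> z" "i \<noteq> w" "i \<noteq> ?l" using assms(1) l by auto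
    with assms(4)[of i] i xs0[of i] show "(if i = hd ys then 0\<^sup>2 else 0) + (\<Sum>t\<leftarrow>links ys (tl ys). dmono y i t) +
         (if i = ?m then 2 * y ?m * y z + y ?l * y w else 0) = 0"
      unfolding S by (auto simp: algebra_simps)
  qed (use assms(1) in auto)
  note Y = chain_eqs_forward[OF this assms(3)]
  have ne: "?l \<noteq> z" "?l \<noteq> w" "?m \<noteq> z" "?m \<noteq> w" "z \<noteq> w" "z \<notin> set xs" "z \<notin> set ys" "w \<notin> set xs" "w \<notin> set ys"
    using assms(1) l by auto
  have Z: "(y ?l)\<^sup>2 + (y ?m)\<^sup>2 + 2 * y z * y w = 0"
    using assms(4)[of z] ne xs0[of z] ys0[of z] unfolding S by (simp add: power2_eq_square algebra_simps)
  have W: "(y z)\<^sup>2 + 3 * (y w)\<^sup>2 + y ?l * y ?m = 0"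
    using assms(4)[of w] ne xs0[of w] ys0[of w] unfolding S by (simp add: power2_eq_square algebra_simps)
  \<comment> \<open>If one arm ended in 0 with a nonzero \<open>q\<close>, the end of the other arm
    would be nonzero; the equations of that arm then give \<open>y z = 0\<close>, and
    \<open>Z\<close> contradicts this.\<close>
  have "(\<forall>v\<in>set (butlast xs). y v = 0) \<and> (\<forall>v\<in>set (butlast ys). y v = 0) \<and>
      2 * y ?l * y z + y ?m * y w = 0 \<and> 2 * y ?m * y z + y ?l * y w = 0"
    using X Y Z by (auto simp: power2_eq_square)
  moreover from this have "y ?l = 0 \<and> y ?m = 0 \<and> y z = 0 \<and> y w = 0"
    using y_core[OF _ _ Z W] by blast
  ultimately show ?thesis
    using assms(2,3) by (simp add: set_butlast_last ball_Un)
qed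

section \<open>From blocks of numbers to polynomials\<close>

definition block_poly :: "(nat \<Rightarrow> 'n) \<Rightarrow> block \<Rightarrow> 'n mpoly" where
  "block_poly \<sigma> b = (\<Sum>t\<leftarrow>block_monos b. mono_poly (xmon (map \<sigma> t)))"

lemma block_vars_nonempty: "proper_block b \<Longrightarrow> block_vars b \<noteq> []"
  by (cases b) auto

lemma block_monos_vars:
  assumes "proper_block b" "t \<in> set (block_monos b)"
  shows "length t = 3" "set t \<subseteq> set (block_vars b)"
proof -
  have "t \<in> set (links xs (tl xs @ [v])) \<Longrightarrow> length t = 3 \<and> set t \<subseteq> insert v (set xs)" for xs v
    by (drule set_links) (auto dest: list.set_sel(2)[rotated])
  note L = this
  have "length t = 3 \<and> set t \<subseteq> set (block_vars b)"
  proof (cases b)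
    case (K xs)
    with assms L[of xs "hd xs"] show ?thesis by auto
  next
    case (T xs)
    with assms L[of xs "last xs"] show ?thesis by auto
  next
    case (Y xs ys z w)
    with assms consider "t \<in> set (links xs (tl xs @ [z]))" | "t \<in> set (links ys (tl ys @ [z]))"
      | "t \<in> {[z, z, w], [w, w, w], [last xs, last ys, w]}" by auto
    then show ?thesis
    proof cases
      case 1 then show ?thesis using L[of xs z] Y by auto
    next
      case 2 then show ?thesis using L[of ys z] Y by auto
    next
      case 3 then show ?thesis using Y assms(1) by auto
    qed
  qed
  then show "length t = 3" "set t \<subseteq> set (block_vars b)" by auto
qed

lemma eval_partial_deriv_mono_poly:
  assumes "inj_on \<sigma> A" "i \<in> A" "set t \<subseteq> A" "length t = 3"
  shows "eval_poly (partial_deriv (\<sigma> i) (mono_poly (xmon (map \<sigma> t)))) x = dmono (\<lambda>v. x $ \<sigma> v) i t"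
proof -
  obtain a b c where t: "t = [a, b, c]"
    using assms(4) by (auto simp: numeral_3_eq_3 length_Suc_conv)
  have "\<sigma> v = \<sigma> i \<longleftrightarrow> v = i" if "v \<in> {a, b, c}" for v
    using assms(1-3) that unfolding t by (auto dest: inj_onD)
  then show ?thesis
    unfolding t mono_poly_def list.map eval_partial_deriv_xmon by simp
qed

lemma eval_partial_deriv_sum_list:
  "eval_poly (partial_deriv i (\<Sum>a\<leftarrow>as. f a)) x = (\<Sum>a\<leftarrow>as. eval_poly (partial_deriv i (f a)) x)"
  by (induction as) (simp_all add: partial_deriv_add eval_poly_add)

lemma Var_square_Var: "Var a ^ 2 * Var b = mono_poly (xmon [a, a, b])"
  by (simp add: Var_def mono_poly_def mult_single xmon_Cons power2_eq_square add.assoc)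

lemma Var_Var_Var: "Var a * Var b * Var c = mono_poly (xmon [a, b, c])"
  by (simp add: Var_def mono_poly_def mult_single xmon_Cons add.assoc)

lemma sum_links:
  assumes "length ys \<le> length xs"
  shows "(\<Sum>t\<leftarrow>links xs ys. mono_poly (xmon (map \<sigma> t))) = (\<Sum>i<length ys. Var (\<sigma> (xs ! i)) ^ 2 * Var (\<sigma> (ys ! i)))"
proof -
  have "(\<Sum>t\<leftarrow>links xs ys. mono_poly (xmon (map \<sigma> t)))
      = (\<Sum>i<length (links xs ys). mono_poly (xmon (map \<sigma> (links xs ys ! i))))"
    by (simp add: sum_list_sum_nth atLeast0LessThan)
  also have "\<dots> = (\<Sum>i<length ys. Var (\<sigma> (xs ! i)) ^ 2 * Var (\<sigma> (ys ! i)))"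
    using assms by (intro sum.cong) (auto simp: links_def Var_square_Var)
  finally show ?thesis .
qed

lemma chain_sum_map:
  "chain_sum 3 (map \<sigma> xs) = (\<Sum>t\<leftarrow>links xs (tl xs). mono_poly (xmon (map \<sigma> t)))"
  unfolding chain_sum_def by (subst sum_links) (auto intro!: sum.cong simp: nth_tl)

text \<open>Matches the list of monomials of a block with the indexed sums in \<open>type_K\<close>,
  \<open>type_T\<close> and \<open>type_Y\<close>; the cyclic successor is an entry of
  \<open>rotate1 xs\<close>.\<close>

lemma block_poly_type:
  assumes "proper_block b" "distinct (block_vars b)" "inj_on \<sigma> (set (block_vars b))"
  shows "type_K 3 (block_poly \<sigma> b) (\<sigma> ` set (block_vars b)) \<or>
    type_T 3 (block_poly \<sigma> b) (\<sigma> ` set (block_vars b)) \<or> type_Y (block_poly \<sigma> b) (\<sigma> ` set (block_vars b))"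
proof (cases b)
  case (K xs)
  then have xs: "xs \<noteq> []" "distinct (map \<sigma> xs)" using assms by (auto simp: distinct_map)
  have "block_poly \<sigma> b = (\<Sum>i<length xs. Var (\<sigma> (xs ! i)) ^ 2 * Var (\<sigma> ((tl xs @ [hd xs]) ! i)))"
    unfolding block_poly_def K block_monos.simps using xs by (subst sum_links) auto
  also have "\<dots> = (\<Sum>i<length (map \<sigma> xs). Var (map \<sigma> xs ! i) ^ (3 - 1) * Var (map \<sigma> xs ! (Suc i mod length (map \<sigma> xs))))"
    using xs(1) nth_rotate1[of _ xs] by (intro sum.cong) (auto simp: rotate1_hd_tl)
  finally have "type_K 3 (block_poly \<sigma> b) (\<sigma> ` set (block_vars b))"
    unfolding type_K_def using K xs by (intro exI[of _ "map \<sigma> xs"]) auto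
  then show ?thesis by simp
next
  case (T xs)
  then have xs: "xs \<noteq> []" "distinct (map \<sigma> xs)" using assms by (auto simp: distinct_map)
  have "Var a ^ 3 = mono_poly (xmon [a, a, a])" for a :: 'a
    by (simp add: Var_Var_Var[symmetric] power3_eq_cube)
  then have "block_poly \<sigma> b = chain_sum 3 (map \<sigma> xs) + Var (last (map \<sigma> xs)) ^ 3"
    unfolding block_poly_def T block_monos.simps chain_sum_map using xs by (simp add: links_append_last last_map)
  then have "type_T 3 (block_poly \<sigma> b) (\<sigma> ` set (block_vars b))"
    unfolding type_T_def using T xs by (intro exI[of _ "map \<sigma> xs"]) auto
  then show ?thesis by simp
next
  case (Y xs ys z w)
  then have xs: "xs \<noteq> []" "ys \<noteq> []" "distinct (map \<sigma> xs @ map \<sigma> ys @ [\<sigma> z, \<sigma> w])"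
    using assms(1) distinct_map[of \<sigma> "block_vars b"] assms(2,3) by auto
  have "Var a ^ 3 = mono_poly (xmon [a, a, a])" for a :: 'a
    by (simp add: Var_Var_Var[symmetric] power3_eq_cube)
  then have "block_poly \<sigma> b = chain_sum 3 (map \<sigma> xs) + chain_sum 3 (map \<sigma> ys)
          + Var (last (map \<sigma> xs)) ^ 2 * Var (\<sigma> z) + Var (last (map \<sigma> ys)) ^ 2 * Var (\<sigma> z)
          + Var (\<sigma> z) ^ 2 * Var (\<sigma> w) + Var (\<sigma> w) ^ 3 + Var (last (map \<sigma> xs)) * Var (last (map \<sigma> ys)) * Var (\<sigma> w)"
    unfolding block_poly_def Y block_monos.simps chain_sum_map using xs
    by (simp add: links_append_last last_map Var_square_Var Var_Var_Var add_ac)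
  moreover have "set (map \<sigma> xs @ map \<sigma> ys @ [\<sigma> z, \<sigma> w]) = \<sigma> ` set (block_vars b)"
    using Y by auto
  ultimately have "type_Y (block_poly \<sigma> b) (\<sigma> ` set (block_vars b))"
    unfolding type_Y_def using xs by (metis map_is_Nil_conv)
  then show ?thesis by simp
qed

lemma block_singular_point:
  assumes "proper_block b" "distinct (block_vars b)"
    "\<And>i. i \<in> set (block_vars b) \<Longrightarrow> (\<Sum>t\<leftarrow>block_monos b. dmono y i t) = 0" "v \<in> set (block_vars b)"
  shows "y v = 0"
proof (cases b)
  case (K xs)
  then show ?thesis using cycle_singular_point[of xs y] assms by simp
next
  case (T xs)
  then show ?thesis using tail_singular_point[of xs y] assms by simp
next
  case (Y xs ys z w)
  then show ?thesis
    using y_singular_point[of xs ys z w y] assms unfolding Y block_vars.simps proper_block.simps by blast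
qed

text \<open>A monomial determines the multiset of its variables, and an injective naming can be
  undone.\<close>

lemma xmon_map_inj:
  assumes "inj_on \<sigma> A" "set t \<subseteq> A" "set u \<subseteq> A" "xmon (map \<sigma> t) = xmon (map \<sigma> u)"
  shows "sort t = sort u"
proof -
  have "count (mset (map \<sigma> t)) i = count (mset (map \<sigma> u)) i" for i
    using arg_cong[OF assms(4), of "\<lambda>m. Poly_Mapping.lookup m i"] by (simp only: lookup_xmon count_mset)
  then have "mset (map \<sigma> t) = mset (map \<sigma> u)"
    by (rule multiset_eqI)
  then have "mset (map (inv_into A \<sigma>) (map \<sigma> t)) = mset (map (inv_into A \<sigma>) (map \<sigma> u))"
    by (simp only: mset_map)
  moreover have inv: "map (inv_into A \<sigma>) (map \<sigma> s) = s" if "set s \<subseteq> A" for s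
    using that assms(1) by (auto intro!: map_idI simp: subset_eq)
  ultimately have "mset t = mset u"
    by (simp only: inv[OF assms(2)] inv[OF assms(3)])
  then show ?thesis
    by (metis mset_sort properties_for_sort sorted_sort)
qed

text \<open>Blocks have disjoint variables, so the equations of a singular point split into those of
  the single blocks. The rest reconciles a sum over a list of blocks with the sum over a partition
  in \<open>simple_cubic\<close>.\<close>

lemma simple_monomials_blocks:
  fixes S :: "'n::finite monomial set" and \<sigma> :: "nat \<Rightarrow> 'n"
  assumes \<sigma>: "bij_betw \<sigma> {1..6} UNIV" and bs: "simple_blocks bs"
    and S: "\<forall>t\<in>set (concat (map block_monos bs)). xmon (map \<sigma> t) \<in> S"
  shows "simple_monomials S"
proof -
  define ts where "ts = concat (map block_monos bs)"
  define A where "A = set (map (\<lambda>t. xmon (map \<sigma> t)) ts)"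
  define f where "f = (\<Sum>m\<in>A. mono_poly m)"
  have proper: "proper_block b" if "b \<in> set bs" for b
    using bs that by (simp add: simple_blocks_def list_all_iff)
  have ms: "mset (concat (map block_vars bs)) = mset [1, 2, 3, 4, 5, 6]"
    using bs unfolding simple_blocks_def by (metis mset_sort)
  have vars: "distinct (concat (map block_vars bs))" "set (concat (map block_vars bs)) = {1..6}"
    using mset_eq_imp_distinct_iff[OF ms] unfolding mset_eq_setD[OF ms] by auto
  have inj: "inj_on \<sigma> {1..6}" and im: "\<sigma> ` {1..6} = UNIV"
    using \<sigma> by (auto simp: bij_betw_def)
  have bvars: "set (block_vars b) \<subseteq> {1..6}" "distinct (block_vars b)" if "b \<in> set bs" for b
    using vars that by (auto simp: distinct_concat_iff)
  have ts: "length t = 3" "set t \<subseteq> {1..6}" if "t \<in> set ts" for t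
    using that block_monos_vars[OF proper] bvars(1) unfolding ts_def by fastforce+
  \<comment> \<open>Needed because \<open>f\<close> is a sum over the set \<open>A\<close>, which
    would merge equal monomials.\<close>
  have "distinct (map (\<lambda>t. xmon (map \<sigma> t)) ts)"
    unfolding distinct_map
  proof
    have "distinct (map sort ts)"
      using bs by (simp add: simple_blocks_def ts_def)
    then have "distinct ts" and sort: "inj_on sort (set ts)"
      by (simp_all add: distinct_map)
    then show "distinct ts" by simp
    show "inj_on (\<lambda>t. xmon (map \<sigma> t)) (set ts)"
    proof (rule inj_onI)
      fix t u assume "t \<in> set ts" "u \<in> set ts" "xmon (map \<sigma> t) = xmon (map \<sigma> u)"
      then show "t = u"
        using xmon_map_inj[OF inj ts(2) ts(2)] inj_onD[OF sort] by blast
    qed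
  qed
  then have f: "f = (\<Sum>t\<leftarrow>ts. mono_poly (xmon (map \<sigma> t)))"
    unfolding f_def A_def by (subst sum_list_distinct_conv_sum_set[symmetric]) (simp_all add: o_def)
  have hom: "homogeneous 3 f"
    unfolding f_def A_def mono_poly_def using ts(1) by (intro homogeneous_sum homogeneous_single) auto
  have "smooth f"
    unfolding smooth_cubic_iff[OF hom]
  proof (intro allI impI)
    fix x assume x: "\<forall>i. eval_poly (partial_deriv i f) x = 0"
    define y where "y = (\<lambda>v. x $ \<sigma> v)"
    have y0: "(\<Sum>t\<leftarrow>ts. dmono y i t) = 0" if "i \<in> {1..6}" for i
    proof -
      have "(\<Sum>t\<leftarrow>ts. dmono y i t) = (\<Sum>t\<leftarrow>ts. eval_poly (partial_deriv (\<sigma> i) (mono_poly (xmon (map \<sigma> t)))) x)"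
        using eval_partial_deriv_mono_poly[OF inj that ts(2,1)] unfolding y_def
        by (intro arg_cong[where f = sum_list] map_cong) auto
      also have "\<dots> = 0"
        using x by (simp add: f flip: eval_partial_deriv_sum_list)
      finally show ?thesis .
    qed
    have "y v = 0" if v: "v \<in> {1..6}" for v
    proof -
      obtain b where b: "b \<in> set bs" "v \<in> set (block_vars b)"
        using v unfolding vars(2)[symmetric] by auto
      obtain bs1 bs2 where split: "bs = bs1 @ b # bs2"
        using split_list[OF b(1)] by auto
      show ?thesis
      proof (rule block_singular_point[OF proper[OF b(1)] bvars(2)[OF b(1)] _ b(2)])
        fix i assume i: "i \<in> set (block_vars b)"
        have "dmono y i t = 0" if "t \<in> set (block_monos b')" "b' \<in> set bs1 \<union> set bs2" for t b'
        proof (rule dmono_not_in)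
          have "i \<notin> set (block_vars b')"
            using vars(1) that(2) i unfolding split by auto
          then show "i \<notin> set t"
            using block_monos_vars(2)[OF proper that(1)] that(2) split by auto
        qed
        then have "sum_list (map (dmono y i) (concat (map block_monos bs1))) = 0"
          "sum_list (map (dmono y i) (concat (map block_monos bs2))) = 0"
          by (auto intro!: sum_list_neutral)
        then show "(\<Sum>t\<leftarrow>block_monos b. dmono y i t) = 0"
          using y0[of i] i bvars(1)[OF b(1)] unfolding ts_def split by auto
      qed
    qed
    then have "x $ j = 0" for j
      using im unfolding y_def by (metis (mono_tags) UNIV_I imageE)
    then show "x = 0" by (simp add: vec_eq_iff)
  qed
  \<comment> \<open>\<open>simple_cubic\<close> indexes the summands by their sets of variables.
    These sets are nonempty and disjoint, so a block can be recovered from its set.\<close>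
  define W where "W b = \<sigma> ` set (block_vars b)" for b
  have disj: "set (block_vars b) \<inter> set (block_vars b') = {}" if b: "b \<in> set bs" "b' \<in> set bs" "b \<noteq> b'" for b b'
  proof -
    obtain bs1 bs2 where split: "bs = bs1 @ b # bs2"
      using split_list[OF b(1)] by auto
    then have "b' \<in> set bs1 \<union> set bs2" using b by auto
    then show ?thesis
      using vars(1) unfolding split by auto
  qed
  have Winj: "inj_on W (set bs)"
  proof (rule inj_onI, rule ccontr)
    fix b b' assume b: "b \<in> set bs" "b' \<in> set bs" "W b = W b'" "b \<noteq> b'"
    have "set (block_vars b) = set (block_vars b')"
      by (rule iffD1[OF inj_on_image_eq_iff[OF inj bvars(1)[OF b(1)] bvars(1)[OF b(2)]] b(3)[unfolded W_def]])
    with disj[OF b(1,2,4)] block_vars_nonempty[OF proper[OF b(1)]] show False by simp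
  qed
  \<comment> \<open>\<open>distinct_concat_iff\<close> compares only the nonempty lists.\<close>
  have "removeAll [] (map block_vars bs) = map block_vars bs"
    using block_vars_nonempty[OF proper] by (intro removeAll_id) force
  then have "distinct (map block_vars bs)"
    using vars(1) unfolding distinct_concat_iff by simp
  then have "distinct bs" by (simp add: distinct_map)
  define p where "p V = block_poly \<sigma> (inv_into (set bs) W V)" for V
  have p: "p (W b) = block_poly \<sigma> b" if "b \<in> set bs" for b
    using that Winj by (simp add: p_def)
  have "partition_on UNIV (W ` set bs)"
  proof (rule partition_onI)
    show "\<Union> (W ` set bs) = UNIV"
    proof -
      have "\<Union> (W ` set bs) = \<sigma> ` set (concat (map block_vars bs))"
        unfolding W_def by auto
      then show ?thesis by (simp only: vars(2) im)
    qed
    show "disjnt V V'" if V: "V \<in> W ` set bs" "V' \<in> W ` set bs" "V \<noteq> V'" for V V'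
    proof -
      obtain b b' where "b \<in> set bs" "b' \<in> set bs" "V = W b" "V' = W b'" "b \<noteq> b'"
        using V by (elim imageE) auto
      then show ?thesis
        unfolding disjnt_def W_def using disj[of b b'] inj_on_image_Int[OF inj bvars(1)[of b] bvars(1)[of b']] by simp
    qed
    show "{} \<notin> W ` set bs"
      using block_vars_nonempty[OF proper] by (auto simp: W_def)
  qed
  moreover have "\<forall>V\<in>W ` set bs. type_K 3 (p V) V \<or> type_T 3 (p V) V \<or> type_Y (p V) V"
  proof
    fix V assume "V \<in> W ` set bs"
    then obtain b where b: "b \<in> set bs" "V = W b" by auto
    show "type_K 3 (p V) V \<or> type_T 3 (p V) V \<or> type_Y (p V) V"
      unfolding b(2) p[OF b(1)] unfolding W_def
      by (rule block_poly_type[OF proper bvars(2) inj_on_subset[OF inj bvars(1)]]) (fact b(1))+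
  qed
  moreover have "f = (\<Sum>V\<in>W ` set bs. p V)"
  proof -
    have "(\<Sum>V\<in>W ` set bs. p V) = (\<Sum>b\<in>set bs. block_poly \<sigma> b)"
      using p by (simp add: sum.reindex[OF Winj])
    also have "\<dots> = (\<Sum>b\<leftarrow>bs. block_poly \<sigma> b)"
      using \<open>distinct bs\<close> by (simp add: sum_list_distinct_conv_sum_set)
    also have "\<dots> = f"
      unfolding f ts_def block_poly_def by (induction bs) auto
    finally show ?thesis ..
  qed
  ultimately have "simple_cubic f"
    unfolding simple_cubic_def using hom \<open>smooth f\<close> by blast
  moreover have "A \<subseteq> S"
    using S unfolding A_def ts_def by auto
  ultimately show ?thesis
    unfolding simple_monomials_def f_def by blast
qed

section \<open>Diagonal groups\<close>

text \<open>The factor by which the diagonal matrix with entries \<open>v\<close> acts on the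
  monomial \<open>m\<close>.\<close>

definition mono_val :: "complex ^ 'n \<Rightarrow> 'n::finite monomial \<Rightarrow> complex" where
  "mono_val v m = (\<Prod>i\<in>UNIV. v $ i ^ Poly_Mapping.lookup m i)"

lemma mono_val_mult: "mono_val (\<chi> i. v $ i * w $ i) m = mono_val v m * mono_val w m"
  by (simp add: mono_val_def power_mult_distrib prod.distrib)

lemma mono_val_inverse: "mono_val (\<chi> i. inverse (v $ i)) m = inverse (mono_val v m)"
  using prod_inversef[of "\<lambda>i. v $ i ^ Poly_Mapping.lookup m i" UNIV]
  by (simp add: mono_val_def power_inverse o_def)

lemma mono_val_one [simp]: "mono_val (\<chi> i. 1) m = 1"
  by (simp add: mono_val_def)

lemma mono_val_nonzero: "\<forall>i. v $ i \<noteq> 0 \<Longrightarrow> mono_val v m \<noteq> 0"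
  by (simp add: mono_val_def)

lemma mono_val_cmult: "mono_val (\<chi> i. c * v $ i) m = c ^ mono_deg m * mono_val v m"
  by (simp add: mono_val_def mono_deg_def power_mult_distrib prod.distrib power_sum)

lemma mono_val_add: "mono_val v (m + m') = mono_val v m * mono_val v m'"
  by (simp add: mono_val_def lookup_add power_add prod.distrib)

lemma mono_val_xmon: "mono_val v (xmon vs) = prod_list (map (($) v) vs)"
  by (simp add: mono_val_def prod_xmon)

lemma diag_mat_mult: "diag_mat v ** diag_mat w = diag_mat (\<chi> i. v $ i * w $ i)"
proof -
  have "(\<Sum>k\<in>UNIV. (if i = k then v $ i else 0) * (if k = j then w $ k else 0))
    = (if i = j then v $ i * w $ i else 0)" for i j
    by (subst sum.cong[OF refl, of _ _ "\<lambda>k. if k = i then (if i = j then v $ i * w $ i else 0) else 0"]) auto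
  then show ?thesis
    by (simp add: vec_eq_iff matrix_matrix_mult_def diag_mat_def)
qed

lemma diag_mat_one: "diag_mat (\<chi> i. 1) = mat 1"
  by (simp add: vec_eq_iff diag_mat_def mat_def)

lemma diag_mat_scale: "mat c ** diag_mat v = diag_mat (\<chi> i. c * v $ i)"
  by (simp add: vec_eq_iff mat_mult_component diag_mat_def)

lemma diag_mat_vec: "diag_mat v *v x = (\<chi> i. v $ i * x $ i)"
  by (simp add: vec_eq_iff matrix_vector_mult_def diag_mat_def if_distrib[of "\<lambda>u. u * _"] cong: if_cong)

lemma diag_mat_inj: "diag_mat v = diag_mat w \<longleftrightarrow> v = w"
  by (auto simp: diag_mat_def vec_eq_iff)

lemma invertible_diag_mat:
  assumes "\<forall>i. v $ i \<noteq> 0"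
  shows "invertible (diag_mat v)"
  unfolding invertible_def
  by (rule exI[of _ "diag_mat (\<chi> i. inverse (v $ i))"]) (simp add: diag_mat_mult assms diag_mat_one)

lemma pgl_class_eq: "pgl_class A = {mat c ** A |c. c \<noteq> 0}"
  by (auto simp: pgl_class_def r_coset_def GL_def scalars_def)

lemma pgl_class_self: "A \<in> pgl_class A"
  unfolding pgl_class_eq by (auto intro!: exI[of _ 1])

lemma pgl_class_eqD: "pgl_class A = pgl_class B \<Longrightarrow> \<exists>c. c \<noteq> 0 \<and> A = mat c ** B"
  using pgl_class_self[of A] by (auto simp: pgl_class_eq)

lemma pgl_class_scale:
  assumes "c \<noteq> 0"
  shows "pgl_class (mat c ** A) = pgl_class A"
proof -
  have "mat d ** A = mat (d / c) ** (mat c ** A)" "mat d ** (mat c ** A) = mat (d * c) ** A" for d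
    using assms by (simp_all add: matrix_mul_assoc mat_mult_mat)
  then show ?thesis
    unfolding pgl_class_eq using assms by (auto; metis divide_eq_0_iff mult_eq_0_iff)
qed

lemma pgl_class_carrier: "invertible A \<Longrightarrow> pgl_class A \<in> carrier PGL"
  unfolding PGL_def FactGroup_def RCOSETS_def pgl_class_def by (auto simp: GL_def)

lemma pgl_class_mult:
  "invertible A \<Longrightarrow> invertible B \<Longrightarrow> pgl_class A \<otimes>\<^bsub>PGL\<^esub> pgl_class B = pgl_class (A ** B)"
  using normal.rcos_sum[OF normal_scalars, of A B]
  by (simp add: PGL_def pgl_class_def FactGroup_def GL_def)

lemma pgl_class_one: "pgl_class (mat 1) = \<one>\<^bsub>PGL\<^esub>"
proof -
  have "mat c ** mat 1 = (mat c :: complex ^ 'n ^ 'n)" for c by simp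
  then show ?thesis
    unfolding pgl_class_eq PGL_def FactGroup_def scalars_def by auto
qed

lemma pgl_act_proj_point: "pgl_act (pgl_class A) (proj_point x) = proj_point (A *v x)"
proof -
  have "(mat c ** A) *v (d *s x) = (c * d) *s (A *v x)" for c d
    by (simp add: vec_eq_iff matrix_vector_mult_def mat_mult_component sum_distrib_left mult_ac)
  note * = this
  show ?thesis
  proof (intro Set.set_eqI iffI)
    fix p assume "p \<in> pgl_act (pgl_class A) (proj_point x)"
    then show "p \<in> proj_point (A *v x)"
      unfolding pgl_act_def pgl_class_eq proj_point_def using * by blast
  next
    fix p assume "p \<in> proj_point (A *v x)"
    then obtain d where "p = (mat 1 ** A) *v (d *s x)"
      unfolding proj_point_def using *[of 1] by auto
    then show "p \<in> pgl_act (pgl_class A) (proj_point x)"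
      unfolding pgl_act_def pgl_class_eq proj_point_def using one_neq_zero by blast
  qed
qed

text \<open>Twisting by \<open>\<xi>\<close> can be undone and composed with further twists, so
  related data have the same class as sets. Nothing is required of \<open>R\<close> off the
  group.\<close>

lemma data_class_eqI:
  fixes R I :: "'n::finite action_data"
  assumes "grp R = grp I" "\<xi> \<in> characters (grp I)"
    "\<And>g i. g \<in> grp I \<Longrightarrow> chrs R i g = chrs I i g * \<xi> g" "\<And>g. g \<in> grp I \<Longrightarrow> chr R g = chr I g * \<xi> g ^ d"
  shows "data_class d I = data_class d R"
proof -
  have nz: "\<xi> g \<noteq> 0" if "g \<in> grp I" for g
    using assms(2) that by (auto simp: characters_def hom_def complex_units_def)
  have mult: "(\<lambda>g. \<xi> g * \<eta> g) \<in> characters (grp I)" and div: "(\<lambda>g. \<eta> g / \<xi> g) \<in> characters (grp I)"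
    if "\<eta> \<in> characters (grp I)" for \<eta>
    using assms(2) that by (auto simp: characters_def hom_def complex_units_def Pi_iff)
  show ?thesis
  proof (intro Set.set_eqI iffI)
    fix J assume "J \<in> data_class d I"
    then obtain \<eta> where \<eta>: "grp J = grp I" "\<eta> \<in> characters (grp I)"
      "\<forall>g\<in>grp I. (\<forall>i. chrs J i g = chrs I i g * \<eta> g) \<and> chr J g = chr I g * \<eta> g ^ d"
      by (auto simp: data_class_def data_rel_def)
    then show "J \<in> data_class d R"
      using assms(1,3,4) nz div[OF \<eta>(2)]
      by (auto simp: data_class_def data_rel_def power_divide intro!: bexI[of _ "\<lambda>g. \<eta> g / \<xi> g"])
  next
    fix J assume "J \<in> data_class d R"
    then obtain \<eta> where \<eta>: "grp J = grp I" "\<eta> \<in> characters (grp I)"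
      "\<forall>g\<in>grp I. (\<forall>i. chrs J i g = chrs R i g * \<eta> g) \<and> chr J g = chr R g * \<eta> g ^ d"
      using assms(1) by (auto simp: data_class_def data_rel_def)
    then show "J \<in> data_class d I"
      using assms(3,4) mult[OF \<eta>(2)]
      by (auto simp: data_class_def data_rel_def power_mult_distrib mult.assoc intro!: bexI[of _
        "\<lambda>g. \<xi> g * \<eta> g"])
  qed
qed

section \<open>The full diagonal symmetry group of a cubic\<close>

text \<open>Normalising one coordinate to \<open>1\<close> makes the action of any diagonal group liftable.\<close>

definition diag_symmetries :: "'n::finite mpoly \<Rightarrow> 'n \<Rightarrow> (complex ^ 'n) set" where
  "diag_symmetries F k = {v. (\<forall>i. v $ i \<noteq> 0) \<and> v $ k = 1 \<and>
     (\<forall>m\<in>Poly_Mapping.keys F. \<forall>m'\<in>Poly_Mapping.keys F. mono_val v m = mono_val v m')}"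

lemma diag_symmetriesI:
  "(\<And>i. v $ i \<noteq> 0) \<Longrightarrow> v $ k = 1 \<Longrightarrow>
    (\<And>m m'. m \<in> Poly_Mapping.keys F \<Longrightarrow> m' \<in> Poly_Mapping.keys F \<Longrightarrow> mono_val v m = mono_val v m') \<Longrightarrow>
    v \<in> diag_symmetries F k"
  unfolding diag_symmetries_def by blast

lemma diag_symmetriesD:
  assumes "v \<in> diag_symmetries F k"
  shows "v $ i \<noteq> 0" "v $ k = 1"
    "m \<in> Poly_Mapping.keys F \<Longrightarrow> m' \<in> Poly_Mapping.keys F \<Longrightarrow> mono_val v m = mono_val v m'"
  using assms unfolding diag_symmetries_def by blast+

lemma diag_symmetries_mult:
  assumes v: "v \<in> diag_symmetries F k" and w: "w \<in> diag_symmetries F k"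
  shows "(\<chi> i. v $ i * w $ i) \<in> diag_symmetries F k"
proof (rule diag_symmetriesI)
  fix m m' assume m: "m \<in> Poly_Mapping.keys F" "m' \<in> Poly_Mapping.keys F"
  show "mono_val (\<chi> i. v $ i * w $ i) m = mono_val (\<chi> i. v $ i * w $ i) m'"
    unfolding mono_val_mult using diag_symmetriesD(3)[OF v m] diag_symmetriesD(3)[OF w m] by simp
qed (simp_all add: diag_symmetriesD[OF v] diag_symmetriesD[OF w])

lemma diag_symmetries_inverse:
  assumes v: "v \<in> diag_symmetries F k"
  shows "(\<chi> i. inverse (v $ i)) \<in> diag_symmetries F k"
proof (rule diag_symmetriesI)
  fix m m' assume m: "m \<in> Poly_Mapping.keys F" "m' \<in> Poly_Mapping.keys F"
  show "mono_val (\<chi> i. inverse (v $ i)) m = mono_val (\<chi> i. inverse (v $ i)) m'"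
    unfolding mono_val_inverse using diag_symmetriesD(3)[OF v m] by simp
qed (simp_all add: diag_symmetriesD[OF v])

lemma diag_symmetries_one: "(\<chi> i. 1) \<in> diag_symmetries F k"
  unfolding diag_symmetries_def by simp

lemma eval_poly_diag_symmetry:
  assumes "v \<in> diag_symmetries F k" "m \<in> Poly_Mapping.keys F"
  shows "eval_poly F (\<chi> i. v $ i * x $ i) = mono_val v m * eval_poly F x"
proof -
  have "eval_poly F (\<chi> i. v $ i * x $ i) =
      (\<Sum>m'\<in>Poly_Mapping.keys F. Poly_Mapping.lookup F m' * (mono_val v m' * mono_val x m'))"
    unfolding eval_poly_def mono_val_mult[symmetric] by (simp add: mono_val_def)
  also have "\<dots> = (\<Sum>m'\<in>Poly_Mapping.keys F. Poly_Mapping.lookup F m' * (mono_val v m * mono_val x m'))"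
    using assms unfolding diag_symmetries_def by (intro sum.cong refl) (metis (mono_tags, lifting) mem_Collect_eq)
  also have "\<dots> = mono_val v m * eval_poly F x"
    by (simp add: eval_poly_def mono_val_def sum_distrib_left mult_ac)
  finally show ?thesis .
qed

locale maximal_action =
  fixes F :: "'n::finite mpoly" and G :: "'n pgl set" and P :: "complex ^ 'n ^ 'n" and I :: "'n action_data"
  assumes action: "abelian_liftable_action F G" and grp: "grp I = G" and assoc: "associated_data F P I"
    and maximal: "maximal_in_poset 3 (data_class 3 I)"
begin

text \<open>Diagonal matrices live in the coordinates given by \<open>P\<close>; conjugation brings
  them back to the original coordinates, in which \<open>G\<close> is given.\<close>

definition "conj_class v = pgl_class (P ** diag_mat v ** matrix_inv P)"

lemma P_inv: "P ** matrix_inv P = mat 1" "matrix_inv P ** P = mat 1"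
proof -
  have "\<exists>Q. P ** Q = mat 1 \<and> Q ** P = mat 1"
    using assoc by (simp add: associated_data_def invertible_def)
  from someI_ex[OF this] show "P ** matrix_inv P = mat 1" "matrix_inv P ** P = mat 1"
    by (simp_all add: matrix_inv_def)
qed

lemma P_inv_cancel: "P ** (matrix_inv P ** A) = A" "matrix_inv P ** (P ** A) = A"
  by (simp_all add: matrix_mul_assoc P_inv)

lemma chrs_nonzero: "g \<in> G \<Longrightarrow> chrs I i g \<noteq> 0"
  using assoc grp by (auto simp: associated_data_def characters_def hom_def complex_units_def)

lemma chrs_mult: "g \<in> G \<Longrightarrow> h \<in> G \<Longrightarrow> chrs I i (g \<otimes>\<^bsub>PGL\<^esub> h) = chrs I i g * chrs I i h"
  using assoc grp by (auto simp: associated_data_def characters_def hom_def complex_units_def)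

lemma conj_invertible: "\<forall>i. v $ i \<noteq> 0 \<Longrightarrow> invertible (P ** diag_mat v ** matrix_inv P)"
  using P_inv by (intro invertible_mult invertible_diag_mat) (auto simp: invertible_def)

lemma conj_class_mult:
  assumes "\<forall>i. v $ i \<noteq> 0" "\<forall>i. w $ i \<noteq> 0"
  shows "conj_class v \<otimes>\<^bsub>PGL\<^esub> conj_class w = conj_class (\<chi> i. v $ i * w $ i)"
proof -
  have "P ** diag_mat v ** matrix_inv P ** (P ** diag_mat w ** matrix_inv P) = P ** (diag_mat v ** diag_mat w) ** matrix_inv P"
    by (simp only: matrix_mul_assoc[symmetric] P_inv_cancel)
  then show ?thesis
    unfolding conj_class_def using assms by (simp add: pgl_class_mult conj_invertible diag_mat_mult)
qed

lemma conj_class_one: "conj_class (\<chi> i. 1) = \<one>\<^bsub>PGL\<^esub>"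
  by (simp add: conj_class_def diag_mat_one P_inv pgl_class_one)

text \<open>Equal classes differ by a scalar, and the entry at \<open>k\<close>, which is 1 on both
  sides, shows that the scalar is 1.\<close>

lemma conj_class_inj: "inj_on conj_class (diag_symmetries H k)"
proof (rule inj_onI)
  fix v w assume v: "v \<in> diag_symmetries H k" and w: "w \<in> diag_symmetries H k" and "conj_class v = conj_class w"
  then obtain c where c: "c \<noteq> 0" "P ** diag_mat v ** matrix_inv P = mat c ** (P ** diag_mat w ** matrix_inv P)"
    unfolding conj_class_def using pgl_class_eqD by blast
  have "matrix_inv P ** (P ** diag_mat v ** matrix_inv P) ** P = diag_mat v"
    by (simp only: matrix_mul_assoc[symmetric] P_inv_cancel P_inv matrix_mul_rid)
  moreover have "matrix_inv P ** (mat c ** (P ** diag_mat w ** matrix_inv P)) ** P = mat c ** diag_mat w"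
  proof -
    have "mat c ** (P ** diag_mat w ** matrix_inv P) = P ** ((mat c ** diag_mat w) ** matrix_inv P)"
      by (metis mat_mult_commute matrix_mul_assoc)
    then show ?thesis
      by (simp only: matrix_mul_assoc[symmetric] P_inv_cancel P_inv matrix_mul_rid)
  qed
  ultimately have "diag_mat v = diag_mat (\<chi> i. c * w $ i)"
    using c(2) by (simp add: diag_mat_scale)
  then have vw: "v = (\<chi> i. c * w $ i)" by (simp only: diag_mat_inj)
  moreover have "v $ k = 1" "w $ k = 1" using v w by (auto simp: diag_symmetries_def)
  ultimately have "c = 1" by (metis mult.right_neutral vec_lambda_beta)
  with vw show "v = w" by simp
qed

lemma action_class:
  assumes "g \<in> G"
  shows "g = conj_class (\<chi> i. chrs I i g)"
proof -
  obtain s where "is_lifting G s" and s: "s g ** P = P ** diag_mat (\<chi> i. chrs I i g)"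
    using assoc grp assms unfolding associated_data_def by blast
  have "s g = s g ** P ** matrix_inv P"
    by (simp add: matrix_mul_assoc[symmetric] P_inv)
  with s have "s g = P ** diag_mat (\<chi> i. chrs I i g) ** matrix_inv P" by simp
  with \<open>is_lifting G s\<close> assms show ?thesis
    unfolding is_lifting_def conj_class_def by metis
qed

text \<open>The eigenvalues of g in the lifting twisted by the inverse of the \<open>k\<close>-th
  character, which makes the \<open>k\<close>-th eigenvalue 1.\<close>

definition "normalized k g = (\<chi> i. inverse (chrs I k g) * chrs I i g)"

lemma conj_class_normalized:
  assumes g: "g \<in> G"
  shows "g = conj_class (normalized k g)"
proof -
  have "P ** diag_mat (\<chi> i. c * w $ i) ** matrix_inv P = mat c ** (P ** diag_mat w ** matrix_inv P)" for c w
    unfolding diag_mat_scale[symmetric] by (metis mat_mult_commute matrix_mul_assoc)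
  from this[of "inverse (chrs I k g)" "\<chi> i. chrs I i g"] have
    "conj_class (normalized k g) = conj_class (\<chi> i. chrs I i g)"
    unfolding conj_class_def normalized_def using chrs_nonzero[OF g] by (simp add: pgl_class_scale)
  then show ?thesis
    using action_class[OF g] by simp
qed

lemma mono_val_normalized:
  "mono_deg m = 3 \<Longrightarrow> mono_val (normalized k g) m = inverse (chrs I k g) ^ 3 * mono_val (\<chi> i. chrs I i g) m"
  using mono_val_cmult[of "inverse (chrs I k g)" "\<chi> i. chrs I i g" m] by (simp add: normalized_def)

text \<open>All monomials of \<open>H\<close> take the value \<open>chr I g\<close> and have degree
  3, so dividing the eigenvalues by the \<open>k\<close>-th one changes all these values by the same
  factor.\<close>

lemma normalized_symmetry:
  assumes g: "g \<in> G" and H: "Poly_Mapping.keys H \<subseteq> monomials_of 3 I"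
  shows "normalized k g \<in> diag_symmetries H k"
proof (rule diag_symmetriesI)
  have "mono_val (normalized k g) m = inverse (chrs I k g) ^ 3 * chr I g" if "m \<in> Poly_Mapping.keys H" for m
  proof -
    have "mono_deg m = 3" "chr I g = mono_val (\<chi> i. chrs I i g) m"
      using that H g grp by (auto simp: monomials_of_def mono_val_def)
    then show ?thesis by (simp add: mono_val_normalized)
  qed
  then show "mono_val (normalized k g) m = mono_val (normalized k g) m'"
    if "m \<in> Poly_Mapping.keys H" "m' \<in> Poly_Mapping.keys H" for m m'
    using that by simp
qed (use chrs_nonzero[OF g] in \<open>simp_all add: normalized_def\<close>)

text \<open>If \<open>H\<close> had more symmetries than \<open>G\<close>, they would form a finite
  abelian group acting liftably on the cubic \<open>H\<close>, moved back to the original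
  coordinates. Its data restrict on \<open>G\<close> to data equivalent to \<open>I\<close>, against
  maximality.\<close>

lemma maximal_diag_symmetries:
  assumes H: "homogeneous 3 H" "smooth H" "Poly_Mapping.keys H \<subseteq> monomials_of 3 I" "m0 \<in> Poly_Mapping.keys H"
    and fin: "finite (diag_symmetries H k)"
  shows "G = conj_class ` diag_symmetries H k"
proof (rule ccontr)
  assume neq: "G \<noteq> conj_class ` diag_symmetries H k"
  define V where "V = diag_symmetries H k"
  define G' where "G' = conj_class ` V"
  \<comment> \<open>The normalised representative of a class. It is multiplicative on
    \<open>G'\<close>, as \<open>V\<close> is closed under products, and so provides the
    lifting.\<close>
  define \<tau> where "\<tau> = inv_into V conj_class"
  interpret PGL: group "PGL :: 'n pgl monoid" by (rule group_PGL)
  have V_nz: "\<forall>i. v $ i \<noteq> 0" if "v \<in> V" for v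
    using that by (simp add: V_def diag_symmetries_def)
  have \<tau>: "\<tau> (conj_class v) = v" if "v \<in> V" for v
    using that conj_class_inj[of H k] by (simp add: \<tau>_def V_def)
  have \<tau>': "\<tau> g \<in> V" "conj_class (\<tau> g) = g" if "g \<in> G'" for g
    using that \<tau> by (auto simp: G'_def)
  have mult: "conj_class v \<otimes>\<^bsub>PGL\<^esub> conj_class w = conj_class (\<chi> i. v $ i * w $ i)" "(\<chi> i. v $ i * w $ i) \<in> V"
    if "v \<in> V" "w \<in> V" for v w
    using that conj_class_mult[OF V_nz V_nz] diag_symmetries_mult by (auto simp: V_def)
  have \<tau>_mult: "\<tau> (g \<otimes>\<^bsub>PGL\<^esub> h) = (\<chi> i. \<tau> g $ i * \<tau> h $ i)" if "g \<in> G'" "h \<in> G'" for g h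
    using that \<tau> mult by (auto simp: G'_def)
  have inverse: "conj_class v \<otimes>\<^bsub>PGL\<^esub> conj_class (\<chi> i. inverse (v $ i)) = \<one>\<^bsub>PGL\<^esub>" "(\<chi> i. inverse (v $ i)) \<in> V"
    if "v \<in> V" for v
  proof -
    show *: "(\<chi> i. inverse (v $ i)) \<in> V"
      using that diag_symmetries_inverse by (simp add: V_def)
    have "(\<chi> i. v $ i * (\<chi> i. inverse (v $ i)) $ i) = (\<chi> i. 1)"
      using V_nz[OF that] by (simp add: vec_eq_iff)
    then show "conj_class v \<otimes>\<^bsub>PGL\<^esub> conj_class (\<chi> i. inverse (v $ i)) = \<one>\<^bsub>PGL\<^esub>"
      unfolding mult(1)[OF that *] by (simp only: conj_class_one)
  qed
  have carrier: "conj_class v \<in> carrier PGL" if "v \<in> V" for v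
    unfolding conj_class_def using V_nz[OF that] by (intro pgl_class_carrier conj_invertible)
  have sub: "subgroup G' PGL"
  proof (rule PGL.subgroupI)
    show "G' \<subseteq> carrier PGL" using carrier by (auto simp: G'_def)
    show "G' \<noteq> {}" using diag_symmetries_one by (auto simp: G'_def V_def)
  next
    fix g assume "g \<in> G'"
    then obtain v where v: "v \<in> V" "g = conj_class v" by (auto simp: G'_def)
    have "inv\<^bsub>PGL\<^esub> g = conj_class (\<chi> i. inverse (v $ i))"
      using PGL.inv_equality[of "conj_class (\<chi> i. inverse (v $ i))" g] inverse[OF v(1)] carrier v
        mult(1)[of v "\<chi> i. inverse (v $ i)"] mult(1)[of "\<chi> i. inverse (v $ i)" v]
      by (simp add: mult.commute)
    with inverse(2)[OF v(1)] show "inv\<^bsub>PGL\<^esub> g \<in> G'" by (simp add: G'_def)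
  next
    fix g h assume "g \<in> G'" "h \<in> G'"
    then show "g \<otimes>\<^bsub>PGL\<^esub> h \<in> G'" using mult by (auto simp: G'_def)
  qed
  have comm: "comm_group (sub_PGL G')"
  proof (rule group.group_comm_groupI)
    show "Group.group (sub_PGL G')"
      using subgroup.subgroup_is_group[OF sub group_PGL] .
    fix g h assume "g \<in> carrier (sub_PGL G')" "h \<in> carrier (sub_PGL G')"
    then show "g \<otimes>\<^bsub>sub_PGL G'\<^esub> h = h \<otimes>\<^bsub>sub_PGL G'\<^esub> g"
      using mult by (auto simp: G'_def mult.commute)
  qed
  \<comment> \<open>\<open>H\<close> is written in the coordinates given by \<open>P\<close>,
    whereas the poset asks for a cubic in the original ones.\<close>
  obtain F' where F': "homogeneous 3 F'" "\<And>x. eval_poly F' x = eval_poly H (matrix_inv P *v x)"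
    "\<And>x i. eval_poly (partial_deriv i F') x
      = (\<Sum>r\<in>UNIV. matrix_inv P $ r $ i * eval_poly (partial_deriv r H) (matrix_inv P *v x))"
    by (rule cubic_substitution[OF H(1), of "matrix_inv P"], rule that)
  have "smooth F'"
    using smooth_substitution[OF H(1,2) _ F'(1,3)] P_inv by (auto simp: invertible_def)
  have F'_conj: "eval_poly F' (P ** diag_mat v ** matrix_inv P *v x) = mono_val v m0 * eval_poly F' x" if
    "v \<in> V" for v x
  proof -
    have "matrix_inv P *v (P ** diag_mat v ** matrix_inv P *v x)
      = (matrix_inv P ** (P ** (diag_mat v ** matrix_inv P))) *v x"
      by (simp only: matrix_vector_mul_assoc matrix_mul_assoc)
    also have "\<dots> = diag_mat v *v (matrix_inv P *v x)"
      by (simp only: P_inv_cancel matrix_vector_mul_assoc)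
    finally show ?thesis
      using that H(4) by (simp add: F'(2) diag_mat_vec V_def eval_poly_diag_symmetry)
  qed
  have lin: "G' \<subseteq> Lin (zero_locus F')"
  proof
    fix g assume "g \<in> G'"
    then obtain v where v: "v \<in> V" "g = conj_class v" by (auto simp: G'_def)
    have into: "pgl_act (conj_class w) ` zero_locus F' \<subseteq> zero_locus F'" if w: "w \<in> V" for w
    proof
      fix p assume "p \<in> pgl_act (conj_class w) ` zero_locus F'"
      then obtain x where x: "x \<noteq> 0" "eval_poly F' x = 0" "p = pgl_act (conj_class w) (proj_point x)"
        by (auto simp: zero_locus_def)
      let ?y = "P ** diag_mat w ** matrix_inv P *v x"
      have "?y \<noteq> 0"
        using x(1) conj_invertible[OF V_nz[OF w]] unfolding invertible_def
        by (metis matrix_vector_mul_assoc matrix_vector_mul_lid matrix_vector_mult_0_right)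
      moreover have "eval_poly F' ?y = 0"
        using x(2) F'_conj[OF w] by simp
      moreover have "p = proj_point ?y"
        using x(3) by (simp add: conj_class_def pgl_act_proj_point)
      ultimately show "p \<in> zero_locus F'" unfolding zero_locus_def by blast
    qed
    \<comment> \<open>A preimage of a point is obtained by applying the inverse symmetry, which also
      maps the zero locus into itself.\<close>
    have "zero_locus F' \<subseteq> pgl_act (conj_class v) ` zero_locus F'"
    proof
      fix p assume p: "p \<in> zero_locus F'"
      then obtain x where x: "p = proj_point x" by (auto simp: zero_locus_def)
      let ?w = "\<chi> i. inverse (v $ i)"
      have "(P ** diag_mat v ** matrix_inv P) ** (P ** diag_mat ?w ** matrix_inv P) = P ** (diag_mat v ** diag_mat ?w) ** matrix_inv P"
        by (simp only: matrix_mul_assoc[symmetric] P_inv_cancel)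
      also have "\<dots> = mat 1"
        using V_nz[OF v(1)] by (simp add: diag_mat_mult diag_mat_one P_inv)
      finally have "pgl_act (conj_class v) (pgl_act (conj_class ?w) p) = p"
        unfolding x conj_class_def pgl_act_proj_point by (simp add: matrix_vector_mul_assoc)
      moreover have "pgl_act (conj_class ?w) p \<in> zero_locus F'"
        using into[OF inverse(2)[OF v(1)]] p by blast
      ultimately show "p \<in> pgl_act (conj_class v) ` zero_locus F'" by (metis imageI)
    qed
    with into[OF v(1)] carrier[OF v(1)] show "g \<in> Lin (zero_locus F')"
      by (auto simp: Lin_def v(2))
  qed
  define s where "s g = P ** diag_mat (\<tau> g) ** matrix_inv P" for g
  have "is_lifting G' s"
    unfolding is_lifting_def
  proof (intro conjI ballI homI)
    fix g assume "g \<in> carrier (sub_PGL G')"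
    then show "s g \<in> carrier GL"
      using V_nz \<tau>' conj_invertible by (auto simp: GL_def s_def)
  next
    fix g h assume "g \<in> carrier (sub_PGL G')" "h \<in> carrier (sub_PGL G')"
    then have "s (g \<otimes>\<^bsub>PGL\<^esub> h) = P ** (diag_mat (\<tau> g) ** diag_mat (\<tau> h)) ** matrix_inv P"
      by (simp add: s_def \<tau>_mult diag_mat_mult)
    also have "\<dots> = s g ** s h"
      unfolding s_def by (simp only: matrix_mul_assoc[symmetric] P_inv_cancel)
    finally show "s (g \<otimes>\<^bsub>sub_PGL G'\<^esub> h) = s g \<otimes>\<^bsub>GL\<^esub> s h"
      by (simp add: GL_def)
  next
    fix g assume "g \<in> G'"
    then show "pgl_class (s g) = g"
      using \<tau>' by (simp add: s_def conj_class_def)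
  qed
  \<comment> \<open>A symmetry multiplies the cubic by the common value of its monomials, read off
    here at \<open>m0\<close>.\<close>
  define I' where "I' = \<lparr>grp = G', chr = (\<lambda>g. mono_val (\<tau> g) m0), chrs = (\<lambda>i g. \<tau> g $ i)\<rparr>"
  have "grp I' = G'" by (simp add: I'_def)
  have "associated_data F' P I'"
    unfolding associated_data_def
  proof (intro conjI exI[of _ s] ballI allI)
    show "invertible P" using assoc by (simp add: associated_data_def)
    show "is_lifting (grp I') s" using \<open>is_lifting G' s\<close> by (simp add: I'_def)
    show "s g ** P = P ** diag_mat (\<chi> i. chrs I' i g)" for g
      by (simp add: s_def I'_def matrix_mul_assoc[symmetric] P_inv)
    show "chr I' \<in> characters (grp I')"
      using V_nz \<tau>' by (auto simp: characters_def hom_def I'_def complex_units_def \<tau>_mult mono_val_mult mono_val_nonzero)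
    show "chrs I' i \<in> characters (grp I')" for i
      using V_nz \<tau>' by (auto simp: characters_def hom_def I'_def complex_units_def \<tau>_mult)
    show "eval_poly F' (P *v (\<chi> i. chrs I' i g * x $ i)) = chr I' g * eval_poly F' (P *v x)" if
      "g \<in> grp I'" for g x
    proof -
      have "P ** diag_mat (\<tau> g) ** matrix_inv P *v (P *v x) = P ** (diag_mat (\<tau> g) ** (matrix_inv P ** P)) *v x"
        by (simp only: matrix_vector_mul_assoc matrix_mul_assoc)
      also have "\<dots> = P *v (diag_mat (\<tau> g) *v x)"
        by (simp add: P_inv matrix_vector_mul_assoc)
      finally have "P *v (\<chi> i. chrs I' i g * x $ i) = P ** diag_mat (\<tau> g) ** matrix_inv P *v (P *v x)"
        by (simp add: I'_def diag_mat_vec)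
      then show ?thesis
        using F'_conj[of "\<tau> g" "P *v x"] \<tau>'(1)[of g] that by (simp add: I'_def)
    qed
  qed
  moreover have "abelian_liftable_action F' (grp I')"
    unfolding abelian_liftable_action_def liftable_def using sub lin comm \<open>is_lifting G' s\<close> by (auto simp: I'_def)
  moreover have "finite (grp I')"
    using fin by (simp add: I'_def G'_def V_def)
  ultimately have "data_class 3 I' \<in> data_poset 3"
    unfolding data_poset_def using F'(1) \<open>smooth F'\<close> by blast
  have G: "g = conj_class (normalized k g)" "normalized k g \<in> V" if g: "g \<in> G" for g
    using conj_class_normalized[OF g] normalized_symmetry[OF g H(3)] by (simp_all add: V_def)
  then have "G \<subseteq> G'" unfolding G'_def by blast
  with neq have "G \<subset> G'" by (auto simp: G'_def V_def)
  have \<tau>G: "\<tau> g = normalized k g" if "g \<in> G" for g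
    using \<tau>[OF G(2)[OF that]] G(1)[OF that] by simp
  \<comment> \<open>On \<open>G\<close> the new characters are the old ones divided by the
    \<open>k\<close>-th. The twisting character is therefore the inverse of the \<open>k\<close>-th
    one, and the degree 3 puts its cube on \<open>chr\<close>.\<close>
  have "data_class 3 I = data_class 3 (restrict_data G I')"
  proof (rule data_class_eqI)
    show "grp (restrict_data G I') = grp I" by (simp add: restrict_data_def grp)
    show "(\<lambda>g. inverse (chrs I k g)) \<in> characters (grp I)"
      using chrs_nonzero chrs_mult grp by (auto simp: characters_def hom_def complex_units_def)
    show "chrs (restrict_data G I') i g = chrs I i g * inverse (chrs I k g)" if "g \<in> grp I" for g i
      using that grp by (simp add: restrict_data_def I'_def \<tau>G normalized_def mult.commute)
    show "chr (restrict_data G I') g = chr I g * inverse (chrs I k g) ^ 3" if "g \<in> grp I" for g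
    proof -
      have "mono_deg m0 = 3" "chr I g = mono_val (\<chi> i. chrs I i g) m0"
        using that H(3,4) by (auto simp: monomials_of_def mono_val_def)
      then show ?thesis
        using mono_val_normalized[of m0 k g] that grp
        by (simp add: restrict_data_def I'_def \<tau>G mult.commute)
    qed
  qed
  moreover have "subgroup G (sub_PGL G')"
    using action \<open>G \<subseteq> G'\<close> PGL.subgroup_incl[OF _ sub] by (simp add: abelian_liftable_action_def)
  ultimately have "data_less 3 (data_class 3 I) (data_class 3 I')"
    unfolding data_less_def using \<open>G \<subset> G'\<close> \<open>grp I' = G'\<close>
    by (intro exI[of _ I'] exI[of _ G] conjI refl) (simp_all only:)
  with maximal \<open>data_class 3 I' \<in> data_poset 3\<close> show False
    unfolding maximal_in_poset_def by blast
qed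

text \<open>As every element of \<open>diag_symmetries H k\<close> comes from \<open>G\<close>,
  membership in the set of monomials can be tested on these symmetries, with the value at
  \<open>m0\<close> in place of \<open>chr I\<close>.\<close>

lemma monomials_of_maximal:
  assumes H: "homogeneous 3 H" "smooth H" "Poly_Mapping.keys H \<subseteq> monomials_of 3 I" "m0 \<in> Poly_Mapping.keys H"
    and fin: "finite (diag_symmetries H k)"
  shows "monomials_of 3 I = {m. mono_deg m = 3 \<and> (\<forall>v\<in>diag_symmetries H k. mono_val v m = mono_val v m0)}"
proof -
  have G: "G = conj_class ` diag_symmetries H k"
    by (rule maximal_diag_symmetries[OF H fin])
  have V: "diag_symmetries H k = normalized k ` G"
  proof
    show "normalized k ` G \<subseteq> diag_symmetries H k"
      using normalized_symmetry[OF _ H(3)] by blast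
    show "diag_symmetries H k \<subseteq> normalized k ` G"
    proof
      fix v assume v: "v \<in> diag_symmetries H k"
      then have g: "conj_class v \<in> G" using G by blast
      then have "v = normalized k (conj_class v)"
        using conj_class_normalized[OF g, of k] normalized_symmetry[OF g H(3), of k]
          inj_onD[OF conj_class_inj _ v] by metis
      with g show "v \<in> normalized k ` G" by blast
    qed
  qed
  have m0: "mono_deg m0 = 3" "\<And>g. g \<in> G \<Longrightarrow> chr I g = mono_val (\<chi> i. chrs I i g) m0"
    using H(3,4) grp by (auto simp: monomials_of_def mono_val_def)
  have "chr I g = mono_val (\<chi> i. chrs I i g) m \<longleftrightarrow> mono_val (normalized k g) m = mono_val (normalized k g) m0"
    if "g \<in> G" "mono_deg m = 3" for g m
    using m0 that chrs_nonzero[OF that(1)] by (auto simp: mono_val_normalized)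
  then show ?thesis
    unfolding V monomials_of_def using grp by (auto simp: mono_val_def)
qed

lemma in_coords_conj_class: "in_coords P (conj_class ` V) = (\<lambda>v. pgl_class (diag_mat v)) ` V"
proof -
  have "(\<lambda>A. matrix_inv P ** A ** P) ` conj_class v = pgl_class (diag_mat v)" for v
  proof -
    have "matrix_inv P ** (mat c ** (P ** diag_mat v ** matrix_inv P)) ** P = mat c ** diag_mat v" for c
    proof -
      have "mat c ** (P ** diag_mat v ** matrix_inv P) = P ** ((mat c ** diag_mat v) ** matrix_inv P)"
        by (metis mat_mult_commute matrix_mul_assoc)
      then show ?thesis
        by (simp only: matrix_mul_assoc[symmetric] P_inv_cancel P_inv matrix_mul_rid)
    qed
    then show ?thesis
      by (simp only: conj_class_def pgl_class_eq setcompr_eq_image image_image)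
  qed
  then show ?thesis
    by (simp add: in_coords_def image_image)
qed

end

section \<open>The exceptional cubics\<close>

text \<open>Up to factors 2 these are the derivatives of (a^2 + b^2 + c^2) d + 2 a b c + d^3. For
  nonzero d they give a^2 = b^2 = c^2, and then a^2 = 0 or a^2 = d^2, either of which contradicts
  the last equation.\<close>

lemma four_quadrics:
  fixes a b c d :: complex
  assumes "a * d + b * c = 0" "b * d + a * c = 0" "c * d + a * b = 0" "a\<^sup>2 + b\<^sup>2 + c\<^sup>2 + 3 * d\<^sup>2 = 0"
  shows "a = 0 \<and> b = 0 \<and> c = 0 \<and> d = 0"
proof (cases "d = 0")
  case True
  with assms have "b * c = 0" "a * c = 0" "a * b = 0" "a\<^sup>2 + b\<^sup>2 + c\<^sup>2 = 0" by simp_all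
  with True show ?thesis by auto
next
  case False
  have "d * (a\<^sup>2 - b\<^sup>2) = 0" "d * (a\<^sup>2 - c\<^sup>2) = 0"
    using assms(1-3) by algebra+
  with False have sq: "b\<^sup>2 = a\<^sup>2" "c\<^sup>2 = a\<^sup>2" by auto
  have "b\<^sup>2 * c\<^sup>2 = a\<^sup>2 * d\<^sup>2" using assms(1) by algebra
  then have "a\<^sup>2 * (a\<^sup>2 - d\<^sup>2) = 0" unfolding sq by algebra
  then have "a\<^sup>2 = 0 \<or> a\<^sup>2 = d\<^sup>2" by simp
  with assms(4) sq False show ?thesis by auto
qed

text \<open>Multiplied by d, e, f, equations 4 to 6 express a d^2, b e^2, c f^2 through the three
  monomials u, v, w; multiplied by a, b, c, equations 1 to 3 then express a^2 b, b^2 c, c^2 a. The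
  multiplicative relations among all these monomials become equations in u, v, w alone.\<close>

lemma exceptional_smooth_1:
  fixes a b c d e f :: complex
  assumes 1: "2 * a * b + c\<^sup>2 + d\<^sup>2 + 2 * e * f = 0" and 2: "a\<^sup>2 + 2 * b * c + e\<^sup>2 + 2 * d * f = 0"
    and 3: "b\<^sup>2 + 2 * c * a + f\<^sup>2 + 2 * d * e = 0" and 4: "d * a + c * e + b * f = 0"
    and 5: "e * b + c * d + a * f = 0" and 6: "f * c + a * e + b * d = 0"
  shows "a = 0 \<and> b = 0 \<and> c = 0 \<and> d = 0 \<and> e = 0 \<and> f = 0"
proof -
  define u v w where uvw: "u = 2 * c * d * e" "v = 2 * a * e * f" "w = 2 * b * d * f"
  have p: "2 * (a * d\<^sup>2) = - (u + w)" using 4 unfolding uvw by algebra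
  have q: "2 * (b * e\<^sup>2) = - (u + v)" using 5 unfolding uvw by algebra
  have r: "2 * (c * f\<^sup>2) = - (v + w)" using 6 unfolding uvw by algebra
  have A: "2 * (a\<^sup>2 * b) + c\<^sup>2 * a + a * d\<^sup>2 + v = 0" using 1 unfolding uvw by algebra
  have B: "a\<^sup>2 * b + 2 * (b\<^sup>2 * c) + b * e\<^sup>2 + w = 0" using 2 unfolding uvw by algebra
  have C: "b\<^sup>2 * c + 2 * (c\<^sup>2 * a) + c * f\<^sup>2 + u = 0" using 3 unfolding uvw by algebra
  have X: "2 * (a\<^sup>2 * b) = u - v" and Y: "2 * (b\<^sup>2 * c) = v - w" and Z: "2 * (c\<^sup>2 * a) = w - u"
    using p q r A B C by algebra+
  have "u\<^sup>2 * (a\<^sup>2 * b) = 4 * (c\<^sup>2 * a) * (a * d\<^sup>2) * (b * e\<^sup>2)" unfolding uvw by algebra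
  then have E1: "2 * u ^ 3 = w\<^sup>2 * (u + v)" using X Z p q by algebra
  have "v\<^sup>2 * (b\<^sup>2 * c) = 4 * (a\<^sup>2 * b) * (b * e\<^sup>2) * (c * f\<^sup>2)" unfolding uvw by algebra
  then have E2: "2 * v ^ 3 = u\<^sup>2 * (v + w)" using X Y q r by algebra
  have "w\<^sup>2 * (c\<^sup>2 * a) = 4 * (b\<^sup>2 * c) * (a * d\<^sup>2) * (c * f\<^sup>2)" unfolding uvw by algebra
  then have E3: "2 * w ^ 3 = v\<^sup>2 * (w + u)" using Y Z p r by algebra
  \<comment> \<open>By \<open>p\<close>, \<open>q\<close>, \<open>r\<close> the right-hand side is
    -(u + v)(v + w)(w + u), which equals u v w - (u + v + w)(u v + v w + w u).\<close>
  have "u * v * w = 8 * (a * d\<^sup>2) * (b * e\<^sup>2) * (c * f\<^sup>2)" unfolding uvw by algebra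
  then have "(u + v + w) * (u * v + v * w + w * u) = 0" using p q r by algebra
  then consider "u + v + w = 0" | "u * v + v * w + w * u = 0" by auto
  then have uvw0: "u = 0 \<and> v = 0 \<and> w = 0"
  proof cases
    case 1
    then have "2 * u ^ 3 = - (w ^ 3)" "2 * v ^ 3 = - (u ^ 3)" "2 * w ^ 3 = - (v ^ 3)"
      using E1 E2 E3 by algebra+
    then have "u ^ 3 = 0" "v ^ 3 = 0" "w ^ 3 = 0" by algebra+
    then show ?thesis by simp
  next
    case 2
    then have "2 * u ^ 3 = - (u * v * w)" "2 * v ^ 3 = - (u * v * w)" "2 * w ^ 3 = - (u * v * w)"
      using E1 E2 E3 by algebra+
    then have "(u * v * w) ^ 3 = 0" by algebra
    then have "u * v * w = 0" by simp
    with \<open>2 * u ^ 3 = - (u * v * w)\<close> \<open>2 * v ^ 3 = - (u * v * w)\<close> \<open>2 * w ^ 3 = - (u * v * w)\<close>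
    show ?thesis by auto
  qed
  have z: "a = 0 \<or> b = 0" "b = 0 \<or> c = 0" "c = 0 \<or> a = 0" "a = 0 \<or> d = 0" "b = 0 \<or> e = 0" "c = 0 \<or> f = 0"
    using X Y Z p q r uvw0 by auto
  have "a = 0" using z 2 3 6 by auto
  moreover have "b = 0" using z 1 3 4 by auto
  moreover have "c = 0" using z 1 2 5 by auto
  ultimately have def: "d\<^sup>2 + 2 * e * f = 0" "e\<^sup>2 + 2 * d * f = 0" "f\<^sup>2 + 2 * d * e = 0"
    using 1 2 3 by auto
  \<comment> \<open>Each equation times its own variable: the three cubes coincide, and t = d e f
    satisfies t^3 = -8 t^3.\<close>
  have "d ^ 3 = - 2 * (d * e * f)" "e ^ 3 = - 2 * (d * e * f)" "f ^ 3 = - 2 * (d * e * f)"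
    using def by algebra+
  moreover from this have "(d * e * f) ^ 3 = 0" by algebra
  ultimately have "d = 0" "e = 0" "f = 0" by auto
  with \<open>a = 0\<close> \<open>b = 0\<close> \<open>c = 0\<close> show ?thesis by simp
qed

lemma exceptional_smooth_2:
  fixes a b c d e f :: complex
  assumes 1: "a * b + e * f = 0" and 2: "a\<^sup>2 + 2 * b * c + e\<^sup>2 + 2 * d * f = 0"
    and 3: "b\<^sup>2 + 2 * c * d + f\<^sup>2 = 0" and 4: "c\<^sup>2 + 3 * d\<^sup>2 + 2 * b * f = 0"
    and 5: "b * e + a * f = 0" and 6: "a * e + c * f + b * d = 0"
  shows "a = 0 \<and> b = 0 \<and> c = 0 \<and> d = 0 \<and> e = 0 \<and> f = 0"
proof -
  have "b * ((a - e) * (a + e)) = 0" "f * ((a - e) * (a + e)) = 0"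
    using 1 5 by algebra+
  then consider "b = 0" "f = 0" | "a - e = 0" | "a + e = 0" by auto
  then have "a = 0 \<and> e = 0"
  proof cases
    case 1
    with 2 6 have "a\<^sup>2 + e\<^sup>2 = 0" "a * e = 0" by auto
    then show ?thesis by auto
  next
    case 2
    have "a * (b + f) = 0" using \<open>a - e = 0\<close> 1 by algebra
    moreover have "a = 0" if "b + f = 0"
    proof -
      have "2 * a\<^sup>2 = 0" using that \<open>a - e = 0\<close> \<open>a\<^sup>2 + 2 * b * c + e\<^sup>2 + 2 * d * f = 0\<close> 6 by algebra
      then show ?thesis by simp
    qed
    ultimately show ?thesis using \<open>a - e = 0\<close> by auto
  next
    case 3
    have "a * (b - f) = 0" using \<open>a + e = 0\<close> 1 by algebra
    moreover have "a = 0" if "b - f = 0"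
    proof -
      have "2 * a\<^sup>2 = 0" using that \<open>a + e = 0\<close> 2 6 by algebra
      then show ?thesis by simp
    qed
    ultimately show ?thesis using \<open>a + e = 0\<close> by auto
  qed
  then have ae: "a = 0" "e = 0" by auto
  have bc: "b * c + d * f = 0" "c * f + b * d = 0" using 2 6 ae by algebra+
  have "b * ((c - d) * (c + d)) = 0" "f * ((c - d) * (c + d)) = 0" using bc by algebra+
  then consider "b = 0" "f = 0" | "c - d = 0" | "c + d = 0" by auto
  then have "c = 0 \<and> d = 0"
  proof cases
    case 1
    with 3 4 have "c * d = 0" "c\<^sup>2 + 3 * d\<^sup>2 = 0" by auto
    then show ?thesis by auto
  next
    case 2
    have "d * (b + f) = 0" using 2 bc by algebra
    moreover have "d = 0" if "b + f = 0"
    proof -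
      have "6 * d\<^sup>2 = 0" using that 2 3 4 by algebra
      then show ?thesis by simp
    qed
    ultimately show ?thesis using 2 by auto
  next
    case 3
    have "d * (b - f) = 0" using \<open>c + d = 0\<close> bc by algebra
    moreover have "d = 0" if "b - f = 0"
    proof -
      have "6 * d\<^sup>2 = 0" using that \<open>c + d = 0\<close> \<open>b\<^sup>2 + 2 * c * d + f\<^sup>2 = 0\<close> 4 by algebra
      then show ?thesis by simp
    qed
    ultimately show ?thesis using 3 by auto
  qed
  with 3 4 have "b\<^sup>2 + f\<^sup>2 = 0" "b * f = 0" by auto
  with ae \<open>c = 0 \<and> d = 0\<close> show ?thesis by auto
qed

lemma exceptional_smooth_3:
  fixes a b c d e f :: complex
  assumes 1: "a * b = 0" and 2: "a\<^sup>2 + 2 * b * c + 2 * d * e = 0" and 3: "b\<^sup>2 + 3 * c\<^sup>2 + e\<^sup>2 = 0"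
    and 4: "b * e + d * f = 0" and 5: "b * d + c * e = 0" and 6: "d\<^sup>2 + 3 * f\<^sup>2 = 0"
  shows "a = 0 \<and> b = 0 \<and> c = 0 \<and> d = 0 \<and> e = 0 \<and> f = 0"
proof -
  have "b = 0"
  proof (rule ccontr)
    assume "b \<noteq> 0"
    with 1 have "a = 0" by simp
    then have bc: "b * c + d * e = 0" using 2 by algebra
    have "d \<noteq> 0"
    proof
      assume "d = 0"
      with 6 4 5 bc \<open>b \<noteq> 0\<close> have "e = 0" "c = 0" by auto
      with 3 \<open>b \<noteq> 0\<close> show False by simp
    qed
    have "d * (b\<^sup>2 - c * f) = 0" using 4 5 by algebra
    with \<open>d \<noteq> 0\<close> have b2: "b\<^sup>2 = c * f" by simp
    have "b * c * b = d\<^sup>2 * f" using bc 4 by algebra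
    then have c2: "f * (c\<^sup>2 + 3 * f\<^sup>2) = 0" using b2 6 by algebra
    have "f \<noteq> 0" using 6 \<open>d \<noteq> 0\<close> by auto
    with c2 have c2: "c\<^sup>2 = - 3 * f\<^sup>2" by algebra
    have "b\<^sup>2 * e\<^sup>2 = d\<^sup>2 * f\<^sup>2" using 4 by algebra
    also have "\<dots> = b\<^sup>2 * b\<^sup>2" using 6 c2 b2 by algebra
    finally have "b\<^sup>2 * (e\<^sup>2 - b\<^sup>2) = 0" by algebra
    then have "e\<^sup>2 = b\<^sup>2" using \<open>b \<noteq> 0\<close> by simp
    then have "2 * c * f = 9 * f\<^sup>2" using 3 b2 c2 by algebra
    then have "2 * c = 9 * f" using \<open>f \<noteq> 0\<close> by (simp add: power2_eq_square)
    then have "93 * f\<^sup>2 = 0" using c2 by algebra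
    with \<open>f \<noteq> 0\<close> show False by simp
  qed
  then have "d * f = 0" "c * e = 0" "3 * c\<^sup>2 + e\<^sup>2 = 0" using 3 4 5 by auto
  with 6 have "d = 0 \<and> f = 0" "c = 0 \<and> e = 0" by auto
  with \<open>b = 0\<close> 2 show ?thesis by auto
qed

lemma exceptional_smooth_4:
  fixes a b c d e f :: complex
  assumes 1: "a * b + d * e = 0" and 2: "a\<^sup>2 + 2 * b * c + 2 * b * f + d\<^sup>2 = 0" and 3: "b\<^sup>2 + 3 * c\<^sup>2 + f\<^sup>2 = 0"
    and 4: "a * e + b * d = 0" and 5: "a * d + e * f = 0" and 6: "b\<^sup>2 + 2 * c * f + e\<^sup>2 = 0"
  shows "a = 0 \<and> b = 0 \<and> c = 0 \<and> d = 0 \<and> e = 0 \<and> f = 0"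
proof -
  have "b * ((a - d) * (a + d)) = 0" "e * ((a - d) * (a + d)) = 0"
    using 1 4 by algebra+
  then consider "b = 0" "e = 0" | "a - d = 0" | "a + d = 0" by auto
  then have "a = 0 \<and> d = 0"
  proof cases
    case 1
    with 2 5 have "a\<^sup>2 + d\<^sup>2 = 0" "a * d = 0" by auto
    then show ?thesis by auto
  next
    case 2
    have "a * (b + e) = 0" using \<open>a - d = 0\<close> 1 by algebra
    moreover have "a = 0" if "b + e = 0"
    proof -
      have "e * (c + 2 * f) = 0" using that \<open>a - d = 0\<close> \<open>a\<^sup>2 + 2 * b * c + 2 * b * f + d\<^sup>2 = 0\<close> 5 by algebra
      moreover have "e = 0" if "c + 2 * f = 0"
      proof -
        have "15 * f\<^sup>2 = 0" using that \<open>b + e = 0\<close> 3 6 by algebra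
        then show ?thesis using that \<open>b + e = 0\<close> 3 by simp
      qed
      ultimately have "e = 0" by auto
      then show ?thesis using 5 \<open>a - d = 0\<close> by simp
    qed
    ultimately show ?thesis using \<open>a - d = 0\<close> by auto
  next
    case 3
    have "a * (b - e) = 0" using \<open>a + d = 0\<close> 1 by algebra
    moreover have "a = 0" if "b - e = 0"
    proof -
      have "e * (c + 2 * f) = 0" using that \<open>a + d = 0\<close> 2 5 by algebra
      moreover have "e = 0" if "c + 2 * f = 0"
      proof -
        have "15 * f\<^sup>2 = 0" using that \<open>b - e = 0\<close> \<open>b\<^sup>2 + 3 * c\<^sup>2 + f\<^sup>2 = 0\<close> 6 by algebra
        then show ?thesis using that \<open>b - e = 0\<close> \<open>b\<^sup>2 + 3 * c\<^sup>2 + f\<^sup>2 = 0\<close> by simp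
      qed
      ultimately have "e = 0" by auto
      then show ?thesis using 5 \<open>a + d = 0\<close> by auto
    qed
    ultimately show ?thesis using \<open>a + d = 0\<close> by auto
  qed
  then have ad: "a = 0" "d = 0" by auto
  have "e = 0 \<or> f = 0"
    "b = 0 \<or> c = - f" using ad 5 2 by (auto simp: eq_neg_iff_add_eq_0 simp flip: distrib_left)
  moreover have "b\<^sup>2 = 0" if "f = 0" "c = - f" using that 3 by simp
  moreover have "f\<^sup>2 = 0" if "e = 0" "c = - f" using that 3 6 by algebra
  ultimately have "b = 0" using 3 by auto
  then have "c = 0 \<and> e = 0 \<and> f = 0" using \<open>e = 0 \<or> f = 0\<close> 3 6 by auto
  with ad \<open>b = 0\<close> show ?thesis by simp
qed

text \<open>Again a determinant a^2 - d^2 forces a = d = 0. The other four variables then satisfy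
  \<open>four_quadrics\<close>, with c as the distinguished one.\<close>

lemma exceptional_smooth_5:
  fixes a b c d e f :: complex
  assumes 1: "a * b + d * e = 0" and 2: "a\<^sup>2 + 2 * b * c + d\<^sup>2 + 2 * e * f = 0" and 3:
    "b\<^sup>2 + 3 * c\<^sup>2 + e\<^sup>2 + f\<^sup>2 = 0"
    and 4: "b * d + a * e = 0" and 5: "a * d + c * e + b * f = 0" and 6: "b * e + c * f = 0"
  shows "a = 0 \<and> b = 0 \<and> c = 0 \<and> d = 0 \<and> e = 0 \<and> f = 0"
proof -
  have "b * ((a - d) * (a + d)) = 0" "e * ((a - d) * (a + d)) = 0"
    using 1 4 by algebra+
  then consider "b = 0" "e = 0" | "a - d = 0" | "a + d = 0" by auto
  then have "a = 0 \<and> d = 0"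
  proof cases
    case 1
    with 2 5 have "a\<^sup>2 + d\<^sup>2 = 0" "a * d = 0" by auto
    then show ?thesis by auto
  next
    case 2
    have "a * (b + e) = 0" using \<open>a - d = 0\<close> 1 by algebra
    moreover have "a = 0" if "b + e = 0"
    proof -
      have "4 * a\<^sup>2 = 0" using that \<open>a - d = 0\<close> \<open>a\<^sup>2 + 2 * b * c + d\<^sup>2 + 2 * e * f = 0\<close> 5 by algebra
      then show ?thesis by simp
    qed
    ultimately show ?thesis using \<open>a - d = 0\<close> by auto
  next
    case 3
    have "a * (b - e) = 0" using \<open>a + d = 0\<close> 1 by algebra
    moreover have "a = 0" if "b - e = 0"
    proof -
      have "4 * a\<^sup>2 = 0" using that \<open>a + d = 0\<close> 2 5 by algebra
      then show ?thesis by simp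
    qed
    ultimately show ?thesis using \<open>a + d = 0\<close> by auto
  qed
  then have ad: "a = 0" "d = 0" by auto
  have "b * c + e * f = 0" "e * c + b * f = 0" "f * c + b * e = 0" "b\<^sup>2 + e\<^sup>2 + f\<^sup>2 + 3 * c\<^sup>2 = 0"
    using ad 2 3 5 6 by algebra+
  from four_quadrics[OF this] ad show ?thesis by simp
qed

section \<open>Groups given by weights\<close>

text \<open>A finite diagonal group is presented as a product of groups of n-th roots of unity, each
  with a list of weights: a root z acts on coordinate i by the power \<open>ws ! (i - 1)\<close>,
  coordinates being numbered from 1.\<close>

fun root_vec :: "(nat \<times> nat list) list \<Rightarrow> complex list \<Rightarrow> nat \<Rightarrow> complex" where
  "root_vec ((n, ws) # gs) (z # zs) i = z ^ (ws ! (i - 1)) * root_vec gs zs i"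
| "root_vec _ _ i = 1"

definition roots :: "(nat \<times> nat list) list \<Rightarrow> complex list set" where
  "roots gs = {zs. list_all2 (\<lambda>(n, ws) z. z ^ n = 1) gs zs}"

definition weight :: "nat list \<Rightarrow> nat list \<Rightarrow> nat" where
  "weight ws t = sum_list (map (\<lambda>i. ws ! (i - 1)) t)"

definition same_weight :: "(nat \<times> nat list) list \<Rightarrow> nat list \<Rightarrow> nat list \<Rightarrow> bool" where
  "same_weight gs t u \<longleftrightarrow> list_all (\<lambda>(n, ws). weight ws t mod n = weight ws u mod n) gs"

lemma roots_Nil: "roots [] = {[]}"
  by (auto simp: roots_def)

lemma roots_Cons: "roots ((n, ws) # gs) = {z # zs |z zs. z ^ n = 1 \<and> zs \<in> roots gs}"
  by (auto simp: roots_def list_all2_Cons1)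

lemma root_vec_mult:
  "zs \<in> roots gs \<Longrightarrow> zs' \<in> roots gs \<Longrightarrow> root_vec gs (map2 (*) zs zs') i = root_vec gs zs i * root_vec gs zs' i"
  by (induction gs arbitrary: zs zs') (auto simp: roots_Nil roots_Cons power_mult_distrib)

lemma root_vec_ones: "root_vec gs (replicate (length gs) 1) i = 1"
  by (induction gs) auto

lemma replicate_roots: "replicate (length gs) 1 \<in> roots gs"
  by (induction gs) (auto simp: roots_Nil roots_Cons)

lemma prod_root_vec_Cons:
  "prod_list (map (root_vec ((n, ws) # gs) (z # zs)) t) = z ^ weight ws t * prod_list (map (root_vec gs zs) t)"
  by (induction t) (simp_all add: weight_def power_add)

lemma root_of_unity_power_eq:
  fixes z :: complex
  assumes "z ^ n = 1" "a mod n = b mod n"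
  shows "z ^ a = z ^ b"
proof -
  have "z ^ a = z ^ (a mod n)" for a
    using assms(1) by (metis div_mult_mod_eq mult.commute mult_1 power_add power_mult power_one)
  from this[of a] this[of b] assms(2) show ?thesis by simp
qed

lemma primitive_root_power_eq:
  fixes n :: nat
  assumes "0 < n" "cis (2 * pi / n) ^ a = cis (2 * pi / n) ^ b"
  shows "a mod n = b mod n"
proof -
  have pow: "cis (2 * pi / n) ^ k = cis (2 * pi * real k / real n)" for k
    by (simp add: DeMoivre mult_ac)
  have one: "cis (2 * pi / n) ^ n = 1"
    using assms(1) by (simp add: DeMoivre)
  have "cis (2 * pi / n) ^ (a mod n) = cis (2 * pi / n) ^ (b mod n)"
    using assms(2) root_of_unity_power_eq[OF one, of "a mod n" a] root_of_unity_power_eq[OF one, of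
      "b mod n" b] by simp
  then show ?thesis
    using bij_betw_roots_unity[OF assms(1)] assms(1) unfolding pow bij_betw_def inj_on_def by simp
qed

text \<open>A primitive root in one factor and 1 in the others detects the weight modulo that n.
  Equality of characters thereby turns into integer arithmetic that can be evaluated.\<close>

lemma same_weight_iff:
  assumes "list_all (\<lambda>(n, ws). 0 < n) gs"
  shows "(\<forall>zs\<in>roots gs. prod_list (map (root_vec gs zs) t) = prod_list (map (root_vec gs zs) u)) \<longleftrightarrow> same_weight gs t u"
  using assms
proof (induction gs)
  case Nil
  have "prod_list (map (\<lambda>a. 1 :: complex) t) = 1" for t :: "nat list" by (induction t) auto
  then show ?case by (simp add: roots_Nil same_weight_def)
next
  case (Cons g gs)
  obtain n ws where g: "g = (n, ws)" by (cases g)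
  have n: "0 < n" using Cons(2) g by simp
  have IH: "(\<forall>zs\<in>roots gs. prod_list (map (root_vec gs zs) t) = prod_list (map (root_vec gs zs) u)) \<longleftrightarrow> same_weight gs t u"
    using Cons by simp
  have ones: "prod_list (map (root_vec gs (replicate (length gs) 1)) t) = 1" for t
    by (induction t) (auto simp: root_vec_ones)
  show ?case
  proof
    assume *: "\<forall>zs\<in>roots (g # gs). prod_list (map (root_vec (g # gs) zs) t) = prod_list (map (root_vec (g # gs) zs) u)"
    have **: "z ^ weight ws t * prod_list (map (root_vec gs zs) t) = z ^ weight ws u * prod_list (map (root_vec gs zs) u)"
      if "z ^ n = 1" "zs \<in> roots gs" for z zs
    proof -
      have "z # zs \<in> roots ((n, ws) # gs)"
        using that by (simp add: roots_Cons)
      from bspec[OF *[unfolded g] this] show ?thesis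
        by (simp only: prod_root_vec_Cons)
    qed
    have "cis (2 * pi / n) ^ weight ws t = cis (2 * pi / n) ^ weight ws u"
      using **[of "cis (2 * pi / n)" "replicate (length gs) 1"] replicate_roots n
      by (simp add: ones DeMoivre)
    then have "weight ws t mod n = weight ws u mod n"
      by (rule primitive_root_power_eq[OF n])
    moreover have "same_weight gs t u"
      unfolding IH[symmetric] using **[of 1] by simp
    ultimately show "same_weight (g # gs) t u"
      by (simp add: same_weight_def g)
  next
    assume "same_weight (g # gs) t u"
    then have "weight ws t mod n = weight ws u mod n" "same_weight gs t u"
      by (simp_all add: same_weight_def g)
    then show "\<forall>zs\<in>roots (g # gs). prod_list (map (root_vec (g # gs) zs) t) = prod_list (map (root_vec (g # gs) zs) u)"
      unfolding IH[symmetric] by (auto simp: g roots_Cons prod_root_vec_Cons intro!: arg_cong2[where f =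
        "(*)"] root_of_unity_power_eq)
  qed
qed

lemma root_vec_nonzero:
  "list_all (\<lambda>(n, ws). 0 < n) gs \<Longrightarrow> zs \<in> roots gs \<Longrightarrow> root_vec gs zs i \<noteq> 0"
  by (induction gs arbitrary: zs) (auto simp: roots_Nil roots_Cons power_0_left)

lemma root_vec_fixed:
  "list_all (\<lambda>(n, ws). ws ! (i - 1) = 0) gs \<Longrightarrow> root_vec gs zs i = 1"
  by (induction gs zs i rule: root_vec.induct) auto

section \<open>The polynomial of an exceptional support\<close>

text \<open>The 2 matches the one that differentiation produces from a square, so that derivatives
  such as 2 (a d + b c) have it as a common factor.\<close>

definition twist :: "nat list \<Rightarrow> complex" where
  "twist t = (if distinct t then 2 else 1)"

definition exceptional_poly :: "(nat \<Rightarrow> 'n) \<Rightarrow> nat list list \<Rightarrow> 'n mpoly" where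
  "exceptional_poly \<tau> ts = (\<Sum>t\<in>set ts. Poly_Mapping.single (xmon (map \<tau> t)) (twist t))"

definition no_singular_point :: "nat list list \<Rightarrow> bool" where
  "no_singular_point ts \<longleftrightarrow> (\<forall>y. (\<forall>i\<in>{1..6}. (\<Sum>t\<leftarrow>ts. twist t * dmono y i t) = 0) \<longrightarrow> (\<forall>i\<in>{1..6}. y i = 0))"

definition cubic_support :: "nat list list \<Rightarrow> bool" where
  "cubic_support ts \<longleftrightarrow> distinct (map sort ts) \<and>
     list_all (\<lambda>t. length t = 3 \<and> list_all (\<lambda>i. List.member [1, 2, 3, 4, 5, 6] i) t) ts"

lemma cubic_supportD:
  assumes "cubic_support ts" "t \<in> set ts"
  shows "length t = 3" "set t \<subseteq> {1..6}"
proof -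
  have "length t = 3" "set t \<subseteq> {1, 2, 3, 4, 5, 6}"
    using assms by (auto simp: cubic_support_def list_all_iff)
  then show "length t = 3" "set t \<subseteq> {1..6}" by auto
qed

lemma cubic_support_inj:
  assumes "cubic_support ts" "inj_on \<tau> {1..6}"
  shows "inj_on (\<lambda>t. xmon (map \<tau> t)) (set ts)"
proof (rule inj_onI)
  fix t u assume tu: "t \<in> set ts" "u \<in> set ts" "xmon (map \<tau> t) = xmon (map \<tau> u)"
  have "inj_on sort (set ts)"
    using assms(1) by (simp add: cubic_support_def distinct_map)
  then show "t = u"
    using xmon_map_inj[OF assms(2) cubic_supportD(2)[OF assms(1) tu(1)] cubic_supportD(2)[OF assms(1) tu(2)] tu(3)] tu(1,2)
    by (auto dest: inj_onD)
qed

lemma keys_exceptional_poly: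
  assumes "cubic_support ts" "inj_on \<tau> {1..6}"
  shows "Poly_Mapping.keys (exceptional_poly \<tau> ts) = (\<lambda>t. xmon (map \<tau> t)) ` set ts"
proof -
  have lookup: "Poly_Mapping.lookup (exceptional_poly \<tau> ts) m
    = (\<Sum>t\<in>set ts. if xmon (map \<tau> t) = m then twist t else 0)" for m
    by (simp add: exceptional_poly_def lookup_sum lookup_single when_def)
  have "Poly_Mapping.lookup (exceptional_poly \<tau> ts) (xmon (map \<tau> u)) = twist u" if "u \<in> set ts" for u
  proof -
    have "(xmon (map \<tau> t) = xmon (map \<tau> u)) = (t = u)" if "t \<in> set ts" for t
      using cubic_support_inj[OF assms] that \<open>u \<in> set ts\<close> by (auto dest: inj_onD)
    then have "Poly_Mapping.lookup (exceptional_poly \<tau> ts) (xmon (map \<tau> u))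
      = (\<Sum>t\<in>set ts. if t = u then twist t else 0)"
      unfolding lookup by (intro sum.cong refl) simp
    also have "\<dots> = twist u" using that by simp
    finally show ?thesis .
  qed
  moreover have "twist u \<noteq> 0" for u by (simp add: twist_def)
  moreover have "Poly_Mapping.lookup (exceptional_poly \<tau> ts) m = 0" if "m \<notin> (\<lambda>t. xmon (map \<tau> t)) ` set ts" for m
    unfolding lookup using that by (intro sum.neutral) auto
  ultimately show ?thesis
    by (auto simp: in_keys_iff) (metis image_eqI)
qed

lemma homogeneous_exceptional_poly: "cubic_support ts \<Longrightarrow> homogeneous 3 (exceptional_poly \<tau> ts)"
  unfolding exceptional_poly_def by (intro homogeneous_sum homogeneous_single) (simp add: cubic_supportD)

lemma smooth_exceptional_poly:
  fixes \<tau> :: "nat \<Rightarrow> 'n::finite"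
  assumes "cubic_support ts" "bij_betw \<tau> {1..6} UNIV" "no_singular_point ts"
  shows "smooth (exceptional_poly \<tau> ts)"
  unfolding smooth_cubic_iff[OF homogeneous_exceptional_poly[OF assms(1)]]
proof (intro allI impI)
  fix x assume x: "\<forall>i. eval_poly (partial_deriv i (exceptional_poly \<tau> ts)) x = 0"
  have inj: "inj_on \<tau> {1..6}" and im: "\<tau> ` {1..6} = UNIV"
    using assms(2) by (auto simp: bij_betw_def)
  have "distinct ts" using assms(1) by (simp add: cubic_support_def distinct_map)
  have "(\<Sum>t\<leftarrow>ts. twist t * dmono (\<lambda>v. x $ \<tau> v) i t) = 0" if i: "i \<in> {1..6}" for i
  proof -
    have "twist t * dmono (\<lambda>v. x $ \<tau> v) i t = eval_poly (partial_deriv (\<tau> i) (Poly_Mapping.single (xmon (map \<tau> t)) (twist t))) x"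
      if ts: "t \<in> set ts" for t
    proof -
      obtain a b c where t: "t = [a, b, c]"
        using cubic_supportD(1)[OF assms(1) ts] by (auto simp: numeral_3_eq_3 length_Suc_conv)
      have "\<tau> v = \<tau> i \<longleftrightarrow> v = i" if "v \<in> {a, b, c}" for v
        using inj i cubic_supportD(2)[OF assms(1) ts] that unfolding t by (auto dest: inj_onD)
      then show ?thesis
        unfolding t list.map eval_partial_deriv_xmon by simp
    qed
    then have "(\<Sum>t\<leftarrow>ts. twist t * dmono (\<lambda>v. x $ \<tau> v) i t)
        = (\<Sum>t\<in>set ts. eval_poly (partial_deriv (\<tau> i) (Poly_Mapping.single (xmon (map \<tau> t)) (twist t))) x)"
      using \<open>distinct ts\<close> by (simp add: sum_list_distinct_conv_sum_set)
    also have "\<dots> = eval_poly (partial_deriv (\<tau> i) (exceptional_poly \<tau> ts)) x"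
      by (simp add: exceptional_poly_def partial_deriv_sum eval_poly_sum)
    finally show ?thesis using x by simp
  qed
  then have "\<forall>i\<in>{1..6}. x $ \<tau> i = 0"
    using assms(3) unfolding no_singular_point_def by blast
  then have "x $ j = 0" for j
    using im by (metis UNIV_I imageE)
  then show "x = 0" by (simp add: vec_eq_iff)
qed

definition sorted_triples :: "nat list list" where
  "sorted_triples = [[a, b, c]. a \<leftarrow> [1, 2, 3, 4, 5, 6], b \<leftarrow> [1, 2, 3, 4, 5, 6], c \<leftarrow> [1, 2, 3, 4, 5, 6], a \<le> b, b \<le> c]"

text \<open>\<open>ts\<close> are the monomials of an exceptional polynomial, \<open>Ms\<close> all monomials of the same weight,
  and \<open>k\<close> is the coordinate that is normalised to \<open>1\<close>.\<close>

definition exceptional_weights :: "(nat \<times> nat list) list \<Rightarrow> nat list list \<Rightarrow> nat list list \<Rightarrow> nat \<Rightarrow> bool" where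
  "exceptional_weights gs ts Ms k \<longleftrightarrow> ts \<noteq> [] \<and> cubic_support ts \<and> cubic_support Ms \<and>
     List.member [1, 2, 3, 4, 5, 6] k \<and>
     list_all (\<lambda>(n, ws). 0 < n) gs \<and> list_all (\<lambda>(n, ws). ws ! (k - 1) = 0) gs \<and>
     list_all (\<lambda>t. same_weight gs t (hd ts)) ts \<and>
     list_all (\<lambda>t. same_weight gs t (hd ts) \<longleftrightarrow> List.member (map sort Ms) t) sorted_triples"

lemma sorted_triplesI:
  assumes "length t = 3" "set t \<subseteq> {1..6}"
  shows "sort t \<in> set sorted_triples"
proof -
  have t: "length (sort t) = 3" "set (sort t) \<subseteq> {1..6}"
    using assms by simp_all
  have "\<exists>a b c. u = [a, b, c]" if "length u = 3" for u :: "nat list"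
    using that by (auto simp: numeral_3_eq_3 length_Suc_conv)
  from this[OF t(1)] obtain a b c where s: "sort t = [a, b, c]" by blast
  have "a \<le> b" "b \<le> c"
    using sorted_sort[of t] unfolding s by auto
  have "set [a, b, c] \<subseteq> {1..6}"
    using t(2) unfolding s .
  also have "{1..6} = set [1, 2, 3, 4, 5, 6 :: nat]" by auto
  finally have abc: "a \<in> set [1, 2, 3, 4, 5, 6]" "b \<in> set [1, 2, 3, 4, 5, 6]"
    "c \<in> set [1, 2, 3, 4, 5, 6]" by auto
  define ks where "ks = [1, 2, 3, 4, 5, 6 :: nat]"
  have "[a, b, c] \<in> set [[a, b, c]. a \<leftarrow> ks, b \<leftarrow> ks, c \<leftarrow> ks, a \<le> b, b \<le> c]"
    using abc \<open>a \<le> b\<close> \<open>b \<le> c\<close> unfolding ks_def[symmetric] by auto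
  then show ?thesis
    unfolding s sorted_triples_def ks_def .
qed

section \<open>Numbering the coordinates, and the general exceptional case\<close>

lemma vector_6: "(vector [a, b, c, d, e, f] :: complex ^ 6) $ of_nat k = [a, b, c, d, e, f] ! (k - 1)" if
  "k \<in> {1..6}"
proof -
  have "(vector [a, b, c, d, e, f] :: complex ^ 6) $ 1 = a" "(vector [a, b, c, d, e, f] :: complex ^ 6) $ 2 = b"
    "(vector [a, b, c, d, e, f] :: complex ^ 6) $ 3 = c" "(vector [a, b, c, d, e, f] :: complex ^ 6) $ 4 = d"
    "(vector [a, b, c, d, e, f] :: complex ^ 6) $ 5 = e" "(vector [a, b, c, d, e, f] :: complex ^ 6) $ 6 = f"
    unfolding vector_def by simp_all
  moreover have "k = 1 \<or> k = 2 \<or> k = 3 \<or> k = 4 \<or> k = 5 \<or> k = 6" using that by auto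
  ultimately show ?thesis by auto
qed

text \<open>The index type 6 consists of residues modulo 6, in which 6 is 0; the numbers 1 to 6
  still represent every residue exactly once.\<close>

lemma bij_of_nat_6: "bij_betw (of_nat :: nat \<Rightarrow> 6) {1..6} UNIV"
proof -
  have "x \<in> of_nat ` {1..6}" for x :: 6
  proof (cases x)
    case (of_int z)
    then have z: "x = of_nat (nat z)" "z < 6" by (simp_all add: of_nat_nat)
    show ?thesis
    proof (cases "z = 0")
      case True
      with of_int have "x = of_nat 6" by simp
      then show ?thesis by (rule image_eqI) simp
    next
      case False
      with z(2) of_int have "nat z \<in> {1..6}" by auto
      with z(1) show ?thesis by blast
    qed
  qed
  then have im: "(of_nat :: nat \<Rightarrow> 6) ` {1..6} = UNIV" by blast
  have "inj_on (of_nat :: nat \<Rightarrow> 6) {1..6}"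
    by (rule eq_card_imp_inj_on) (simp_all only: im finite_atLeastAtMost card_atLeastAtMost card_bit0 card_bit1 card_num1, simp)
  with im show ?thesis
    unfolding bij_betw_def by (rule conjI[rotated])
qed

lemma same_weight_sort: "same_weight gs (sort t) u = same_weight gs t u"
proof -
  have "weight ws (sort t) = weight ws t" for ws
    by (simp only: weight_def sum_mset_sum_list[symmetric] mset_map mset_sort)
  then show ?thesis by (simp add: same_weight_def)
qed

lemma xmon_map_sort_eq: "sort t = sort u \<Longrightarrow> xmon (map \<tau> t) = xmon (map \<tau> u)"
  by (rule xmon_cong_mset) (metis mset_map mset_sort)

lemma count_list_map_inj: "inj f \<Longrightarrow> count_list (map f xs) (f x) = count_list xs x"
  by (induction xs) (auto dest: injD)

text \<open>What all exceptional sets have in common. The weights show that \<open>roots gs\<close>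
  acts by symmetries and that \<open>Ms\<close> lists all monomials of the right character;
  \<open>complete\<close>, the only part to be solved by hand, says that there are no further
  symmetries. Their finiteness is inherited from \<open>H\<close>.\<close>

lemma exceptional_case:
  fixes F :: "6 mpoly" and I :: "6 action_data" and H :: "('h, 'c) monoid_scheme"
  assumes "maximal_action F G P I"
    and \<tau>: "bij_betw \<tau> {1..6} UNIV"
    and T: "\<forall>t\<in>set ts. xmon (map \<tau> t) \<in> monomials_of 3 I"
    and nosing: "no_singular_point ts"
    and chk: "exceptional_weights gs ts Ms k"
    and H: "group H" "finite (carrier H)"
    and \<phi>: "bij_betw \<phi> (carrier H) (roots gs)"
      "\<And>x y. x \<in> carrier H \<Longrightarrow> y \<in> carrier H \<Longrightarrow> \<phi> (x \<otimes>\<^bsub>H\<^esub> y) = map2 (*) (\<phi> x) (\<phi> y)"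
    and inj: "\<And>zs zs'. zs \<in> roots gs \<Longrightarrow> zs' \<in> roots gs \<Longrightarrow>
      \<forall>i\<in>{1..6}. root_vec gs zs i = root_vec gs zs' i \<Longrightarrow> zs = zs'"
    and complete: "\<And>w. \<forall>i\<in>{1..6}. w i \<noteq> 0 \<Longrightarrow> w k = 1 \<Longrightarrow>
      \<forall>t\<in>set ts. prod_list (map w t) = prod_list (map w (hd ts)) \<Longrightarrow>
      \<exists>zs\<in>roots gs. \<forall>i\<in>{1..6}. w i = root_vec gs zs i"
  shows "same_up_to_perm (in_coords P G) (monomials_of 3 I)
      ((\<lambda>zs. vector (map (root_vec gs zs) [1, 2, 3, 4, 5, 6])) ` roots gs)
      (set (map (\<lambda>t. xmon (map of_nat t)) Ms)) \<and> sub_PGL G \<cong> H"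
proof -
  interpret maximal_action F G P I by fact
  define E where "E = exceptional_poly \<tau> ts"
  define V where "V = diag_symmetries E (\<tau> k)"
  \<comment> \<open>\<open>\<rho>\<close> returns the number of a variable, and
    \<open>\<psi>\<close> puts the values of \<open>root_vec\<close> on the named variables.\<close>
  define \<rho> where "\<rho> = inv_into {1..6} \<tau>"
  define \<psi> where "\<psi> zs = (\<chi> j. root_vec gs zs (\<rho> j))" for zs
  have \<tau>_inj: "inj_on \<tau> {1..6}" and \<tau>_im: "\<tau> ` {1..6} = UNIV"
    using \<tau> by (auto simp: bij_betw_def)
  have \<rho>: "\<rho> j \<in> {1..6}" "\<tau> (\<rho> j) = j" for j
    unfolding \<rho>_def using \<tau>_im by (metis UNIV_I inv_into_into, metis UNIV_I f_inv_into_f)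
  have \<rho>\<tau>: "\<rho> (\<tau> i) = i" if "i \<in> {1..6}" for i
    unfolding \<rho>_def using \<tau>_inj that by (rule inv_into_f_f)
  have ts: "ts \<noteq> []" "cubic_support ts" and Ms: "cubic_support Ms" and k: "k \<in> {1..6}"
    and pos: "list_all (\<lambda>(n, ws). 0 < n) gs" and kw: "list_all (\<lambda>(n, ws). ws ! (k - 1) = 0) gs"
    and tw: "\<And>t. t \<in> set ts \<Longrightarrow> same_weight gs t (hd ts)"
    and Mw: "\<And>t. t \<in> set sorted_triples \<Longrightarrow> same_weight gs t (hd ts) \<longleftrightarrow> t \<in> set (map sort Ms)"
    using chk by (auto simp: exceptional_weights_def list_all_iff)
  have keys: "Poly_Mapping.keys E = (\<lambda>t. xmon (map \<tau> t)) ` set ts"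
    unfolding E_def by (rule keys_exceptional_poly[OF ts(2) \<tau>_inj])
  define m0 where "m0 = xmon (map \<tau> (hd ts))"
  have m0: "m0 \<in> Poly_Mapping.keys E"
    using ts(1) by (auto simp: keys m0_def)
  have E: "homogeneous 3 E" "smooth E" "Poly_Mapping.keys E \<subseteq> monomials_of 3 I"
    unfolding keys using T homogeneous_exceptional_poly[OF ts(2)] smooth_exceptional_poly[OF ts(2) \<tau> nosing]
    by (auto simp: E_def)
  have hd: "set (hd ts) \<subseteq> {1..6}" and ts_sub: "\<And>t. t \<in> set ts \<Longrightarrow> set t \<subseteq> {1..6}"
    using cubic_supportD(2)[OF ts(2)] ts(1) by auto
  have val: "mono_val (\<psi> zs) (xmon (map \<tau> t)) = prod_list (map (root_vec gs zs) t)" if "set t \<subseteq> {1..6}" for zs t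
  proof -
    have "map (($) (\<psi> zs)) (map \<tau> t) = map (root_vec gs zs) t"
      using that \<rho>\<tau> by (auto simp: \<psi>_def subset_eq)
    then show ?thesis by (simp only: mono_val_xmon)
  qed
  have V: "V = \<psi> ` roots gs"
  proof
    show "\<psi> ` roots gs \<subseteq> V"
    proof
      fix v assume "v \<in> \<psi> ` roots gs"
      then obtain zs where zs: "zs \<in> roots gs" "v = \<psi> zs" by auto
      have eq: "mono_val v (xmon (map \<tau> t)) = mono_val v m0" if "t \<in> set ts" for t
        using same_weight_iff[OF pos, of t "hd ts"] tw[OF that] zs
        by (simp add: val[OF ts_sub[OF that]] val[OF hd] m0_def)
      show "v \<in> V"
        unfolding V_def
      proof (rule diag_symmetriesI)
        show "v $ i \<noteq> 0" for i
          using root_vec_nonzero[OF pos zs(1)] by (simp add: zs(2) \<psi>_def)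
        show "v $ \<tau> k = 1"
          using root_vec_fixed[OF kw] \<rho>\<tau>[OF k] by (simp add: zs(2) \<psi>_def)
        show "mono_val v m = mono_val v m'" if "m \<in> Poly_Mapping.keys E" "m' \<in> Poly_Mapping.keys E" for m m'
          using that eq unfolding keys by force
      qed
    qed
    \<comment> \<open>A symmetry gives all monomials of \<open>ts\<close> the same value; solving
      these equations is the task of \<open>complete\<close>.\<close>
    show "V \<subseteq> \<psi> ` roots gs"
    proof
      fix v assume v: "v \<in> V"
      note D = diag_symmetriesD[OF v[unfolded V_def]]
      have "\<exists>zs\<in>roots gs. \<forall>i\<in>{1..6}. (\<lambda>i. v $ \<tau> i) i = root_vec gs zs i"
      proof (rule complete)
        show "\<forall>t\<in>set ts. prod_list (map (\<lambda>i. v $ \<tau> i) t) = prod_list (map (\<lambda>i. v $ \<tau> i) (hd ts))"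
        proof
          fix t assume "t \<in> set ts"
          then have "mono_val v (xmon (map \<tau> t)) = mono_val v m0"
            using m0 by (intro D(3)) (auto simp: keys)
          then show "prod_list (map (\<lambda>i. v $ \<tau> i) t) = prod_list (map (\<lambda>i. v $ \<tau> i) (hd ts))"
            by (simp add: mono_val_xmon m0_def o_def)
        qed
      qed (use D(1,2) in auto)
      then obtain zs where zs: "zs \<in> roots gs" "\<forall>i\<in>{1..6}. v $ \<tau> i = root_vec gs zs i" by auto
      have "v = \<psi> zs"
        using zs(2) \<rho> unfolding vec_eq_iff \<psi>_def by (metis vec_lambda_beta)
      with zs(1) show "v \<in> \<psi> ` roots gs" by blast
    qed
  qed
  have fin: "finite V"
    unfolding V bij_betw_imp_surj_on[OF \<phi>(1), symmetric] using H(2) by simp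
  have G: "G = conj_class ` V"
    unfolding V_def using maximal_diag_symmetries[OF E m0] fin by (simp add: V_def)
  have S: "monomials_of 3 I = {m. mono_deg m = 3 \<and> (\<forall>v\<in>V. mono_val v m = mono_val v m0)}"
    unfolding V_def using monomials_of_maximal[OF E m0] fin by (simp add: V_def)
  \<comment> \<open>The permutation asked for: from a variable to its number, read in the index
    type.\<close>
  define \<sigma> where "\<sigma> j = (of_nat (\<rho> j) :: 6)" for j
  have \<sigma>\<tau>: "\<sigma> (\<tau> i) = of_nat i" if "i \<in> {1..6}" for i
    using \<rho>\<tau>[OF that] by (simp add: \<sigma>_def)
  have "bij \<sigma>"
  proof -
    have "bij_betw \<rho> UNIV {1..6}"
      unfolding \<rho>_def by (rule bij_betw_inv_into[OF \<tau>])
    from bij_betw_trans[OF this bij_of_nat_6] show ?thesis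
      by (simp add: \<sigma>_def[abs_def] o_def)
  qed
  have member: "xmon (map \<tau> t) \<in> monomials_of 3 I \<longleftrightarrow> sort t \<in> set (map sort Ms)" if
    "length t = 3" "set t \<subseteq> {1..6}" for t
  proof -
    have "xmon (map \<tau> t) \<in> monomials_of 3 I \<longleftrightarrow>
        (\<forall>zs\<in>roots gs. prod_list (map (root_vec gs zs) t) = prod_list (map (root_vec gs zs) (hd ts)))"
      unfolding S V using that hd by (simp add: val m0_def)
    also have "\<dots> \<longleftrightarrow> same_weight gs (sort t) (hd ts)"
      unfolding same_weight_iff[OF pos] same_weight_sort ..
    also have "\<dots> \<longleftrightarrow> sort t \<in> set (map sort Ms)"
      by (rule Mw[OF sorted_triplesI[OF that]])
    finally show ?thesis .
  qed
  \<comment> \<open>On 1, ..., 6 the composition of \<open>\<sigma>\<close> and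
    \<open>\<tau>\<close> is \<open>of_nat\<close>, so renaming by \<open>\<sigma>\<close> matches
    the numbered monomial with the one named by \<open>\<tau>\<close>.\<close>
  have transport: "(\<forall>i. Poly_Mapping.lookup m i = Poly_Mapping.lookup (xmon (map of_nat t)) (\<sigma> i)) \<longleftrightarrow> m = xmon (map \<tau> t)"
    if "set t \<subseteq> {1..6}" for m t
  proof -
    have "map of_nat t = map \<sigma> (map \<tau> t)"
      using that \<sigma>\<tau> by (auto simp: subset_eq)
    then have "Poly_Mapping.lookup (xmon (map of_nat t)) (\<sigma> i) = Poly_Mapping.lookup (xmon (map \<tau> t)) i" for i
      using \<open>bij \<sigma>\<close> by (simp only: lookup_xmon) (metis bij_is_inj count_list_map_inj)
    then show ?thesis
      by (auto intro: poly_mapping_eqI)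
  qed
  have "same_up_to_perm (in_coords P G) (monomials_of 3 I)
      ((\<lambda>zs. vector (map (root_vec gs zs) [1, 2, 3, 4, 5, 6])) ` roots gs) (set (map (\<lambda>t. xmon (map of_nat t)) Ms))"
    unfolding same_up_to_perm_def
  proof (intro exI[of _ \<sigma>] conjI)
    show "\<sigma> permutes UNIV"
      using \<open>bij \<sigma>\<close> by (intro bij_imp_permutes) auto
    have "(\<chi> i. (vector (map (root_vec gs zs) [1, 2, 3, 4, 5, 6]) :: complex ^ 6) $ \<sigma> i) = \<psi> zs" for zs
    proof -
      have "(vector (map (root_vec gs zs) [1, 2, 3, 4, 5, 6]) :: complex ^ 6) $ of_nat i = root_vec gs zs i" if
        "i \<in> {1..6}" for i
      proof -
        have "i = 1 \<or> i = 2 \<or> i = 3 \<or> i = 4 \<or> i = 5 \<or> i = 6" using that by auto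
        then show ?thesis
          using vector_6[OF that, of "root_vec gs zs 1" "root_vec gs zs 2" "root_vec gs zs 3" "root_vec gs zs 4"
              "root_vec gs zs 5" "root_vec gs zs 6"] by auto
      qed
      then show ?thesis
        using \<rho>(1) by (simp add: \<sigma>_def \<psi>_def vec_eq_iff)
    qed
    moreover have "in_coords P G = (\<lambda>v. pgl_class (diag_mat v)) ` V"
      by (simp only: G in_coords_conj_class)
    ultimately show "in_coords P G = (\<lambda>v. pgl_class (diag_mat (\<chi> i. v $ \<sigma> i))) `
        (\<lambda>zs. vector (map (root_vec gs zs) [1, 2, 3, 4, 5, 6])) ` roots gs"
      by (simp only: V image_image)
    show "monomials_of 3 I = {m. \<exists>m'\<in>set (map (\<lambda>t. xmon (map of_nat t)) Ms).
        \<forall>i. Poly_Mapping.lookup m i = Poly_Mapping.lookup m' (\<sigma> i)}"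
    proof (intro Set.set_eqI iffI)
      fix m assume m: "m \<in> monomials_of 3 I"
      then obtain a b c where "m = xmon [a, b, c]"
        unfolding S using cubic_monomial[of m] by auto
      then have m': "m = xmon (map \<tau> [\<rho> a, \<rho> b, \<rho> c])"
        by (simp add: \<rho>)
      have "sort [\<rho> a, \<rho> b, \<rho> c] \<in> set (map sort Ms)"
        using m member[of "[\<rho> a, \<rho> b, \<rho> c]"] \<rho>(1) unfolding m' by auto
      then obtain t where t: "t \<in> set Ms" "sort t = sort [\<rho> a, \<rho> b, \<rho> c]"
        by (metis (mono_tags) imageE set_map)
      have "m = xmon (map \<tau> t)"
        unfolding m' by (metis t(2) xmon_map_sort_eq)
      with transport[OF cubic_supportD(2)[OF Ms t(1)], of m] t(1)
      show "m \<in> {m. \<exists>m'\<in>set (map (\<lambda>t. xmon (map of_nat t)) Ms). \<forall>i. Poly_Mapping.lookup m i = Poly_Mapping.lookup m' (\<sigma> i)}"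
        by auto
    next
      fix m assume "m \<in> {m. \<exists>m'\<in>set (map (\<lambda>t. xmon (map of_nat t)) Ms). \<forall>i. Poly_Mapping.lookup m i = Poly_Mapping.lookup m' (\<sigma> i)}"
      then obtain t where t: "t \<in> set Ms"
        "\<forall>i. Poly_Mapping.lookup m i = Poly_Mapping.lookup (xmon (map of_nat t)) (\<sigma> i)"
        by auto
      then have "m = xmon (map \<tau> t)"
        using transport[OF cubic_supportD(2)[OF Ms t(1)], of m] by blast
      moreover have "sort t \<in> set (map sort Ms)" using t(1) by auto
      ultimately show "m \<in> monomials_of 3 I"
        using member[OF cubic_supportD[OF Ms t(1)]] by simp
    qed
  qed
  moreover have "sub_PGL G \<cong> H"
  proof (rule group.iso_sym[OF H(1)])
    have \<phi>_roots: "\<phi> x \<in> roots gs" if "x \<in> carrier H" for x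
      using that \<phi>(1) by (auto simp: bij_betw_def)
    define f where "f = (\<lambda>x. conj_class (\<psi> (\<phi> x)))"
    have "inj_on \<psi> (roots gs)"
    proof (rule inj_onI)
      fix zs zs' assume zs: "zs \<in> roots gs" "zs' \<in> roots gs" "\<psi> zs = \<psi> zs'"
      have "root_vec gs zs i = root_vec gs zs' i" if "i \<in> {1..6}" for i
        using arg_cong[OF zs(3), of "\<lambda>v. v $ \<tau> i"] \<rho>\<tau>[OF that] by (simp add: \<psi>_def)
      then show "zs = zs'" using inj[OF zs(1,2)] by blast
    qed
    then have "bij_betw \<psi> (roots gs) V"
      by (simp add: bij_betw_def V)
    moreover have "bij_betw conj_class V G"
      using conj_class_inj[of E "\<tau> k"] G by (simp add: bij_betw_def V_def)
    ultimately have "bij_betw f (carrier H) G"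
      using bij_betw_trans[OF bij_betw_trans[OF \<phi>(1)]] by (simp add: f_def o_def)
    moreover have "f (x \<otimes>\<^bsub>H\<^esub> y) = f x \<otimes>\<^bsub>PGL\<^esub> f y" if x: "x \<in> carrier H" and y: "y \<in> carrier H" for x y
    proof -
      have nz: "\<forall>i. \<psi> (\<phi> x) $ i \<noteq> 0" if "x \<in> carrier H" for x
        using root_vec_nonzero[OF pos \<phi>_roots[OF that]] by (simp add: \<psi>_def)
      have "\<psi> (\<phi> (x \<otimes>\<^bsub>H\<^esub> y)) = (\<chi> i. \<psi> (\<phi> x) $ i * \<psi> (\<phi> y) $ i)"
        unfolding \<phi>(2)[OF x y] by (simp add: \<psi>_def root_vec_mult \<phi>_roots x y vec_eq_iff)
      then show ?thesis
        unfolding f_def conj_class_mult[OF nz[OF x] nz[OF y]] by simp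
    qed
    ultimately have "f \<in> Group.iso H (sub_PGL G)"
      by (auto simp: Group.iso_def hom_def bij_betw_def)
    then show "H \<cong> sub_PGL G"
      by (auto simp: is_iso_def)
  qed
  ultimately show ?thesis ..
qed

lemma atLeastAtMost_1_6: "{1..6} = {1, 2, 3, 4, 5, 6 :: nat}"
  by auto

section \<open>Cyclic groups of roots of unity\<close>

definition root_group :: "nat \<Rightarrow> complex monoid" where
  "root_group n = \<lparr>carrier = {z. z ^ n = 1}, mult = (*), one = 1\<rparr>"

lemma group_root_group: "0 < n \<Longrightarrow> group (root_group n)"
proof (rule groupI)
  fix z assume "0 < n" "z \<in> carrier (root_group n)"
  moreover from this have "z \<noteq> 0"
    by (auto simp: root_group_def power_0_left)
  ultimately show "\<exists>u\<in>carrier (root_group n). u \<otimes>\<^bsub>root_group n\<^esub> z = \<one>\<^bsub>root_group n\<^esub>"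
    by (intro bexI[of _ "inverse z"]) (auto simp: root_group_def power_inverse)
qed (auto simp: root_group_def power_mult_distrib)

lemma finite_root_group: "0 < n \<Longrightarrow> finite (carrier (root_group n))"
  using finite_roots_unity[of n] by (simp add: root_group_def)

text \<open>Powers of the primitive root \<open>cis (2 * pi / n)\<close> give the isomorphism. The
  multiplicative model serves as an intermediate step because it agrees with the entries of
  \<open>roots\<close>.\<close>

lemma root_group_iso:
  assumes "0 < n"
  shows "root_group n \<cong> Cyc n"
proof -
  define f where "f a = cis (2 * pi / n) ^ nat a" for a :: int
  have one: "cis (2 * pi / n) ^ n = 1"
    using assms by (simp add: DeMoivre)
  have "bij_betw nat {0..<int n} {..<n}"
    by (rule bij_betw_byWitness[where f' = int]) auto
  moreover have "bij_betw (\<lambda>k. cis (2 * pi / n) ^ k) {..<n} {z. z ^ n = 1}"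
    using bij_betw_roots_unity[OF assms] by (simp add: DeMoivre mult_ac)
  ultimately have "bij_betw ((\<lambda>k. cis (2 * pi / n) ^ k) \<circ> nat) {0..<int n} {z. z ^ n = 1}"
    by (rule bij_betw_trans)
  then have "bij_betw f (carrier (Cyc n)) (carrier (root_group n))"
    using assms by (simp add: f_def[abs_def] o_def carrier_integer_mod_group root_group_def)
  moreover have "f ((a + b) mod int n) = f a * f b" if "a \<in> {0..<int n}" "b \<in> {0..<int n}" for a b
  proof -
    have "nat ((a + b) mod int n) = (nat a + nat b) mod n"
      using that by (simp add: nat_mod_distrib nat_add_distrib)
    then show ?thesis
      unfolding f_def power_add[symmetric] by (intro root_of_unity_power_eq[OF one]) simp
  qed
  ultimately have "f \<in> Group.iso (Cyc n) (root_group n)"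
    using assms
    by (auto simp: Group.iso_def hom_def carrier_integer_mod_group mult_integer_mod_group root_group_def bij_betw_def)
  then have "Cyc n \<cong> root_group n" by (auto simp: is_iso_def)
  then show ?thesis by (rule group.iso_sym[OF group_integer_mod_group])
qed

text \<open>Divides a vanishing derivative by a constant \<open>g\<close>, in practice 1, 2 or 3,
  common to its terms.\<close>

lemma mult_cancel_0: "g \<noteq> 0 \<Longrightarrow> s = g * l \<Longrightarrow> s = 0 \<Longrightarrow> l = (0 :: complex)"
  by simp

section \<open>Smoothness of the exceptional cubics\<close>

lemma exceptional_nonsingular_0: "no_singular_point (exceptional_supports ! 0)"
  unfolding no_singular_point_def
proof (intro allI impI)
  fix y :: "nat \<Rightarrow> complex"
  assume "\<forall>i\<in>{1..6}. (\<Sum>t\<leftarrow>exceptional_supports ! 0. twist t * dmono y i t) = 0"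
  then have e: "(\<Sum>t\<leftarrow>exceptional_supports ! 0. twist t * dmono y i t) = 0" if "i \<in> {1, 2, 3, 4, 5, 6}" for i
    using that by auto
  have e1: "2 * y 1 * y 2 + (y 3)\<^sup>2 + (y 4)\<^sup>2 + 2 * y 5 * y 6 = 0"
    by (rule mult_cancel_0[of 1, OF _ _ e[of 1]])
      (simp_all add: exceptional_supports_def twist_def algebra_simps power2_eq_square)
  have e2: "(y 1)\<^sup>2 + 2 * y 2 * y 3 + (y 5)\<^sup>2 + 2 * y 4 * y 6 = 0"
    by (rule mult_cancel_0[of 1, OF _ _ e[of 2]])
      (simp_all add: exceptional_supports_def twist_def algebra_simps power2_eq_square)
  have e3: "(y 2)\<^sup>2 + 2 * y 1 * y 3 + (y 6)\<^sup>2 + 2 * y 4 * y 5 = 0"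
    by (rule mult_cancel_0[of 1, OF _ _ e[of 3]])
      (simp_all add: exceptional_supports_def twist_def algebra_simps power2_eq_square)
  have e4: "y 1 * y 4 + y 3 * y 5 + y 2 * y 6 = 0"
    by (rule mult_cancel_0[of 2, OF _ _ e[of 4]])
      (simp_all add: exceptional_supports_def twist_def algebra_simps power2_eq_square)
  have e5: "y 2 * y 5 + y 3 * y 4 + y 1 * y 6 = 0"
    by (rule mult_cancel_0[of 2, OF _ _ e[of 5]])
      (simp_all add: exceptional_supports_def twist_def algebra_simps power2_eq_square)
  have e6: "y 3 * y 6 + y 1 * y 5 + y 2 * y 4 = 0"
    by (rule mult_cancel_0[of 2, OF _ _ e[of 6]])
      (simp_all add: exceptional_supports_def twist_def algebra_simps power2_eq_square)
  have "y 1 = 0 \<and> y 2 = 0 \<and> y 3 = 0 \<and> y 4 = 0 \<and> y 5 = 0 \<and> y 6 = 0"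
    by (rule exceptional_smooth_1) (use e1 e2 e3 e4 e5 e6 in \<open>simp_all add: algebra_simps\<close>)
  then show "\<forall>i\<in>{1..6}. y i = 0"
    unfolding atLeastAtMost_1_6 by simp
qed

lemma exceptional_nonsingular_1: "no_singular_point (exceptional_supports ! 1)"
  unfolding no_singular_point_def
proof (intro allI impI)
  fix y :: "nat \<Rightarrow> complex"
  assume "\<forall>i\<in>{1..6}. (\<Sum>t\<leftarrow>exceptional_supports ! 1. twist t * dmono y i t) = 0"
  then have e: "(\<Sum>t\<leftarrow>exceptional_supports ! 1. twist t * dmono y i t) = 0" if "i \<in> {1, 2, 3, 4, 5, 6}" for i
    using that by auto
  have e1: "y 1 * y 2 + y 5 * y 6 = 0"
    by (rule mult_cancel_0[of 2, OF _ _ e[of 1]])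
      (simp_all add: exceptional_supports_def twist_def algebra_simps power2_eq_square)
  have e2: "(y 1)\<^sup>2 + 2 * y 2 * y 3 + (y 5)\<^sup>2 + 2 * y 4 * y 6 = 0"
    by (rule mult_cancel_0[of 1, OF _ _ e[of 2]])
      (simp_all add: exceptional_supports_def twist_def algebra_simps power2_eq_square)
  have e3: "(y 2)\<^sup>2 + 2 * y 3 * y 4 + (y 6)\<^sup>2 = 0"
    by (rule mult_cancel_0[of 1, OF _ _ e[of 3]])
      (simp_all add: exceptional_supports_def twist_def algebra_simps power2_eq_square)
  have e4: "(y 3)\<^sup>2 + 3 * (y 4)\<^sup>2 + 2 * y 2 * y 6 = 0"
    by (rule mult_cancel_0[of 1, OF _ _ e[of 4]])
      (simp_all add: exceptional_supports_def twist_def algebra_simps power2_eq_square)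
  have e5: "y 2 * y 5 + y 1 * y 6 = 0"
    by (rule mult_cancel_0[of 2, OF _ _ e[of 5]])
      (simp_all add: exceptional_supports_def twist_def algebra_simps power2_eq_square)
  have e6: "y 1 * y 5 + y 3 * y 6 + y 2 * y 4 = 0"
    by (rule mult_cancel_0[of 2, OF _ _ e[of 6]])
      (simp_all add: exceptional_supports_def twist_def algebra_simps power2_eq_square)
  have "y 1 = 0 \<and> y 2 = 0 \<and> y 3 = 0 \<and> y 4 = 0 \<and> y 5 = 0 \<and> y 6 = 0"
    by (rule exceptional_smooth_2) (use e1 e2 e3 e4 e5 e6 in \<open>simp_all add: algebra_simps\<close>)
  then show "\<forall>i\<in>{1..6}. y i = 0"
    unfolding atLeastAtMost_1_6 by simp
qed

lemma exceptional_nonsingular_2: "no_singular_point (exceptional_supports ! 2)"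
  unfolding no_singular_point_def
proof (intro allI impI)
  fix y :: "nat \<Rightarrow> complex"
  assume "\<forall>i\<in>{1..6}. (\<Sum>t\<leftarrow>exceptional_supports ! 2. twist t * dmono y i t) = 0"
  then have e: "(\<Sum>t\<leftarrow>exceptional_supports ! 2. twist t * dmono y i t) = 0" if "i \<in> {1, 2, 3, 4, 5, 6}" for i
    using that by auto
  have e1: "y 1 * y 2 = 0"
    by (rule mult_cancel_0[of 2, OF _ _ e[of 1]])
      (simp_all add: exceptional_supports_def twist_def algebra_simps power2_eq_square)
  have e2: "(y 1)\<^sup>2 + 2 * y 4 * y 5 + 2 * y 2 * y 3 = 0"
    by (rule mult_cancel_0[of 1, OF _ _ e[of 2]])
      (simp_all add: exceptional_supports_def twist_def algebra_simps power2_eq_square)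
  have e3: "(y 2)\<^sup>2 + 3 * (y 3)\<^sup>2 + (y 5)\<^sup>2 = 0"
    by (rule mult_cancel_0[of 1, OF _ _ e[of 3]])
      (simp_all add: exceptional_supports_def twist_def algebra_simps power2_eq_square)
  have e4: "y 2 * y 5 + y 4 * y 6 = 0"
    by (rule mult_cancel_0[of 2, OF _ _ e[of 4]])
      (simp_all add: exceptional_supports_def twist_def algebra_simps power2_eq_square)
  have e5: "y 2 * y 4 + y 3 * y 5 = 0"
    by (rule mult_cancel_0[of 2, OF _ _ e[of 5]])
      (simp_all add: exceptional_supports_def twist_def algebra_simps power2_eq_square)
  have e6: "(y 4)\<^sup>2 + 3 * (y 6)\<^sup>2 = 0"
    by (rule mult_cancel_0[of 1, OF _ _ e[of 6]])
      (simp_all add: exceptional_supports_def twist_def algebra_simps power2_eq_square)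
  have "y 1 = 0 \<and> y 2 = 0 \<and> y 3 = 0 \<and> y 4 = 0 \<and> y 5 = 0 \<and> y 6 = 0"
    by (rule exceptional_smooth_3) (use e1 e2 e3 e4 e5 e6 in \<open>simp_all add: algebra_simps\<close>)
  then show "\<forall>i\<in>{1..6}. y i = 0"
    unfolding atLeastAtMost_1_6 by simp
qed

lemma exceptional_nonsingular_3: "no_singular_point (exceptional_supports ! 3)"
  unfolding no_singular_point_def
proof (intro allI impI)
  fix y :: "nat \<Rightarrow> complex"
  assume "\<forall>i\<in>{1..6}. (\<Sum>t\<leftarrow>exceptional_supports ! 3. twist t * dmono y i t) = 0"
  then have e: "(\<Sum>t\<leftarrow>exceptional_supports ! 3. twist t * dmono y i t) = 0" if "i \<in> {1, 2, 3, 4, 5, 6}" for i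
    using that by auto
  have e1: "y 1 * y 2 + y 4 * y 5 = 0"
    by (rule mult_cancel_0[of 2, OF _ _ e[of 1]])
      (simp_all add: exceptional_supports_def twist_def algebra_simps power2_eq_square)
  have e2: "(y 1)\<^sup>2 + 2 * y 2 * y 3 + 2 * y 2 * y 6 + (y 4)\<^sup>2 = 0"
    by (rule mult_cancel_0[of 1, OF _ _ e[of 2]])
      (simp_all add: exceptional_supports_def twist_def algebra_simps power2_eq_square)
  have e3: "(y 2)\<^sup>2 + 3 * (y 3)\<^sup>2 + (y 6)\<^sup>2 = 0"
    by (rule mult_cancel_0[of 1, OF _ _ e[of 3]])
      (simp_all add: exceptional_supports_def twist_def algebra_simps power2_eq_square)
  have e4: "y 1 * y 5 + y 2 * y 4 = 0"
    by (rule mult_cancel_0[of 2, OF _ _ e[of 4]])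
      (simp_all add: exceptional_supports_def twist_def algebra_simps power2_eq_square)
  have e5: "y 1 * y 4 + y 5 * y 6 = 0"
    by (rule mult_cancel_0[of 2, OF _ _ e[of 5]])
      (simp_all add: exceptional_supports_def twist_def algebra_simps power2_eq_square)
  have e6: "(y 2)\<^sup>2 + 2 * y 3 * y 6 + (y 5)\<^sup>2 = 0"
    by (rule mult_cancel_0[of 1, OF _ _ e[of 6]])
      (simp_all add: exceptional_supports_def twist_def algebra_simps power2_eq_square)
  have "y 1 = 0 \<and> y 2 = 0 \<and> y 3 = 0 \<and> y 4 = 0 \<and> y 5 = 0 \<and> y 6 = 0"
    by (rule exceptional_smooth_4) (use e1 e2 e3 e4 e5 e6 in \<open>simp_all add: algebra_simps\<close>)
  then show "\<forall>i\<in>{1..6}. y i = 0"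
    unfolding atLeastAtMost_1_6 by simp
qed

lemma exceptional_nonsingular_4: "no_singular_point (exceptional_supports ! 4)"
  unfolding no_singular_point_def
proof (intro allI impI)
  fix y :: "nat \<Rightarrow> complex"
  assume "\<forall>i\<in>{1..6}. (\<Sum>t\<leftarrow>exceptional_supports ! 4. twist t * dmono y i t) = 0"
  then have e: "(\<Sum>t\<leftarrow>exceptional_supports ! 4. twist t * dmono y i t) = 0" if "i \<in> {1, 2, 3, 4, 5, 6}" for i
    using that by auto
  have e1: "y 1 * y 2 + y 4 * y 5 = 0"
    by (rule mult_cancel_0[of 2, OF _ _ e[of 1]])
      (simp_all add: exceptional_supports_def twist_def algebra_simps power2_eq_square)
  have e2: "(y 1)\<^sup>2 + 2 * y 2 * y 3 + (y 4)\<^sup>2 + 2 * y 5 * y 6 = 0"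
    by (rule mult_cancel_0[of 1, OF _ _ e[of 2]])
      (simp_all add: exceptional_supports_def twist_def algebra_simps power2_eq_square)
  have e3: "(y 2)\<^sup>2 + 3 * (y 3)\<^sup>2 + (y 5)\<^sup>2 + (y 6)\<^sup>2 = 0"
    by (rule mult_cancel_0[of 1, OF _ _ e[of 3]])
      (simp_all add: exceptional_supports_def twist_def algebra_simps power2_eq_square)
  have e4: "y 2 * y 4 + y 1 * y 5 = 0"
    by (rule mult_cancel_0[of 2, OF _ _ e[of 4]])
      (simp_all add: exceptional_supports_def twist_def algebra_simps power2_eq_square)
  have e5: "y 1 * y 4 + y 3 * y 5 + y 2 * y 6 = 0"
    by (rule mult_cancel_0[of 2, OF _ _ e[of 5]])
      (simp_all add: exceptional_supports_def twist_def algebra_simps power2_eq_square)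
  have e6: "y 2 * y 5 + y 3 * y 6 = 0"
    by (rule mult_cancel_0[of 2, OF _ _ e[of 6]])
      (simp_all add: exceptional_supports_def twist_def algebra_simps power2_eq_square)
  have "y 1 = 0 \<and> y 2 = 0 \<and> y 3 = 0 \<and> y 4 = 0 \<and> y 5 = 0 \<and> y 6 = 0"
    by (rule exceptional_smooth_5) (use e1 e2 e3 e4 e5 e6 in \<open>simp_all add: algebra_simps\<close>)
  then show "\<forall>i\<in>{1..6}. y i = 0"
    unfolding atLeastAtMost_1_6 by simp
qed

lemma exceptional_nonsingular_5: "no_singular_point (exceptional_supports ! 5)"
  unfolding no_singular_point_def
proof (intro allI impI)
  fix y :: "nat \<Rightarrow> complex"
  assume "\<forall>i\<in>{1..6}. (\<Sum>t\<leftarrow>exceptional_supports ! 5. twist t * dmono y i t) = 0"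
  then have e: "(\<Sum>t\<leftarrow>exceptional_supports ! 5. twist t * dmono y i t) = 0" if "i \<in> {1, 2, 3, 4, 5, 6}" for i
    using that by auto
  have e1: "y 1 * y 4 + y 2 * y 3 = 0"
    by (rule mult_cancel_0[of 2, OF _ _ e[of 1]])
      (simp_all add: exceptional_supports_def twist_def algebra_simps power2_eq_square)
  have e2: "y 2 * y 4 + y 1 * y 3 = 0"
    by (rule mult_cancel_0[of 2, OF _ _ e[of 2]])
      (simp_all add: exceptional_supports_def twist_def algebra_simps power2_eq_square)
  have e3: "y 3 * y 4 + y 1 * y 2 = 0"
    by (rule mult_cancel_0[of 2, OF _ _ e[of 3]])
      (simp_all add: exceptional_supports_def twist_def algebra_simps power2_eq_square)
  have e4: "(y 1)\<^sup>2 + (y 2)\<^sup>2 + (y 3)\<^sup>2 + 3 * (y 4)\<^sup>2 = 0"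
    by (rule mult_cancel_0[of 1, OF _ _ e[of 4]])
      (simp_all add: exceptional_supports_def twist_def algebra_simps power2_eq_square)
  have e5: "(y 5)\<^sup>2 = 0"
    by (rule mult_cancel_0[of 3, OF _ _ e[of 5]])
      (simp_all add: exceptional_supports_def twist_def algebra_simps power2_eq_square)
  have e6: "(y 6)\<^sup>2 = 0"
    by (rule mult_cancel_0[of 3, OF _ _ e[of 6]])
      (simp_all add: exceptional_supports_def twist_def algebra_simps power2_eq_square)
  \<comment> \<open>The cubic is a cubic in x_1, ..., x_4 plus the cubes of x_5 and x_6.\<close>
  have "y 1 = 0 \<and> y 2 = 0 \<and> y 3 = 0 \<and> y 4 = 0"
    by (rule four_quadrics) (use e1 e2 e3 e4 in \<open>simp_all add: algebra_simps\<close>)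
  with e5 e6 have "y 1 = 0 \<and> y 2 = 0 \<and> y 3 = 0 \<and> y 4 = 0 \<and> y 5 = 0 \<and> y 6 = 0" by auto
  then show "\<forall>i\<in>{1..6}. y i = 0"
    unfolding atLeastAtMost_1_6 by simp
qed

lemma exceptional_nonsingular_6: "no_singular_point (exceptional_supports ! 6)"
  unfolding no_singular_point_def
proof (intro allI impI)
  fix y :: "nat \<Rightarrow> complex"
  assume "\<forall>i\<in>{1..6}. (\<Sum>t\<leftarrow>exceptional_supports ! 6. twist t * dmono y i t) = 0"
  then have e: "(\<Sum>t\<leftarrow>exceptional_supports ! 6. twist t * dmono y i t) = 0" if "i \<in> {1, 2, 3, 4, 5, 6}" for i
    using that by auto
  have e1: "y 1 * y 5 + y 2 * y 3 = 0"
    by (rule mult_cancel_0[of 2, OF _ _ e[of 1]])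
      (simp_all add: exceptional_supports_def twist_def algebra_simps power2_eq_square)
  have e2: "y 2 * y 5 + y 1 * y 3 = 0"
    by (rule mult_cancel_0[of 2, OF _ _ e[of 2]])
      (simp_all add: exceptional_supports_def twist_def algebra_simps power2_eq_square)
  have e3: "y 3 * y 5 + y 1 * y 2 = 0"
    by (rule mult_cancel_0[of 2, OF _ _ e[of 3]])
      (simp_all add: exceptional_supports_def twist_def algebra_simps power2_eq_square)
  have e4: "y 4 * y 6 = 0"
    by (rule mult_cancel_0[of 2, OF _ _ e[of 4]])
      (simp_all add: exceptional_supports_def twist_def algebra_simps power2_eq_square)
  have e5: "(y 1)\<^sup>2 + (y 2)\<^sup>2 + (y 3)\<^sup>2 + 3 * (y 5)\<^sup>2 = 0"
    by (rule mult_cancel_0[of 1, OF _ _ e[of 5]])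
      (simp_all add: exceptional_supports_def twist_def algebra_simps power2_eq_square)
  have e6: "(y 4)\<^sup>2 + 3 * (y 6)\<^sup>2 = 0"
    by (rule mult_cancel_0[of 1, OF _ _ e[of 6]])
      (simp_all add: exceptional_supports_def twist_def algebra_simps power2_eq_square)
  have "y 1 = 0 \<and> y 2 = 0 \<and> y 3 = 0 \<and> y 5 = 0"
    by (rule four_quadrics) (use e1 e2 e3 e5 in \<open>simp_all add: algebra_simps\<close>)
  \<comment> \<open>The remaining summand is the chain x_4^2 x_6 + x_6^3, whose derivatives are
    \<open>e4\<close> and \<open>e6\<close>.\<close>
  with e4 e6 have "y 1 = 0 \<and> y 2 = 0 \<and> y 3 = 0 \<and> y 4 = 0 \<and> y 5 = 0 \<and> y 6 = 0" by auto
  then show "\<forall>i\<in>{1..6}. y i = 0"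
    unfolding atLeastAtMost_1_6 by simp
qed

section \<open>The group in each exceptional case\<close>

lemma exceptional_case_two_generators:
  fixes F :: "6 mpoly" and I :: "6 action_data"
  assumes "maximal_action F G P I" "bij_betw \<tau> {1..6} UNIV"
    "\<forall>t\<in>set ts. xmon (map \<tau> t) \<in> monomials_of 3 I" "no_singular_point ts"
    and chk: "exceptional_weights [(p, us), (q, vs)] ts Ms k"
    and inj: "\<And>a b a' b'. a ^ p = 1 \<Longrightarrow> b ^ q = 1 \<Longrightarrow> a' ^ p = 1 \<Longrightarrow> b' ^ q = 1 \<Longrightarrow>
      (\<And>i. i \<in> {1, 2, 3, 4, 5, 6} \<Longrightarrow> a ^ (us ! (i - 1)) * b ^ (vs ! (i - 1)) = a' ^ (us ! (i - 1)) * b' ^ (vs ! (i - 1))) \<Longrightarrow>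
      a = a' \<and> b = (b' :: complex)"
    and complete: "\<And>w :: nat \<Rightarrow> complex. (\<And>i. i \<in> {1, 2, 3, 4, 5, 6} \<Longrightarrow> w i \<noteq> 0) \<Longrightarrow> w k = 1 \<Longrightarrow>
      \<forall>t\<in>set ts. prod_list (map w t) = prod_list (map w (hd ts)) \<Longrightarrow>
      \<exists>a b. a ^ p = 1 \<and> b ^ q = 1 \<and> (\<forall>i\<in>{1, 2, 3, 4, 5, 6}. w i = a ^ (us ! (i - 1)) * b ^ (vs ! (i - 1)))"
    and D: "D = {vector (map (\<lambda>i. b ^ (vs ! (i - 1)) * a ^ (us ! (i - 1))) [1, 2, 3, 4, 5, 6])
      |a b. a ^ p = 1 \<and> b ^ q = 1}"
    and M: "M = set (map (\<lambda>t. xmon (map of_nat t)) Ms)"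
  shows "same_up_to_perm (in_coords P G) (monomials_of 3 I) D M \<and> sub_PGL G \<cong> Cyc p \<times>\<times> Cyc q"
proof -
  let ?gs = "[(p, us), (q, vs)]"
  have pos: "0 < p" "0 < q"
    using chk by (simp_all add: exceptional_weights_def)
  have roots: "roots ?gs = {[a, b] |a b. a ^ p = 1 \<and> b ^ q = 1}"
    by (auto simp: roots_Cons roots_Nil)
  have vec: "root_vec ?gs [a, b] i = a ^ (us ! (i - 1)) * b ^ (vs ! (i - 1))" for a b i
    by simp
  have "same_up_to_perm (in_coords P G) (monomials_of 3 I)
      ((\<lambda>zs. vector (map (root_vec ?gs zs) [1, 2, 3, 4, 5, 6])) ` roots ?gs)
      (set (map (\<lambda>t. xmon (map of_nat t)) Ms)) \<and> sub_PGL G \<cong> root_group p \<times>\<times> root_group q"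
  proof (rule exceptional_case[OF assms(1-4) chk])
    show "group (root_group p \<times>\<times> root_group q)" "finite (carrier (root_group p \<times>\<times> root_group q))"
      using pos by (simp_all add: DirProd_group group_root_group finite_root_group)
    show "bij_betw (\<lambda>(a, b). [a, b]) (carrier (root_group p \<times>\<times> root_group q)) (roots ?gs)"
      unfolding roots by (rule bij_betwI') (auto simp: root_group_def)
    show "(\<lambda>(a, b). [a, b]) (x \<otimes>\<^bsub>root_group p \<times>\<times> root_group q\<^esub> y)
        = map2 (*) ((\<lambda>(a, b). [a, b]) x) ((\<lambda>(a, b). [a, b]) y)" for x y
      by (auto simp: DirProd_def root_group_def split: prod.splits)
  next
    fix zs zs'
    assume zs: "zs \<in> roots ?gs" "zs' \<in> roots ?gs" "\<forall>i\<in>{1..6}. root_vec ?gs zs i = root_vec ?gs zs' i"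
    obtain a b a' b' where z: "zs = [a, b]" "zs' = [a', b']" "a ^ p = 1" "b ^ q = 1" "a' ^ p = 1" "b' ^ q = 1"
      using zs(1,2) unfolding roots by blast
    show "zs = zs'"
      using inj[OF z(3-6)] zs(3) unfolding z(1,2) vec atLeastAtMost_1_6 by blast
  next
    fix w :: "nat \<Rightarrow> complex"
    assume w: "\<forall>i\<in>{1..6}. w i \<noteq> 0" "w k = 1" "\<forall>t\<in>set ts. prod_list (map w t) = prod_list (map w (hd ts))"
    obtain a b where "a ^ p = 1" "b ^ q = 1"
      "\<forall>i\<in>{1, 2, 3, 4, 5, 6}. w i = a ^ (us ! (i - 1)) * b ^ (vs ! (i - 1))"
      using complete[OF _ w(2,3)] w(1) unfolding atLeastAtMost_1_6 by blast
    then show "\<exists>zs\<in>roots ?gs. \<forall>i\<in>{1..6}. w i = root_vec ?gs zs i"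
      unfolding roots atLeastAtMost_1_6 by (intro bexI[of _ "[a, b]"]) (simp_all only: vec, blast)
  qed
  moreover have "(\<lambda>zs. vector (map (root_vec ?gs zs) [1, 2, 3, 4, 5, 6])) ` roots ?gs = D"
  proof -
    \<comment> \<open>The factors of \<open>D\<close> are in the order of the expressions \<omega>^2
      \<zeta> of the theorem: \<open>b\<close> is \<omega> and \<open>a\<close> is \<zeta>.\<close>
    have vec': "root_vec ?gs [a, b] i = b ^ (vs ! (i - 1)) * a ^ (us ! (i - 1))" for a b i
      by (simp add: mult.commute)
    have "(\<lambda>zs. vector (map (root_vec ?gs zs) [1, 2, 3, 4, 5, 6])) ` roots ?gs
        = ({vector (map (root_vec ?gs [a, b]) [1, 2, 3, 4, 5, 6])
          |a b. a ^ p = 1 \<and> b ^ q = 1} :: (complex ^ 6) set)"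
      unfolding roots by blast
    also have "\<dots> = D"
      by (simp only: D vec' list.map)
    finally show ?thesis .
  qed
  moreover have "root_group p \<times>\<times> root_group q \<cong> Cyc p \<times>\<times> Cyc q"
    using pos by (intro group.DirProd_iso_trans root_group_iso DirProd_group group_root_group)
  ultimately show ?thesis
    unfolding M by (metis Group.iso_trans)
qed

lemma exceptional_case_0:
  fixes F :: "6 mpoly" and I :: "6 action_data"
  assumes "maximal_action F G P I" "bij_betw \<tau> {1..6} UNIV"
    "\<forall>t\<in>set (exceptional_supports ! 0). xmon (map \<tau> t) \<in> monomials_of 3 I"
  shows "same_up_to_perm (in_coords P G) (monomials_of 3 I)
      {vector [\<omega>, \<omega>^5, \<omega>^3, 1, \<omega>^4, \<omega>^2] |\<omega>. \<omega>^6 = 1}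
      {xmon [1,1,2], xmon [2,2,3], xmon [3,3,1], xmon [4,4,1], xmon [5,5,2], xmon [6,6,3], xmon [3,4,5],
        xmon [1,5,6], xmon [2,4,6]}
    \<and> sub_PGL G \<cong> Cyc 2 \<times>\<times> Cyc 3"
\<comment> \<open>\<open>us\<close> and \<open>vs\<close> are the exponents 1, 5, 3, 0, 4, 2 of
  \<omega> modulo 2 and modulo 3: the group is described by one sixth root of unity but identified
  with a product of two factors.\<close>
proof (rule exceptional_case_two_generators[OF assms exceptional_nonsingular_0, where k = 4
      and p = 2 and us = "[1, 1, 1, 0, 0, 0]" and q = 3 and vs = "[1, 2, 0, 0, 1, 2]"
      and Ms = "[[1,1,2],[2,2,3],[3,3,1],[4,4,1],[5,5,2],[6,6,3],[3,4,5],[1,5,6],[2,4,6]]"])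
  show "exceptional_weights [(2, [1, 1, 1, 0, 0, 0]), (3, [1, 2, 0, 0, 1, 2])] (exceptional_supports ! 0)
      [[1,1,2],[2,2,3],[3,3,1],[4,4,1],[5,5,2],[6,6,3],[3,4,5],[1,5,6],[2,4,6]] 4"
    by code_simp
next
  fix a b a' b' :: complex
  assume z: "b ^ 3 = 1" and eq: "\<And>i. i \<in> {1, 2, 3, 4, 5, 6} \<Longrightarrow>
    a ^ ([1, 1, 1, 0, 0, 0] ! (i - 1)) * b ^ ([1, 2, 0, 0, 1, 2] ! (i - 1)) = a' ^ ([1, 1, 1, 0, 0, 0] ! (i - 1)) * b' ^ ([1, 2, 0, 0, 1, 2] ! (i - 1))"
  from eq[of 3] eq[of 5] show "a = a' \<and> b = b'"
    by simp
next
  fix w :: "nat \<Rightarrow> complex"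
  assume w: "\<And>i. i \<in> {1, 2, 3, 4, 5, 6} \<Longrightarrow> w i \<noteq> 0" "w 4 = 1"
    "\<forall>t\<in>set (exceptional_supports ! 0). prod_list (map w t) = prod_list (map w (hd (exceptional_supports ! 0)))"
  have nz: "w 1 \<noteq> 0" using w(1) by simp
  have "exceptional_supports ! 0 = [[1, 1, 2], [2, 2, 3], [1, 3, 3], [1, 4, 4], [2, 5, 5], [3, 6, 6], [3, 4, 5], [1, 5, 6], [2, 4, 6]]"
    by (simp add: exceptional_supports_def)
  from w(3)[unfolded this] have eqs: "w 2 * (w 2 * w 3) = w 1 * (w 1 * w 2)"
    "w 1 * (w 3 * w 3) = w 1 * (w 1 * w 2)" "w 1 * (w 4 * w 4) = w 1 * (w 1 * w 2)"
    "w 2 * (w 5 * w 5) = w 1 * (w 1 * w 2)" "w 3 * (w 6 * w 6) = w 1 * (w 1 * w 2)"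
    "w 3 * (w 4 * w 5) = w 1 * (w 1 * w 2)" "w 1 * (w 5 * w 6) = w 1 * (w 1 * w 2)"
    "w 2 * (w 4 * w 6) = w 1 * (w 1 * w 2)"
    by (simp_all only: list.set ball_simps list.map list.sel prod_list.Nil prod_list.Cons mult_1_right simp_thms)
  \<comment> \<open>With \<open>w 4 = 1\<close>, equality of the values of x_1 x_4^2 and x_1^2 x_2
    means exactly this, after cancelling \<open>w 1\<close>.\<close>
  have "w 1 * w 2 = 1"
    using eqs(3) w(2) nz by (simp add: mult.assoc)
  obtain a b where z: "a ^ 2 = 1" "b ^ 3 = 1" "w 1 = a * b" "w 2 = a * b ^ 2" "w 3 = a" "w 5 = b" "w 6 = b ^ 2"
  \<comment> \<open>\<open>w 1\<close> is a sixth root of unity \<omega>, and \<omega> = \<omega>^3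
    \<omega>^4 splits it into a square root and a cube root of 1.\<close>
  proof (rule that[of "w 1 ^ 3" "w 1 ^ 4"])
    show "(w 1 ^ 3) ^ 2 = 1" "(w 1 ^ 4) ^ 3 = 1" "w 1 = (w 1 ^ 3) * (w 1 ^ 4)" "w 2 = (w 1 ^ 3) * (w 1 ^ 4) ^ 2"
      "w 3 = (w 1 ^ 3)" "w 5 = (w 1 ^ 4)" "w 6 = (w 1 ^ 4) ^ 2"
      using eqs \<open>w 1 * w 2 = 1\<close> w(2) by algebra+
  qed
  then show "\<exists>a b. a ^ 2 = 1 \<and> b ^ 3 = 1 \<and> (\<forall>i\<in>{1, 2, 3, 4, 5, 6}. w i = a ^ ([1, 1, 1, 0, 0, 0] ! (i - 1)) * b ^ ([1, 2, 0, 0, 1, 2] ! (i - 1)))"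
    using w(2) by (intro exI[of _ a] exI[of _ b]) (simp)
next
  show "({vector [\<omega>, \<omega>^5, \<omega>^3, 1, \<omega>^4, \<omega>^2] |\<omega>. \<omega>^6 = 1} :: (complex ^ 6) set)
      = {vector (map (\<lambda>i. b ^ ([1, 2, 0, 0, 1, 2] ! (i - 1)) * a ^ ([1, 1, 1, 0, 0, 0] ! (i - 1))) [1, 2, 3, 4, 5, 6]) |a b. a ^ 2 = 1 \<and> b ^ 3 = 1}"
    (is "?D = ?E")
  proof -
    have "?E = ({vector [a * b, a * b ^ 2, a, 1, b, b ^ 2] |a b. a ^ 2 = 1 \<and> b ^ 3 = 1} :: (complex ^ 6) set)"
      by (simp add: mult.commute)
    also have "\<dots> = {vector [\<omega>, \<omega>^5, \<omega>^3, 1, \<omega>^4, \<omega>^2] |\<omega>. \<omega>^6 = 1}"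
    proof (intro Set.set_eqI iffI; elim CollectE exE conjE)
      fix x :: "complex ^ 6" and a b :: complex assume x: "x = vector [a * b, a * b ^ 2, a, 1, b, b ^ 2]"
        "a ^ 2 = 1" "b ^ 3 = 1"
      from x(2,3) have "a * b ^ 2 = (a * b) ^ 5" "a = (a * b) ^ 3" "b = (a * b) ^ 4" "b ^ 2 = (a * b) ^ 2"
        "(a * b) ^ 6 = 1"
        by algebra+
      then show "x \<in> {vector [\<omega>, \<omega>^5, \<omega>^3, 1, \<omega>^4, \<omega>^2]
        |\<omega>. \<omega>^6 = 1}" unfolding x(1) by (intro CollectI exI[of _ "a * b"] conjI) (simp_all only:)
    next
      fix x :: "complex ^ 6" and \<omega> :: complex assume x: "x = vector [\<omega>, \<omega>^5, \<omega>^3, 1, \<omega>^4, \<omega>^2]" "\<omega>^6 = 1"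
      from x(2) have "\<omega> = \<omega>^3 * \<omega>^4" "\<omega>^5 = \<omega>^3 * (\<omega>^4)^2" "\<omega>^2 = (\<omega>^4)^2" "(\<omega>^3)^2 = 1" "(\<omega>^4)^3 = 1"
        by algebra+
      then show "x \<in> {vector [a * b, a * b ^ 2, a, 1, b, b ^ 2] |a b. a ^ 2 = 1 \<and> b ^ 3 = 1}"
        unfolding x(1) by (intro CollectI exI[of _ "\<omega>^3"] exI[of _
          "\<omega>^4"] conjI) (rule arg_cong[where f = vector], auto)
    qed
    finally show ?thesis ..
  qed
qed simp

lemma exceptional_case_1:
  fixes F :: "6 mpoly" and I :: "6 action_data"
  assumes "maximal_action F G P I" "bij_betw \<tau> {1..6} UNIV"
    "\<forall>t\<in>set (exceptional_supports ! 1). xmon (map \<tau> t) \<in> monomials_of 3 I"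
  shows "same_up_to_perm (in_coords P G) (monomials_of 3 I)
      {vector [\<omega>, \<omega>^6, \<omega>^4, 1, \<omega>^5, \<omega>^2] |\<omega>. \<omega>^8 = 1}
      {xmon [1,1,2], xmon [2,2,3], xmon [3,3,4], xmon [4,4,4], xmon [5,5,2], xmon [1,5,6], xmon [6,6,3],
        xmon [2,6,4]}
    \<and> sub_PGL G \<cong> Cyc 8"
proof -
  define gs :: "(nat \<times> nat list) list" where "gs = [(8, [1,6,4,0,5,2])]"
  let ?Ms = "[[1,1,2],[2,2,3],[3,3,4],[4,4,4],[5,5,2],[1,5,6],[6,6,3],[2,6,4]]"
  have roots: "roots gs = {[a] |a. a ^ 8 = 1}"
    by (auto simp: gs_def roots_Cons roots_Nil)
  have *: "same_up_to_perm (in_coords P G) (monomials_of 3 I)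
      ((\<lambda>zs. vector (map (root_vec gs zs) [1, 2, 3, 4, 5, 6])) ` roots gs)
      (set (map (\<lambda>t. xmon (map of_nat t)) ?Ms)) \<and> sub_PGL G \<cong> root_group 8"
  proof (rule exceptional_case[OF assms exceptional_nonsingular_1, where k = 4])
    show "exceptional_weights gs (exceptional_supports ! 1) ?Ms 4"
      unfolding gs_def by code_simp
    show "group (root_group 8)" "finite (carrier (root_group 8))"
      by (simp_all add: DirProd_group group_root_group finite_root_group)
    show "bij_betw (\<lambda>a. [a]) (carrier (root_group 8)) (roots gs)"
      unfolding roots by (rule bij_betwI') (auto simp: root_group_def)
    show "(\<lambda>a. [a]) (x \<otimes>\<^bsub>root_group 8\<^esub> y) = map2 (*) ((\<lambda>a. [a]) x) ((\<lambda>a. [a]) y)" for x y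
      by (auto simp: DirProd_def root_group_def split: prod.splits)
  next
    fix zs zs'
    assume zs: "zs \<in> roots gs" "zs' \<in> roots gs" "\<forall>i\<in>{1..6}. root_vec gs zs i = root_vec gs zs' i"
    obtain a a' where z: "zs = [a]" "zs' = [a']" "a ^ 8 = 1" "a' ^ 8 = 1"
      using zs(1,2) unfolding roots by blast
    have "root_vec gs zs i = root_vec gs zs' i" if "i \<in> {1, 2, 3, 4, 5, 6}" for i
      using that zs(3) by auto
    from this[of 1] show "zs = zs'"
      using z(1,2) by (simp add: gs_def)
  next
    fix w :: "nat \<Rightarrow> complex"
    assume w: "\<forall>i\<in>{1..6}. w i \<noteq> 0" "w 4 = 1"
      "\<forall>t\<in>set (exceptional_supports ! 1). prod_list (map w t) = prod_list (map w (hd (exceptional_supports ! 1)))"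
    have "exceptional_supports ! 1 = [[1, 1, 2], [2, 2, 3], [3, 3, 4], [4, 4, 4], [2, 5, 5], [1, 5, 6], [3, 6, 6], [2, 4, 6]]"
      by (simp add: exceptional_supports_def)
    from w(3)[unfolded this] have eqs: "w 2 * (w 2 * w 3) = w 1 * (w 1 * w 2)"
      "w 3 * (w 3 * w 4) = w 1 * (w 1 * w 2)" "w 4 * (w 4 * w 4) = w 1 * (w 1 * w 2)"
      "w 2 * (w 5 * w 5) = w 1 * (w 1 * w 2)" "w 1 * (w 5 * w 6) = w 1 * (w 1 * w 2)"
      "w 3 * (w 6 * w 6) = w 1 * (w 1 * w 2)" "w 2 * (w 4 * w 6) = w 1 * (w 1 * w 2)"
      by (simp_all only: list.set ball_simps list.map list.sel prod_list.Nil prod_list.Cons mult_1_right simp_thms)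
    \<comment> \<open>The cube x_4^3 with \<open>w 4 = 1\<close> makes all monomial values 1; the
      other coordinates are then powers of \<open>w 1\<close>.\<close>
    obtain a where z: "a ^ 8 = 1" "w 1 = a" "w 2 = a ^ 6" "w 3 = a ^ 4" "w 5 = a ^ 5" "w 6 = a ^ 2"
    proof (rule that[of "w 1"])
      show "w 1 ^ 8 = 1" "w 2 = w 1 ^ 6" "w 3 = w 1 ^ 4" "w 5 = w 1 ^ 5" "w 6 = w 1 ^ 2"
        using eqs w(2) by algebra+
      show "w 1 = w 1"
        by (rule refl)+
    qed
    show "\<exists>zs\<in>roots gs. \<forall>i\<in>{1..6}. w i = root_vec gs zs i"
    proof
      show "[a] \<in> roots gs"
        unfolding roots using z by blast
      show "\<forall>i\<in>{1..6}. w i = root_vec gs [a] i"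
        unfolding atLeastAtMost_1_6 using z w(2) by (simp add: gs_def)
    qed
  qed
  have "vector (map (root_vec gs [a]) [1, 2, 3, 4, 5, 6]) = vector [a, a ^ 6, a ^ 4, 1, a ^ 5, a ^ 2]" for a
    by (simp add: gs_def)
  note v = this
  have "(\<lambda>zs. vector (map (root_vec gs zs) [1, 2, 3, 4, 5, 6])) ` roots gs
      = ({vector (map (root_vec gs [a]) [1, 2, 3, 4, 5, 6]) |a. a ^ 8 = 1} :: (complex ^ 6) set)"
    unfolding roots by blast
  also have "\<dots> = {vector [a, a ^ 6, a ^ 4, 1, a ^ 5, a ^ 2] |a. a ^ 8 = 1}"
    by (simp only: v)
  finally have im: "(\<lambda>zs. vector (map (root_vec gs zs) [1, 2, 3, 4, 5, 6])) ` roots gs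
    = ({vector [\<omega>, \<omega>^6, \<omega>^4, 1, \<omega>^5, \<omega>^2] |\<omega>. \<omega>^8 = 1} :: (complex ^ 6) set)" .
  have ms: "set (map (\<lambda>t. xmon (map of_nat t)) ?Ms)
    = {xmon [1,1,2], xmon [2,2,3], xmon [3,3,4], xmon [4,4,4], xmon [5,5,2], xmon [1,5,6], xmon [6,6,3],
    xmon [2,6,4]}"
    by simp
  have "root_group 8 \<cong> Cyc 8"
    by (intro group.DirProd_iso_trans root_group_iso DirProd_group group_root_group) simp_all
  with * show ?thesis
    unfolding im ms by (blast intro: Group.iso_trans)
qed

lemma exceptional_case_2:
  fixes F :: "6 mpoly" and I :: "6 action_data"
  assumes "maximal_action F G P I" "bij_betw \<tau> {1..6} UNIV"
    "\<forall>t\<in>set (exceptional_supports ! 2). xmon (map \<tau> t) \<in> monomials_of 3 I"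
  shows "same_up_to_perm (in_coords P G) (monomials_of 3 I)
      {vector [\<omega>, \<omega>^2, 1, \<zeta>, \<omega>^2 * \<zeta>, 1] |\<omega> \<zeta>. \<omega>^4 = 1 \<and> \<zeta>^2 = 1}
      {xmon [1,1,2], xmon [2,2,3], xmon [2,2,6], xmon [2,4,5], xmon [3,3,3], xmon [3,3,6], xmon [4,4,3],
        xmon [5,5,3], xmon [6,6,3], xmon [4,4,6], xmon [5,5,6], xmon [6,6,6]}
    \<and> sub_PGL G \<cong> Cyc 2 \<times>\<times> Cyc 4"
\<comment> \<open>\<open>us\<close> holds the exponents of \<zeta> and \<open>vs\<close> those of
  \<omega>. The seven monomials of the support already cut out the group; the monomials with the
  same character are the twelve in \<open>Ms\<close>.\<close>
proof (rule exceptional_case_two_generators[OF assms exceptional_nonsingular_2, where k = 3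
      and p = 2 and us = "[0, 0, 0, 1, 1, 0]" and q = 4 and vs = "[1, 2, 0, 0, 2, 0]"
      and Ms = "[[1,1,2],[2,2,3],[2,2,6],[2,4,5],[3,3,3],[3,3,6],[4,4,3],[5,5,3],[6,6,3],[4,4,6],[5,5,6],[6,6,6]]"])
  show "exceptional_weights [(2, [0, 0, 0, 1, 1, 0]), (4, [1, 2, 0, 0, 2, 0])] (exceptional_supports ! 2)
      [[1,1,2],[2,2,3],[2,2,6],[2,4,5],[3,3,3],[3,3,6],[4,4,3],[5,5,3],[6,6,3],[4,4,6],[5,5,6],[6,6,6]] 3"
    by code_simp
next
  fix a b a' b' :: complex
  assume z: "b ^ 4 = 1" and eq: "\<And>i. i \<in> {1, 2, 3, 4, 5, 6} \<Longrightarrow>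
    a ^ ([0, 0, 0, 1, 1, 0] ! (i - 1)) * b ^ ([1, 2, 0, 0, 2, 0] ! (i - 1)) = a' ^ ([0, 0, 0, 1, 1, 0] ! (i - 1)) * b' ^ ([1, 2, 0, 0, 2, 0] ! (i - 1))"
  from eq[of 4] eq[of 1] show "a = a' \<and> b = b'"
    by simp
next
  fix w :: "nat \<Rightarrow> complex"
  assume w: "\<And>i. i \<in> {1, 2, 3, 4, 5, 6} \<Longrightarrow> w i \<noteq> 0" "w 3 = 1"
    "\<forall>t\<in>set (exceptional_supports ! 2). prod_list (map w t) = prod_list (map w (hd (exceptional_supports ! 2)))"
  have "exceptional_supports ! 2 = [[1, 1, 2], [2, 4, 5], [2, 2, 3], [3, 3, 3], [3, 5, 5], [4, 4, 6], [6, 6, 6]]"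
    by (simp add: exceptional_supports_def)
  from w(3)[unfolded this] have eqs: "w 2 * (w 4 * w 5) = w 1 * (w 1 * w 2)"
    "w 2 * (w 2 * w 3) = w 1 * (w 1 * w 2)" "w 3 * (w 3 * w 3) = w 1 * (w 1 * w 2)"
    "w 3 * (w 5 * w 5) = w 1 * (w 1 * w 2)" "w 4 * (w 4 * w 6) = w 1 * (w 1 * w 2)"
    "w 6 * (w 6 * w 6) = w 1 * (w 1 * w 2)"
    by (simp_all only: list.set ball_simps list.map list.sel prod_list.Nil prod_list.Cons mult_1_right simp_thms)
  \<comment> \<open>That \<open>w 6 = 1\<close> comes from x_4^2 x_6: the squares of
    \<open>w 2\<close> and \<open>w 5\<close> are 1 and \<open>w 2 * w 4 * w 5 = 1\<close>, so
    \<open>w 4\<close> is a square root of 1 as well.\<close>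
  obtain a b where z: "a ^ 2 = 1" "b ^ 4 = 1" "w 1 = b" "w 2 = b ^ 2" "w 4 = a" "w 5 = b ^ 2 * a" "w 6 = 1"
  proof (rule that[of "w 4" "w 1"])
    show "w 4 ^ 2 = 1" "w 1 ^ 4 = 1" "w 2 = w 1 ^ 2" "w 5 = w 1 ^ 2 * w 4" "w 6 = 1"
      using eqs w(2) by algebra+
    show "w 1 = w 1" "w 4 = w 4"
      by (rule refl)+
  qed
  then show "\<exists>a b. a ^ 2 = 1 \<and> b ^ 4 = 1 \<and> (\<forall>i\<in>{1, 2, 3, 4, 5, 6}. w i = a ^ ([0, 0, 0, 1, 1, 0] ! (i - 1)) * b ^ ([1, 2, 0, 0, 2, 0] ! (i - 1)))"
    using w(2) by (intro exI[of _ a] exI[of _ b]) (simp add: mult.commute)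
next
  show "({vector [\<omega>, \<omega>^2, 1, \<zeta>, \<omega>^2 * \<zeta>, 1] |\<omega> \<zeta>. \<omega>^4 = 1 \<and> \<zeta>^2 = 1} :: (complex ^ 6) set)
      = {vector (map (\<lambda>i. b ^ ([1, 2, 0, 0, 2, 0] ! (i - 1)) * a ^ ([0, 0, 0, 1, 1, 0] ! (i - 1))) [1, 2, 3, 4, 5, 6]) |a b. a ^ 2 = 1 \<and> b ^ 4 = 1}"
    by simp blast
qed simp

lemma exceptional_case_3:
  fixes F :: "6 mpoly" and I :: "6 action_data"
  assumes "maximal_action F G P I" "bij_betw \<tau> {1..6} UNIV"
    "\<forall>t\<in>set (exceptional_supports ! 3). xmon (map \<tau> t) \<in> monomials_of 3 I"
  shows "same_up_to_perm (in_coords P G) (monomials_of 3 I)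
      {vector [\<omega>, \<omega>^2, 1, \<omega> * \<zeta>, \<omega>^2 * \<zeta>, 1] |\<omega> \<zeta>. \<omega>^4 = 1 \<and> \<zeta>^2 = 1}
      {xmon [1,1,2], xmon [2,2,3], xmon [3,3,3], xmon [4,4,2], xmon [1,4,5], xmon [5,5,3], xmon [5,5,6],
        xmon [6,6,3], xmon [2,2,6], xmon [3,3,6], xmon [6,6,6]}
    \<and> sub_PGL G \<cong> Cyc 2 \<times>\<times> Cyc 4"
proof (rule exceptional_case_two_generators[OF assms exceptional_nonsingular_3, where k = 3
      and p = 2 and us = "[0, 0, 0, 1, 1, 0]" and q = 4 and vs = "[1, 2, 0, 1, 2, 0]"
      and Ms = "[[1,1,2],[2,2,3],[3,3,3],[4,4,2],[1,4,5],[5,5,3],[5,5,6],[6,6,3],[2,2,6],[3,3,6],[6,6,6]]"])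
  show "exceptional_weights [(2, [0, 0, 0, 1, 1, 0]), (4, [1, 2, 0, 1, 2, 0])] (exceptional_supports ! 3)
      [[1,1,2],[2,2,3],[3,3,3],[4,4,2],[1,4,5],[5,5,3],[5,5,6],[6,6,3],[2,2,6],[3,3,6],[6,6,6]] 3"
    by code_simp
next
  fix a b a' b' :: complex
  assume z: "b ^ 4 = 1" and eq: "\<And>i. i \<in> {1, 2, 3, 4, 5, 6} \<Longrightarrow>
    a ^ ([0, 0, 0, 1, 1, 0] ! (i - 1)) * b ^ ([1, 2, 0, 1, 2, 0] ! (i - 1)) = a' ^ ([0, 0, 0, 1, 1, 0] ! (i - 1)) * b' ^ ([1, 2, 0, 1, 2, 0] ! (i - 1))"
  have "b \<noteq> 0" using z by auto
  from eq[of 1] eq[of 4] show "a = a' \<and> b = b'"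
    using \<open>b \<noteq> 0\<close> by simp
next
  fix w :: "nat \<Rightarrow> complex"
  assume w: "\<And>i. i \<in> {1, 2, 3, 4, 5, 6} \<Longrightarrow> w i \<noteq> 0" "w 3 = 1"
    "\<forall>t\<in>set (exceptional_supports ! 3). prod_list (map w t) = prod_list (map w (hd (exceptional_supports ! 3)))"
  have "exceptional_supports ! 3 = [[1, 1, 2], [1, 4, 5], [2, 2, 3], [2, 2, 6], [2, 4, 4], [3, 3, 3], [3, 6, 6], [5, 5, 6]]"
    by (simp add: exceptional_supports_def)
  from w(3)[unfolded this] have eqs: "w 1 * (w 4 * w 5) = w 1 * (w 1 * w 2)"
    "w 2 * (w 2 * w 3) = w 1 * (w 1 * w 2)" "w 2 * (w 2 * w 6) = w 1 * (w 1 * w 2)"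
    "w 2 * (w 4 * w 4) = w 1 * (w 1 * w 2)" "w 3 * (w 3 * w 3) = w 1 * (w 1 * w 2)"
    "w 3 * (w 6 * w 6) = w 1 * (w 1 * w 2)" "w 5 * (w 5 * w 6) = w 1 * (w 1 * w 2)"
    by (simp_all only: list.set ball_simps list.map list.sel prod_list.Nil prod_list.Cons mult_1_right simp_thms)
  obtain a b where z: "a ^ 2 = 1" "b ^ 4 = 1" "w 1 = b" "w 2 = b ^ 2" "w 4 = b * a" "w 5 = b ^ 2 * a" "w 6 = 1"
  \<comment> \<open>The fourth coordinate is \<omega> \<zeta>; as \<omega>^4 = 1, multiplication by
    \<omega>^3 isolates \<zeta>.\<close>
  proof (rule that[of "w 4 * w 1 ^ 3" "w 1"])
    show "(w 4 * w 1 ^ 3) ^ 2 = 1" "w 1 ^ 4 = 1" "w 2 = w 1 ^ 2" "w 4 = w 1 * (w 4 * w 1 ^ 3)"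
      "w 5 = w 1 ^ 2 * (w 4 * w 1 ^ 3)" "w 6 = 1"
      using eqs w(2) by algebra+
    show "w 1 = w 1"
      by (rule refl)+
  qed
  then show "\<exists>a b. a ^ 2 = 1 \<and> b ^ 4 = 1 \<and> (\<forall>i\<in>{1, 2, 3, 4, 5, 6}. w i = a ^ ([0, 0, 0, 1, 1, 0] ! (i - 1)) * b ^ ([1, 2, 0, 1, 2, 0] ! (i - 1)))"
    using w(2) by (intro exI[of _ a] exI[of _ b]) (simp add: mult.commute)
next
  show "({vector [\<omega>, \<omega>^2, 1, \<omega> * \<zeta>, \<omega>^2 * \<zeta>, 1] |\<omega> \<zeta>. \<omega>^4 = 1 \<and> \<zeta>^2 = 1} :: (complex ^ 6) set)
      = {vector (map (\<lambda>i. b ^ ([1, 2, 0, 1, 2, 0] ! (i - 1)) * a ^ ([0, 0, 0, 1, 1, 0] ! (i - 1))) [1, 2, 3, 4, 5, 6]) |a b. a ^ 2 = 1 \<and> b ^ 4 = 1}"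
    by simp blast
qed simp

lemma exceptional_case_4:
  fixes F :: "6 mpoly" and I :: "6 action_data"
  assumes "maximal_action F G P I" "bij_betw \<tau> {1..6} UNIV"
    "\<forall>t\<in>set (exceptional_supports ! 4). xmon (map \<tau> t) \<in> monomials_of 3 I"
  shows "same_up_to_perm (in_coords P G) (monomials_of 3 I)
      {vector [\<omega>, \<omega>^2, 1, \<omega> * \<zeta>, \<omega>^2 * \<zeta>, \<zeta>] |\<omega> \<zeta>. \<omega>^4 = 1 \<and> \<zeta>^2 = 1}
      {xmon [1,1,2], xmon [2,2,3], xmon [3,3,3], xmon [4,4,2], xmon [1,4,5], xmon [5,5,3], xmon [2,5,6],
        xmon [6,6,3]}
    \<and> sub_PGL G \<cong> Cyc 2 \<times>\<times> Cyc 4"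
proof (rule exceptional_case_two_generators[OF assms exceptional_nonsingular_4, where k = 3
      and p = 2 and us = "[0, 0, 0, 1, 1, 1]" and q = 4 and vs = "[1, 2, 0, 1, 2, 0]"
      and Ms = "[[1,1,2],[2,2,3],[3,3,3],[4,4,2],[1,4,5],[5,5,3],[2,5,6],[6,6,3]]"])
  show "exceptional_weights [(2, [0, 0, 0, 1, 1, 1]), (4, [1, 2, 0, 1, 2, 0])] (exceptional_supports ! 4)
      [[1,1,2],[2,2,3],[3,3,3],[4,4,2],[1,4,5],[5,5,3],[2,5,6],[6,6,3]] 3"
    by code_simp
next
  fix a b a' b' :: complex
  assume z: "b ^ 4 = 1" and eq: "\<And>i. i \<in> {1, 2, 3, 4, 5, 6} \<Longrightarrow>
    a ^ ([0, 0, 0, 1, 1, 1] ! (i - 1)) * b ^ ([1, 2, 0, 1, 2, 0] ! (i - 1)) = a' ^ ([0, 0, 0, 1, 1, 1] ! (i - 1)) * b' ^ ([1, 2, 0, 1, 2, 0] ! (i - 1))"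
  from eq[of 6] eq[of 1] show "a = a' \<and> b = b'"
    by simp
next
  fix w :: "nat \<Rightarrow> complex"
  assume w: "\<And>i. i \<in> {1, 2, 3, 4, 5, 6} \<Longrightarrow> w i \<noteq> 0" "w 3 = 1"
    "\<forall>t\<in>set (exceptional_supports ! 4). prod_list (map w t) = prod_list (map w (hd (exceptional_supports ! 4)))"
  have "exceptional_supports ! 4 = [[1, 1, 2], [2, 2, 3], [3, 3, 3], [2, 4, 4], [1, 4, 5], [3, 5, 5], [2, 5, 6], [3, 6, 6]]"
    by (simp add: exceptional_supports_def)
  from w(3)[unfolded this] have eqs: "w 2 * (w 2 * w 3) = w 1 * (w 1 * w 2)"
    "w 3 * (w 3 * w 3) = w 1 * (w 1 * w 2)" "w 2 * (w 4 * w 4) = w 1 * (w 1 * w 2)"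
    "w 1 * (w 4 * w 5) = w 1 * (w 1 * w 2)" "w 3 * (w 5 * w 5) = w 1 * (w 1 * w 2)"
    "w 2 * (w 5 * w 6) = w 1 * (w 1 * w 2)" "w 3 * (w 6 * w 6) = w 1 * (w 1 * w 2)"
    by (simp_all only: list.set ball_simps list.map list.sel prod_list.Nil prod_list.Cons mult_1_right simp_thms)
  obtain a b where z: "a ^ 2 = 1" "b ^ 4 = 1" "w 1 = b" "w 2 = b ^ 2" "w 4 = b * a" "w 5 = b ^ 2 * a" "w 6 = a"
  proof (rule that[of "w 6" "w 1"])
    show "w 6 ^ 2 = 1" "w 1 ^ 4 = 1" "w 2 = w 1 ^ 2" "w 4 = w 1 * w 6" "w 5 = w 1 ^ 2 * w 6"
      using eqs w(2) by algebra+
    show "w 1 = w 1" "w 6 = w 6"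
      by (rule refl)+
  qed
  then show "\<exists>a b. a ^ 2 = 1 \<and> b ^ 4 = 1 \<and> (\<forall>i\<in>{1, 2, 3, 4, 5, 6}. w i = a ^ ([0, 0, 0, 1, 1, 1] ! (i - 1)) * b ^ ([1, 2, 0, 1, 2, 0] ! (i - 1)))"
    using w(2) by (intro exI[of _ a] exI[of _ b]) (simp add: mult.commute)
next
  show "({vector [\<omega>, \<omega>^2, 1, \<omega> * \<zeta>, \<omega>^2 * \<zeta>, \<zeta>] |\<omega> \<zeta>. \<omega>^4 = 1 \<and> \<zeta>^2 = 1} :: (complex ^ 6) set)
      = {vector (map (\<lambda>i. b ^ ([1, 2, 0, 1, 2, 0] ! (i - 1)) * a ^ ([0, 0, 0, 1, 1, 1] ! (i - 1))) [1, 2, 3, 4, 5, 6]) |a b. a ^ 2 = 1 \<and> b ^ 4 = 1}"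
    by simp blast
qed simp

lemma exceptional_case_5:
  fixes F :: "6 mpoly" and I :: "6 action_data"
  assumes "maximal_action F G P I" "bij_betw \<tau> {1..6} UNIV"
    "\<forall>t\<in>set (exceptional_supports ! 5). xmon (map \<tau> t) \<in> monomials_of 3 I"
  shows "same_up_to_perm (in_coords P G) (monomials_of 3 I)
      {vector [\<alpha>, \<beta>, \<alpha> * \<beta>, 1, \<omega>, \<zeta>] |\<alpha> \<beta> \<omega> \<zeta>. \<alpha>^2 = 1 \<and> \<beta>^2 = 1 \<and> \<omega>^3 = 1 \<and> \<zeta>^3 = 1}
      {xmon [1,1,4], xmon [2,2,4], xmon [3,3,4], xmon [1,2,3], xmon [4,4,4], xmon [5,5,5], xmon [6,6,6]}
    \<and> sub_PGL G \<cong> (Cyc 2 \<times>\<times> Cyc 2) \<times>\<times> (Cyc 3 \<times>\<times> Cyc 3)"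
proof -
  define gs :: "(nat \<times> nat list) list" where
    "gs = [(2, [1,0,1,0,0,0]), (2, [0,1,1,0,0,0]), (3, [0,0,0,0,1,0]), (3, [0,0,0,0,0,1])]"
  let ?Ms = "[[1,1,4],[2,2,4],[3,3,4],[1,2,3],[4,4,4],[5,5,5],[6,6,6]]"
  have roots: "roots gs = {[a, b, c, d] |a b c d. a ^ 2 = 1 \<and> b ^ 2 = 1 \<and> c ^ 3 = 1 \<and> d ^ 3 = 1}"
    by (auto simp: gs_def roots_Cons roots_Nil)
  have *: "same_up_to_perm (in_coords P G) (monomials_of 3 I)
      ((\<lambda>zs. vector (map (root_vec gs zs) [1, 2, 3, 4, 5, 6])) ` roots gs)
      (set (map (\<lambda>t. xmon (map of_nat t)) ?Ms)) \<and> sub_PGL G \<cong> (root_group 2 \<times>\<times> root_group 2) \<times>\<times> (root_group 3 \<times>\<times> root_group 3)"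
  proof (rule exceptional_case[OF assms exceptional_nonsingular_5, where k = 4])
    show "exceptional_weights gs (exceptional_supports ! 5) ?Ms 4"
      unfolding gs_def by code_simp
    show "group ((root_group 2 \<times>\<times> root_group 2) \<times>\<times> (root_group 3 \<times>\<times> root_group 3))" "finite (carrier ((root_group 2 \<times>\<times> root_group 2) \<times>\<times> (root_group 3 \<times>\<times> root_group 3)))"
      by (simp_all add: DirProd_group group_root_group finite_root_group)
    show "bij_betw (\<lambda>((a, b), (c, d)). [a, b, c, d]) (carrier ((root_group 2 \<times>\<times> root_group 2) \<times>\<times> (root_group 3 \<times>\<times> root_group 3))) (roots gs)"
      unfolding roots by (rule bij_betwI') (auto simp: root_group_def)
    show "(\<lambda>((a, b), (c, d)). [a, b, c, d]) (x \<otimes>\<^bsub>(root_group 2 \<times>\<times> root_group 2) \<times>\<times> (root_group 3 \<times>\<times> root_group 3)\<^esub> y) = map2 (*) ((\<lambda>((a, b), (c, d)). [a, b, c, d]) x) ((\<lambda>((a, b), (c, d)). [a, b, c, d]) y)" for x y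
      by (auto simp: DirProd_def root_group_def split: prod.splits)
  next
    fix zs zs'
    assume zs: "zs \<in> roots gs" "zs' \<in> roots gs" "\<forall>i\<in>{1..6}. root_vec gs zs i = root_vec gs zs' i"
    obtain a b c d a' b' c' d' where z: "zs = [a, b, c, d]" "zs' = [a', b', c', d']" "a ^ 2 = 1" "b ^ 2 = 1"
      "c ^ 3 = 1" "d ^ 3 = 1" "a' ^ 2 = 1" "b' ^ 2 = 1" "c' ^ 3 = 1" "d' ^ 3 = 1"
      using zs(1,2) unfolding roots by blast
    have "root_vec gs zs i = root_vec gs zs' i" if "i \<in> {1, 2, 3, 4, 5, 6}" for i
      using that zs(3) by auto
    from this[of 1] this[of 2] this[of 5] this[of 6] show "zs = zs'"
      using z(1,2) by (simp add: gs_def)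
  next
    fix w :: "nat \<Rightarrow> complex"
    assume w: "\<forall>i\<in>{1..6}. w i \<noteq> 0" "w 4 = 1"
      "\<forall>t\<in>set (exceptional_supports ! 5). prod_list (map w t) = prod_list (map w (hd (exceptional_supports ! 5)))"
    have "exceptional_supports ! 5 = [[1, 1, 4], [2, 2, 4], [3, 3, 4], [1, 2, 3], [4, 4, 4], [5, 5, 5], [6, 6, 6]]"
      by (simp add: exceptional_supports_def)
    from w(3)[unfolded this] have eqs: "w 2 * (w 2 * w 4) = w 1 * (w 1 * w 4)"
      "w 3 * (w 3 * w 4) = w 1 * (w 1 * w 4)" "w 1 * (w 2 * w 3) = w 1 * (w 1 * w 4)"
      "w 4 * (w 4 * w 4) = w 1 * (w 1 * w 4)" "w 5 * (w 5 * w 5) = w 1 * (w 1 * w 4)"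
      "w 6 * (w 6 * w 6) = w 1 * (w 1 * w 4)"
      by (simp_all only: list.set ball_simps list.map list.sel prod_list.Nil prod_list.Cons mult_1_right simp_thms)
    obtain a b c d where z: "a ^ 2 = 1" "b ^ 2 = 1" "c ^ 3 = 1" "d ^ 3 = 1" "w 1 = a" "w 2 = b" "w 3 = a * b"
      "w 5 = c" "w 6 = d"
    proof (rule that[of "w 1" "w 2" "w 5" "w 6"])
      show "w 1 ^ 2 = 1" "w 2 ^ 2 = 1" "w 5 ^ 3 = 1" "w 6 ^ 3 = 1" "w 3 = w 1 * w 2"
        using eqs w(2) by algebra+
      show "w 1 = w 1" "w 2 = w 2" "w 5 = w 5" "w 6 = w 6"
        by (rule refl)+
    qed
    show "\<exists>zs\<in>roots gs. \<forall>i\<in>{1..6}. w i = root_vec gs zs i"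
    proof
      show "[a, b, c, d] \<in> roots gs"
        unfolding roots using z by blast
      show "\<forall>i\<in>{1..6}. w i = root_vec gs [a, b, c, d] i"
        unfolding atLeastAtMost_1_6 using z w(2) by (simp add: gs_def)
    qed
  qed
  have "vector (map (root_vec gs [a, b, c, d]) [1, 2, 3, 4, 5, 6]) = vector [a, b, a * b, 1, c, d]" for a b c d
    by (simp add: gs_def)
  note v = this
  have "(\<lambda>zs. vector (map (root_vec gs zs) [1, 2, 3, 4, 5, 6])) ` roots gs
      = ({vector (map (root_vec gs [a, b, c, d]) [1, 2, 3, 4, 5, 6])
        |a b c d. a ^ 2 = 1 \<and> b ^ 2 = 1 \<and> c ^ 3 = 1 \<and> d ^ 3 = 1} :: (complex ^ 6) set)"
    unfolding roots by blast
  also have "\<dots> = {vector [a, b, a * b, 1, c, d] |a b c d. a ^ 2 = 1 \<and> b ^ 2 = 1 \<and> c ^ 3 = 1 \<and> d ^ 3 = 1}"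
    by (simp only: v)
  finally have im: "(\<lambda>zs. vector (map (root_vec gs zs) [1, 2, 3, 4, 5, 6])) ` roots gs
    = ({vector [\<alpha>, \<beta>, \<alpha> * \<beta>, 1, \<omega>, \<zeta>] |\<alpha> \<beta> \<omega> \<zeta>. \<alpha>^2 = 1 \<and> \<beta>^2 = 1 \<and> \<omega>^3 = 1 \<and> \<zeta>^3 = 1} :: (complex ^ 6) set)" .
  have ms: "set (map (\<lambda>t. xmon (map of_nat t)) ?Ms)
    = {xmon [1,1,4], xmon [2,2,4], xmon [3,3,4], xmon [1,2,3], xmon [4,4,4], xmon [5,5,5], xmon [6,6,6]}"
    by simp
  have "(root_group 2 \<times>\<times> root_group 2) \<times>\<times> (root_group 3 \<times>\<times> root_group 3) \<cong> (Cyc 2 \<times>\<times> Cyc 2) \<times>\<times> (Cyc 3 \<times>\<times> Cyc 3)"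
    by (intro group.DirProd_iso_trans root_group_iso DirProd_group group_root_group) simp_all
  with * show ?thesis
    unfolding im ms by (blast intro: Group.iso_trans)
qed

lemma exceptional_case_6:
  fixes F :: "6 mpoly" and I :: "6 action_data"
  assumes "maximal_action F G P I" "bij_betw \<tau> {1..6} UNIV"
    "\<forall>t\<in>set (exceptional_supports ! 6). xmon (map \<tau> t) \<in> monomials_of 3 I"
  shows "same_up_to_perm (in_coords P G) (monomials_of 3 I)
      {vector [\<alpha>, \<beta>, \<alpha> * \<beta>, \<omega>, 1, \<omega>^4] |\<alpha> \<beta> \<omega>. \<alpha>^2 = 1 \<and> \<beta>^2 = 1 \<and> \<omega>^6 = 1}
      {xmon [1,1,5], xmon [2,2,5], xmon [3,3,5], xmon [1,2,3], xmon [5,5,5], xmon [4,4,6], xmon [6,6,6]}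
    \<and> sub_PGL G \<cong> (Cyc 2 \<times>\<times> Cyc 2 \<times>\<times> Cyc 2) \<times>\<times> Cyc 3"
proof -
  \<comment> \<open>The sixth root of unity \<omega> is split as c d with c = \<omega>^3 and d =
    \<omega>^4, so the fourth coordinate has weight 1 in both factors and the sixth, \<omega>^4, is
    d alone.\<close>
  define gs :: "(nat \<times> nat list) list" where
    "gs = [(2, [1,0,1,0,0,0]), (2, [0,1,1,0,0,0]), (2, [0,0,0,1,0,0]), (3, [0,0,0,1,0,1])]"
  let ?Ms = "[[1,1,5],[2,2,5],[3,3,5],[1,2,3],[5,5,5],[4,4,6],[6,6,6]]"
  have roots: "roots gs = {[a, b, c, d] |a b c d. a ^ 2 = 1 \<and> b ^ 2 = 1 \<and> c ^ 2 = 1 \<and> d ^ 3 = 1}"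
    by (auto simp: gs_def roots_Cons roots_Nil)
  have *: "same_up_to_perm (in_coords P G) (monomials_of 3 I)
      ((\<lambda>zs. vector (map (root_vec gs zs) [1, 2, 3, 4, 5, 6])) ` roots gs)
      (set (map (\<lambda>t. xmon (map of_nat t)) ?Ms)) \<and> sub_PGL G \<cong> (root_group 2 \<times>\<times> root_group 2 \<times>\<times> root_group 2) \<times>\<times> root_group 3"
  proof (rule exceptional_case[OF assms exceptional_nonsingular_6, where k = 5])
    show "exceptional_weights gs (exceptional_supports ! 6) ?Ms 5"
      unfolding gs_def by code_simp
    show "group ((root_group 2 \<times>\<times> root_group 2 \<times>\<times> root_group 2) \<times>\<times> root_group 3)" "finite (carrier ((root_group 2 \<times>\<times> root_group 2 \<times>\<times> root_group 2) \<times>\<times> root_group 3))"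
      by (simp_all add: DirProd_group group_root_group finite_root_group)
    show "bij_betw (\<lambda>((a, b, c), d). [a, b, c, d]) (carrier ((root_group 2 \<times>\<times> root_group 2 \<times>\<times> root_group 2) \<times>\<times> root_group 3)) (roots gs)"
      unfolding roots by (rule bij_betwI') (auto simp: root_group_def)
    show "(\<lambda>((a, b, c), d). [a, b, c, d]) (x \<otimes>\<^bsub>(root_group 2 \<times>\<times> root_group 2 \<times>\<times> root_group 2) \<times>\<times> root_group 3\<^esub> y) = map2 (*) ((\<lambda>((a, b, c), d). [a, b, c, d]) x) ((\<lambda>((a, b, c), d). [a, b, c, d]) y)" for x y
      by (auto simp: DirProd_def root_group_def split: prod.splits)
  next
    fix zs zs'
    assume zs: "zs \<in> roots gs" "zs' \<in> roots gs" "\<forall>i\<in>{1..6}. root_vec gs zs i = root_vec gs zs' i"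
    obtain a b c d a' b' c' d' where z: "zs = [a, b, c, d]" "zs' = [a', b', c', d']" "a ^ 2 = 1" "b ^ 2 = 1"
      "c ^ 2 = 1" "d ^ 3 = 1" "a' ^ 2 = 1" "b' ^ 2 = 1" "c' ^ 2 = 1" "d' ^ 3 = 1"
      using zs(1,2) unfolding roots by blast
    have "d \<noteq> 0" using z by auto
      have "root_vec gs zs i = root_vec gs zs' i" if "i \<in> {1, 2, 3, 4, 5, 6}" for i
      using that zs(3) by auto
    from this[of 1] this[of 2] this[of 6] this[of 4] show "zs = zs'"
      using \<open>d \<noteq> 0\<close> z(1,2) by (simp add: gs_def)
  next
    fix w :: "nat \<Rightarrow> complex"
    assume w: "\<forall>i\<in>{1..6}. w i \<noteq> 0" "w 5 = 1"
      "\<forall>t\<in>set (exceptional_supports ! 6). prod_list (map w t) = prod_list (map w (hd (exceptional_supports ! 6)))"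
    have "exceptional_supports ! 6 = [[1, 1, 5], [2, 2, 5], [3, 3, 5], [1, 2, 3], [5, 5, 5], [4, 4, 6], [6, 6, 6]]"
      by (simp add: exceptional_supports_def)
    from w(3)[unfolded this] have eqs: "w 2 * (w 2 * w 5) = w 1 * (w 1 * w 5)"
      "w 3 * (w 3 * w 5) = w 1 * (w 1 * w 5)" "w 1 * (w 2 * w 3) = w 1 * (w 1 * w 5)"
      "w 5 * (w 5 * w 5) = w 1 * (w 1 * w 5)" "w 4 * (w 4 * w 6) = w 1 * (w 1 * w 5)"
      "w 6 * (w 6 * w 6) = w 1 * (w 1 * w 5)"
      by (simp_all only: list.set ball_simps list.map list.sel prod_list.Nil prod_list.Cons mult_1_right simp_thms)
    obtain a b c d where z: "a ^ 2 = 1" "b ^ 2 = 1" "c ^ 2 = 1" "d ^ 3 = 1" "w 1 = a" "w 2 = b" "w 3 = a * b"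
      "w 4 = c * d" "w 6 = d"
    proof (rule that[of "w 1" "w 2" "w 4 ^ 3" "w 6"])
      show "w 1 ^ 2 = 1" "w 2 ^ 2 = 1" "(w 4 ^ 3) ^ 2 = 1" "w 6 ^ 3 = 1" "w 3 = w 1 * w 2"
        "w 4 = (w 4 ^ 3) * w 6"
        using eqs w(2) by algebra+
      show "w 1 = w 1" "w 2 = w 2" "w 6 = w 6"
        by (rule refl)+
    qed
    show "\<exists>zs\<in>roots gs. \<forall>i\<in>{1..6}. w i = root_vec gs zs i"
    proof
      show "[a, b, c, d] \<in> roots gs"
        unfolding roots using z by blast
      show "\<forall>i\<in>{1..6}. w i = root_vec gs [a, b, c, d] i"
        unfolding atLeastAtMost_1_6 using z w(2) by (simp add: gs_def)
    qed
  qed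
  have "vector (map (root_vec gs [a, b, c, d]) [1, 2, 3, 4, 5, 6]) = vector [a, b, a * b, c * d, 1, d]" for a b c d
    by (simp add: gs_def)
  note v = this
  have "(\<lambda>zs. vector (map (root_vec gs zs) [1, 2, 3, 4, 5, 6])) ` roots gs
      = ({vector (map (root_vec gs [a, b, c, d]) [1, 2, 3, 4, 5, 6])
        |a b c d. a ^ 2 = 1 \<and> b ^ 2 = 1 \<and> c ^ 2 = 1 \<and> d ^ 3 = 1} :: (complex ^ 6) set)"
    unfolding roots by blast
  also have "\<dots> = {vector [a, b, a * b, c * d, 1, d] |a b c d. a ^ 2 = 1 \<and> b ^ 2 = 1 \<and> c ^ 2 = 1 \<and> d ^ 3 = 1}"
    by (simp only: v)
  also have "\<dots> = {vector [\<alpha>, \<beta>, \<alpha> * \<beta>, \<omega>, 1, \<omega>^4] |\<alpha> \<beta> \<omega>. \<alpha>^2 = 1 \<and> \<beta>^2 = 1 \<and> \<omega>^6 = 1}"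
  proof (intro Set.set_eqI iffI; elim CollectE exE conjE)
    fix x :: "complex ^ 6" and a b c d :: complex
    assume x: "x = vector [a, b, a * b, c * d, 1, d]" "a ^ 2 = 1" "b ^ 2 = 1" "c ^ 2 = 1" "d ^ 3 = 1"
    from x(4,5) have "d = (c * d) ^ 4" "(c * d) ^ 6 = 1"
      by algebra+
    with x(2,3) show "x \<in> {vector [\<alpha>, \<beta>, \<alpha> * \<beta>, \<omega>, 1, \<omega>^4]
      |\<alpha> \<beta> \<omega>. \<alpha>^2 = 1 \<and> \<beta>^2 = 1 \<and> \<omega>^6 = 1}" unfolding x(1) by (intro CollectI exI[of _ a] exI[of _ b] exI[of _ "c * d"] conjI) (simp_all only:)
  next
    fix x :: "complex ^ 6" and \<alpha> \<beta> \<omega> :: complex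
    assume x: "x = vector [\<alpha>, \<beta>, \<alpha> * \<beta>, \<omega>, 1, \<omega>^4]" "\<alpha>^2 = 1" "\<beta>^2 = 1" "\<omega>^6 = 1"
    from x(4) have "\<omega> = \<omega>^3 * \<omega>^4" "(\<omega>^3)^2 = 1" "(\<omega>^4)^3 = 1"
      by algebra+
    with x(2,3) show "x \<in> {vector [a, b, a * b, c * d, 1, d]
      |a b c d. a ^ 2 = 1 \<and> b ^ 2 = 1 \<and> c ^ 2 = 1 \<and> d ^ 3 = 1}"
      unfolding x(1) by (intro CollectI exI[of _ \<alpha>] exI[of _ \<beta>] exI[of _ "\<omega>^3"] exI[of _
        "\<omega>^4"] conjI) (rule arg_cong[where f = vector], auto)
  qed
  finally have im: "(\<lambda>zs. vector (map (root_vec gs zs) [1, 2, 3, 4, 5, 6])) ` roots gs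
    = ({vector [\<alpha>, \<beta>, \<alpha> * \<beta>, \<omega>, 1, \<omega>^4] |\<alpha> \<beta> \<omega>. \<alpha>^2 = 1 \<and> \<beta>^2 = 1 \<and> \<omega>^6 = 1} :: (complex ^ 6) set)" .
  have ms: "set (map (\<lambda>t. xmon (map of_nat t)) ?Ms)
    = {xmon [1,1,5], xmon [2,2,5], xmon [3,3,5], xmon [1,2,3], xmon [5,5,5], xmon [4,4,6], xmon [6,6,6]}"
    by simp
  have "(root_group 2 \<times>\<times> root_group 2 \<times>\<times> root_group 2) \<times>\<times> root_group 3 \<cong> (Cyc 2 \<times>\<times> Cyc 2 \<times>\<times> Cyc 2) \<times>\<times> Cyc 3"
    by (intro group.DirProd_iso_trans root_group_iso DirProd_group group_root_group) simp_all
  with * show ?thesis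
    unfolding im ms by (blast intro: Group.iso_trans)
qed

section \<open>The set of monomials of an action, and the conclusion\<close>

lemma monomials_of_closed:
  fixes I :: "'n::finite action_data"
  assumes nz: "\<And>g i. g \<in> grp I \<Longrightarrow> chrs I i g \<noteq> 0"
    and pos: "set pos \<subseteq> monomials_of d I" and neg: "set neg \<subseteq> monomials_of d I"
    and len: "length pos = Suc (length neg)" and m: "m + sum_list neg = sum_list pos"
  shows "m \<in> monomials_of d I"
proof -
  have mem: "m \<in> monomials_of d I \<longleftrightarrow> mono_deg m = d \<and> (\<forall>g\<in>grp I. chr I g = mono_val (\<chi> i. chrs I i g) m)" for m
    by (simp add: monomials_of_def mono_val_def)
  have deg: "mono_deg (m + m') = mono_deg m + mono_deg m'" for m m' :: "'n monomial"
    by (simp add: mono_deg_def lookup_add sum.distrib)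
  have deg_list: "mono_deg (sum_list ms) = d * length ms" if "set ms \<subseteq> monomials_of d I" for ms
    using that by (induction ms) (auto simp: deg mem, simp add: mono_deg_def)
  have val_list: "mono_val (\<chi> i. chrs I i g) (sum_list ms) = chr I g ^ length ms"
    if "set ms \<subseteq> monomials_of d I" "g \<in> grp I" for ms g
    using that by (induction ms) (auto simp: mono_val_add mem, simp add: mono_val_def)
  have "mono_deg m + d * length neg = d * Suc (length neg)"
    using arg_cong[OF m, of mono_deg] deg_list[OF pos] deg_list[OF neg] len by (simp add: deg)
  then have "mono_deg m = d" by simp
  moreover have "chr I g = mono_val (\<chi> i. chrs I i g) m" if g: "g \<in> grp I" for g
  proof -
    have "mono_val (\<chi> i. chrs I i g) m * chr I g ^ length neg = chr I g * chr I g ^ length neg"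
      using arg_cong[OF m, of "mono_val (\<chi> i. chrs I i g)"] val_list[OF pos g] val_list[OF neg g] len
      by (simp add: mono_val_add)
    \<comment> \<open>\<open>pos\<close> is nonempty, and \<open>chr I g\<close> is the value of any
      of its monomials at nonzero eigenvalues; hence it can be cancelled.\<close>
    moreover have "chr I g \<noteq> 0"
    proof -
      obtain m' where "m' \<in> monomials_of d I"
        using pos len by (cases pos) auto
      then have "chr I g = mono_val (\<chi> i. chrs I i g) m'"
        using g by (simp add: mem)
      then show ?thesis
        using nz[OF g] mono_val_nonzero[of "\<chi> i. chrs I i g" m'] by simp
    qed
    ultimately show ?thesis by simp
  qed
  ultimately show ?thesis
    by (simp add: mem)
qed

text \<open>Written in coordinates of eigenvectors, \<open>F\<close> is a semi-invariant of the
  group, so each of its monomials satisfies the condition that defines \<open>monomials_of\<close>.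
  This is the smooth cubic to which the clauses of the search refer.\<close>

lemma coordinate_form:
  assumes "homogeneous 3 F" "smooth F" "associated_data F P I"
  obtains H where "homogeneous 3 H" "smooth H" "Poly_Mapping.keys H \<subseteq> monomials_of 3 I"
proof -
  obtain H where H: "homogeneous 3 H" "\<And>x. eval_poly H x = eval_poly F (P *v x)"
    "\<And>x i. eval_poly (partial_deriv i H) x = (\<Sum>r\<in>UNIV. P $ r $ i * eval_poly (partial_deriv r F) (P *v x))"
    using cubic_substitution[OF assms(1), of P] by blast
  have "smooth H"
    using assms(3) by (intro smooth_substitution[OF assms(1,2) _ H(1,3)]) (simp add: associated_data_def)
  moreover have "m \<in> monomials_of 3 I" if m: "m \<in> Poly_Mapping.keys H" for m
  proof -
    have "chr I g = (\<Prod>i\<in>UNIV. chrs I i g ^ Poly_Mapping.lookup m i)" if "g \<in> grp I" for g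
    proof (rule semi_invariant_monomials[symmetric])
      show "eval_poly H (\<chi> i. chrs I i g * x $ i) = chr I g * eval_poly H x" for x
        using assms(3) that unfolding H(2) by (simp add: associated_data_def)
    qed (rule m)
    then show ?thesis
      using H(1) m by (simp add: monomials_of_def homogeneous_def)
  qed
  ultimately show ?thesis
    using that[OF H(1)] by blast
qed

theorem theorem4p2:
  fixes F :: "6 mpoly" and G :: "6 pgl set" and P :: "complex ^ 6 ^ 6"
    and I :: "6 action_data" and S :: "6 monomial set"
  assumes "homogeneous 3 F" and "smooth F"
    and "abelian_liftable_action F G"
    and "grp I = G" and "associated_data F P I"
    and "maximal_in_poset 3 (data_class 3 I)"
    and "S = monomials_of 3 I"
  shows "simple_monomials S \<or>
    \<comment> \<open>(1)\<close>
    (same_up_to_perm (in_coords P G) S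
       {vector [\<omega>, \<omega>^5, \<omega>^3, 1, \<omega>^4, \<omega>^2] |\<omega>. \<omega>^6 = 1}
       {xmon [1,1,2], xmon [2,2,3], xmon [3,3,1], xmon [4,4,1], xmon [5,5,2], xmon [6,6,3],
        xmon [3,4,5], xmon [1,5,6], xmon [2,4,6]}
     \<and> sub_PGL G \<cong> Cyc 2 \<times>\<times> Cyc 3) \<or>
    \<comment> \<open>(2)\<close>
    (same_up_to_perm (in_coords P G) S
       {vector [\<omega>, \<omega>^6, \<omega>^4, 1, \<omega>^5, \<omega>^2] |\<omega>. \<omega>^8 = 1}
       {xmon [1,1,2], xmon [2,2,3], xmon [3,3,4], xmon [4,4,4], xmon [5,5,2], xmon [1,5,6],
        xmon [6,6,3], xmon [2,6,4]}
     \<and> sub_PGL G \<cong> Cyc 8) \<or>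
    \<comment> \<open>(3)\<close>
    (same_up_to_perm (in_coords P G) S
       {vector [\<omega>, \<omega>^2, 1, \<zeta>, \<omega>^2 * \<zeta>, 1] |\<omega> \<zeta>. \<omega>^4 = 1 \<and> \<zeta>^2 = 1}
       {xmon [1,1,2], xmon [2,2,3], xmon [2,2,6], xmon [2,4,5], xmon [3,3,3], xmon [3,3,6],
        xmon [4,4,3], xmon [5,5,3], xmon [6,6,3], xmon [4,4,6], xmon [5,5,6], xmon [6,6,6]}
     \<and> sub_PGL G \<cong> Cyc 2 \<times>\<times> Cyc 4) \<or>
    \<comment> \<open>(4)\<close>
    (same_up_to_perm (in_coords P G) S
       {vector [\<omega>, \<omega>^2, 1, \<omega> * \<zeta>, \<omega>^2 * \<zeta>, 1] |\<omega> \<zeta>. \<omega>^4 = 1 \<and> \<zeta>^2 = 1}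
       {xmon [1,1,2], xmon [2,2,3], xmon [3,3,3], xmon [4,4,2], xmon [1,4,5], xmon [5,5,3],
        xmon [5,5,6], xmon [6,6,3], xmon [2,2,6], xmon [3,3,6], xmon [6,6,6]}
     \<and> sub_PGL G \<cong> Cyc 2 \<times>\<times> Cyc 4) \<or>
    \<comment> \<open>(5)\<close>
    (same_up_to_perm (in_coords P G) S
       {vector [\<omega>, \<omega>^2, 1, \<omega> * \<zeta>, \<omega>^2 * \<zeta>, \<zeta>] |\<omega> \<zeta>. \<omega>^4 = 1 \<and> \<zeta>^2 = 1}
       {xmon [1,1,2], xmon [2,2,3], xmon [3,3,3], xmon [4,4,2], xmon [1,4,5], xmon [5,5,3],
        xmon [2,5,6], xmon [6,6,3]}
     \<and> sub_PGL G \<cong> Cyc 2 \<times>\<times> Cyc 4) \<or>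
    \<comment> \<open>(6)\<close>
    (same_up_to_perm (in_coords P G) S
       {vector [\<omega>, \<omega>^2, 1, \<omega>^2 * \<zeta>, \<zeta>, \<omega>^3 * \<zeta>] |\<omega> \<zeta>. \<omega>^4 = 1 \<and> \<zeta>^2 = 1}
       {xmon [1,1,2], xmon [2,2,3], xmon [3,3,3], xmon [4,4,3], xmon [5,5,3], xmon [2,4,5],
        xmon [1,5,6], xmon [6,6,2]}
     \<and> sub_PGL G \<cong> Cyc 2 \<times>\<times> Cyc 4) \<or>
    \<comment> \<open>(7)\<close>
    (same_up_to_perm (in_coords P G) S
       {vector [\<alpha>, \<beta>, \<alpha> * \<beta>, 1, \<omega>, \<zeta>] |\<alpha> \<beta> \<omega> \<zeta>. \<alpha>^2 = 1 \<and> \<beta>^2 = 1 \<and> \<omega>^3 = 1 \<and> \<zeta>^3 = 1}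
       {xmon [1,1,4], xmon [2,2,4], xmon [3,3,4], xmon [1,2,3], xmon [4,4,4], xmon [5,5,5],
        xmon [6,6,6]}
     \<and> sub_PGL G \<cong> (Cyc 2 \<times>\<times> Cyc 2) \<times>\<times> (Cyc 3 \<times>\<times> Cyc 3)) \<or>
    \<comment> \<open>(8)\<close>
    (same_up_to_perm (in_coords P G) S
       {vector [\<alpha>, \<beta>, \<alpha> * \<beta>, \<omega>, 1, \<omega>^4] |\<alpha> \<beta> \<omega>. \<alpha>^2 = 1 \<and> \<beta>^2 = 1 \<and> \<omega>^6 = 1}
       {xmon [1,1,5], xmon [2,2,5], xmon [3,3,5], xmon [1,2,3], xmon [5,5,5], xmon [4,4,6],
        xmon [6,6,6]}
     \<and> sub_PGL G \<cong> (Cyc 2 \<times>\<times> Cyc 2 \<times>\<times> Cyc 2) \<times>\<times> Cyc 3)"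
proof -
  interpret maximal_action F G P I
    using assms(3-6) by unfold_locales
  obtain H where H: "homogeneous 3 H" "smooth H" "Poly_Mapping.keys H \<subseteq> monomials_of 3 I"
    by (rule coordinate_form[OF assms(1,2,5)])
  \<comment> \<open>The search only has to locate the monomials of an exceptional support inside
    \<open>S\<close>; the group and the exact set \<open>S\<close> are computed afterwards from
    maximality.\<close>
  define Q where "Q \<longleftrightarrow> simple_monomials S \<or>
    (\<exists>\<tau> j. bij_betw \<tau> {1..6} (UNIV :: 6 set) \<and> j < 7 \<and> (\<forall>t\<in>set (exceptional_supports ! j). xmon (map \<tau> t) \<in> S))"
  interpret cubic_case_distinction S Q
  proof
    fix J E :: "6 list" assume "distinct J" "length J \<le> 3" "length E < length J"
    from smooth_cubic_monomials[OF H(1,2) this]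
    show "\<exists>i\<in>set J. \<exists>j\<in>set J. \<exists>k. k \<notin> set E \<and> xmon [i, j, k] \<in> S"
      using H(3) assms(7) by blast
  next
    fix m :: "6 monomial" and pos neg
    assume "set pos \<subseteq> S" "set neg \<subseteq> S" "length pos = Suc (length neg)" "m + sum_list neg = sum_list pos"
    then show "m \<in> S"
      unfolding assms(7) using chrs_nonzero grp by (intro monomials_of_closed) simp_all
  next
    fix \<sigma> :: "nat \<Rightarrow> 6" and bs
    assume "bij_betw \<sigma> {1..6} UNIV" "simple_blocks bs" "\<forall>t\<in>set (concat (map block_monos bs)). xmon (map \<sigma> t) \<in> S"
    then show Q
      unfolding Q_def using simple_monomials_blocks by blast
  next
    fix \<sigma> :: "nat \<Rightarrow> 6" and j :: nat
    assume "bij_betw \<sigma> {1..6} UNIV" "j < 7" "\<forall>t\<in>set (exceptional_supports ! j). xmon (map \<sigma> t) \<in> S"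
    then show Q
      unfolding Q_def by blast
  qed
  have Q by (rule conclusion) simp
  then show ?thesis
    unfolding Q_def
  proof (elim disjE exE conjE)
    fix \<tau> :: "nat \<Rightarrow> 6" and j :: nat
    assume \<tau>: "bij_betw \<tau> {1..6} UNIV" and "j < 7"
      and T: "\<forall>t\<in>set (exceptional_supports ! j). xmon (map \<tau> t) \<in> S"
    from \<open>j < 7\<close> consider "j = 0" | "j = 1" | "j = 2" | "j = 3" | "j = 4" | "j = 5" | "j = 6"
      by linarith
    then show ?thesis
    proof cases
      case 1
      from exceptional_case_0[OF maximal_action_axioms \<tau> T[unfolded 1 assms(7)]] show ?thesis
        unfolding assms(7) by blast
    next
      case 2
      from exceptional_case_1[OF maximal_action_axioms \<tau> T[unfolded 2 assms(7)]] show ?thesis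
        unfolding assms(7) by blast
    next
      case 3
      from exceptional_case_2[OF maximal_action_axioms \<tau> T[unfolded 3 assms(7)]] show ?thesis
        unfolding assms(7) by blast
    next
      case 4
      from exceptional_case_3[OF maximal_action_axioms \<tau> T[unfolded 4 assms(7)]] show ?thesis
        unfolding assms(7) by blast
    next
      case 5
      \<comment> \<open>Exchanging x_4 and x_6 and replacing \<zeta> by \<omega>^2 \<zeta> turns the
        group and the monomials of (5) into those of (6), so this support stands for both.\<close>
      from exceptional_case_4[OF maximal_action_axioms \<tau> T[unfolded 5 assms(7)]] show ?thesis
        unfolding assms(7) by blast
    next
      case 6
      from exceptional_case_5[OF maximal_action_axioms \<tau> T[unfolded 6 assms(7)]] show ?thesis
        unfolding assms(7) by blast
    next
      case 7
      from exceptional_case_6[OF maximal_action_axioms \<tau> T[unfolded 7 assms(7)]] show ?thesis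
        unfolding assms(7) by blast
    qed
  qed (rule disjI1)
qed

end
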